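(* Let $W$ be a finite-dimensional complex vector space, let $\mathbf{F}$ be a symbol system of rank $r$ on $W$, let $\phi_{\mathbf F}:\mathbb{P}(\mathbb{C}\oplus W)\dashrightarrow \mathbb{P}V_{\mathbf F}$ be the associated rational map and $M(\mathbf{F}) \subset \mathbb{P}V_{\mathbf F}$ its proper image. Let $o=[1:0:\cdots:0]\in M(\mathbf{F})$ be the point $\phi_{\mathbf F}([t=1:w=0])$. Then: (i) The natural action of the vector group $W$ on $\mathbb{P}(\mathbb{C}\oplus W)$, $v\cdot[t:w]=[t:w+tv]$, can be extended (via $\phi_{\mathbf F}$) to an action of $W$ on $\mathbb{P}V_{\mathbf F}$ preserving $M(\mathbf{F})$ such that the orbit of $o$ is an open subset of $M(\mathbf F)$ biregular to $W$. (ii) The $\mathbb{C}^{\times}$-action on $W$ with weight $1$ (scalar multiplication) induces a $\mathbb{C}^{\times}$-action on $M(\mathbf{F})$ of Euler type at $o$, making $M(\mathbf{F})\subset\mathbb{P}V_{\mathbf F}$ Euler-symmetric. (iii) The system of fundamental forms of $M(\mathbf{F}) \subset \mathbb{P}V_{\mathbf F}$ at $o$ is isomorphic to the symbol system $\mathbf{F}$. Conversely, any nondegenerate Euler-symmetric projective variety is, up to projective isomorphism, of the form $M(\mathbf{F})\subset\mathbb{P}V_{\mathbf F}$ for some symbol system $\mathbf{F}$ on a vector space $W$.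
   Context: Everything is over $\mathbb{C}$; $\mathbb{P}V$ is the projective space of one-dimensional subspaces of $V$; varieties are irreducible; "general point" means any point in some nonempty Zariski-open subset; a subvariety of $\mathbb{P}V$ is nondegenerate if it lies in no hyperplane. Symbol systems. Regard $\mathrm{Sym}^kW^*$ as the space of symmetric $k$-linear forms on $W$. For $w\in W$, the contraction $\iota_w:\mathrm{Sym}^{k+1}W^*\to\mathrm{Sym}^kW^*$ is $\iota_w\varphi(w_1,\dots,w_k)=\varphi(w,w_1,\dots,w_k)$, with $\iota_w(\mathrm{Sym}^0W^* )=0$. For $F\subset\mathrm{Sym}^kW^*$, $\mathbf{prolong}(F):=\bigcap_{w\in W}\iota_w^{-1}(F)\subset\mathrm{Sym}^{k+1}W^*$. Fix a natural number $r\geq 1$. A subspace $\mathbf{F}=\bigoplus_{k\ge0}F^k\subset\bigoplus_{k\ge0}\mathrm{Sym}^kW^*$ (with $F^k\subset\mathrm{Sym}^kW^*$) satisfying $F^0=\mathbb{C}$, $F^1=W^*$, $F^r\ne0$ and $F^{r+i}=0$ for all $i\ge1$ is a symbol system of rank $r$ if $F^{k+1}\subset\mathbf{prolong}(F^k)$ for each $1\le k\le r$, equivalently $\iota_w\mathbf{F}\subset\mathbf{F}$ for all $w\in W$. The variety $M(\mathbf{F})$. For $w\in W$ let $\iota_w^k\in(F^k)^*$ denote the functional $\varphi\mapsto\varphi(w,\dots,w)$. Put $V_{\mathbf F}:=\mathbb{C}\oplus W\oplus(F^2)^*\oplus\cdots\oplus(F^r)^*$ and define the rational map $\phi_{\mathbf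 F}:\mathbb{P}(\mathbb{C}\oplus W)\dashrightarrow\mathbb{P}V_{\mathbf F}$ by $$[t:w]\mapsto[t^r:t^{r-1}w:t^{r-2}\iota_w^2:\cdots:t\,\iota_w^{r-1}:\iota_w^r].$$ $M(\mathbf{F})\subset\mathbb{P}V_{\mathbf F}$ is the proper image of $\phi_{\mathbf F}$ (the closure of the image of the locus where it is defined). Euler-symmetric varieties. For a nonsingular point $x$ of a projective variety $Z\subset\mathbb{P}V$, a $\mathbb{C}^{\times}$-action on $Z$ coming from a multiplicative subgroup of $\mathbf{GL}(V)$ is of Euler type at $x$ if $x$ is an isolated fixed point of the induced action on $Z$ and the isotropic action on $T_xZ$ is by scalar multiplication (i.e. trivial on $\mathbb{P}T_xZ$). $Z\subset\mathbb{P}V$ is Euler-symmetric if for a general point $x\in Z$ there is a $\mathbb{C}^{\times}$-action on $Z$ of Euler type at $x$. Fundamental forms. Let $x\in Z\subset\mathbb{P}V$ be a nonsingular point of a nondegenerate projective variety, $L$ the restriction of the hyperplane line bundle, and $j_x^k(s)$ the $k$-jet at $x$ of $s\in H^0(Z,L)$. View $V^*\subset H^0(Z,L)$. The natural homomorphism $(V^*\cap\mathrm{Ker}(j_x^{k-1}))/(V^*\cap\mathrm{Ker}(j_x^k))\to L_x\otimes\mathrm{Sym}^kT_x^*Z$ is injective; for $k\ge2$ the subspace $F^k_x\subset\mathrm{Sym}^kT^*_xZ$ defined by its image is the $k$-th fundamental form at $x$. With $F^0_x=\mathbb{C}$, $F^1_x=T^*_xZ$, the system of fundamental forms is $\mathbf{F}_x=\bigoplus_{k\ge0}F^k_x$.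 It is isomorphic to a symbol system $\mathbf{F}$ on $W$ if some linear isomorphism $T_x^*Z\to W^*$ induces an isomorphism of symmetric algebras sending $\mathbf{F}_x$ onto $\mathbf{F}$.
   Formalization: In the converse the variety is assumed not to be a single point: the point P(C^1) is nondegenerate and Euler-symmetric, but it is no M(F), since r ≥ 1 and F^r ≠ 0 force W ≠ 0. *)

theory Defs
  imports
    "HOL-Analysis.Analysis"
    "HOL-Library.Function_Algebras"
    "HOL-Library.Multiset"
    "HOL-Combinatorics.Permutations"
    "HOL-Computational_Algebra.Polynomial"
begin

section \<open>Complex vector spaces\<close>

class scaleC =
  fixes scaleC :: "complex \<Rightarrow> 'a \<Rightarrow> 'a"  (infixr "*\<^sub>C" 75)

class complex_vector = ab_group_add + scaleC +
  assumes scaleC_add_right: "a *\<^sub>C (x + y) = a *\<^sub>C x + a *\<^sub>C y"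
    and scaleC_add_left: "(a + b) *\<^sub>C x = a *\<^sub>C x + b *\<^sub>C x"
    and scaleC_scaleC: "a *\<^sub>C (b *\<^sub>C x) = (a * b) *\<^sub>C x"
    and scaleC_one: "1 *\<^sub>C x = x"

global_interpretation cvs: vector_space "scaleC :: complex \<Rightarrow> 'a \<Rightarrow> 'a::complex_vector"
  defines csubspace = cvs.subspace
    and cspan = cvs.span
    and cdependent = cvs.dependent
    and crepresentation = cvs.representation
    and cextend_basis = cvs.extend_basis
    and cdim = cvs.dim
  by unfold_locales (simp_all add: scaleC_add_right scaleC_add_left scaleC_scaleC scaleC_one)

instantiation complex :: complex_vector
begin
definition scaleC_complex :: "complex \<Rightarrow> complex \<Rightarrow> complex"
  where "scaleC_complex c z = c * z"
instance
  by standard (simp_all add: scaleC_complex_def algebra_simps)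
end

instantiation "fun" :: (type, complex_vector) complex_vector
begin
definition scaleC_fun :: "complex \<Rightarrow> ('a \<Rightarrow> 'b) \<Rightarrow> 'a \<Rightarrow> 'b"
  where "scaleC_fun c f = (\<lambda>x. c *\<^sub>C f x)"
instance
  by standard (simp_all add: scaleC_fun_def plus_fun_def fun_eq_iff scaleC_add_right
      scaleC_add_left scaleC_scaleC scaleC_one)
end

instantiation prod :: (complex_vector, complex_vector) complex_vector
begin
definition scaleC_prod :: "complex \<Rightarrow> 'a \<times> 'b \<Rightarrow> 'a \<times> 'b"
  where "scaleC_prod c p = (c *\<^sub>C fst p, c *\<^sub>C snd p)"
instance
  by standard (simp_all add: scaleC_prod_def prod_eq_iff scaleC_add_right
      scaleC_add_left scaleC_scaleC scaleC_one)
end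

text \<open>
  Since \<open>V\<^sub>F\<close> below depends on \<open>F\<close>, every vector space is a subspace of an ambient type, and maps
  are only constrained on that subspace.
\<close>

definition finite_dim :: "'a::complex_vector set \<Rightarrow> bool"
  where "finite_dim V \<longleftrightarrow> csubspace V \<and> (\<exists>B. finite B \<and> V = cspan B)"

definition clinear_on :: "'a::complex_vector set \<Rightarrow> ('a \<Rightarrow> 'b::complex_vector) \<Rightarrow> bool"
  where "clinear_on V f \<longleftrightarrow>
    (\<forall>x\<in>V. \<forall>y\<in>V. f (x + y) = f x + f y) \<and> (\<forall>c. \<forall>x\<in>V. f (c *\<^sub>C x) = c *\<^sub>C f x)"

definition lin_iso :: "'a::complex_vector set \<Rightarrow> 'b::complex_vector set \<Rightarrow> ('a \<Rightarrow> 'b) \<Rightarrow> bool"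
  where "lin_iso V U f \<longleftrightarrow> clinear_on V f \<and> bij_betw f V U"


section \<open>Symbol systems\<close>

text \<open>
  \<open>Sym\<^sup>k W\<^sup>*\<close> as symmetric \<open>k\<close>-linear forms: the argument tuple is a list, and forms are extended by
  zero to lists of the wrong length or with entries outside \<open>W\<close>.
\<close>

definition sym_forms :: "'w::complex_vector set \<Rightarrow> nat \<Rightarrow> ('w list \<Rightarrow> complex) set"
  where "sym_forms W k = {\<phi>.
    (\<forall>ws. \<not> (length ws = k \<and> set ws \<subseteq> W) \<longrightarrow> \<phi> ws = 0) \<and>
    (\<forall>us vs. length us + 1 + length vs = k \<longrightarrow> set us \<subseteq> W \<longrightarrow> set vs \<subseteq> W \<longrightarrow>
       clinear_on W (\<lambda>x. \<phi> (us @ x # vs))) \<and>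
    (\<forall>ws ws'. mset ws = mset ws' \<longrightarrow> \<phi> ws = \<phi> ws')}"

text \<open>On \<open>Sym\<^sup>0\<close> the contraction vanishes, because \<open>w # ws\<close> is never the empty list.\<close>

definition contract :: "'w \<Rightarrow> ('w list \<Rightarrow> complex) \<Rightarrow> 'w list \<Rightarrow> complex"
  where "contract w \<phi> = (\<lambda>ws. \<phi> (w # ws))"

definition prolong ::
    "'w::complex_vector set \<Rightarrow> nat \<Rightarrow> ('w list \<Rightarrow> complex) set \<Rightarrow> ('w list \<Rightarrow> complex) set"
  where "prolong W k A = {\<phi> \<in> sym_forms W (k + 1). \<forall>w\<in>W. contract w \<phi> \<in> A}"

text \<open>\<open>F r \<noteq> {0}\<close> with \<open>r \<ge> 1\<close> forces \<open>W \<noteq> 0\<close>, so that \<open>M(F)\<close> is never a single point.\<close>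

definition symbol_system ::
    "'w::complex_vector set \<Rightarrow> nat \<Rightarrow> (nat \<Rightarrow> ('w list \<Rightarrow> complex) set) \<Rightarrow> bool"
  where "symbol_system W r F \<longleftrightarrow>
    r \<ge> 1 \<and>
    (\<forall>k. csubspace (F k) \<and> F k \<subseteq> sym_forms W k) \<and>
    F 0 = sym_forms W 0 \<and> F 1 = sym_forms W 1 \<and>
    F r \<noteq> {0} \<and> (\<forall>i\<ge>1. F (r + i) = {0}) \<and>
    (\<forall>k. 1 \<le> k \<and> k \<le> r \<longrightarrow> F (k + 1) \<subseteq> prolong W k (F k))"


section \<open>Projective spaces and their subvarieties\<close>

definition proj :: "'v::complex_vector set \<Rightarrow> 'v set set"
  where "proj V = {cspan {v} | v. v \<in> V \<and> v \<noteq> 0}"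

inductive_set poly_funs :: "'v::complex_vector set \<Rightarrow> ('v \<Rightarrow> complex) set"
  for V :: "'v set"
where
  const: "(\<lambda>_. c) \<in> poly_funs V"
| linear: "clinear_on V l \<Longrightarrow> l \<in> poly_funs V"
| add: "p \<in> poly_funs V \<Longrightarrow> q \<in> poly_funs V \<Longrightarrow> (\<lambda>v. p v + q v) \<in> poly_funs V"
| mult: "p \<in> poly_funs V \<Longrightarrow> q \<in> poly_funs V \<Longrightarrow> (\<lambda>v. p v * q v) \<in> poly_funs V"

definition homog_polys :: "'v::complex_vector set \<Rightarrow> nat \<Rightarrow> ('v \<Rightarrow> complex) set"
  where "homog_polys V d = {p \<in> poly_funs V. \<forall>c. \<forall>v\<in>V. p (c *\<^sub>C v) = c ^ d * p v}"

definition basic_open :: "'v::complex_vector set \<Rightarrow> ('v \<Rightarrow> complex) \<Rightarrow> 'v set set"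
  where "basic_open V p = {L \<in> proj V. \<forall>v\<in>L - {0}. p v \<noteq> 0}"

definition zariski :: "'v::complex_vector set \<Rightarrow> 'v set topology"
  where "zariski V = topology_generated_by {basic_open V p | d p. p \<in> homog_polys V d}"

abbreviation zariski_on :: "'v::complex_vector set \<Rightarrow> 'v set set \<Rightarrow> 'v set topology"
  where "zariski_on V Z \<equiv> subtopology (zariski V) Z"

definition irreducible_space :: "'a topology \<Rightarrow> bool"
  where "irreducible_space T \<longleftrightarrow> topspace T \<noteq> {} \<and>
    (\<forall>A B. closedin T A \<longrightarrow> closedin T B \<longrightarrow> topspace T = A \<union> B \<longrightarrow> topspace T = A \<or> topspace T = B)"

definition proj_variety :: "'v::complex_vector set \<Rightarrow> 'v set set \<Rightarrow> bool"
  where "proj_variety V Z \<longleftrightarrow> closedin (zariski V) Z \<and> irreducible_space (zariski_on V Z)"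

definition nondegenerate :: "'v::complex_vector set \<Rightarrow> 'v set set \<Rightarrow> bool"
  where "nondegenerate V Z \<longleftrightarrow>
    (\<forall>l :: 'v \<Rightarrow> complex. clinear_on V l \<and> (\<forall>L\<in>Z. \<forall>v\<in>L. l v = 0) \<longrightarrow> (\<forall>v\<in>V. l v = 0))"

text \<open>Regular functions on a locally closed subset \<open>U\<close> of \<open>\<P>V\<close>.\<close>

definition regular_funs :: "'v::complex_vector set \<Rightarrow> 'v set set \<Rightarrow> ('v set \<Rightarrow> complex) set"
  where "regular_funs V U = {f. \<forall>L\<in>U. \<exists>d. \<exists>p\<in>homog_polys V d. \<exists>q\<in>homog_polys V d.
    L \<in> basic_open V q \<and> (\<forall>M\<in>U \<inter> basic_open V q. \<forall>v\<in>M - {0}. f M = p v / q v)}"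

definition affine_zariski :: "'w::complex_vector set \<Rightarrow> 'w topology"
  where "affine_zariski W = topology_generated_by {{w \<in> W. p w \<noteq> 0} | p. p \<in> poly_funs W}"

definition affine_regular_funs :: "'w::complex_vector set \<Rightarrow> 'w set \<Rightarrow> ('w \<Rightarrow> complex) set"
  where "affine_regular_funs W U = {f. \<forall>w\<in>U. \<exists>p\<in>poly_funs W. \<exists>q\<in>poly_funs W.
    q w \<noteq> 0 \<and> (\<forall>u\<in>U. q u \<noteq> 0 \<longrightarrow> f u = p u / q u)}"

definition biregular ::
    "'a topology \<Rightarrow> ('a set \<Rightarrow> ('a \<Rightarrow> complex) set) \<Rightarrow> 'b topology \<Rightarrow> ('b set \<Rightarrow> ('b \<Rightarrow> complex) set) \<Rightarrow>
     ('a \<Rightarrow> 'b) \<Rightarrow> bool"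
  where "biregular X \<O>\<^sub>X Y \<O>\<^sub>Y f \<longleftrightarrow> homeomorphic_map X Y f \<and>
    (\<forall>U h. openin Y U \<longrightarrow> (h \<in> \<O>\<^sub>Y U \<longleftrightarrow> h \<circ> f \<in> \<O>\<^sub>X {x \<in> topspace X. f x \<in> U}))"


section \<open>Local rings, tangent spaces and nonsingular points\<close>

text \<open>Elements of \<open>\<O>\<^bsub>Z,x\<^esub>\<close> are represented by functions; two of them are equal as germs if
  \<open>germ_eq\<close> holds.\<close>

definition germ_eq ::
    "'v::complex_vector set \<Rightarrow> 'v set set \<Rightarrow> 'v set \<Rightarrow> ('v set \<Rightarrow> complex) \<Rightarrow> ('v set \<Rightarrow> complex) \<Rightarrow> bool"
  where "germ_eq V Z x f g \<longleftrightarrow> (\<exists>U. openin (zariski_on V Z) U \<and> x \<in> U \<and> (\<forall>y\<in>U. f y = g y))"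

definition local_ring :: "'v::complex_vector set \<Rightarrow> 'v set set \<Rightarrow> 'v set \<Rightarrow> ('v set \<Rightarrow> complex) set"
  where "local_ring V Z x = {f. \<exists>U. openin (zariski_on V Z) U \<and> x \<in> U \<and> f \<in> regular_funs V U}"

definition max_ideal :: "'v::complex_vector set \<Rightarrow> 'v set set \<Rightarrow> 'v set \<Rightarrow> ('v set \<Rightarrow> complex) set"
  where "max_ideal V Z x = {f \<in> local_ring V Z x. f x = 0}"

inductive_set max_ideal_pow ::
    "'v::complex_vector set \<Rightarrow> 'v set set \<Rightarrow> 'v set \<Rightarrow> nat \<Rightarrow> ('v set \<Rightarrow> complex) set"
  for V :: "'v set" and Z :: "'v set set" and x :: "'v set" and k :: nat
where
  prod: "h \<in> local_ring V Z x \<Longrightarrow> (\<And>i. i < k \<Longrightarrow> f i \<in> max_ideal V Z x) \<Longrightarrow>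
    (\<lambda>y. h y * (\<Prod>i<k. f i y)) \<in> max_ideal_pow V Z x k"
| add: "f \<in> max_ideal_pow V Z x k \<Longrightarrow> g \<in> max_ideal_pow V Z x k \<Longrightarrow>
    (\<lambda>y. f y + g y) \<in> max_ideal_pow V Z x k"
| germ: "f \<in> max_ideal_pow V Z x k \<Longrightarrow> germ_eq V Z x f g \<Longrightarrow> g \<in> max_ideal_pow V Z x k"

text \<open>
  The Zariski tangent space as the space of derivations \<open>\<O>\<^bsub>Z,x\<^esub> \<rightarrow> \<complex>\<close>, extended by zero to functions
  not representing a germ.
\<close>

definition tangent ::
    "'v::complex_vector set \<Rightarrow> 'v set set \<Rightarrow> 'v set \<Rightarrow> (('v set \<Rightarrow> complex) \<Rightarrow> complex) set"
  where "tangent V Z x = {D.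
    (\<forall>f\<in>local_ring V Z x. \<forall>g\<in>local_ring V Z x.
       D (\<lambda>y. f y + g y) = D f + D g \<and>
       D (\<lambda>y. f y * g y) = f x * D g + g x * D f \<and>
       (germ_eq V Z x f g \<longrightarrow> D f = D g)) \<and>
    (\<forall>c. \<forall>f\<in>local_ring V Z x. D (\<lambda>y. c * f y) = c * D f) \<and>
    (\<forall>f. f \<notin> local_ring V Z x \<longrightarrow> D f = 0)}"

definition differential ::
    "('p \<Rightarrow> 'p) \<Rightarrow> (('p \<Rightarrow> complex) \<Rightarrow> complex) \<Rightarrow> ('p \<Rightarrow> complex) \<Rightarrow> complex"
  where "differential g D = (\<lambda>f. D (f \<circ> g))"

text \<open>
  Nonsingular points of a variety as in Shafarevich, \<open>Basic Algebraic Geometry\<close>: the dimension of the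
  tangent space is the minimal (equivalently, the general) one, which is \<open>dim Z\<close>.
\<close>

definition nonsingular_point :: "'v::complex_vector set \<Rightarrow> 'v set set \<Rightarrow> 'v set \<Rightarrow> bool"
  where "nonsingular_point V Z x \<longleftrightarrow>
    x \<in> Z \<and> (\<forall>y\<in>Z. cdim (tangent V Z x) \<le> cdim (tangent V Z y))"


section \<open>The variety attached to a symbol system\<close>

definition dual :: "'a::complex_vector set \<Rightarrow> ('a \<Rightarrow> complex) set"
  where "dual A = {\<eta>. clinear_on A \<eta> \<and> (\<forall>a. a \<notin> A \<longrightarrow> \<eta> a = 0)}"

definition power_functional :: "('w list \<Rightarrow> complex) set \<Rightarrow> nat \<Rightarrow> 'w \<Rightarrow> ('w list \<Rightarrow> complex) \<Rightarrow> complex"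
  where "power_functional A k w = (\<lambda>\<phi>. if \<phi> \<in> A then \<phi> (replicate k w) else 0)"

type_synonym 'w target = "complex \<times> 'w \<times> (nat \<Rightarrow> ('w list \<Rightarrow> complex) \<Rightarrow> complex)"

text \<open>The third component of \<open>(t, w, \<eta>)\<close> is the family of the \<open>\<eta> k \<in> (F\<^sup>k)\<^sup>*\<close>, \<open>2 \<le> k \<le> r\<close>.\<close>

definition VF ::
    "'w::complex_vector set \<Rightarrow> nat \<Rightarrow> (nat \<Rightarrow> ('w list \<Rightarrow> complex) set) \<Rightarrow> 'w target set"
  where "VF W r F = {(t, w, \<eta>). w \<in> W \<and> (\<forall>k. if 2 \<le> k \<and> k \<le> r then \<eta> k \<in> dual (F k) else \<eta> k = 0)}"

definition phi_vec ::
    "nat \<Rightarrow> (nat \<Rightarrow> ('w::complex_vector list \<Rightarrow> complex) set) \<Rightarrow> complex \<times> 'w \<Rightarrow> 'w target"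
  where "phi_vec r F = (\<lambda>(t, w). (t ^ r, t ^ (r - 1) *\<^sub>C w,
    \<lambda>k. if 2 \<le> k \<and> k \<le> r then t ^ (r - k) *\<^sub>C power_functional (F k) k w else 0))"

text \<open>As \<open>phi_vec\<close> is homogeneous of degree \<open>r\<close>, it maps a line onto a line or to \<open>0\<close>.\<close>

definition phi_dom ::
    "'w::complex_vector set \<Rightarrow> nat \<Rightarrow> (nat \<Rightarrow> ('w list \<Rightarrow> complex) set) \<Rightarrow> (complex \<times> 'w) set set"
  where "phi_dom W r F = {L \<in> proj (UNIV \<times> W). \<forall>u\<in>L - {0}. phi_vec r F u \<noteq> 0}"

definition phi ::
    "nat \<Rightarrow> (nat \<Rightarrow> ('w::complex_vector list \<Rightarrow> complex) set) \<Rightarrow> (complex \<times> 'w) set \<Rightarrow> 'w target set"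
  where "phi r F L = cspan (phi_vec r F ` L)"

definition MF ::
    "'w::complex_vector set \<Rightarrow> nat \<Rightarrow> (nat \<Rightarrow> ('w list \<Rightarrow> complex) set) \<Rightarrow> 'w target set set"
  where "MF W r F = zariski (VF W r F) closure_of (phi r F ` phi_dom W r F)"

definition base_point :: "'w::complex_vector target set"
  where "base_point = cspan {(1, 0, 0)}"


section \<open>Group actions\<close>

text \<open>
  Algebraic actions on \<open>\<P>V\<close> are those induced by rational representations of the acting group on
  \<open>V\<close>; a linear automorphism \<open>g\<close> moves the line \<open>L\<close> to \<open>g ` L\<close>.
\<close>

definition vector_group_rep ::
    "'w::complex_vector set \<Rightarrow> 'v::complex_vector set \<Rightarrow> ('w \<Rightarrow> 'v \<Rightarrow> 'v) \<Rightarrow> bool"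
  where "vector_group_rep W V \<rho> \<longleftrightarrow>
    (\<forall>w\<in>W. lin_iso V V (\<rho> w)) \<and>
    (\<forall>v\<in>V. \<rho> 0 v = v) \<and>
    (\<forall>w\<in>W. \<forall>w'\<in>W. \<forall>v\<in>V. \<rho> (w + w') v = \<rho> w (\<rho> w' v)) \<and>
    (\<forall>v\<in>V. \<forall>l. clinear_on V l \<longrightarrow> (\<lambda>w. l (\<rho> w v)) \<in> poly_funs W)"

definition mult_group_rep :: "'v::complex_vector set \<Rightarrow> (complex \<Rightarrow> 'v \<Rightarrow> 'v) \<Rightarrow> bool"
  where "mult_group_rep V \<rho> \<longleftrightarrow>
    (\<forall>c. c \<noteq> 0 \<longrightarrow> lin_iso V V (\<rho> c)) \<and>
    (\<forall>v\<in>V. \<rho> 1 v = v) \<and>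
    (\<forall>c d. c \<noteq> 0 \<longrightarrow> d \<noteq> 0 \<longrightarrow> (\<forall>v\<in>V. \<rho> (c * d) v = \<rho> c (\<rho> d v))) \<and>
    (\<forall>v\<in>V. \<forall>l. clinear_on V l \<longrightarrow>
       (\<exists>(p :: complex poly) m. \<forall>c. c \<noteq> 0 \<longrightarrow> l (\<rho> c v) = poly p c / c ^ m))"

definition translate :: "'w::complex_vector \<Rightarrow> complex \<times> 'w \<Rightarrow> complex \<times> 'w"
  where "translate v = (\<lambda>(t, w). (t, w + t *\<^sub>C v))"

definition euler_type ::
    "'v::complex_vector set \<Rightarrow> 'v set set \<Rightarrow> 'v set \<Rightarrow> (complex \<Rightarrow> 'v \<Rightarrow> 'v) \<Rightarrow> bool"
  where "euler_type V Z x \<rho> \<longleftrightarrow>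
    nonsingular_point V Z x \<and>
    mult_group_rep V \<rho> \<and> (\<forall>c. c \<noteq> 0 \<longrightarrow> image (\<rho> c) ` Z = Z) \<and>
    (\<forall>c. c \<noteq> 0 \<longrightarrow> \<rho> c ` x = x) \<and>
    (\<exists>U. openin (zariski_on V Z) U \<and> x \<in> U \<and>
       (\<forall>y\<in>U. (\<forall>c. c \<noteq> 0 \<longrightarrow> \<rho> c ` y = y) \<longrightarrow> y = x)) \<and>
    (\<forall>c. c \<noteq> 0 \<longrightarrow> (\<exists>\<mu>. \<forall>D\<in>tangent V Z x. differential (image (\<rho> c)) D = \<mu> *\<^sub>C D))"

definition euler_symmetric :: "'v::complex_vector set \<Rightarrow> 'v set set \<Rightarrow> bool"
  where "euler_symmetric V Z \<longleftrightarrow> proj_variety V Z \<and>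
    (\<exists>U. U \<noteq> {} \<and> openin (zariski_on V Z) U \<and> (\<forall>x\<in>U. \<exists>\<rho>. euler_type V Z x \<rho>))"


section \<open>Fundamental forms\<close>

definition sym_prod ::
    "'w set \<Rightarrow> nat \<Rightarrow> (nat \<Rightarrow> 'w \<Rightarrow> complex) \<Rightarrow> 'w list \<Rightarrow> complex"
  where "sym_prod W k \<theta> = (\<lambda>ws. if length ws = k \<and> set ws \<subseteq> W
    then (\<Sum>\<sigma> | \<sigma> permutes {..<k}. \<Prod>i<k. \<theta> i (ws ! \<sigma> i)) / fact k else 0)"

text \<open>
  \<open>leading_form V Z x k f \<phi>\<close>: the class of \<open>f\<close> in \<open>\<mm>\<^sup>k/\<mm>\<^sup>k\<^sup>+\<^sup>1\<close> corresponds to \<open>\<phi>\<close> under the natural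
  isomorphism \<open>\<mm>\<^sup>k/\<mm>\<^sup>k\<^sup>+\<^sup>1 \<cong> Sym\<^sup>k(\<mm>/\<mm>\<^sup>2) = Sym\<^sup>k T\<^sub>x\<^sup>*Z\<close> at a nonsingular point.  The class of \<open>f\<close> in
  \<open>\<mm>/\<mm>\<^sup>2\<close> is the linear form \<open>D \<mapsto> D f\<close> on the tangent space.
\<close>

inductive leading_form ::
    "'v::complex_vector set \<Rightarrow> 'v set set \<Rightarrow> 'v set \<Rightarrow> nat \<Rightarrow> ('v set \<Rightarrow> complex) \<Rightarrow>
     ((('v set \<Rightarrow> complex) \<Rightarrow> complex) list \<Rightarrow> complex) \<Rightarrow> bool"
  for V :: "'v set" and Z :: "'v set set" and x :: "'v set" and k :: nat
where
  prod: "(\<And>i. i < k \<Longrightarrow> f i \<in> max_ideal V Z x) \<Longrightarrow>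
    leading_form V Z x k (\<lambda>y. c * (\<Prod>i<k. f i y))
      (c *\<^sub>C sym_prod (tangent V Z x) k (\<lambda>i D. D (f i)))"
| add: "leading_form V Z x k f \<phi> \<Longrightarrow> leading_form V Z x k g \<psi> \<Longrightarrow>
    leading_form V Z x k (\<lambda>y. f y + g y) (\<phi> + \<psi>)"
| higher: "leading_form V Z x k f \<phi> \<Longrightarrow> (\<lambda>y. g y - f y) \<in> max_ideal_pow V Z x (k + 1) \<Longrightarrow>
    leading_form V Z x k g \<phi>"

text \<open>
  The section of the hyperplane bundle given by the linear form \<open>l\<close>, as a function, in the
  trivialization near \<open>x\<close> given by a linear form \<open>q\<close> with \<open>q(x) \<noteq> 0\<close>.
\<close>

definition section_fun ::
    "('v::complex_vector \<Rightarrow> complex) \<Rightarrow> ('v \<Rightarrow> complex) \<Rightarrow> 'v set \<Rightarrow> complex"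
  where "section_fun q l = (\<lambda>y. let v = (SOME v. v \<in> y \<and> v \<noteq> 0) in l v / q v)"

definition trivializing :: "'v::complex_vector set \<Rightarrow> 'v set \<Rightarrow> ('v \<Rightarrow> complex) \<Rightarrow> bool"
  where "trivializing V x q \<longleftrightarrow> clinear_on V q \<and> x \<in> basic_open V q"

definition jet_kernel ::
    "'v::complex_vector set \<Rightarrow> 'v set set \<Rightarrow> 'v set \<Rightarrow> nat \<Rightarrow> ('v \<Rightarrow> complex) set"
  where "jet_kernel V Z x k = {l. clinear_on V l \<and>
    (\<forall>q. trivializing V x q \<longrightarrow> section_fun q l \<in> max_ideal_pow V Z x (k + 1))}"

text \<open>
  Another choice of \<open>q\<close> rescales the leading form, so that the subspace of \<open>Sym\<^sup>k T\<^sub>x\<^sup>*Z\<close> does not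
  depend on the identification \<open>L\<^sub>x \<cong> \<complex>\<close>.
\<close>

definition fundamental_form ::
    "'v::complex_vector set \<Rightarrow> 'v set set \<Rightarrow> 'v set \<Rightarrow> nat \<Rightarrow>
     ((('v set \<Rightarrow> complex) \<Rightarrow> complex) list \<Rightarrow> complex) set"
  where "fundamental_form V Z x k =
    (if k \<le> 1 then sym_forms (tangent V Z x) k
     else {\<phi>. \<exists>l\<in>jet_kernel V Z x (k - 1). \<exists>q. trivializing V x q \<and>
       leading_form V Z x k (section_fun q l) \<phi>})"

definition pullback_form ::
    "'w set \<Rightarrow> ('w \<Rightarrow> 't) \<Rightarrow> ('t list \<Rightarrow> complex) \<Rightarrow> 'w list \<Rightarrow> complex"
  where "pullback_form W h \<phi> = (\<lambda>ws. if set ws \<subseteq> W then \<phi> (map h ws) else 0)"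

text \<open>
  A linear isomorphism \<open>T\<^sub>x\<^sup>*Z \<rightarrow> W\<^sup>*\<close> is the transpose of a linear isomorphism \<open>h: W \<rightarrow> T\<^sub>xZ\<close>; the
  induced isomorphism of symmetric algebras is pullback of forms along \<open>h\<close>.
\<close>

definition fundamental_forms_iso ::
    "'v::complex_vector set \<Rightarrow> 'v set set \<Rightarrow> 'v set \<Rightarrow>
     'w::complex_vector set \<Rightarrow> (nat \<Rightarrow> ('w list \<Rightarrow> complex) set) \<Rightarrow> bool"
  where "fundamental_forms_iso V Z x W F \<longleftrightarrow>
    (\<exists>h. lin_iso W (tangent V Z x) h \<and>
      (\<forall>k. pullback_form W h ` fundamental_form V Z x k = F k))"

end

theory Submission
  imports Defs
begin

text \<open>
  \<open>M(F)\<close> is the closure of the image of a polynomial map \<open>\<nu>: W \<rightarrow> V\<^sub>F\<close> with a linear left inverse. The functions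
  \<open>l \<circ> \<nu>\<close> for \<open>l \<in> V\<^sub>F\<^sup>*\<close> form a space of polynomials on \<open>W\<close> which is stable under dilations and, since \<open>F\<close> is closed
  under contractions, under translations. Hence these maps of \<open>W\<close> extend to linear maps of \<open>V\<^sub>F\<close>, and dilations
  about \<open>u\<close> are of Euler type at \<open>\<nu>(u)\<close>.

  Conversely, let a torus act with Euler type at \<open>x\<close>. Split off the eigenvectors of \<open>V\<close>; the equations of \<open>Z\<close> may be chosen to be
  eigenvectors, too. As all tangent weights coincide, Nakayama's argument shows that near \<open>x\<close> only multiples of the
  tangent weight occur, and solving the equations weight by weight expresses a point of the chart polynomially by its
  tangential part. This is again a map \<open>\<nu>\<close> as above, and \<open>{l \<circ> \<nu>}\<close> is stable under dilations. At a point with minimal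
  dimensions of jets it is stable under translations by Cartan's argument, and its homogeneous parts form the symbol system.
\<close>

text \<open>Two obstacles shape the converse. A dilation about one point says nothing about
  translations. Cartan's comparison closes the gap: a nonzero pulled-back functional of degree below
  \<open>k\<close> cannot vanish to order \<open>k\<close> at any point, and at the origin those of
  degree below \<open>k\<close> are complementary to those vanishing to order \<open>k\<close>.
  Where dimensions agree with those at the origin, complementarity persists, so a homogeneous part
  of degree \<open>k\<close> can be corrected by lower terms until it vanishes to order
  \<open>k\<close> at \<open>u\<close>; it is then the translate to \<open>u\<close>. This covers an
  open set of \<open>u\<close> and spreads to all \<open>u\<close> as a polynomial identity. The
  other obstacle is to recognize \<open>Z\<close> as the closure of a graph without dimension theory
  of varieties. Nonsingularity makes the tangent cones of both agree at common points; so
  derivatives of functions that vanish on \<open>Z\<close> vanish there again, and Taylor expansion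
  at \<open>x\<close> finishes. The torus is normalized beforehand: a twist by a character gives
  \<open>x\<close> weight 0, isolation of the fixed point excludes tangent weight 0, and passing to
  the inverse torus makes a negative weight positive.\<close>

abbreviation (input) "lin \<equiv> clinear_on"
abbreviation (input) "homog \<equiv> homog_polys"
abbreviation (input) "pfuns \<equiv> poly_funs"
notation scaleC (infixr "*." 75)

section \<open>Linear algebra\<close>

global_interpretation cvp: vector_space_pair
 "scaleC :: complex=>'a=>'a::complex_vector" "scaleC :: complex=>'b=>'b::complex_vector"
 by unfold_locales

abbreviation clinear :: "('a::complex_vector=>'b::complex_vector)=>bool"
 where "clinear \<equiv> Vector_Spaces.linear scaleC scaleC"

lemma clinear_iff: "clinear f \<longleftrightarrow> (ALL x y. f (x + y)=f x + f y)&(ALL c x. f (c *. x)=c *. f x)"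
 unfolding Vector_Spaces.linear_iff by (simp add: cvs.vector_space_axioms)

lemma scaleC_complex [simp]: "c *. (z::complex)=c * z"
 by (simp add: scaleC_complex_def)

lemma clinear_onI:
 "(!!x y. x:V==>y:V==>f (x + y)=f x + f y)==>(!!c x. x:V==>f (c *. x)=c *. f x)==>lin V f"
 by (simp add: clinear_on_def)

lemma lin_add: "lin V f==>x:V==>y:V==>f (x + y)=f x + f y"
 and lin_scale: "lin V f==>x:V==>f (c *. x)=c *. f x"
 by (simp_all add: clinear_on_def)

lemma lin_subset: "lin V f==>S \<subseteq> V==>lin S f"
 unfolding clinear_on_def by (meson subsetD)

lemma clinear_clinear_on: "clinear f==>lin V f"
 by (simp add: clinear_iff clinear_on_def)

lemmas sub_add = cvs.subspace_add and sub_scale = cvs.subspace_scale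
 and sub_0 = cvs.subspace_0 and sub_diff = cvs.subspace_diff
 and sub_neg = cvs.subspace_neg and sub_sum = cvs.subspace_sum

lemma lin_0: "csubspace V==>lin V f==>f 0=0"
 using lin_scale[of V f 0 0] sub_0[of V] by simp

lemma lin_diff: "csubspace V==>lin V f==>x:V==>y:V==>f (x - y)=f x - f y"
 using lin_add[of V f x "(-1) *. y"] lin_scale[of V f y "-1"] sub_neg[of V y]
 by (simp add: cvs.scale_minus_left)

lemma lin_sum:
 assumes "csubspace V" "lin V f" "!!i. i:I==>g i:V"
 shows "f (sum g I)=(SUM i:I. f (g i))"
 using assms(3)
 by (induction I rule: infinite_finite_induct)
  (simp_all add: lin_0[OF assms(1,2)] lin_add[OF assms(2)] sub_sum[OF assms(1)])

lemma lin_lincomb: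
 assumes "csubspace V" "lin V f" "!!i. i:I==>g i:V"
 shows "f (SUM i:I. c i *. g i)=(SUM i:I. c i *. f (g i))"
 using lin_sum[OF assms(1,2), of I "%i. c i *. g i"] assms
 by (simp add: sub_scale lin_scale[OF assms(2)])

lemma lin_comp: "lin V f==>lin U g==>f ` V \<subseteq> U==>lin V (%x. g (f x))"
 unfolding clinear_on_def by (simp add: image_subset_iff)

lemma lin_plus: "lin V f==>lin V g==>lin V (%x. f x + g x)"
 and lin_cmult: "lin V f==>lin V (%x. c *. f x)"
 by (simp_all add: clinear_on_def scaleC_add_right cvs.scale_left_commute)

lemma lin_cmult': "lin V (f :: _=>complex)==>lin V (%x. c * f x)"
 using lin_cmult[of V f c] by simp

lemma lin_lincomb_fun:
 "(!!i. i:I==>lin V (f i))==>lin V (%x. SUM i:I. c i *. f i x)"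
 by (induction I rule: infinite_finite_induct)
  (simp_all add: lin_plus lin_cmult, simp_all add: clinear_on_def)

lemma lin_cong: "csubspace V==>lin V f==>(!!x. x:V==>f x=g x)==>lin V g"
 by (simp add: clinear_on_def sub_add sub_scale)

lemma sub_ker:
 assumes "csubspace V" "lin V f" shows "csubspace {v:V. f v=0}"
 unfolding cvs.subspace_def[of "{v:V. f v=0}"]
 by (simp add: lin_add[OF assms(2)] lin_scale[OF assms(2)] lin_0[OF assms]
   sub_0[OF assms(1)] sub_add[OF assms(1)] sub_scale[OF assms(1)])

lemma sub_image:
 assumes "csubspace V" "lin V f" shows "csubspace (f ` V)"
 unfolding cvs.subspace_def[of "f ` V"]
proof safe
 show "0:f ` V" using lin_0[OF assms] sub_0[OF assms(1)] by (metis imageI)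
 show "f x + f y:f ` V" if "x:V" "y:V" for x y
  using lin_add[OF assms(2) that] sub_add[OF assms(1) that] by (metis imageI)
 show "c *. f x:f ` V" if "x:V" for c x
  using lin_scale[OF assms(2) that] sub_scale[OF assms(1) that] by (metis imageI)
qed

text \<open>Available for every set, so that the three facts in \<open>vbasis\<close> carry no side
  condition; for a subspace it is a basis by \<open>span_vbasis\<close>.\<close>

definition vbasis :: "'a::complex_vector set=>'a set"
 where "vbasis V=(SOME B. B \<subseteq> V&\<not> cdependent B&V \<subseteq> cspan B)"

definition coord :: "'a::complex_vector set=>'a=>'a=>complex"
 where "coord V b v=crepresentation (vbasis V) v b"

lemma vbasis: "vbasis V \<subseteq> V" "\<not> cdependent (vbasis V)" "V \<subseteq> cspan (vbasis V)"
proof -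
 have "EX B. B \<subseteq> V&\<not> cdependent B&V \<subseteq> cspan B"
  using cvs.maximal_independent_subset by metis
 from someI_ex[OF this] show "vbasis V \<subseteq> V" "\<not> cdependent (vbasis V)" "V \<subseteq> cspan (vbasis V)"
  unfolding vbasis_def by blast+
qed

lemma span_vbasis: "csubspace V==>cspan (vbasis V)=V"
 using vbasis[of V] cvs.span_minimal by blast

lemma card_vbasis: "card (vbasis V)=cdim V"
 using vbasis[of V] by (intro cvs.basis_card_eq_dim)

lemma finite_dimI: "csubspace V==>finite B==>V \<subseteq> cspan B==>finite_dim V"
proof -
 assume V: "csubspace V" and B: "finite B" "V \<subseteq> cspan B"
 have "finite (vbasis V)"
  using cvs.independent_span_bound[OF B(1) vbasis(2)[of V]] vbasis(1)[of V] B(2) by blast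
 then show ?thesis unfolding finite_dim_def using V span_vbasis[OF V] by auto
qed

lemma fd_sub: "finite_dim V==>csubspace V"
 by (simp add: finite_dim_def)

lemma finite_vbasis: "finite_dim V==>finite (vbasis V)"
 using cvs.independent_span_bound[OF _ vbasis(2)[of V]] vbasis(1)[of V] unfolding finite_dim_def by blast

lemma finite_dim_subspace: "finite_dim V==>csubspace S==>S \<subseteq> V==>finite_dim S"
 by (metis finite_dimI finite_dim_def)

lemma coord_linear: "csubspace V==>lin V (coord V b)"
 using vbasis(2)[of V] span_vbasis[of V]
 by (intro clinear_onI) (simp_all add: coord_def cvs.representation_add cvs.representation_scale)

lemma coord_expand: "finite_dim V==>v:V==>(SUM b:vbasis V. coord V b v *. b)=v"
 unfolding coord_def
 using vbasis(2)[of V] span_vbasis[of V] finite_vbasis[of V] fd_sub[of V]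
 by (intro cvs.sum_representation_eq) auto

lemma lin_expand:
 assumes "finite_dim V" "lin V f" "v:V"
 shows "f v=(SUM b:vbasis V. coord V b v *. f b)"
proof -
 have "f (SUM b:vbasis V. coord V b v *. b)=(SUM b:vbasis V. coord V b v *. f b)"
  using vbasis(1) by (intro lin_lincomb[OF fd_sub[OF assms(1)] assms(2)]) blast
 then show ?thesis by (simp add: coord_expand[OF assms(1,3)])
qed

text \<open>Maps in this development are linear on a subspace only, whereas the library's
  independence results speak of total linear maps. Values on \<open>vbasis S\<close> are extended,
  and the set of agreement is a subspace containing that basis.\<close>

lemma lin_extend:
 assumes "csubspace S" "lin S f"
 shows "EX g. clinear g&(ALL x:S. g x=f x)"
proof -
 obtain g where g: "clinear g" "ALL x:vbasis S. g x=f x"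
  using cvp.linear_independent_extend[OF vbasis(2), where f = f] by blast
 have "csubspace {x:S. g x - f x=0}"
  by (rule sub_ker[OF assms(1)])
   (use g(1) assms(2) in \<open>auto simp: clinear_on_def clinear_iff cvs.scale_right_diff_distrib\<close>)
 moreover have "vbasis S \<subseteq> {x:S. g x - f x=0}" using g(2) vbasis(1)[of S] by auto
 ultimately have "cspan (vbasis S) \<subseteq> {x:S. g x - f x=0}" by (rule cvs.span_minimal[rotated])
 then show ?thesis using g(1) span_vbasis[OF assms(1)] by auto
qed

lemma independent_insert_vbasis:
 assumes "csubspace S" "v \<notin> S" shows "\<not> cdependent (insert v (vbasis S))"
 by (rule cvs.independent_insertI) (simp_all add: assms vbasis span_vbasis[OF assms(1)])

text \<open>Adding \<open>v\<close> to a basis of \<open>S\<close> keeps it independent, so values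
  on the enlarged set can be prescribed freely.\<close>

lemma separating_functional:
 assumes "csubspace S" "v \<notin> S"
 shows "EX l :: 'a::complex_vector=>complex. clinear l&(ALL x:S. l x=0)&l v=1"
proof -
 have ind: "\<not> cdependent (insert v (vbasis S))"
  by (rule independent_insert_vbasis[OF assms])
 obtain l :: "'a=>complex" where l: "clinear l" "ALL x:insert v (vbasis S). l x=(if x=v then 1 else 0)"
  using cvp.linear_independent_extend[OF ind, where f = "%x. if x=v then 1 else 0"] by blast
 have "v \<notin> vbasis S" using vbasis(1) assms(2) by blast
 then have "vbasis S \<subseteq> {x:UNIV. l x=0}" using l(2) by auto
 moreover have "csubspace {x:UNIV. l x=0}"
  by (rule sub_ker) (use l(1) in \<open>auto simp: clinear_clinear_on cvs.subspace_UNIV\<close>)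
 ultimately have "cspan (vbasis S) \<subseteq> {x:UNIV. l x=0}" by (rule cvs.span_minimal)
 then show ?thesis using l span_vbasis[OF assms(1)] by (intro exI[of _ l]) auto
qed

lemma cdim_mono:
 assumes "finite_dim T" "csubspace S" "S \<subseteq> T" shows "cdim S<=cdim T"
proof -
 have "card (vbasis S)<=card (vbasis T)"
  using cvs.independent_span_bound[OF finite_vbasis[OF assms(1)] vbasis(2)[of S]] vbasis(1)[of S]
   span_vbasis[OF fd_sub[OF assms(1)]] assms(3) by auto
 then show ?thesis by (simp add: card_vbasis)
qed

lemma card_le_cdim:
 assumes "finite_dim T" "\<not> cdependent B" "B \<subseteq> T" shows "finite B&card B<=cdim T"
 using cvs.independent_span_bound[OF finite_vbasis[OF assms(1)] assms(2)]
  span_vbasis[OF fd_sub[OF assms(1)]] assms(3) by (simp add: card_vbasis)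

text \<open>A vector of \<open>T\<close> outside \<open>S\<close> would extend a basis of
  \<open>S\<close> to an independent set with more than \<open>cdim T\<close> elements.\<close>

lemma cdim_eq_imp_eq:
 assumes T: "finite_dim T" and S: "csubspace S" "S \<subseteq> T" and "cdim T<=cdim S" shows "S=T"
proof (rule ccontr)
 assume "S~=T"
 then obtain v where v: "v:T" "v \<notin> S" using S by auto
 have ind: "\<not> cdependent (insert v (vbasis S))"
  by (rule independent_insert_vbasis[OF S(1) v(2)])
 have "card (insert v (vbasis S))<=cdim T"
  using card_le_cdim[OF T ind] vbasis(1)[of S] v(1) S(2) by blast
 moreover have "v \<notin> vbasis S" using vbasis(1) v(2) by blast
 moreover have "finite (vbasis S)" using finite_vbasis finite_dim_subspace[OF T S] by blast
 ultimately show False using assms(4) by (simp add: card_vbasis)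
qed

text \<open>The image of a basis stays independent, so the target bounds its size. The source
  receives its finite dimension from the target; this serves
  \<open>sym_forms_finite_dim\<close>.\<close>

lemma inj_linear_dim:
 assumes U: "csubspace U" and f: "lin U f" "inj_on f U" "f ` U \<subseteq> T" and T: "finite_dim T"
 shows "finite_dim U" "cdim U<=cdim T"
proof -
 obtain g where g: "clinear g" "ALL x:U. g x=f x" using lin_extend[OF U f(1)] by blast
 have ginj: "inj_on g U" using f(2) g(2) by (auto simp: inj_on_def)
 have "\<not> cdependent (g ` vbasis U)"
  by (rule cvp.linear_independent_injective_image[OF g(1)]) (use vbasis(2)[of U] span_vbasis[OF U] ginj in auto)
 then have "finite (g ` vbasis U)&card (g ` vbasis U)<=cdim T"
  using g(2) f(3) vbasis(1)[of U] by (intro card_le_cdim[OF T]) auto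
 moreover have "inj_on g (vbasis U)" using ginj vbasis(1) inj_on_subset by blast
 ultimately have "finite (vbasis U)" "card (vbasis U)<=cdim T"
  by (auto simp: card_image dest: finite_imageD)
 then show "finite_dim U" "cdim U<=cdim T"
  using finite_dimI[OF U _ vbasis(3)] by (auto simp: card_vbasis)
qed

lemma surj_linear_dim:
 assumes U: "finite_dim U" and f: "lin U f"
 shows "finite_dim (f ` U)" "cdim (f ` U)<=cdim U"
proof -
 have sub: "f ` U \<subseteq> cspan (f ` vbasis U)"
 proof safe
  fix u assume "u:U"
  then show "f u:cspan (f ` vbasis U)"
   by (subst lin_expand[OF U f], assumption)
    (rule cvs.span_sum, rule cvs.span_scale, rule cvs.span_base, rule imageI)
 qed
 have fin: "finite (f ` vbasis U)" using finite_vbasis[OF U] by blast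
 show "finite_dim (f ` U)"
  by (rule finite_dimI[OF sub_image[OF fd_sub[OF U] f] fin sub])
 have "cdim (f ` U)<=card (f ` vbasis U)" by (rule cvs.dim_le_card[OF sub fin])
 also have "\<dots><=card (vbasis U)" using finite_vbasis[OF U] by (rule card_image_le)
 finally show "cdim (f ` U)<=cdim U" by (simp add: card_vbasis)
qed

lemma lin_iso_cdim:
 assumes U: "finite_dim U" and f: "lin_iso U T f"
 shows "finite_dim T" "cdim T=cdim U"
proof -
 have f': "lin U f" "inj_on f U" "f ` U=T" using f by (auto simp: lin_iso_def bij_betw_def)
 show T: "finite_dim T" using surj_linear_dim[OF U f'(1)] f'(3) by simp
 show "cdim T=cdim U"
  using surj_linear_dim(2)[OF U f'(1)] f'(3) inj_linear_dim(2)[OF fd_sub[OF U] f'(1,2) _ T]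
  by simp
qed

text \<open>The union of bases of \<open>S\<close> and \<open>T\<close> is independent, since a
  relation would give an element of \<open>S \<inter> T\<close>. The second conclusion is the
  counting form used in \<open>cartan\<close>: subspaces that meet in 0 and are large enough
  together fill \<open>V\<close>.\<close>

lemma direct_sum_dim:
 assumes V: "finite_dim V" and S: "csubspace S" "S \<subseteq> V" and T: "csubspace T" "T \<subseteq> V" and "S \<inter> T={0}"
 shows "cdim S + cdim T<=cdim V" and "cdim V<=cdim S + cdim T==>v:V==>EX s:S. EX t:T. v = s + t"
  and "(!!v. v:V==>EX s:S. EX t:T. v = s + t)==>cdim S + cdim T=cdim V"
proof -
 let ?P = "S \<times> T" and ?f = "%(s, t). s + t"
 let ?B = "vbasis S \<union> vbasis T"
 have fin: "finite (vbasis S)" "finite (vbasis T)"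
  using finite_vbasis finite_dim_subspace[OF V] S T by blast+
 have disj: "vbasis S \<inter> vbasis T={}"
 proof -
  have "0 \<notin> vbasis S" using vbasis(2)[of S] cvs.dependent_zero by blast
  moreover have "x:S \<inter> T" if "x:vbasis S \<inter> vbasis T" for x
   using that vbasis(1)[of S] vbasis(1)[of T] by (meson IntD1 IntD2 IntI subsetD)
  ultimately show ?thesis unfolding assms(6) by (metis equals0I IntD1 singletonD)
 qed
 have ind: "\<not> cdependent ?B"
 proof (rule cvs.independent_if_scalars_zero)
  fix g x assume s: "(SUM x:?B. g x *. x)=0" and x: "x:?B"
  have "(SUM x:vbasis S. g x *. x) + (SUM x:vbasis T. g x *. x)=0"
   using s by (simp add: sum.union_disjoint[OF fin disj])
  moreover have inS: "(SUM x:vbasis S. g x *. x):S"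
   using vbasis(1)[of S] by (intro sub_sum[OF S(1)] sub_scale[OF S(1)]) auto
  moreover have inT: "(SUM x:vbasis T. g x *. x):T"
   using vbasis(1)[of T] by (intro sub_sum[OF T(1)] sub_scale[OF T(1)]) auto
  ultimately have "(SUM x:vbasis S. g x *. x)=- (SUM x:vbasis T. g x *. x)"
   by (simp add: eq_neg_iff_add_eq_0)
  then have "(SUM x:vbasis S. g x *. x):S \<inter> T" using inS inT sub_neg[OF T(1) inT] by auto
  then have z: "(SUM x:vbasis S. g x *. x)=0" "(SUM x:vbasis T. g x *. x)=0"
   using assms(6) \<open>_ + _ = 0\<close> by auto
  show "g x=0"
   using x cvs.independentD[OF vbasis(2) fin(1) subset_refl z(1)] cvs.independentD[OF vbasis(2) fin(2) subset_refl z(2)]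
   by blast
 qed (use fin in auto)
 have card: "card ?B=cdim S + cdim T" by (simp add: card_Un_disjoint[OF fin disj] card_vbasis)
 have BV: "?B \<subseteq> V" using vbasis(1)[of S] vbasis(1)[of T] S T by auto
 show "cdim S + cdim T<=cdim V" using card_le_cdim[OF V ind BV] card by simp
 let ?Q = "{x + y | x y. x:S&y:T}"
 have Q: "csubspace ?Q" by (rule cvs.subspace_sums[OF S(1) T(1)])
 have QV: "?Q \<subseteq> V" using S T sub_add[OF fd_sub[OF V]] by blast
 have "S \<subseteq> ?Q"
 proof fix x assume "x:S" then show "x:?Q" using sub_0[OF T(1)] by (intro CollectI exI[of _ x] exI[of _ 0]) auto qed
 moreover have "T \<subseteq> ?Q"
 proof fix x assume "x:T" then show "x:?Q" using sub_0[OF S(1)] by (intro CollectI exI[of _ 0] exI[of _ x]) auto qed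
 ultimately have BQ: "?B \<subseteq> ?Q" using vbasis(1)[of S] vbasis(1)[of T] by blast
 have "cdim S + cdim T<=cdim ?Q"
  using card_le_cdim[OF finite_dim_subspace[OF V Q QV] ind BQ] card by simp
 then show "cdim V<=cdim S + cdim T==>v:V==>EX s:S. EX t:T. v = s + t"
  using cdim_eq_imp_eq[OF V Q QV] by auto
 show "cdim S + cdim T=cdim V" if *: "!!v. v:V==>EX s:S. EX t:T. v = s + t"
 proof -
  have "V \<subseteq> cspan ?B"
  proof
   fix v assume "v:V"
   then obtain s t where st: "s:S" "t:T" "v = s + t" using * by blast
   have "s:cspan ?B" using st(1) vbasis(3)[of S] cvs.span_mono[of "vbasis S" ?B] by blast
   moreover have "t:cspan ?B" using st(2) vbasis(3)[of T] cvs.span_mono[of "vbasis T" ?B] by blast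
   ultimately show "v:cspan ?B" using st(3) cvs.span_add by blast
  qed
  then have "cdim V=card ?B" using cvs.basis_card_eq_dim[OF BV _ ind] by simp
  then show ?thesis using card by simp
 qed
qed

section \<open>Common kernels of spaces of functionals\<close>

definition dual_system ::
  "'v::complex_vector set=>('v=>complex) set=>'v set=>('v=>'v=>complex)=>bool"
 where "dual_system V E I e \<longleftrightarrow> finite I&I \<subseteq> V&(ALL i:I. e i:E)&(ALL i:I. ALL j:I. e i j=(if i=j then 1 else 0))"

lemma dual_system_independent:
 assumes "csubspace V" "dual_system V E I e" "!!l. l:E==>lin V l"
 shows "\<not> cdependent I"
proof (rule cvs.independent_if_scalars_zero)
 show "finite I" using assms by (simp add: dual_system_def)
 fix g i assume s: "(SUM x:I. g x *. x)=0" and i: "i:I"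
 have "0=e i (SUM x:I. g x *. x)"
  using s lin_0[OF assms(1)] assms(2,3) i by (metis dual_system_def)
 also have "\<dots>=(SUM x:I. g x *. e i x)"
  using assms i by (intro lin_lincomb[OF assms(1)]) (auto simp: dual_system_def)
 also have "\<dots>=(SUM x:I. if x=i then g x else 0)"
  using assms(2) i by (intro sum.cong) (auto simp: dual_system_def)
 also have "\<dots>=g i" using i \<open>finite I\<close> by simp
 finally show "g i=0" by simp
qed

text \<open>
 \<open>V = K \<oplus> \<langle>I\<rangle>\<close> for the common kernel \<open>K\<close> of \<open>E\<close>: a dual system of maximal size splits off \<open>K\<close>.
\<close>

lemma dual_system_exists:
 fixes V :: "'v::complex_vector set"
 assumes V: "finite_dim V" and lin: "!!l. l:E==>lin V l"
  and E: "!!l m c. l:E==>m:E==>(%v. l v + c * m v):E"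
 obtains I e where "dual_system V E I e"
  "!!v l. v:V==>l:E==>l (v - (SUM i:I. e i v *. i))=0"
proof -
 have V': "csubspace V" using V by (rule fd_sub)
 define P where "P n \<longleftrightarrow> (EX I e. dual_system V E I e&card I=n)" for n
 have "P 0" unfolding P_def
  by (intro exI[of _ "{}"]) (auto simp: dual_system_def)
 have bd: "n<=cdim V" if n: "P n" for n
 proof -
  obtain I e where I: "dual_system V E I e" "card I=n" using n unfolding P_def by (elim exE conjE)
  then have "I \<subseteq> V" by (simp add: dual_system_def)
  then show ?thesis using card_le_cdim[OF V dual_system_independent[OF V' I(1) lin]] I(2) by blast
 qed
 define n where "n=(GREATEST n. P n)"
 have Pn: "P n" unfolding n_def by (rule GreatestI_nat[of P 0 "cdim V"]; fact)
 have nmax: "m<=n" if "P m" for m unfolding n_def by (rule Greatest_le_nat[of P m "cdim V"]; fact)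
 obtain I e where Ie: "dual_system V E I e" and cI: "card I=n" using Pn[unfolded P_def] by (elim exE conjE)
 have fin: "finite I" and IV: "I \<subseteq> V" and eE: "!!i. i:I==>e i:E"
  and d: "!!i j. i:I==>j:I==>e i j=(if i=j then 1 else 0)"
  using Ie by (auto simp: dual_system_def)
 have E': "(%v. l v - (SUM i:J. c i * e i v)):E" if "l:E" "finite J" "J \<subseteq> I" for l c J
  using that(2,3)
 proof (induction J rule: finite_induct)
  case (insert j J)
  then have "(%v. (l v - (SUM i:J. c i * e i v)) + (- c j) * e j v):E" using eE by (intro E) auto
  also have "(%v. (l v - (SUM i:J. c i * e i v)) + (- c j) * e j v)=(%v. l v - (SUM i:insert j J. c i * e i v))"
   using insert by (auto simp: fun_eq_iff)
  finally show ?case .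
 qed (use that in simp)
 show thesis
 proof (rule that[OF Ie], rule ccontr)
  fix v l assume v: "v:V" and l: "l:E" and ne: "l (v - (SUM i:I. e i v *. i))~=0"
  define v' where "v'=v - (SUM i:I. e i v *. i)"
  have sV: "(SUM i:I. c i *. i):V" for c using IV by (intro sub_sum[OF V'] sub_scale[OF V']) auto
  have v'V: "v':V" unfolding v'_def using v sV by (intro sub_diff[OF V']) auto
  have ev': "e i v'=0" if i: "i:I" for i
  proof -
   have "e i (SUM i:I. e i v *. i)=(SUM j:I. e j v *. e i j)"
    using IV by (intro lin_lincomb[OF V' lin[OF eE[OF i]]]) auto
   also have "\<dots>=(SUM j:I. if j=i then e j v else 0)"
    using i by (intro sum.cong) (auto simp: d)
   finally show ?thesis unfolding v'_def
    using lin_diff[OF V' lin[OF eE[OF i]] v sV] i fin by simp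
  qed
  \<comment> \<open>\<open>w\<close> and \<open>m\<close> are \<open>v\<close> and \<open>l\<close>
    made orthogonal to the old system, with \<open>w\<close> normalized. They enlarge the system,
    against maximality.\<close>
  define w where "w=inverse (l v') *. v'"
  define m where "m=(%v. l v - (SUM i:I. l i * e i v))"
  have wV: "w:V" unfolding w_def using v'V by (rule sub_scale[OF V'])
  have ew: "e i w=0" if "i:I" for i
   unfolding w_def using lin_scale[OF lin[OF eE[OF that]] v'V] ev'[OF that] by simp
  have wI: "w \<notin> I" using ew d by force
  have mE: "m:E" unfolding m_def using E'[OF l fin subset_refl] .
  have mw: "m w=1" unfolding m_def using ew lin_scale[OF lin[OF l] v'V, of "inverse (l v')"] ne
   by (simp add: w_def[symmetric] v'_def[symmetric])
  have mi: "m i=0" if "i:I" for i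
  proof -
   have "(SUM j:I. l j * e j i)=(SUM j:I. if j=i then l j else 0)"
    using that by (intro sum.cong) (auto simp: d)
   then show ?thesis using that fin by (simp add: m_def)
  qed
  have "dual_system V E (insert w I) (e(w := m))"
   unfolding dual_system_def using fin IV wV eE mE d ew mw mi wI by auto
  then have "P (Suc n)" unfolding P_def using wI fin cI
   by (intro exI[of _ "insert w I"] exI[of _ "e(w := m)"]) simp
  then show False using nmax[of "Suc n"] by simp
 qed
qed

text \<open>The map taking \<open>v\<close> to \<open>v - (SUM i:I. e i v *. i)\<close> projects
  onto the common kernel along \<open>cspan I\<close>, so the two are complementary.\<close>

lemma dual_system_dim:
 assumes V: "finite_dim V" and lin: "!!l. l:E==>lin V l" and I: "dual_system V E I e"
  and red: "!!v l. v:V==>l:E==>l (v - (SUM i:I. e i v *. i))=0"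
 shows "card I + cdim {v:V. ALL l:E. l v=0}=cdim V"
proof -
 have V': "csubspace V" using V by (rule fd_sub)
 let ?K = "{v:V. ALL l:E. l v=0}"
 have K: "csubspace ?K"
 proof (rule cvs.subspaceI)
  show "0:?K" using lin_0[OF V' lin] sub_0[OF V'] by simp
  fix x y c assume x: "x:?K"
  have xl: "l x=0" if "l:E" for l using x that by blast
  have "l (c *. x)=0" if "l:E" for l using x lin_scale[OF lin[OF that], of x c] xl[OF that] by simp
  then show "c *. x:?K" using x sub_scale[OF V', of x c] by simp
  assume y: "y:?K"
  have yl: "l y=0" if "l:E" for l using y that by blast
  have "l (x + y)=0" if "l:E" for l
   using x y lin_add[OF lin[OF that], of x y] xl[OF that] yl[OF that] by simp
  then show "x + y:?K" using x y sub_add[OF V', of x y] by simp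
 qed
 have fin: "finite I" and IV: "I \<subseteq> V" and eE: "!!i. i:I==>e i:E"
  and d: "!!i j. i:I==>j:I==>e i j=(if i=j then 1 else 0)"
  using I by (auto simp: dual_system_def)
 have ind: "\<not> cdependent I" by (rule dual_system_independent[OF V' I lin])
 have SV: "cspan I \<subseteq> V" using IV V' by (rule cvs.span_minimal)
 have "cdim (cspan I) + cdim ?K=cdim V"
 proof (rule direct_sum_dim(3)[OF V cvs.subspace_span SV K])
  show "cspan I \<inter> ?K={0}"
  proof safe
   fix x assume x: "x:cspan I" "x:V" and k: "ALL l:E. l x=0"
   obtain c where c: "x=(SUM i:I. c i *. i)" using x(1) cvs.span_finite[OF fin] by auto
   have "c i=0" if i: "i:I" for i
   proof -
    have "0=e i x" using k eE i by simp
    also have "\<dots>=(SUM j:I. c j *. e i j)"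
     unfolding c using IV by (intro lin_lincomb[OF V' lin[OF eE[OF i]]]) auto
    also have "\<dots>=(SUM j:I. if j=i then c j else 0)"
     using i by (intro sum.cong) (auto simp: d)
    finally show ?thesis using i fin by simp
   qed
   then show "x=0" unfolding c by simp
  qed (use cvs.span_zero sub_0[OF V'] lin_0[OF V' lin] in auto)
  show "EX s:cspan I. EX t:?K. v = s + t" if v: "v:V" for v
  proof (intro bexI)
   show s: "(SUM i:I. e i v *. i):cspan I"
    by (rule cvs.span_sum, rule cvs.span_scale, rule cvs.span_base)
   then show "v - (SUM i:I. e i v *. i):?K" using red[OF v] v SV sub_diff[OF V'] by auto
  qed simp
 qed auto
 then show ?thesis by (simp add: cvs.dim_eq_card_independent[OF ind])
qed

text \<open>
 Gaussian elimination over a graded ring of functions: instead of a determinant it yields some \<open>g\<close>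
 whose non-vanishing forces the square matrix \<open>M\<close> to be injective.
\<close>

lemma nonsingular_locus:
 fixes M :: "'i=>'i=>'a=>complex"
 assumes "finite I"
  and mult: "!!d e f g. f:H d==>g:H e==>(%x. f x * g x):H (d + e)"
  and diff: "!!d f g. f:H d==>g:H d==>(%x. f x - g x):H d"
  and one: "(%_. 1):H (0::nat)"
  and M: "!!i j. i:I==>j:I==>M i j:H (d i)"
  and Mx: "!!i j. i:I==>j:I==>M i j x=(if i=j then 1 else 0)"
 shows "EX e. EX g:H e. g x=1 &
  (ALL y h. g y~=0-->(ALL i:I. (SUM j:I. M i j y * h j)=0)-->(ALL j:I. h j=0))"
 using assms(1) M Mx
proof (induction I arbitrary: M d rule: finite_induct)
 case empty
 then show ?case using one by (intro exI[of _ 0] bexI[of _ "%_. 1"]) auto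
next
 case (insert k I)
 \<comment> \<open>Elimination by cross-multiplication with the pivot \<open>M k k\<close>: nothing
   is divided, degrees only add up, and at \<open>x\<close>, where the pivot is 1 and the rest of
   its column 0, the identity matrix survives.\<close>
 define M' where "M' i j=(%x. M k k x * M i j x - M i k x * M k j x)" for i j
 have "M' i j:H (d k + d i)" if "i:I" "j:I" for i j
  unfolding M'_def using that insert.prems(1) mult[of "M i k" "d i" "M k j" "d k"] mult[of "M k k" "d k" "M i j" "d i"]
  by (intro diff) (auto simp: add.commute)
 moreover have "M' i j x=(if i=j then 1 else 0)" if "i:I" "j:I" for i j
  unfolding M'_def using that insert.prems(2)[of k k] insert.prems(2)[of i k] insert.prems(2)[of i j] insert.hyps(2)
  by auto
 ultimately obtain e g where g: "g:H e" "g x=1" and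
  inj: "!!y h. g y~=0==>(ALL i:I. (SUM j:I. M' i j y * h j)=0)==>(ALL j:I. h j=0)"
  using insert.IH[of M' "%i. d k + d i"] by blast
 show ?case
 proof (intro exI[of _ "d k + e"] bexI[of _ "%x. M k k x * g x"] conjI allI impI)
  show "(%x. M k k x * g x):H (d k + e)" using insert.prems(1) g by (intro mult) auto
  show "M k k x * g x=1" using insert.prems(2)[of k k] g by simp
  fix y h assume ne: "M k k y * g y~=0" and eq: "ALL i:insert k I. (SUM j:insert k I. M i j y * h j)=0"
  have *: "(SUM j:I. M i j y * h j)=- M i k y * h k" if "i:insert k I" for i
   
  proof -
   have "(SUM j:insert k I. M i j y * h j)=0" using eq that by (rule bspec)
   then show ?thesis using insert.hyps by (simp add: eq_neg_iff_add_eq_0 add.commute)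
  qed
  have "(SUM j:I. M' i j y * h j)=0" if "i:I" for i
  proof -
   have "(SUM j:I. M' i j y * h j)=M k k y * (SUM j:I. M i j y * h j) - M i k y * (SUM j:I. M k j y * h j)"
    by (simp add: M'_def sum_distrib_left sum_subtractf algebra_simps)
   then show ?thesis using that by (simp add: *)
  qed
  then have hI: "ALL j:I. h j=0" using inj[of y h] ne by simp
  then have "M k k y * h k=0" using *[of k] by simp
  then show "ALL j:insert k I. h j=0" using hI ne by simp
 qed
qed

section \<open>Polynomial functions\<close>

text \<open>The difference vanishes on \<open>V\<close>, hence is linear on \<open>V\<close> and may
  be added: polynomial functions are insensitive to values outside \<open>V\<close>.\<close>

lemma poly_funs_cong:
 assumes V: "csubspace V" and p: "p : pfuns V" and eq: "!!v. v:V ==> p v = p' v"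
 shows "p' : pfuns V"
proof -
 have "lin V (%v. p' v - p v)"
  by (rule clinear_onI) (simp_all add: eq[symmetric] sub_add[OF V] sub_scale[OF V])
 from poly_funs.add[OF p poly_funs.linear[OF this]] show ?thesis by simp
qed

lemma poly_funs_cmult: "p : pfuns V==>(%v. c * p v) : pfuns V"
 by (rule poly_funs.mult[OF poly_funs.const])

lemma poly_funs_diff: "p : pfuns V==>q : pfuns V==>(%v. p v - q v) : pfuns V"
 using poly_funs.add[OF _ poly_funs_cmult[of q V "-1"]] by simp

lemma poly_funs_sum: "(!!i. i:I ==> p i : pfuns V)==>(%v. SUM i:I. p i v) : pfuns V"
 by (induction I rule: infinite_finite_induct) (simp_all add: poly_funs.const poly_funs.add)

lemma poly_funs_prod: "(!!i. i:I ==> p i : pfuns V)==>(%v. PROD i:I. p i v) : pfuns V"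
 by (induction I rule: infinite_finite_induct) (simp_all add: poly_funs.const poly_funs.mult)

lemma poly_funs_comp:
 assumes "p : pfuns V" and f: "!!l. lin V l==>(%w. l (f w)) : pfuns W"
 shows "(%w. p (f w)) : pfuns W"
 using assms(1) by induction (auto intro: poly_funs.intros f)

lemma poly_funs_curve:
 assumes "p : pfuns V" and f: "!!l. lin V l==>EX P. ALL s. l (\<gamma> s) = poly P s"
 shows "EX P. ALL s::complex. p (\<gamma> s) = poly P s"
 using assms(1)
proof induction
 case (const c)
 show ?case by (rule exI[of _ "[:c:]"]) simp
next
 case (linear l)
 then show ?case by (rule f)
next
 case (add p q)
 then obtain P Q where "ALL s. p (\<gamma> s) = poly P s" "ALL s. q (\<gamma> s) = poly Q s" by (elim exE)
 then show ?case by (intro exI[of _ "P + Q"]) simp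
next
 case (mult p q)
 then obtain P Q where "ALL s. p (\<gamma> s) = poly P s" "ALL s. q (\<gamma> s) = poly Q s" by (elim exE)
 then show ?case by (intro exI[of _ "P * Q"]) simp
qed

lemma poly_funs_line:
 assumes "csubspace V" "p : pfuns V" "u:V" "v:V"
 shows "EX P. ALL s::complex. p (u + s *. v) = poly P s"
proof (rule poly_funs_curve[OF assms(2)])
 fix l :: "'a=>complex" assume l: "lin V l"
 show "EX P. ALL s. l (u + s *. v) = poly P s"
  by (rule exI[of _ "[:l u, l v:]"])
   (simp add: lin_add[OF l] lin_scale[OF l] sub_scale assms)
qed

text \<open>The nonzero scalars already are infinitely many roots. This replaces passing to the
  limit whenever an identity is known only for invertible parameters.\<close>

lemma poly_eq_0_off_0:
 assumes "!!s::complex. s~=0 ==> poly P s=0" shows "poly P s=0"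
proof -
 have "infinite (UNIV - {0::complex})" by (simp add: infinite_UNIV_char_0)
 moreover have "UNIV - {0} \<subseteq> {s. poly P s=0}" using assms by auto
 ultimately have "infinite {s. poly P s=0}" using finite_subset by blast
 then have "P=0" using poly_roots_finite by blast
 then show ?thesis by simp
qed

text \<open>Restriction to the line from \<open>u\<close> to \<open>v\<close> reduces the claim to
  polynomials in one variable, which form a domain.\<close>

lemma poly_funs_no_zero_divisors:
 assumes W: "csubspace W" and p: "p : pfuns W" and q: "q : pfuns W"
  and z: "!!w. w:W ==> p w * q w=0" and u: "u:W" "p u~=0" and v: "v:W"
 shows "q v=0"
proof -
 have d: "v - u:W" using u v by (intro sub_diff[OF W])
 obtain P where P: "!!s. p (u + s *. (v - u)) = poly P s" using poly_funs_line[OF W p u(1) d] by (elim exE) simp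
 obtain Q where Q: "!!s. q (u + s *. (v - u)) = poly Q s" using poly_funs_line[OF W q u(1) d] by (elim exE) simp
 have "poly (P * Q) s=0" for s
  using z[of "u + s *. (v - u)"] P Q sub_add[OF W u(1) sub_scale[OF W d]] by simp
 then have "P * Q=0" using poly_all_0_iff_0 by blast
 moreover have "P~=0" using P[of 0] u(2) by auto
 ultimately have "Q=0" by simp
 then show ?thesis using Q[of 1] by (simp add: scaleC_one)
qed

text \<open>The direction precedes the point, so that \<open>dd p v\<close> is again a function and
  can be differentiated repeatedly.\<close>

definition dd :: "('v::complex_vector=>complex)=>'v=>'v=>complex"
 where "dd p v x=deriv (%s. p (x + s *. v)) 0"

text \<open>The induction produces one number \<open>D\<close> that serves all curves through
  \<open>x\<close> with velocity \<open>v\<close> at once; the straight line then identifies it as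
  \<open>dd p v x\<close>.\<close>

lemma dd_curve:
 fixes V :: "'v::complex_vector set" and \<gamma> :: "complex=>'v"
 assumes V: "csubspace V" and p: "p : pfuns V" and x: "x:V" "v:V" and \<gamma>: "\<gamma> 0=x"
  and d: "!!l. lin V l==>((%s. l (\<gamma> s)) has_field_derivative l v) (at 0)"
 shows "((%s. p (\<gamma> s)) has_field_derivative dd p v x) (at 0)"
proof -
 define C where "C \<gamma> \<longleftrightarrow> \<gamma> 0=x&(ALL l. lin V l-->((%s. l (\<gamma> s)) has_field_derivative l v) (at 0))"
  for \<gamma> :: "complex=>'v"
 have "EX D. ALL \<gamma>. C \<gamma>-->((%s. p (\<gamma> s)) has_field_derivative D) (at 0)"
  using p
 proof induction
  case (const c)
  show ?case by (rule exI[of _ 0]) simp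
 next
  case (linear l)
  then show ?case by (intro exI[of _ "l v"]) (simp add: C_def)
 next
  case (add p q)
  then obtain D E where "ALL \<gamma>. C \<gamma>-->((%s. p (\<gamma> s)) has_field_derivative D) (at 0)"
   "ALL \<gamma>. C \<gamma>-->((%s. q (\<gamma> s)) has_field_derivative E) (at 0)" by (elim exE)
  then show ?case by (intro exI[of _ "D + E"]) (simp add: DERIV_add)
 next
  case (mult p q)
  then obtain D E where *: "ALL \<gamma>. C \<gamma>-->((%s. p (\<gamma> s)) has_field_derivative D) (at 0)"
   "ALL \<gamma>. C \<gamma>-->((%s. q (\<gamma> s)) has_field_derivative E) (at 0)" by (elim exE)
  show ?case
  proof (intro exI[of _ "D * q x + E * p x"] allI impI)
   fix \<gamma> assume C: "C \<gamma>"
   then have "\<gamma> 0=x" by (simp add: C_def)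
   then show "((%s. p (\<gamma> s) * q (\<gamma> s)) has_field_derivative D * q x + E * p x) (at 0)"
    using DERIV_mult[OF *(1)[rule_format, OF C] *(2)[rule_format, OF C]] by simp
  qed
 qed
 then obtain D where "ALL \<gamma>. C \<gamma>-->((%s. p (\<gamma> s)) has_field_derivative D) (at 0)" by (elim exE)
 note D = this[rule_format]
 have "C (%s. x + s *. v)" unfolding C_def
 proof (intro conjI allI impI)
  fix l :: "'v=>complex" assume l: "lin V l"
  have "(%s. l (x + s *. v))=(%s. l x + s * l v)"
   by (simp add: lin_add[OF l] lin_scale[OF l] sub_scale V x)
  then show "((%s. l (x + s *. v)) has_field_derivative l v) (at 0)"
   by (auto intro!: derivative_eq_intros)
 qed simp
 from DERIV_imp_deriv[OF D[OF this]] have "D=dd p v x" by (simp add: dd_def)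
 moreover have "C \<gamma>" using \<gamma> d by (simp add: C_def)
 ultimately show ?thesis using D by simp
qed

lemma dd_line:
 assumes V: "csubspace V" and p: "p : pfuns V" and x: "x:V" "v:V"
 shows "((%s. p (x + s *. v)) has_field_derivative dd p v x) (at 0)"
proof (rule dd_curve[OF V p x])
 fix l :: "_=>complex" assume l: "lin V l"
 have "(%s. l (x + s *. v))=(%s. l x + s * l v)"
  by (simp add: lin_add[OF l] lin_scale[OF l] sub_scale V x)
 then show "((%s. l (x + s *. v)) has_field_derivative l v) (at 0)"
  by (auto intro!: derivative_eq_intros)
qed simp

lemma dd_eqI:
 "((%s. p (x + s *. v)) has_field_derivative D) (at 0)==>dd p v x=D"
 by (simp add: dd_def DERIV_imp_deriv)

lemma dd_cong:
 assumes "csubspace V" "x:V" "v:V" "!!y. y:V ==> p y=q y"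
 shows "dd p v x=dd q v x"
 unfolding dd_def by (simp add: assms sub_add sub_scale)

lemma dd_const: "dd (%_. c) v x=0"
 by (rule dd_eqI) simp

context
 fixes V :: "'v::complex_vector set" and x v :: 'v
 assumes V: "csubspace V" and xv: "x:V" "v:V"
begin

lemma dd_linear:
 assumes l: "lin V l" shows "dd l v x=l v"
proof (rule dd_eqI)
 have "(%s. l (x + s *. v))=(%s. l x + s * l v)"
  by (simp add: lin_add[OF l] lin_scale[OF l] sub_scale V xv)
 then show "((%s. l (x + s *. v)) has_field_derivative l v) (at 0)"
  by (auto intro!: derivative_eq_intros)
qed

lemma dd_add: "p : pfuns V==>q : pfuns V==>dd (%y. p y + q y) v x=dd p v x + dd q v x"
 by (rule dd_eqI) (intro DERIV_add dd_line[OF V _ xv])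

lemma dd_diff: "p : pfuns V==>q : pfuns V==>dd (%y. p y - q y) v x=dd p v x - dd q v x"
 by (rule dd_eqI) (intro DERIV_diff dd_line[OF V _ xv])

lemma dd_mult:
 assumes "p : pfuns V" "q : pfuns V"
 shows "dd (%y. p y * q y) v x=dd p v x * q x + p x * dd q v x"
 using DERIV_mult[OF dd_line[OF V assms(1) xv] dd_line[OF V assms(2) xv]]
 by (intro dd_eqI) (simp add: mult.commute)

lemma dd_cmult: "p : pfuns V==>dd (%y. c * p y) v x=c * dd p v x"
 using dd_mult[OF poly_funs.const[of c]] by (simp add: dd_const)

lemma dd_power:
 assumes "p : pfuns V"
 shows "dd (%y. p y ^ n) v x = of_nat n * p x ^ (n - 1) * dd p v x"
 using DERIV_power[OF dd_line[OF V assms(1) xv], of n]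
 by (intro dd_eqI) (simp add: algebra_simps)

end

lemma dd_linear_dir:
 assumes V: "csubspace V" and p: "p : pfuns V" and x: "x:V"
 shows "lin V (%v. dd p v x)"
proof (rule clinear_onI)
 show "dd p (u + v) x=dd p u x + dd p v x" if uv: "u:V" "v:V" for u v
  using p
 proof induction
  case (linear l)
  then show ?case
   by (simp add: dd_linear[OF V x] sub_add[OF V] uv lin_add[OF linear uv])
 qed (simp_all add: dd_const dd_add[OF V x] dd_mult[OF V x] sub_add[OF V] uv algebra_simps)
 show "dd p (c *. v) x=c *. dd p v x" if v: "v:V" for c v
  using p
 proof induction
  case (linear l)
  then show ?case
   by (simp add: dd_linear[OF V x] sub_scale[OF V] v lin_scale[OF linear v])
 qed (simp_all add: dd_const dd_add[OF V x] dd_mult[OF V x] sub_scale[OF V] v algebra_simps)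
qed

lemma dd_poly_funs:
 assumes V: "csubspace V" and p: "p : pfuns V" and v: "v:V"
 shows "dd p v : pfuns V"
 using p
proof induction
 case (const c)
 show ?case by (rule poly_funs_cong[OF V poly_funs.const[of 0]]) (simp add: dd_const)
next
 case (linear l)
 show ?case by (rule poly_funs_cong[OF V poly_funs.const[of "l v"]]) (simp add: dd_linear[OF V _ v linear])
next
 case (add p q)
 show ?case by (rule poly_funs_cong[OF V poly_funs.add[OF add.IH]]) (simp add: dd_add[OF V _ v] add)
next
 case (mult p q)
 show ?case
  by (rule poly_funs_cong[OF V poly_funs.add[OF poly_funs.mult[OF mult.IH(1) mult.hyps(2)] poly_funs.mult[OF mult.hyps(1) mult.IH(2)]]])
   (simp add: dd_mult[OF V _ v] mult)
qed

text \<open>Along the line through 0 and \<open>v\<close> the iterated derivatives at 0 are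
  factorial multiples of the coefficients of a polynomial in one variable.\<close>

lemma poly_funs_eq_0_by_derivatives:
 assumes W: "csubspace W" and p: "p : pfuns W" and v: "v:W"
  and d: "!!k. ((%f. dd f v) ^^ k) p 0=0"
 shows "p v=0"
proof -
 have *: "EX P. (ALL s. f (s *. v) = poly P s)&(ALL s. dd f v (s *. v) = poly (pderiv P) s)"
  if f: "f : pfuns W" for f
 proof -
  obtain P where P: "!!s. f (0 + s *. v) = poly P s"
   using poly_funs_line[OF W f sub_0[OF W] v] by (elim exE) simp
  have "dd f v (s *. v) = poly (pderiv P) s" for s
  proof (rule dd_eqI)
   have "(%t. f (s *. v + t *. v))=(%t. poly P (s + t))"
    using P by (simp add: scaleC_add_left[symmetric])
   moreover have "((%t. poly P (s + t)) has_field_derivative poly (pderiv P) s) (at 0)"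
    using DERIV_chain2[of "poly P" "poly (pderiv P) s" "%t. s + t" 0 1 UNIV] poly_DERIV[of P s]
    by (simp add: DERIV_add_const)
   ultimately show "((%t. f (s *. v + t *. v)) has_field_derivative poly (pderiv P) s) (at 0)" by simp
  qed
  then show ?thesis using P by (intro exI[of _ P]) simp
 qed
 have pk: "((%f. dd f v) ^^ k) p : pfuns W" for k
  by (induction k) (simp_all add: p dd_poly_funs[OF W _ v])
 obtain P where P: "!!s. p (s *. v) = poly P s" using *[OF p] by (elim exE) simp
 have "ALL s. ((%f. dd f v) ^^ k) p (s *. v) = poly ((pderiv ^^ k) P) s" for k
 proof (induction k)
  case (Suc k)
  obtain Q where Q: "ALL s. ((%f. dd f v) ^^ k) p (s *. v) = poly Q s"
   "ALL s. dd (((%f. dd f v) ^^ k) p) v (s *. v) = poly (pderiv Q) s" using *[OF pk[of k]] by (elim exE conjE)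
  have "poly Q = poly ((pderiv ^^ k) P)" using Q(1) Suc by auto
  then have "Q=(pderiv ^^ k) P" by (simp add: poly_eq_poly_eq_iff)
  then show ?case using Q(2) by simp
 qed (simp add: P)
 from this[THEN spec, of _ 0] d have "poly ((pderiv ^^ k) P) 0=0" for k by simp
 then have "coeff ((pderiv ^^ k) P) 0=0" for k by (simp add: poly_0_coeff_0)
 then have "coeff P k=0" for k by (simp add: coeff_higher_pderiv pochhammer_fact[symmetric])
 then have "P=0" by (simp add: poly_eq_iff)
 then show ?thesis using P[of 1] by (simp add: scaleC_one)
qed

section \<open>Homogeneous polynomials\<close>

lemma homogD: "p:homog V d ==> p : pfuns V"
 "p:homog V d==>v:V ==> p (c *. v)=c ^ d * p v"
 by (simp_all add: homog_polys_def)

lemma homog_mult: "p:homog V d==>q:homog V e==>(%v. p v * q v):homog V (d + e)"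
 by (auto simp: homog_polys_def poly_funs.mult power_add)

lemma homog_add: "p:homog V d==>q:homog V d==>(%v. p v + q v):homog V d"
 by (auto simp: homog_polys_def poly_funs.add algebra_simps)

lemma homog_diff: "p:homog V d==>q:homog V d==>(%v. p v - q v):homog V d"
 by (auto simp: homog_polys_def poly_funs_diff algebra_simps)

lemma homog_const: "(%_. c):homog V 0"
 by (simp add: homog_polys_def poly_funs.const)

lemma homog_cmult: "p:homog V d==>(%v. c * p v):homog V d"
 using homog_mult[OF homog_const] by fastforce

lemma homog_linear: "lin V l==>l:homog V 1"
 by (simp add: homog_polys_def poly_funs.linear lin_scale)

lemma homog_power: "p:homog V d==>(%v. p v ^ n):homog V (n * d)"
 using homog_mult by (induction n) (fastforce simp: homog_const)+

lemma homog_linear_power: "lin V l==>(%v. l v ^ n):homog V n"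
 using homog_power[OF homog_linear, of V l n] by simp

text \<open>All sufficiently large degrees are offered, because sums and quotients require two
  polynomials of the same degree. Where \<open>q\<close> vanishes nothing is claimed.\<close>

lemma homogenize:
 assumes V: "csubspace V" and q: "lin V q" and g: "g : pfuns V"
 shows "EX d0. ALL d>=d0. EX H:homog V d. ALL v:V. q v~=0-->H v=q v ^ d * g (inverse (q v) *. v)"
 using g
proof induction
 case (const c)
 show ?case
  by (intro exI[of _ 0] allI impI bexI[OF _ homog_cmult[OF homog_linear_power[OF q]]] ballI)
   (rule mult.commute)
next
 case (linear l)
 show ?case
 proof (intro exI[of _ 1] allI impI)
  fix d :: nat assume d: "d >= 1"
  show "EX H:homog V d. ALL v:V. q v~=0-->H v=q v ^ d * l (inverse (q v) *. v)"
  proof (intro bexI[of _ "%v. q v ^ (d - 1) * l v"] ballI impI)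
   show "(%v. q v ^ (d - 1) * l v):homog V d"
    using homog_mult[OF homog_linear_power[OF q] homog_linear[OF linear], of "d - 1"] d by simp
   show "q v ^ (d - 1) * l v=q v ^ d * l (inverse (q v) *. v)" if "v:V" "q v~=0" for v
    using that d lin_scale[OF linear that(1)] by (cases d) (simp_all add: field_simps)
  qed
 qed
next
 case (add g g')
 obtain d0 d1 where
  0: "ALL d>=d0. EX H:homog V d. ALL v:V. q v~=0-->H v=q v ^ d * g (inverse (q v) *. v)" and
  1: "ALL d>=d1. EX H:homog V d. ALL v:V. q v~=0-->H v=q v ^ d * g' (inverse (q v) *. v)"
  using add.IH by (elim exE)
 show ?case
 proof (intro exI[of _ "max d0 d1"] allI impI)
  fix d assume d: "max d0 d1<=d"
  have "d0<=d" "d1<=d" using d by simp_all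
  from 0[rule_format, OF this(1)] 1[rule_format, OF this(2)]
  obtain H H' where "H:homog V d" "ALL v:V. q v~=0-->H v=q v ^ d * g (inverse (q v) *. v)"
   "H':homog V d" "ALL v:V. q v~=0-->H' v=q v ^ d * g' (inverse (q v) *. v)"
   by (elim bexE)
  then show "EX H:homog V d. ALL v:V. q v~=0-->H v=q v ^ d * (g (inverse (q v) *. v) + g' (inverse (q v) *. v))"
   by (intro bexI[OF _ homog_add[of H V d H']]) (simp_all add: distrib_left)
 qed
next
 case (mult g g')
 obtain d0 d1 where
  0: "ALL d>=d0. EX H:homog V d. ALL v:V. q v~=0-->H v=q v ^ d * g (inverse (q v) *. v)" and
  1: "ALL d>=d1. EX H:homog V d. ALL v:V. q v~=0-->H v=q v ^ d * g' (inverse (q v) *. v)"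
  using mult.IH by (elim exE)
 show ?case
 proof (intro exI[of _ "d0 + d1"] allI impI)
  fix d assume d: "d0 + d1<=d"
  have pw: "x ^ d=x ^ d0 * x ^ (d - d0)" for x :: complex using d power_add[of x d0 "d - d0"] by simp
  have "d0<=d0" "d1<=d - d0" using d by simp_all
  from 0[rule_format, OF this(1)] 1[rule_format, OF this(2)]
  obtain H H' where "H:homog V d0" "ALL v:V. q v~=0-->H v=q v ^ d0 * g (inverse (q v) *. v)"
   "H':homog V (d - d0)" "ALL v:V. q v~=0-->H' v=q v ^ (d - d0) * g' (inverse (q v) *. v)"
   by (elim bexE)
  then show "EX H:homog V d. ALL v:V. q v~=0-->H v=q v ^ d * (g (inverse (q v) *. v) * g' (inverse (q v) *. v))"
   using homog_mult[of H V d0 H' "d - d0"] d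
   by (intro bexI[of _ "%v. H v * H' v"]) (simp_all add: pw mult_ac)
 qed
qed

text \<open>Scaling by a nonzero \<open>c\<close> is the chain rule; \<open>c = 0\<close> follows
  because both sides are polynomial in \<open>c\<close>. For \<open>d = 0\<close> the derivative is
  0, so the truncated degree \<open>d - 1 = 0\<close> remains correct.\<close>

lemma dd_homog:
 assumes V: "csubspace V" and p: "p:homog V d" and v: "v:V"
 shows "dd p v:homog V (d - 1)"
proof -
 note pp = homogD(1)[OF p]
 have off0: "dd p v (c *. x)=c ^ (d - 1) * dd p v x" if x: "x:V" and c: "c~=0" for c x
 proof (cases d)
  case 0
  have "dd p v y=0" if "y:V" for y
  proof -
   have "dd p v y=dd (%_. p 0) v y"
    by (rule dd_cong[OF V that v]) (use homogD(2)[OF p, of _ 0] 0 in simp)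
   then show ?thesis by (simp add: dd_const)
  qed
  then show ?thesis using sub_scale[OF V x] x by simp
 next
  case (Suc k)
  have "((%s. c ^ d * p (x + (s * inverse c) *. v)) has_field_derivative c ^ d * (dd p v x * inverse c)) (at 0)"
  proof (rule DERIV_cmult)
   have "((%s. s * inverse c) has_field_derivative inverse c) (at 0)" by (auto intro!: derivative_eq_intros)
   from DERIV_chain2[of "%s. p (x + s *. v)" "dd p v x" "%s. s * inverse c" 0, OF _ this]
   show "((%s. p (x + (s * inverse c) *. v)) has_field_derivative dd p v x * inverse c) (at 0)"
    using dd_line[OF V pp x v] by simp
  qed
  moreover have "c ^ d * p (x + (s * inverse c) *. v) = p (c *. x + s *. v)" for s
   using homogD(2)[OF p, of "x + (s * inverse c) *. v" c] c x v
    nonzero_mult_div_cancel_left[OF c, of s, unfolded divide_inverse mult.assoc]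
   by (simp add: sub_add[OF V] sub_scale[OF V] scaleC_add_right scaleC_scaleC)
  ultimately have "dd p v (c *. x)=c ^ d * (dd p v x * inverse c)" by (intro dd_eqI) simp
  then show ?thesis using c Suc by (simp add: field_simps)
 qed
 have "dd p v (c *. x)=c ^ (d - 1) * dd p v x" if x: "x:V" for c x
 proof -
  obtain P where P: "!!s. dd p v (0 + s *. x) = poly P s"
   using poly_funs_line[OF V dd_poly_funs[OF V pp v] sub_0[OF V] x] by (elim exE) simp
  have "poly (P - monom (dd p v x) (d - 1)) s=0" if "s~=0" for s
  proof -
   have "poly P s = s ^ (d - 1) * dd p v x" using P[of s] off0[OF x that] by simp
   then show ?thesis by (simp add: poly_monom)
  qed
  from poly_eq_0_off_0[OF this, of c] show ?thesis using P[of c] by (simp add: poly_monom mult.commute)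
 qed
 then show ?thesis by (simp add: homog_polys_def dd_poly_funs[OF V pp v])
qed

text \<open>Euler's identity; it places the point itself in its tangent cone, see
  \<open>x_tcone\<close>.\<close>

lemma dd_homog_self:
 assumes V: "csubspace V" and p: "p:homog V d" and x: "x:V"
 shows "dd p x x = of_nat d * p x"
proof (rule dd_eqI)
 have "(%s. p (x + s *. x))=(%s. (1 + s) ^ d * p x)"
  using homogD(2)[OF p x] by (metis scaleC_add_left scaleC_one)
 then show "((%s. p (x + s *. x)) has_field_derivative of_nat d * p x) (at 0)"
  by (auto intro!: derivative_eq_intros)
qed

section \<open>Symmetric forms and homogeneous polynomials\<close>

lemma sym_formsD:
 assumes "phq : sym_forms W k"
 shows sym_forms_outside: "\<not> (length ws=k & set ws \<subseteq> W)==>phq ws=0"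
  and sym_forms_linear: "length us + 1 + length vs=k ==> set us \<subseteq> W ==> set vs \<subseteq> W==>lin W (%x. phq (us @ x # vs))"
  and sym_forms_mset: "mset ws=mset ws'==>phq ws=phq ws'"
 using assms unfolding sym_forms_def by blast+

lemma sum_fun_apply: "(SUM i:I. f i) x=(SUM i:I. (f i x :: 'b::comm_monoid_add))"
 by (induction I rule: infinite_finite_induct) simp_all

lemma sym_forms_csubspace: "csubspace (sym_forms W k)"
proof (rule cvs.subspaceI)
 show "0 : sym_forms W k" by (simp add: sym_forms_def clinear_on_def)
next
 fix phq psq assume *: "phq : sym_forms W k" "psq : sym_forms W k"
 show "phq + psq : sym_forms W k"
  unfolding sym_forms_def
 proof (intro CollectI conjI allI impI)
  show "lin W (%x. (phq + psq) (us @ x # vs))"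
   if "length us + 1 + length vs=k" "set us \<subseteq> W" "set vs \<subseteq> W" for us vs
   using lin_plus[OF sym_forms_linear[OF *(1) that] sym_forms_linear[OF *(2) that]] by simp
  show "(phq + psq) ws=(phq + psq) ws'" if "mset ws=mset ws'" for ws ws'
   using sym_forms_mset[OF *(1) that] sym_forms_mset[OF *(2) that] by simp
  show "(phq + psq) ws=0" if "\<not> (length ws=k & set ws \<subseteq> W)" for ws
   using sym_forms_outside[OF *(1) that] sym_forms_outside[OF *(2) that] by simp
 qed
next
 fix c phq assume *: "phq : sym_forms W k"
 show "c *. phq : sym_forms W k"
  unfolding sym_forms_def
 proof (intro CollectI conjI allI impI)
  show "lin W (%x. (c *. phq) (us @ x # vs))"
   if "length us + 1 + length vs=k" "set us \<subseteq> W" "set vs \<subseteq> W" for us vs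
   using lin_cmult[OF sym_forms_linear[OF * that], of c] by (simp add: scaleC_fun_def)
  show "(c *. phq) ws=(c *. phq) ws'" if "mset ws=mset ws'" for ws ws'
   using sym_forms_mset[OF * that] by (simp add: scaleC_fun_def)
  show "(c *. phq) ws=0" if "\<not> (length ws=k & set ws \<subseteq> W)" for ws
   using sym_forms_outside[OF * that] by (simp add: scaleC_fun_def)
 qed
qed

lemma contract_sym_forms:
 assumes phq: "phq : sym_forms W (Suc k)" and w: "w:W" shows "contract w phq : sym_forms W k"
 unfolding sym_forms_def contract_def
proof (intro CollectI conjI allI impI)
 show "lin W (%x. phq (w # us @ x # vs))"
  if "length us + 1 + length vs=k" "set us \<subseteq> W" "set vs \<subseteq> W" for us vs
  using sym_forms_linear[OF phq, of "w # us" vs] that w by simp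
 show "phq (w # ws)=phq (w # ws')" if "mset ws=mset ws'" for ws ws'
  using sym_forms_mset[OF phq, of "w # ws" "w # ws'"] that by simp
 show "phq (w # ws)=0" if "\<not> (length ws=k & set ws \<subseteq> W)" for ws
  using sym_forms_outside[OF phq, of "w # ws"] that w by auto
qed

lemma contract_linear: "phq : sym_forms W (Suc k)==>lin W (%w. contract w phq)"
proof (rule clinear_onI)
 assume phq: "phq : sym_forms W (Suc k)"
 note l = sym_forms_linear[OF phq, of "[]", simplified]
 note o = sym_forms_outside[OF phq]
 fix x y :: 'a and c assume x: "x:W"
 show "contract (c *. x) phq=c *. contract x phq"
 proof
  fix vs
  show "contract (c *. x) phq vs=(c *. contract x phq) vs"
  proof (cases "length vs=k & set vs \<subseteq> W")
   case True then show ?thesis using lin_scale[OF l x, of vs c] by (simp add: contract_def scaleC_fun_def)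
  next
   case False then show ?thesis using o[of "x # vs"] o[of "c *. x # vs"] by (simp add: contract_def scaleC_fun_def)
  qed
 qed
 assume y: "y:W"
 show "contract (x + y) phq=contract x phq + contract y phq"
 proof
  fix vs
  show "contract (x + y) phq vs=(contract x phq + contract y phq) vs"
  proof (cases "length vs=k & set vs \<subseteq> W")
   case True then show ?thesis using lin_add[OF l x y, of vs] by (simp add: contract_def)
  next
   case False then show ?thesis using o[of "x # vs"] o[of "y # vs"] o[of "(x + y) # vs"] by (simp add: contract_def)
  qed
 qed
qed

text \<open>Pascal's rule in the shape of the induction step of
  \<open>sym_form_binomial\<close>.\<close>

lemma pascal_sum:
 fixes a :: "nat=>complex"
 shows "(SUM j<=Suc k. of_nat (Suc k choose j) * a j)=(SUM j<=k. of_nat (k choose j) * (a j + a (Suc j)))"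
proof -
 have "(SUM j<=Suc k. of_nat (Suc k choose j) * a j)=a 0 + (SUM j<=k. of_nat (Suc k choose Suc j) * a (Suc j))"
  by (subst sum.atMost_Suc_shift) simp
 also have "\<dots>=(a 0 + (SUM j<=k. of_nat (k choose Suc j) * a (Suc j))) + (SUM j<=k. of_nat (k choose j) * a (Suc j))"
  by (simp add: sum.distrib algebra_simps)
 also have "a 0 + (SUM j<=k. of_nat (k choose Suc j) * a (Suc j))=(SUM j<=Suc k. of_nat (k choose j) * a j)"
  by (subst sum.atMost_Suc_shift) simp
 finally show ?thesis by (simp add: sum.distrib distrib_left)
qed

lemma sym_form_binomial:
 assumes "phq : sym_forms W k" and W: "csubspace W" and vw: "v:W" "w:W"
 shows "phq (replicate k (w + v))=(SUM j<=k. of_nat (k choose j) * phq (replicate (k - j) v @ replicate j w))"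
 using assms(1)
proof (induction k arbitrary: phq)
 case (Suc k)
 note phq = Suc.prems
 have c: "contract w phq : sym_forms W k" "contract v phq : sym_forms W k"
  by (rule contract_sym_forms[OF phq], fact)+
 have "phq (replicate (Suc k) (w + v))=contract (w + v) phq (replicate k (w + v))" by (simp add: contract_def)
 also have "\<dots>=contract w phq (replicate k (w + v)) + contract v phq (replicate k (w + v))"
  by (simp add: lin_add[OF contract_linear[OF phq] vw(2,1)])
 also have "\<dots>=(SUM j<=k. of_nat (k choose j) *
   (phq (replicate (Suc k - j) v @ replicate j w) + phq (replicate (Suc k - Suc j) v @ replicate (Suc j) w)))"
  unfolding Suc.IH[OF c(1)] Suc.IH[OF c(2)] sum.distrib[symmetric]
 proof (rule sum.cong[OF refl])
  fix j assume "j:{..k}"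
  then have "Suc k - j=Suc (k - j)" by simp
  moreover have "contract w phq (replicate (k - j) v @ replicate j w)=phq (replicate (k - j) v @ replicate (Suc j) w)"
   unfolding contract_def by (rule sym_forms_mset[OF phq]) simp
  ultimately show "of_nat (k choose j) * contract w phq (replicate (k - j) v @ replicate j w) +
   of_nat (k choose j) * contract v phq (replicate (k - j) v @ replicate j w) =
   of_nat (k choose j) * (phq (replicate (Suc k - j) v @ replicate j w) + phq (replicate (Suc k - Suc j) v @ replicate (Suc j) w))"
   by (simp add: contract_def distrib_left)
 qed
 also have "\<dots>=(SUM j<=Suc k. of_nat (Suc k choose j) * phq (replicate (Suc k - j) v @ replicate j w))"
  by (rule pascal_sum[symmetric])
 finally show ?case .
qed simp

lemma sym_form_scale:
 assumes "phq : sym_forms W k" and W: "csubspace W" and w: "w:W"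
 shows "phq (replicate k (c *. w))=c ^ k * phq (replicate k w)"
 using assms(1)
proof (induction k arbitrary: phq)
 case (Suc k)
 have "phq (replicate (Suc k) (c *. w))=contract (c *. w) phq (replicate k (c *. w))" by (simp add: contract_def)
 also have "\<dots>=c * contract w phq (replicate k (c *. w))"
  by (simp add: lin_scale[OF contract_linear[OF Suc.prems] w] scaleC_fun_def)
 finally show ?case by (simp add: Suc.IH[OF contract_sym_forms[OF Suc.prems w]]) (simp add: contract_def)
qed simp

lemma sym_form_scale_part:
 assumes "phq : sym_forms W (i + j)" and W: "csubspace W" and v: "v:W" "w:W"
 shows "phq (replicate i (c *. v) @ replicate j w)=c ^ i * phq (replicate i v @ replicate j w)"
 using assms(1)
proof (induction i arbitrary: phq)
 case (Suc i)
 have phq: "phq : sym_forms W (Suc (i + j))" using Suc.prems by simp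
 have "phq (replicate (Suc i) (c *. v) @ replicate j w)=contract (c *. v) phq (replicate i (c *. v) @ replicate j w)"
  by (simp add: contract_def)
 also have "\<dots>=c * contract v phq (replicate i (c *. v) @ replicate j w)"
  by (simp add: lin_scale[OF contract_linear[OF phq] v(1)] scaleC_fun_def)
 finally show ?case by (simp add: Suc.IH[OF contract_sym_forms[OF phq v(1)]]) (simp add: contract_def)
qed simp

text \<open>Polarization: the coefficient of \<open>s\<close> in \<open>phq(w + s v, \<dots>, w + s v)\<close> is \<open>k phq(v, w, \<dots>, w)\<close>.\<close>

lemma polarization_zero:
 assumes "phq : sym_forms W k" and W: "csubspace W" and z: "!!w. w:W==>phq (replicate k w)=0"
 shows "phq=(%_. 0)"
 using assms(1) z
proof (induction k arbitrary: phq)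
 case 0
 show ?case
 proof
  fix ws show "phq ws=0"
   using "0.prems"(2)[OF sub_0[OF W]] sym_forms_outside[OF "0.prems"(1), of ws] by (cases ws) simp_all
 qed
next
 case (Suc k)
 note phq = Suc.prems(1)
 have "phq (v # replicate k w)=0" if v: "v:W" and w: "w:W" for v w
 proof -
  let ?c = "%i. of_nat (Suc k choose (Suc k - i)) * phq (replicate i v @ replicate (Suc k - i) w)"
  have "(SUM i<=Suc k. ?c i * s ^ i)=0" for s
  proof -
   have "0=phq (replicate (Suc k) (w + s *. v))"
    using Suc.prems(2)[of "w + s *. v"] sub_add[OF W w sub_scale[OF W v]] by simp
   also have "\<dots>=(SUM j<=Suc k. of_nat (Suc k choose j) * phq (replicate (Suc k - j) (s *. v) @ replicate j w))"
    by (rule sym_form_binomial[OF phq W sub_scale[OF W v] w])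
   also have "\<dots>=(SUM j<=Suc k. ?c (Suc k - j) * s ^ (Suc k - j))"
   proof (rule sum.cong[OF refl])
    fix j assume j: "j:{..Suc k}"
    then have "phq (replicate (Suc k - j) (s *. v) @ replicate j w) = s ^ (Suc k - j) * phq (replicate (Suc k - j) v @ replicate j w)"
     by (intro sym_form_scale_part[OF _ W v w]) (use phq in simp)
    then show "of_nat (Suc k choose j) * phq (replicate (Suc k - j) (s *. v) @ replicate j w)=?c (Suc k - j) * s ^ (Suc k - j)"
     using j by simp
   qed
   also have "\<dots>=(SUM i<=Suc k. ?c i * s ^ i)"
    by (rule sum.reindex_bij_witness[of _ "%j. Suc k - j" "%j. Suc k - j"]) auto
   finally show ?thesis by simp
  qed
  then have "?c 1=0" using polyfun_eq_0[of ?c "Suc k"] by (metis One_nat_def Suc_le_mono le0)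
  then show ?thesis by (simp add: of_nat_neq_0 del: of_nat_Suc)
 qed
 then have "contract v phq=(%_. 0)" if "v:W" for v
  using Suc.IH[OF contract_sym_forms[OF phq that]] that by (simp add: contract_def)
 then have *: "phq (v # ws)=0" if "v:W" for v ws using that by (metis contract_def)
 show ?case
 proof
  fix ws show "phq ws=0"
   using * sym_forms_outside[OF phq, of ws] by (cases ws) auto
 qed
qed

lemma polarization_unique:
 assumes "phq : sym_forms W k" "psq : sym_forms W k" and W: "csubspace W"
  and z: "!!w. w:W==>phq (replicate k w)=psq (replicate k w)"
 shows "phq=psq"
proof -
 have "phq - psq : sym_forms W k" using assms(1,2) by (rule sub_diff[OF sym_forms_csubspace])
 from polarization_zero[OF this W] z show ?thesis by (simp add: fun_eq_iff)
qed

text \<open>Symmetry is reindexing of the sum over permutations. Linearity holds because each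
  permutation sends exactly one factor to the given position.\<close>

lemma sym_prod_sym_forms:
 assumes W: "csubspace W" and \<theta>: "!!i. i < k==>lin W (\<theta> i)"
 shows "sym_prod W k \<theta> : sym_forms W k"
 unfolding sym_forms_def
proof (intro CollectI conjI allI impI)
 let ?P = "{sgq. sgq permutes {..<k}}"
 show "sym_prod W k \<theta> ws=0" if "\<not> (length ws=k & set ws \<subseteq> W)" for ws
  unfolding sym_prod_def using that by (simp only: if_False)
 show "sym_prod W k \<theta> ws = sym_prod W k \<theta> ws'" if m: "mset ws=mset ws'" for ws ws'
 proof (cases "length ws'=k")
  case True
  obtain \<tau> where \<tau>: "\<tau> permutes {..<length ws'}" "permute_list \<tau> ws'=ws"
   by (rule mset_eq_permutation[OF m])
  have \<tau>': "\<tau> permutes {..<k}" using \<tau>(1) True by simp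
  have "(SUM sgq:?P. PROD i<k. \<theta> i (ws' ! sgq i))=(SUM sgq:?P. PROD i<k. \<theta> i (ws' ! (\<tau> \<circ> sgq) i))"
  proof (rule sum.reindex_bij_witness[of _ "%sgq. \<tau> \<circ> sgq" "%sgq. inv \<tau> \<circ> sgq"])
   fix sgq assume sgq: "sgq:?P"
   show "inv \<tau> \<circ> sgq:?P" "\<tau> \<circ> sgq:?P"
    using permutes_compose[OF _ permutes_inv[OF \<tau>']] permutes_compose[OF _ \<tau>'] sgq by simp_all
   show "\<tau> \<circ> (inv \<tau> \<circ> sgq)=sgq" "inv \<tau> \<circ> (\<tau> \<circ> sgq)=sgq"
    using permutes_inverses[OF \<tau>'] by (simp_all add: fun_eq_iff)
   show "(PROD i<k. \<theta> i (ws' ! (\<tau> \<circ> (inv \<tau> \<circ> sgq)) i))=(PROD i<k. \<theta> i (ws' ! sgq i))"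
    using permutes_inverses[OF \<tau>'] by simp
  qed
  also have "\<dots>=(SUM sgq:?P. PROD i<k. \<theta> i (ws ! sgq i))"
  proof (intro sum.cong prod.cong refl)
   fix sgq i assume "sgq:?P" "i:{..<k}"
   then have "sgq i < k" using permutes_in_image[of sgq "{..<k}" i] by simp
   then show "\<theta> i (ws' ! (\<tau> \<circ> sgq) i)=\<theta> i (ws ! sgq i)"
    using permute_list_nth[OF \<tau>(1), of "sgq i"] \<tau>(2) True by simp
  qed
  finally show ?thesis using mset_eq_length[OF m] mset_eq_setD[OF m] by (simp add: sym_prod_def)
 next
  case False
  then show ?thesis using mset_eq_length[OF m] by (simp add: sym_prod_def)
 qed
 show "lin W (%x. sym_prod W k \<theta> (us @ x # vs))"
  if l: "length us + 1 + length vs=k" and uv: "set us \<subseteq> W" "set vs \<subseteq> W" for us vs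
 proof -
  let ?m = "length us"
  \<comment> \<open>\<open>?c sgq\<close> collects the factors that do not see position
    \<open>?m\<close>; the entry 0 there is a placeholder.\<close>
  let ?c = "%sgq. PROD i:{..<k} - {inv sgq ?m}. \<theta> i ((us @ 0 # vs) ! sgq i)"
  have *: "(PROD i<k. \<theta> i ((us @ x # vs) ! sgq i))=\<theta> (inv sgq ?m) x * ?c sgq" if sgq: "sgq:?P" for x sgq
  proof -
   have s: "sgq permutes {..<k}" using sgq by simp
   have "inv sgq ?m:{..<k}" using permutes_in_image[OF permutes_inv[OF s], of ?m] l by simp
   then have "(PROD i<k. \<theta> i ((us @ x # vs) ! sgq i)) =
     \<theta> (inv sgq ?m) ((us @ x # vs) ! sgq (inv sgq ?m)) * (PROD i:{..<k} - {inv sgq ?m}. \<theta> i ((us @ x # vs) ! sgq i))"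
    by (intro prod.remove) auto
   also have "sgq (inv sgq ?m)=?m" using permutes_inverses(1)[OF s] by simp
   also have "(PROD i:{..<k} - {inv sgq ?m}. \<theta> i ((us @ x # vs) ! sgq i))=?c sgq"
   proof (intro prod.cong refl)
    fix i assume "i:{..<k} - {inv sgq ?m}"
    then have "sgq i~=?m" using permutes_inverses(2)[OF s, of i] by auto
    then show "\<theta> i ((us @ x # vs) ! sgq i)=\<theta> i ((us @ 0 # vs) ! sgq i)"
     by (auto simp: nth_append nth_Cons split: nat.split)
   qed
   finally show ?thesis by (simp add: nth_append)
  qed
  have "lin W (%x. SUM sgq:?P. (?c sgq / fact k) *. \<theta> (inv sgq ?m) x)"
  proof (intro lin_lincomb_fun \<theta>)
   fix sgq assume "sgq:?P"
   then show "inv sgq ?m < k" using permutes_in_image[OF permutes_inv, of sgq "{..<k}" ?m] l by simp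
  qed
  then show ?thesis
  proof (rule lin_cong[OF W])
   fix x assume "x:W"
   then have "sym_prod W k \<theta> (us @ x # vs)=(SUM sgq:?P. PROD i<k. \<theta> i ((us @ x # vs) ! sgq i)) / fact k"
    using l uv by (simp add: sym_prod_def)
   also have "(SUM sgq:?P. PROD i<k. \<theta> i ((us @ x # vs) ! sgq i))=(SUM sgq:?P. \<theta> (inv sgq ?m) x * ?c sgq)"
    by (rule sum.cong[OF refl *])
   finally show "(SUM sgq:?P. (?c sgq / fact k) *. \<theta> (inv sgq ?m) x) = sym_prod W k \<theta> (us @ x # vs)"
    by (simp add: sum_divide_distrib mult.commute)
  qed
 qed
qed

text \<open>All \<open>fact k\<close> permutations contribute the same product, which the
  normalization of \<open>sym_prod\<close> cancels.\<close>

lemma sym_prod_diag: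
 assumes "w:W" shows "sym_prod W k \<theta> (replicate k w)=(PROD i<k. \<theta> i w)"
proof -
 let ?P = "{sgq. sgq permutes {..<k}}"
 have "(PROD i<k. \<theta> i (replicate k w ! sgq i))=(PROD i<k. \<theta> i w)" if "sgq:?P" for sgq
 proof (intro prod.cong refl)
  fix i assume "i:{..<k}"
  then have "sgq i < k" using that permutes_in_image[of sgq "{..<k}" i] by simp
  then show "\<theta> i (replicate k w ! sgq i)=\<theta> i w" by simp
 qed
 then have "(SUM sgq:?P. PROD i<k. \<theta> i (replicate k w ! sgq i)) = of_nat (card ?P) * (PROD i<k. \<theta> i w)" by simp
 also have "card ?P=fact k" by (rule card_permutations) simp_all
 finally have "(SUM sgq:?P. PROD i<k. \<theta> i (replicate k w ! sgq i))=fact k * (PROD i<k. \<theta> i w)" by simp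
 moreover have "set (replicate k w) \<subseteq> W" using assms by auto
 ultimately show ?thesis by (simp add: sym_prod_def)
qed

text \<open>Homogeneous polynomials in a concrete shape, as sums of products of \<open>k\<close>
  linear forms. Both \<open>sym_prod\<close> and the generators in \<open>max_ideal_pow\<close> and
  \<open>leading_form\<close> have this shape, so it mediates between them.\<close>

inductive_set lin_prods :: "'w::complex_vector set=>nat=>('w=>complex) set"
 for W :: "'w set" and k :: nat
where
 prod: "(!!i. i < k==>lin W (\<theta> i))==>(%w. c * (PROD i<k. \<theta> i w)):lin_prods W k"
| add: "f:lin_prods W k==>g:lin_prods W k==>(%w. f w + g w):lin_prods W k"

lemma lin_zero: "lin W (%_. 0)"
 by (simp add: clinear_on_def)

lemma lin_prods_zero: "(%_. 0):lin_prods W k"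
 using lin_prods.prod[of k W "%_ _. 0" 0] by (simp add: lin_zero)

lemma lin_prods_sum: "(!!i. i:I==>f i:lin_prods W k)==>(%w. SUM i:I. f i w):lin_prods W k"
 by (induction I rule: infinite_finite_induct) (simp_all add: lin_prods_zero lin_prods.add)

lemma lin_prods_mult_prod:
 assumes "f:lin_prods W k" "!!i. i < l==>lin W (\<theta> i)"
 shows "(%w. f w * (c * (PROD i<l. \<theta> i w))):lin_prods W (k + l)"
 using assms(1)
proof induction
 case (prod \<eta> d)
 define \<zeta> where "\<zeta> i=(if i < k then \<eta> i else \<theta> (i - k))" for i
 have "(%w. (d * c) * (PROD i<k+l. \<zeta> i w)):lin_prods W (k + l)"
  by (rule lin_prods.prod) (use prod assms(2) in \<open>auto simp: \<zeta>_def\<close>)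
 moreover have "(PROD i<k+l. \<zeta> i w)=(PROD i<k. \<eta> i w) * (PROD i<l. \<theta> i w)" for w
 proof -
  have "(PROD i<k+l. \<zeta> i w)=(PROD i<k. \<zeta> i w) * (PROD i<l. \<zeta> (k + i) w)"
   by (induction l) (simp_all add: mult.assoc)
  then show ?thesis by (simp add: \<zeta>_def)
 qed
 ultimately show ?case by (simp add: mult_ac)
next
 case (add f g)
 from lin_prods.add[OF add.IH] show ?case by (simp add: distrib_right)
qed

lemma lin_prods_mult:
 assumes "f:lin_prods W k" "g:lin_prods W l"
 shows "(%w. f w * g w):lin_prods W (k + l)"
 using assms(2)
proof induction
 case (prod \<theta> c)
 then show ?case by (rule lin_prods_mult_prod[OF assms(1)])
next
 case (add g h)
 from lin_prods.add[OF add.IH] show ?case by (simp add: distrib_left)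
qed

lemma lin_prods_linear: "lin W l==>l:lin_prods W 1"
 using lin_prods.prod[of 1 W "%_. l" 1] by simp

lemma lin_prods_const: "(%_. c):lin_prods W 0"
 using lin_prods.prod[of 0 W "%_ _. 0" c] by simp

lemma lin_prods_poly_funs: "f:lin_prods W k==>f : pfuns W"
proof (induction rule: lin_prods.induct)
 case (prod \<theta> c)
 then show ?case by (intro poly_funs_cmult poly_funs_prod, intro poly_funs.linear) simp
qed (rule poly_funs.add)

lemma lin_prods_sym_form:
 assumes W: "csubspace W" and "f:lin_prods W k"
 shows "EX phq:sym_forms W k. ALL w:W. f w=phq (replicate k w)"
 using assms(2)
proof induction
 case (prod \<theta> c)
 show ?case
 proof (rule bexI[of _ "c *. sym_prod W k \<theta>"])
  show "c *. sym_prod W k \<theta> : sym_forms W k"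
   using prod by (intro sub_scale[OF sym_forms_csubspace] sym_prod_sym_forms[OF W])
 qed (simp add: sym_prod_diag scaleC_fun_def)
next
 case (add f g)
 then obtain phq psq where "phq : sym_forms W k" "ALL w:W. f w=phq (replicate k w)"
  "psq : sym_forms W k" "ALL w:W. g w=psq (replicate k w)" by (elim bexE)
 then show ?case
  by (intro bexI[of _ "phq + psq"]) (simp_all add: sub_add[OF sym_forms_csubspace])
qed

text \<open>Expanding one argument in a basis writes the form as coordinates times contractions, to
  which the induction hypothesis applies.\<close>

lemma sym_form_lin_prods:
 assumes W: "finite_dim W" and phq: "phq : sym_forms W k"
 shows "EX f:lin_prods W k. ALL w:W. f w=phq (replicate k w)"
 using phq
proof (induction k arbitrary: phq)
 case 0
 show ?case by (rule bexI[OF _ lin_prods_const[of "phq []"]]) simp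
next
 case (Suc k)
 note sW = fd_sub[OF W]
 have "EX f:lin_prods W k. ALL w:W. f w=phq (b # replicate k w)" if "b:vbasis W" for b
  using Suc.IH[OF contract_sym_forms[OF Suc.prems, of b]] that vbasis(1)[of W] by (auto simp: contract_def)
 then obtain f where f: "!!b. b:vbasis W==>f b:lin_prods W k"
  "!!b w. b:vbasis W==>w:W==>f b w=phq (b # replicate k w)" by metis
 show ?case
 proof (intro bexI[of _ "%w. SUM b:vbasis W. coord W b w * f b w"] ballI)
  show "(%w. SUM b:vbasis W. coord W b w * f b w):lin_prods W (Suc k)"
   using lin_prods_mult[OF lin_prods_linear[OF coord_linear[OF sW]] f(1)] by (intro lin_prods_sum) simp
  fix w assume w: "w:W"
  have "contract w phq=(SUM b:vbasis W. coord W b w *. contract b phq)"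
   by (rule lin_expand[OF W contract_linear[OF Suc.prems] w])
  then have "phq (replicate (Suc k) w)=(SUM b:vbasis W. coord W b w *. contract b phq) (replicate k w)"
   by (simp add: contract_def fun_eq_iff)
  also have "\<dots>=(SUM b:vbasis W. coord W b w * phq (b # replicate k w))"
   by (simp add: sum_fun_apply scaleC_fun_def contract_def)
  finally show "(SUM b:vbasis W. coord W b w * f b w)=phq (replicate (Suc k) w)"
   using f(2)[OF _ w] by simp
 qed
qed

lemma sym_form_poly_funs:
 assumes W: "finite_dim W" and phq: "phq : sym_forms W k"
 shows "(%w. phq (replicate k w)) : pfuns W"
proof -
 obtain f where "f:lin_prods W k" "ALL w:W. f w=phq (replicate k w)"
  using sym_form_lin_prods[OF assms] by (elim bexE)
 then show ?thesis
  by (intro poly_funs_cong[OF fd_sub[OF W] lin_prods_poly_funs[of f W k]]) simp_all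
qed

text \<open>Splitting into homogeneous parts is done on \<open>lin_prods\<close>, where products add
  degrees; each part then becomes a symmetric form.\<close>

lemma poly_funs_sym_expand:
 assumes W: "csubspace W" and p: "p : pfuns W"
 shows "EX N phq. (ALL k. phq k : sym_forms W k)&(ALL w:W. p w=(SUM k<=N. phq k (replicate k w)))"
proof -
 define A where "A p \<longleftrightarrow> (EX N f. (ALL k::nat. f k:lin_prods W k) & p=(%w. SUM k<=(N::nat). f k w))" for p
 have single: "A g" if "g:lin_prods W k" for g k
  unfolding A_def
  by (rule exI[of _ k], rule exI[of _ "%j. if j=k then g else (%_. 0)"])
   (use that in \<open>auto simp: lin_prods_zero if_distrib[of "%f. f _"] cong: if_cong\<close>)
 have Aadd: "A (%w. p w + q w)" if p: "A p" and q: "A q" for p q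
 proof -
  obtain N f where f: "ALL k. f k:lin_prods W k" "p=(%w. SUM k<=(N::nat). f k w)"
   using p unfolding A_def by (elim exE conjE)
  obtain M g where g: "ALL k. g k:lin_prods W k" "q=(%w. SUM k<=(M::nat). g k w)"
   using q unfolding A_def by (elim exE conjE)
  \<comment> \<open>Both sums are padded with zero terms up to a common upper bound.\<close>
  let ?f = "%k w. if k<=N then f k w else 0" and ?g = "%k w. if k<=M then g k w else 0"
  have "(%w. ?f k w + ?g k w):lin_prods W k" for k
   using f(1) g(1) by (intro lin_prods.add) (cases "k<=N"; cases "k<=M"; simp add: lin_prods_zero)+
  moreover have "p w=(SUM k<=max N M. ?f k w)" "q w=(SUM k<=max N M. ?g k w)" for w
   unfolding f(2) g(2) by (rule sum.mono_neutral_cong_left; auto)+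
  ultimately show ?thesis unfolding A_def
   by (intro exI[of _ "max N M"] exI[of _ "%k w. ?f k w + ?g k w"]) (simp add: sum.distrib)
 qed
 have Asum: "A (%w. SUM i:I. h i w)" if "finite I" "!!i. i:I==>A (h i)" for I :: "nat set" and h
  using that by (induction I rule: finite_induct) (simp_all add: Aadd single[OF lin_prods_zero])
 have "A p" using p
 proof induction
  case (const c) show ?case by (rule single[OF lin_prods_const])
 next
  case (linear l) then show ?case by (rule single[OF lin_prods_linear])
 next
  case (add p q) then show ?case by (intro Aadd)
 next
  case (mult p q)
  obtain N f where f: "ALL k. f k:lin_prods W k" "p=(%w. SUM k<=(N::nat). f k w)"
   using mult.IH(1) unfolding A_def by (elim exE conjE)
  obtain M g where g: "ALL k. g k:lin_prods W k" "q=(%w. SUM k<=(M::nat). g k w)"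
   using mult.IH(2) unfolding A_def by (elim exE conjE)
  have "(%w. p w * q w)=(%w. SUM k<=N. SUM j<=M. f k w * g j w)"
   by (simp add: f(2) g(2) sum_product)
  moreover have "A (%w. SUM k<=N. SUM j<=M. f k w * g j w)"
   by (intro Asum finite_atMost single[OF lin_prods_mult]) (use f(1) g(1) in auto)
  ultimately show ?case by simp
 qed
 then obtain N f where f: "ALL k. f k:lin_prods W k" "p=(%w. SUM k<=(N::nat). f k w)"
  unfolding A_def by (elim exE conjE)
 have "ALL k. EX phq. phq : sym_forms W k&(ALL w:W. f k w=phq (replicate k w))"
  using lin_prods_sym_form[OF W] f(1) by blast
 then obtain phq where "ALL k. phq k : sym_forms W k&(ALL w:W. f k w=phq k (replicate k w))" by metis
 then show ?thesis using f(2) by (intro exI[of _ N] exI[of _ phq]) simp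
qed

text \<open>Comparing coefficients of \<open>s\<close> in \<open>p (s *. w)\<close> leaves only the
  part of degree \<open>k\<close>; if that degree exceeds \<open>N\<close>, the form 0
  serves.\<close>

lemma homog_sym_form:
 assumes W: "csubspace W" and p: "p:homog W k"
 shows "EX phq:sym_forms W k. ALL w:W. p w=phq (replicate k w)"
proof -
 obtain N phq where phq: "ALL k. phq k : sym_forms W k" "ALL w:W. p w=(SUM k<=N. phq k (replicate k w))"
  using poly_funs_sym_expand[OF W homogD(1)[OF p]] by (elim exE conjE)
 define psq where "psq=(if k<=N then phq k else 0)"
 have "p w=psq (replicate k w)" if w: "w:W" for w
 proof -
  let ?a = "%j. if j<=N then phq j (replicate j w) else 0"
  let ?b = "%j. if j=k then p w else 0"
  have "(SUM j<=max N k. ?a j * s ^ j)=(SUM j<=max N k. ?b j * s ^ j)" for s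
  proof -
   have "(SUM j<=max N k. ?a j * s ^ j)=(SUM j<=N. phq j (replicate j w) * s ^ j)"
    by (rule sum.mono_neutral_cong_right) auto
   also have "\<dots> = p (s *. w)"
    using phq sym_form_scale[OF _ W w] sub_scale[OF W w] by (simp add: mult.commute)
   also have "\<dots> = p w * s ^ k" using homogD(2)[OF p w] by simp
   also have "\<dots>=(SUM j<=max N k. ?b j * s ^ j)"
    by (subst sum.mono_neutral_cong_right[of _ "{k}" _ "%j. p w * s ^ k"]) auto
   finally show ?thesis .
  qed
  then have "ALL j<=max N k. ?a j=?b j" by (subst polyfun_eq_coeffs[symmetric]) simp
  from this[rule_format, of k] show ?thesis by (simp add: psq_def split: if_splits)
 qed
 moreover have "psq : sym_forms W k" using phq(1) sub_0[OF sym_forms_csubspace[of W k]] by (simp add: psq_def)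
 ultimately show ?thesis by blast
qed

section \<open>Zariski topology and tangent spaces\<close>

definition acone :: "'v::complex_vector set=>'v set set=>'v set"
 where "acone V Z={v:V. v~=0&cspan {v}:Z}"

text \<open>The degree \<open>d\<close> part of the homogeneous ideal of \<open>Z\<close>.\<close>

definition vid :: "'v::complex_vector set=>'v set set=>nat=>('v=>complex) set"
 where "vid V Z d={p:homog V d. ALL v:acone V Z. p v=0}"

lemma mem_span1: "u:cspan {v} \<longleftrightarrow> (EX c. u=c *. v)"
 by (auto simp: cvs.span_singleton)

lemma span1_self: "v:cspan {v}"
 by (simp add: cvs.span_base)

lemma span1_scale: "c~=0==>cspan {c *. v}=cspan {v}"
proof (intro set_eqI)
 fix u assume c: "c~=0"
 have "u=d *. v==>u=(d * inverse c) *. c *. v" for d using c by (simp add: scaleC_scaleC)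
 then show "u:cspan {c *. v} \<longleftrightarrow> u:cspan {v}" by (metis mem_span1 scaleC_scaleC)
qed

lemma span1_eq: "u:cspan {v}==>u~=0==>cspan {u}=cspan {v}"
 by (metis cvs.scale_zero_left mem_span1 span1_scale)

lemma proj_rep: "L : proj V==>EX v:V. v~=0&L=cspan {v}"
 by (auto simp: proj_def)

lemma span1_proj: "v:V==>v~=0==>cspan {v} : proj V"
 by (auto simp: proj_def)

lemma proj_elem: "csubspace V==>L : proj V==>v:L==>v~=0==>v:V&L=cspan {v}"
 by (metis sub_scale mem_span1 proj_rep span1_eq)

lemma cone_rep: "Z \<subseteq> proj V==>L:Z==>EX v:acone V Z. L=cspan {v}"
 unfolding acone_def using proj_rep by blast

lemma cone_elem: "csubspace V==>Z \<subseteq> proj V==>L:Z==>v:L==>v~=0==>v:acone V Z&L=cspan {v}"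
 using proj_elem[of V L v] unfolding acone_def by auto

lemma cone_scale: "csubspace V==>v:acone V Z==>c~=0==>c *. v:acone V Z"
 by (simp add: acone_def sub_scale span1_scale)

lemma coneD: "v:acone V Z==>v:V" "v:acone V Z==>v~=0" "v:acone V Z==>cspan {v}:Z"
 by (simp_all add: acone_def)

lemma basic_span1:
 assumes p: "p:homog V d" and v: "v:V" "v~=0"
 shows "cspan {v}:basic_open V p \<longleftrightarrow> p v~=0"
proof
 show "p v~=0" if "cspan {v}:basic_open V p" using that v span1_self[of v] by (auto simp: basic_open_def)
 show "cspan {v}:basic_open V p" if ne: "p v~=0"
  unfolding basic_open_def
 proof (intro CollectI conjI ballI)
  show "cspan {v} : proj V" using v by (rule span1_proj)
  fix u assume u: "u:cspan {v} - {0}"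
  then obtain c where c: "u=c *. v" by (auto simp: mem_span1)
  then have "c~=0" using u by auto
  then show "p u~=0" using homogD(2)[OF p v(1), of c] ne c by simp
 qed
qed

lemma basic_open_mult: "basic_open V (%v. p v * q v)=basic_open V p \<inter> basic_open V q"
 by (auto simp: basic_open_def)

lemma basic_open_proj: "basic_open V p \<subseteq> proj V"
 by (auto simp: basic_open_def)

lemma basic_open_1: "basic_open V (%_. 1) = proj V"
 by (auto simp: basic_open_def)

lemma openin_basic: "p:homog V d ==> openin (zariski V) (basic_open V p)"
 unfolding zariski_def by (rule topology_generated_by_Basis) blast

text \<open>\<open>U\<close> contains all points of \<open>Z\<close> near \<open>L\<close>.\<close>

definition znbhd :: "'v::complex_vector set=>'v set set=>'v set=>'v set set=>bool"
 where "znbhd V Z L U \<longleftrightarrow> (EX d. EX p:homog V d. L:basic_open V p&Z \<inter> basic_open V p \<subseteq> U)"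

lemma znbhdI: "p:homog V d==>L:basic_open V p==>Z \<inter> basic_open V p \<subseteq> U==>znbhd V Z L U"
 unfolding znbhd_def by (intro exI bexI conjI)

lemma znbhdE:
 assumes "znbhd V Z L U"
 obtains d p where "p:homog V d" "L:basic_open V p" "Z \<inter> basic_open V p \<subseteq> U"
 using assms unfolding znbhd_def by (elim exE bexE conjE)

lemma znbhd_ballE:
 assumes "ALL L:S. znbhd V Z L U" "L:S"
 obtains d p where "p:homog V d" "L:basic_open V p" "Z \<inter> basic_open V p \<subseteq> U"
 using assms(1)[rule_format, OF assms(2)] by (rule znbhdE)

text \<open>Products of homogeneous polynomials are homogeneous, so the generating sets are closed
  under intersection and form a basis: openness becomes a condition point by point.\<close>

lemma openin_zariski: "openin (zariski V) U \<longleftrightarrow> U \<subseteq> proj V&(ALL L:U. znbhd V (proj V) L U)"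
proof
 assume "openin (zariski V) U"
 then have "generate_topology_on {basic_open V p | d p. p:homog V d} U"
  by (simp add: zariski_def openin_topology_generated_by_iff)
 then show "U \<subseteq> proj V&(ALL L:U. znbhd V (proj V) L U)"
 proof induction
  case (Int A B)
  show ?case
  proof (intro conjI ballI)
   show "A \<inter> B \<subseteq> proj V" using Int.IH(1) by (auto simp: subset_iff)
   fix L assume L: "L:A \<inter> B"
   obtain d p where p: "p:homog V d" "L:basic_open V p" "proj V \<inter> basic_open V p \<subseteq> A"
    using Int.IH(1) L by (elim conjE IntE) (erule (1) znbhd_ballE)
   obtain e q where q: "q:homog V e" "L:basic_open V q" "proj V \<inter> basic_open V q \<subseteq> B"
    using Int.IH(2) L by (elim conjE IntE) (erule (1) znbhd_ballE)
   show "znbhd V (proj V) L (A \<inter> B)"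
    by (rule znbhdI[OF homog_mult[OF p(1) q(1)]]) (use p(2,3) q(2,3) in \<open>auto simp: basic_open_mult\<close>)
  qed
 next
  case (UN K)
  show ?case
  proof (intro conjI ballI)
   show "\<Union>K \<subseteq> proj V" using UN.IH by (meson Union_least)
   fix L assume "L:\<Union>K"
   then obtain A where A: "A:K" "L:A" by (rule UnionE)
   obtain d p where p: "p:homog V d" "L:basic_open V p" "proj V \<inter> basic_open V p \<subseteq> A"
    using UN.IH[OF A(1)] A(2) by (elim conjE) (erule (1) znbhd_ballE)
   show "znbhd V (proj V) L (\<Union>K)"
    by (rule znbhdI[OF p(1,2)]) (use p(3) A(1) in \<open>meson Union_upper order_trans\<close>)
  qed
 next
  case (Basis s)
  then obtain d p where p: "p:homog V d" "s=basic_open V p" by (elim CollectE exE conjE)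
  then show ?case using basic_open_proj[of V p] by (auto intro: znbhdI[OF p(1)])
 qed simp
next
 assume *: "U \<subseteq> proj V&(ALL L:U. znbhd V (proj V) L U)"
 let ?T = "\<Union>{basic_open V p | d p. p:homog V d&basic_open V p \<subseteq> U}"
 have "L:?T" if LU: "L:U" for L
 proof -
  obtain d p where p: "p:homog V d" "L:basic_open V p" "proj V \<inter> basic_open V p \<subseteq> U"
   using * LU by (elim conjE) (erule (1) znbhd_ballE)
  then have "basic_open V p \<subseteq> U" using basic_open_proj[of V p] by (simp add: inf.absorb2)
  then show ?thesis using p(1,2) by (intro UnionI[of "basic_open V p"] CollectI exI[of _ d] exI[of _ p]) simp_all
 qed
 then have "U=?T" by (intro equalityI subsetI) (assumption | (elim UnionE CollectE exE conjE, simp add: subset_iff))+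
 moreover have "openin (zariski V) ?T"
  by (rule openin_Union) (elim CollectE exE conjE, simp add: openin_basic)
 ultimately show "openin (zariski V) U" by simp
qed

lemma topspace_zariski: "topspace (zariski V) = proj V"
proof
 show "topspace (zariski V) \<subseteq> proj V" using openin_topspace[of "zariski V"] openin_zariski[of V "topspace (zariski V)"] by simp
 show "proj V \<subseteq> topspace (zariski V)"
  using openin_subset[OF openin_basic[OF homog_const[of 1 V]]] by (simp add: basic_open_1)
qed

lemma openin_on_basic: "p:homog V d ==> openin (zariski_on V Z) (Z \<inter> basic_open V p)"
 by (rule openin_subtopology_Int2[OF openin_basic])

lemma openin_zariski_on:
 assumes ZP: "Z \<subseteq> proj V"
 shows "openin (zariski_on V Z) U \<longleftrightarrow> U \<subseteq> Z&(ALL L:U. znbhd V Z L U)"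
proof
 assume "openin (zariski_on V Z) U"
 then obtain T where T: "openin (zariski V) T" "U=T \<inter> Z" unfolding openin_subtopology by (elim exE conjE)
 show "U \<subseteq> Z&(ALL L:U. znbhd V Z L U)"
 proof (intro conjI ballI)
  show "U \<subseteq> Z" using T(2) by simp
  fix L assume "L:U"
  then have "znbhd V (proj V) L T" using T unfolding openin_zariski by simp
  then obtain d p where p: "p:homog V d" "L:basic_open V p" "proj V \<inter> basic_open V p \<subseteq> T"
   by (rule znbhdE)
  show "znbhd V Z L U" by (rule znbhdI[OF p(1,2)]) (use p(3) T(2) ZP in auto)
 qed
next
 assume *: "U \<subseteq> Z&(ALL L:U. znbhd V Z L U)"
 let ?T = "\<Union>{Z \<inter> basic_open V p | d p. p:homog V d&Z \<inter> basic_open V p \<subseteq> U}"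
 have "L:?T" if "L:U" for L
 proof -
  have L: "L:Z" and "znbhd V Z L U" using * that by auto
  from this(2) obtain d p where p: "p:homog V d" "L:basic_open V p" "Z \<inter> basic_open V p \<subseteq> U"
   by (rule znbhdE)
  then show ?thesis using L by (intro UnionI[of "Z \<inter> basic_open V p"] CollectI exI[of _ d] exI[of _ p]) simp_all
 qed
 then have "U=?T" by (intro equalityI subsetI) (assumption | (elim UnionE CollectE exE conjE, simp add: subset_iff))+
 moreover have "openin (zariski_on V Z) ?T"
  by (rule openin_Union) (elim CollectE exE conjE, simp add: openin_on_basic)
 ultimately show "openin (zariski_on V Z) U" by simp
qed

lemma in_closure_zariski:
 "L:zariski V closure_of S \<longleftrightarrow>
  L : proj V&(ALL d p. p:homog V d-->L:basic_open V p-->(EX M:S. M:basic_open V p))"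
proof
 assume L: "L:zariski V closure_of S"
 show "L : proj V&(ALL d p. p:homog V d-->L:basic_open V p-->(EX M:S. M:basic_open V p))"
 proof (intro conjI allI impI)
  show "L : proj V" using L unfolding in_closure_of topspace_zariski by simp
  fix d p assume "p:homog V d" "L:basic_open V p"
  then have "EX y. y:S&y:basic_open V p" using L openin_basic[of p V d] unfolding in_closure_of by simp
  then show "EX M:S. M:basic_open V p" by (simp add: Bex_def)
 qed
next
 assume *: "L : proj V&(ALL d p. p:homog V d-->L:basic_open V p-->(EX M:S. M:basic_open V p))"
 show "L:zariski V closure_of S"
  unfolding in_closure_of topspace_zariski
 proof (intro conjI allI impI)
  fix T assume T: "L:T & openin (zariski V) T"
  then have "znbhd V (proj V) L T" by (simp add: openin_zariski)
  then obtain d p where p: "p:homog V d" "L:basic_open V p" "proj V \<inter> basic_open V p \<subseteq> T"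
   by (rule znbhdE)
  obtain M where "M:S" "M:basic_open V p" using *[THEN conjunct2, rule_format, OF p(1,2)] by (rule bexE)
  then show "EX M. M:S&M:T" using p(3) basic_open_proj[of V p] by (intro exI[of _ M]) auto
 qed (use * in simp)
qed

lemma closed_separate:
 assumes V: "csubspace V" and Z: "closedin (zariski V) Z" and v: "v:V" "v~=0" "cspan {v} \<notin> Z"
 shows "EX d. EX p:vid V Z d. p v~=0"
proof -
 have "cspan {v} \<notin> zariski V closure_of Z" using closure_of_closedin[OF Z] v(3) by simp
 then have "EX d p. p:homog V d&cspan {v}:basic_open V p&(ALL M:Z. M \<notin> basic_open V p)"
  unfolding in_closure_zariski using span1_proj[OF v(1,2)] by simp
 then obtain d p where p: "p:homog V d" "cspan {v}:basic_open V p" "ALL M:Z. M \<notin> basic_open V p"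
  by (elim exE conjE)
 have "p:vid V Z d" unfolding vid_def
  using p(1,3) basic_span1[OF p(1)] by (auto simp: acone_def)
 moreover have "p v~=0" using p(2) basic_span1[OF p(1) v(1,2)] by simp
 ultimately show ?thesis by blast
qed

lemma closed_subset_proj: "closedin (zariski V) Z==>Z \<subseteq> proj V"
 using closedin_subset[of "zariski V" Z] by (simp add: topspace_zariski)

text \<open>Irreducibility read as primality of the homogeneous ideal: the zero sets of
  \<open>p\<close> and \<open>q\<close> in \<open>Z\<close> are closed and cover \<open>Z\<close>,
  so one of them is everything.\<close>

lemma variety_no_zero_divisors:
 assumes V: "csubspace V" and Z: "proj_variety V Z" and p: "p:homog V d" and q: "q:homog V e"
  and pq: "!!v. v:acone V Z ==> p v * q v=0" and u: "u:acone V Z" "p u~=0" and v: "v:acone V Z"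
 shows "q v=0"
proof (rule ccontr)
 assume "q v~=0"
 have ZP: "Z \<subseteq> proj V" using Z closed_subset_proj[of V Z] unfolding proj_variety_def by simp
 let ?T = "zariski_on V Z"
 have ts: "topspace ?T=Z" using ZP by (simp add: topspace_zariski inf.absorb2)
 have cl: "closedin ?T (Z - basic_open V r)" if "r:homog V n" for r n
 proof -
  have "closedin ?T (topspace ?T - (Z \<inter> basic_open V r))"
   by (rule closedin_diff[OF closedin_topspace openin_on_basic[OF that]])
  moreover have "topspace ?T - (Z \<inter> basic_open V r)=Z - basic_open V r" unfolding ts by blast
  ultimately show ?thesis by simp
 qed
 have "Z=(Z - basic_open V p) \<union> (Z - basic_open V q)"
 proof -
  have "L \<notin> basic_open V p \<or> L \<notin> basic_open V q" if L: "L:Z" for L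
  proof -
   obtain w where w: "w:acone V Z" "L=cspan {w}" using cone_rep[OF ZP L] by blast
   then show ?thesis using pq[OF w(1)] basic_span1[OF p] basic_span1[OF q] by (auto simp: acone_def)
  qed
  then show ?thesis by blast
 qed
 then have "Z=Z - basic_open V p \<or> Z=Z - basic_open V q"
  using Z cl[OF p] cl[OF q] unfolding proj_variety_def irreducible_space_def ts by blast
 moreover have "cspan {u}:Z" "cspan {u}:basic_open V p"
  using u basic_span1[OF p] by (auto simp: acone_def)
 moreover have "cspan {v}:Z" "cspan {v}:basic_open V q"
  using v \<open>q v ~= 0\<close> basic_span1[OF q] by (auto simp: acone_def)
 ultimately show False by blast
qed

text \<open>Points missing from two closed pieces have principal neighbourhoods avoiding them. If
  the pieces cover \<open>Z\<close>, the product of the two polynomials vanishes on the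
  cone.\<close>

lemma proj_varietyI:
 assumes V: "csubspace V" and Z: "closedin (zariski V) Z" "Z~={}"
  and zd: "!!p q d e u v. p:homog V d==>q:homog V e ==>
   (!!v. v:acone V Z ==> p v * q v=0)==>u:acone V Z ==> p u~=0==>v:acone V Z==>q v=0"
 shows "proj_variety V Z"
proof -
 have ZP: "Z \<subseteq> proj V" by (rule closed_subset_proj[OF Z(1)])
 let ?T = "zariski_on V Z"
 have ts: "topspace ?T=Z" using ZP by (simp add: topspace_zariski inf.absorb2)
 have sep: "znbhd V Z L (Z - A)" if A: "closedin ?T A" and L: "L:Z" "L \<notin> A" for A L
  using openin_diff[OF openin_topspace A] L unfolding ts openin_zariski_on[OF ZP] by simp
 have "Z=A \<or> Z=B" if AB: "closedin ?T A" "closedin ?T B" "Z=A \<union> B" for A B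
 proof (rule ccontr)
  assume "\<not> (Z=A \<or> Z=B)"
  then obtain L M where L: "L:Z" "L \<notin> A" and M: "M:Z" "M \<notin> B" using AB(3) by blast
  obtain d p where p: "p:homog V d" "L:basic_open V p" "Z \<inter> basic_open V p \<subseteq> Z - A"
   by (rule znbhdE[OF sep[OF AB(1) L]])
  obtain e q where q: "q:homog V e" "M:basic_open V q" "Z \<inter> basic_open V q \<subseteq> Z - B"
   by (rule znbhdE[OF sep[OF AB(2) M]])
  obtain u where u: "u:acone V Z" "L=cspan {u}" using cone_rep[OF ZP L(1)] by blast
  obtain v where v: "v:acone V Z" "M=cspan {v}" using cone_rep[OF ZP M(1)] by blast
  have pu: "p u~=0" using p(2) u basic_span1[OF p(1)] by (auto simp: acone_def)
  have qv: "q v~=0" using q(2) v basic_span1[OF q(1)] by (auto simp: acone_def)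
  have "p w * q w=0" if w: "w:acone V Z" for w
  proof (rule ccontr)
   assume "p w * q w~=0"
   then have "cspan {w}:Z \<inter> basic_open V p" "cspan {w}:Z \<inter> basic_open V q"
    using w basic_span1[OF p(1)] basic_span1[OF q(1)] by (auto simp: acone_def)
   then show False using p(3) q(3) AB(3) by blast
  qed
  from zd[OF p(1) q(1) this u(1) pu v(1)] qv show False by simp
 qed
 then show ?thesis unfolding proj_variety_def irreducible_space_def ts
  using Z by (intro conjI allI impI) assumption+
qed

text \<open>The tangent space of the affine cone over \<open>Z\<close>.\<close>

definition tcone :: "'v::complex_vector set=>'v set set=>'v=>'v set"
 where "tcone V Z x={v:V. ALL d. ALL p:vid V Z d. dd p v x=0}"

text \<open>A presentation of \<open>f\<close> as a quotient of homogeneous polynomials of equal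
  degree. It is valid on all of \<open>Z\<close> where \<open>g\<close> is nonzero, so the
  neighbourhood is encoded in the denominator.\<close>

definition lrep :: "'v::complex_vector set=>'v set set=>'v=>('v set=>complex)=>('v=>complex)=>('v=>complex)=>bool"
 where "lrep V Z x f p g \<longleftrightarrow> (EX d. p:homog V d&g:homog V d)&g x~=0 &
  (ALL v:acone V Z. g v~=0-->f (cspan {v}) = p v / g v)"

text \<open>The derivation given by the quotient rule. For \<open>v\<close> in the tangent cone the
  choice of the presentation is immaterial by \<open>tvec_unique\<close>; outside the local ring the
  value is 0, as \<open>tangent\<close> prescribes.\<close>

definition tvec :: "'v::complex_vector set=>'v set set=>'v=>'v=>('v set=>complex)=>complex"
 where "tvec V Z x v f=(if f:local_ring V Z (cspan {x})
  then (let (p, g)=(SOME (p, g). lrep V Z x f p g) in (dd p v x - f (cspan {x}) * dd g v x) / g x) else 0)"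

text \<open>The polynomial function \<open>p\<close> on the affine chart \<open>q = 1\<close>.\<close>

definition dehom :: "('v::complex_vector=>complex)=>('v=>complex)=>'v set=>complex"
 where "dehom q p L=(let v=(SOME v. v:L&v~=0) in p (inverse (q v) *. v))"

lemma some_span1: "v~=0==>EX c. c~=0&(SOME u. u:cspan {v}&u~=0)=c *. v"
proof -
 assume v: "v~=0"
 have "(SOME u. u:cspan {v}&u~=0):cspan {v}&(SOME u. u:cspan {v}&u~=0)~=0"
  by (rule someI[of _ v]) (simp add: v span1_self)
 then show ?thesis unfolding mem_span1 by (metis cvs.scale_zero_left)
qed

lemma dehom_span1:
 assumes "lin V q" "v:V" "v~=0"
 shows "dehom q p (cspan {v}) = p (inverse (q v) *. v)"
proof -
 obtain c where c: "c~=0" "(SOME u. u:cspan {v}&u~=0)=c *. v" using some_span1[OF assms(3)] by blast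
 have "inverse (q (c *. v)) * c=inverse (q v)"
  using c(1) lin_scale[OF assms(1,2), of c] by simp
 then have e: "inverse (q (c *. v)) *. c *. v=inverse (q v) *. v"
  by (simp only: scaleC_scaleC)
 show ?thesis unfolding dehom_def c(2) Let_def e ..
qed

lemma section_fun_span1:
 assumes "lin V q" "lin V l" "v:V" "v~=0"
 shows "section_fun q l (cspan {v})=l v / q v"
proof -
 obtain c where c: "c~=0" "(SOME u. u:cspan {v}&u~=0)=c *. v" using some_span1[OF assms(4)] by blast
 show ?thesis
  using c lin_scale[OF assms(1,3), of c] lin_scale[OF assms(2,3), of c]
  by (simp add: section_fun_def c(2))
qed

section \<open>Local rings and tangent spaces in an affine chart\<close>

locale proj_point =
 fixes V :: "'v::complex_vector set" and Z :: "'v set set" and x :: 'v and q :: "'v=>complex"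
 assumes fdV: "finite_dim V" and ZP: "Z \<subseteq> proj V" and xZ: "x:acone V Z"
  and q: "lin V q" and qx: "q x=1"
begin

abbreviation "pt \<equiv> cspan {x}"
abbreviation "R \<equiv> local_ring V Z pt"

lemma V: "csubspace V" using fdV by (rule fd_sub)
lemma xV: "x:V" using xZ by (rule coneD)

lemma local_ring_iff: "f:R \<longleftrightarrow> (EX p g. lrep V Z x f p g)"
proof
 assume "f:R"
 then obtain U where U: "openin (zariski_on V Z) U" "pt:U" "f:regular_funs V U"
  unfolding local_ring_def by (elim CollectE exE conjE)
 from U(3) obtain d p g where pg: "p:homog V d" "g:homog V d" "pt:basic_open V g"
  "ALL M:U \<inter> basic_open V g. ALL v:M - {0}. f M = p v / g v"
  unfolding regular_funs_def using U(2) by (elim CollectE) (drule bspec, assumption, elim exE bexE conjE, rule)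
 obtain e s where s: "s:homog V e" "pt:basic_open V s" "Z \<inter> basic_open V s \<subseteq> U"
  using U(1,2) unfolding openin_zariski_on[OF ZP] by (elim conjE) (erule (1) znbhd_ballE)
 have x0: "x~=0" using xZ by (rule coneD)
 \<comment> \<open>Multiplication by \<open>s\<close> shrinks the locus of nonzero denominator to
   the set where the quotient is known to represent \<open>f\<close>.\<close>
 have "lrep V Z x f (%v. p v * s v) (%v. g v * s v)"
  unfolding lrep_def
 proof (intro conjI exI ballI impI)
  show "(%v. p v * s v):homog V (d + e)" "(%v. g v * s v):homog V (d + e)"
   using pg s by (auto intro: homog_mult)
  show "g x * s x~=0"
   using pg(3) s(2) basic_span1[OF pg(2) xV x0] basic_span1[OF s(1) xV x0] by simp
  fix v assume v: "v:acone V Z" and ne: "g v * s v~=0"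
  have "cspan {v}:U \<inter> basic_open V g"
   using s(3) coneD[OF v] ne basic_span1[OF pg(2)] basic_span1[OF s(1)] by auto
  then have "f (cspan {v}) = p v / g v" using pg(4) coneD(2)[OF v] span1_self[of v] by blast
  then show "f (cspan {v}) = p v * s v / (g v * s v)" using ne by simp
 qed
 then show "EX p g. lrep V Z x f p g" by blast
next
 assume "EX p g. lrep V Z x f p g"
 then obtain d p g where pg: "p:homog V d" "g:homog V d" "g x~=0"
  "ALL v:acone V Z. g v~=0-->f (cspan {v}) = p v / g v" unfolding lrep_def by blast
 let ?U = "Z \<inter> basic_open V g"
 have "pt:?U" using basic_span1[OF pg(2) xV] pg(3) coneD[OF xZ] by simp
 moreover have "f:regular_funs V ?U"
  unfolding regular_funs_def
 proof (intro CollectI ballI, rule exI[of _ d], rule bexI[OF _ pg(1)], rule bexI[OF _ pg(2)], intro conjI ballI)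
  fix L assume "L:?U"
  then show "L:basic_open V g" by blast
  fix M v assume M: "M:?U \<inter> basic_open V g" and v: "v:M - {0}"
  have v': "v:acone V Z" "M=cspan {v}" using cone_elem[OF V ZP, of M v] M v by auto
  then have "g v~=0" using M v basic_span1[OF pg(2)] by (auto simp: acone_def)
  then show "f M = p v / g v" using pg(4) v' by blast
 qed
 ultimately show "f:R" unfolding local_ring_def using openin_on_basic[OF pg(2), of Z] by blast
qed

lemma germ_eq_iff:
 "germ_eq V Z pt f f' \<longleftrightarrow> (EX e. EX s:homog V e. s x~=0&(ALL v:acone V Z. s v~=0-->f (cspan {v})=f' (cspan {v})))"
proof
 assume "germ_eq V Z pt f f'"
 then obtain U where U: "openin (zariski_on V Z) U" "pt:U" "ALL y:U. f y=f' y" by (auto simp: germ_eq_def)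
 obtain e s where s: "s:homog V e" "pt:basic_open V s" "Z \<inter> basic_open V s \<subseteq> U"
  using U(1,2) unfolding openin_zariski_on[OF ZP] by (elim conjE) (erule (1) znbhd_ballE)
 show "EX e. EX s:homog V e. s x~=0&(ALL v:acone V Z. s v~=0-->f (cspan {v})=f' (cspan {v}))"
 proof (intro exI[of _ e] bexI[OF _ s(1)] conjI ballI impI)
  show "s x~=0" using s(2) basic_span1[OF s(1) xV coneD(2)[OF xZ]] by simp
  fix v assume v: "v:acone V Z" "s v~=0"
  then have "cspan {v}:Z \<inter> basic_open V s" using basic_span1[OF s(1)] by (auto simp: acone_def)
  then show "f (cspan {v})=f' (cspan {v})" using s(3) U(3) by blast
 qed
next
 assume "EX e. EX s:homog V e. s x~=0&(ALL v:acone V Z. s v~=0-->f (cspan {v})=f' (cspan {v}))"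
 then obtain e s where s: "s:homog V e" "s x~=0" "ALL v:acone V Z. s v~=0-->f (cspan {v})=f' (cspan {v})" by blast
 show "germ_eq V Z pt f f'"
  unfolding germ_eq_def
 proof (intro exI[of _ "Z \<inter> basic_open V s"] conjI ballI)
  show "openin (zariski_on V Z) (Z \<inter> basic_open V s)" by (rule openin_on_basic[OF s(1)])
  show "pt:Z \<inter> basic_open V s" using s(2) basic_span1[OF s(1) xV] coneD[OF xZ] by simp
  fix y assume y: "y:Z \<inter> basic_open V s"
  then obtain v where v: "v:acone V Z" "y=cspan {v}" using cone_rep[OF ZP, of y] by blast
  then show "f y=f' y" using s(3) y basic_span1[OF s(1)] by (auto simp: acone_def)
 qed
qed

lemma lrepD:
 assumes "lrep V Z x f p g"
 shows "p : pfuns V" "g : pfuns V" "g x~=0" "p x=f pt * g x"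
  "!!v. v:acone V Z==>g v~=0==>f (cspan {v}) = p v / g v"
 using assms xZ homogD(1) unfolding lrep_def by auto

lemma lrep_add:
 assumes "lrep V Z x f p g" "lrep V Z x f' p' g'"
 shows "lrep V Z x (%y. f y + f' y) (%v. p v * g' v + p' v * g v) (%v. g v * g' v)"
proof -
 obtain d d' where d: "p:homog V d" "g:homog V d" "p':homog V d'" "g':homog V d'"
  using assms unfolding lrep_def by blast
 have "(%v. p v * g' v + p' v * g v):homog V (d + d')"
  using homog_mult[OF d(1,4)] homog_mult[OF d(3,2)] by (intro homog_add) (simp_all add: add.commute)
 then show ?thesis
  using assms homog_mult[OF d(2,4)] unfolding lrep_def by (auto simp: add_frac_eq)
qed

lemma lrep_mult:
 assumes "lrep V Z x f p g" "lrep V Z x f' p' g'"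
 shows "lrep V Z x (%y. f y * f' y) (%v. p v * p' v) (%v. g v * g' v)"
proof -
 obtain d d' where d: "p:homog V d" "g:homog V d" "p':homog V d'" "g':homog V d'"
  using assms unfolding lrep_def by blast
 show ?thesis
  using assms homog_mult[OF d(1,3)] homog_mult[OF d(2,4)] unfolding lrep_def by auto
qed

lemma lrep_const: "lrep V Z x (%_. c) (%_. c) (%_. 1)"
 using homog_const unfolding lrep_def by fastforce

lemma lrep_cong:
 assumes "lrep V Z x f p g" "s:homog V e" "s x~=0" "!!v. v:acone V Z ==> s v~=0==>f (cspan {v})=f' (cspan {v})"
 shows "lrep V Z x f' (%v. p v * s v) (%v. g v * s v)"
proof -
 obtain d where "p:homog V d" "g:homog V d" using assms(1) unfolding lrep_def by blast
 then show ?thesis using homog_mult[OF _ assms(2)] assms unfolding lrep_def by auto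
qed

lemma local_ring_add: "f:R==>g:R==>(%y. f y + g y):R"
 and local_ring_mult: "f:R==>g:R==>(%y. f y * g y):R"
 and local_ring_const: "(%_. c):R"
 unfolding local_ring_iff using lrep_add lrep_mult lrep_const by blast+

lemma local_ring_cmult: "f:R==>(%y. c * f y):R"
 by (rule local_ring_mult[OF local_ring_const])

lemma local_ring_germ: "f:R==>germ_eq V Z pt f f'==>f':R"
 unfolding local_ring_iff germ_eq_iff using lrep_cong by blast

lemma tconeD: "v:tcone V Z x==>v:V" "v:tcone V Z x ==> p:vid V Z d==>dd p v x=0"
 by (auto simp: tcone_def)

lemma tcone_csubspace: "csubspace (tcone V Z x)"
proof (rule cvs.subspaceI)
 have l: "lin V (%v. dd p v x)" if "p:vid V Z d" for p d
  using dd_linear_dir[OF V _ xV] homogD(1) that unfolding vid_def by blast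
 show "0:tcone V Z x" using lin_0[OF V l] sub_0[OF V] by (simp add: tcone_def)
 fix u v c assume u: "u:tcone V Z x"
 show "c *. u:tcone V Z x" unfolding tcone_def
  using lin_scale[OF l, of _ _ u c] tconeD[OF u] sub_scale[OF V] by simp
 assume v: "v:tcone V Z x"
 show "u + v:tcone V Z x" unfolding tcone_def
  using lin_add[OF l, of _ _ u v] tconeD[OF u] tconeD[OF v] sub_add[OF V] by simp
qed

lemma x_tcone: "x:tcone V Z x"
 unfolding tcone_def vid_def using dd_homog_self[OF V _ xV] xV xZ by auto

text \<open>Two presentations agree only where both denominators are nonzero, so
  \<open>p g' - p' g\<close> is multiplied by \<open>g g'\<close> to obtain an element of the ideal.
  A vector of the tangent cone kills its differential, and \<open>g g'\<close> is nonzero at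
  \<open>x\<close>.\<close>

lemma tvec_unique:
 assumes v: "v:tcone V Z x" and 1: "lrep V Z x f p g" and 2: "lrep V Z x f p' g'"
 shows "(dd p v x - f pt * dd g v x) / g x=(dd p' v x - f pt * dd g' v x) / g' x"
proof -
 note D = lrepD[OF 1] lrepD[OF 2]
 have vV: "v:V" using v by (rule tconeD)
 obtain d d' where d: "p:homog V d" "g:homog V d" "p':homog V d'" "g':homog V d'"
  using 1 2 unfolding lrep_def by blast
 let ?r = "%v. p v * g' v - p' v * g v"
 have r: "?r:homog V (d + d')"
  using homog_mult[OF d(1,4)] homog_mult[OF d(3,2)] by (intro homog_diff) (simp_all add: add.commute)
 have gg: "(%v. g v * g' v):homog V (d + d')" by (rule homog_mult[OF d(2,4)])
 have "(%v. ?r v * (g v * g' v)):vid V Z ((d + d') + (d + d'))"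
  unfolding vid_def
 proof (intro CollectI conjI ballI)
  show "(%v. ?r v * (g v * g' v)):homog V ((d + d') + (d + d'))" by (rule homog_mult[OF r gg])
  fix w assume w: "w:acone V Z"
  show "?r w * (g w * g' w)=0"
  proof (cases "g w=0 \<or> g' w=0")
   case False
   then have "p w / g w = p' w / g' w" using D(5)[OF w] D(10)[OF w] by simp
   then show ?thesis using False by (simp add: frac_eq_eq)
  qed auto
 qed
 then have "0=dd (%v. ?r v * (g v * g' v)) v x" using tconeD(2)[OF v] by simp
 also have "\<dots>=dd ?r v x * (g x * g' x)"
  using D(4,9) by (subst dd_mult[OF V xV vV homogD(1)[OF r] homogD(1)[OF gg]]) simp
 finally have "dd ?r v x=0" using D by simp
 moreover have "dd ?r v x=(dd p v x * g' x + p x * dd g' v x) - (dd p' v x * g x + p' x * dd g v x)"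
  using D by (simp add: dd_diff[OF V xV vV] dd_mult[OF V xV vV] poly_funs.mult)
 ultimately have "dd p v x * g' x + p x * dd g' v x=dd p' v x * g x + p' x * dd g v x" by simp
 then show ?thesis using D(3,8) by (simp add: D(4,9) frac_eq_eq algebra_simps)
qed

lemma tvec_eq:
 assumes v: "v:tcone V Z x" and 1: "lrep V Z x f p g"
 shows "tvec V Z x v f=(dd p v x - f pt * dd g v x) / g x"
proof -
 have f: "f:R" unfolding local_ring_iff using 1 by blast
 obtain p' g' where pg: "(SOME (p, g). lrep V Z x f p g)=(p', g')" by (cases "SOME (p, g). lrep V Z x f p g")
 have "case (SOME (p, g). lrep V Z x f p g) of (p, g)=>lrep V Z x f p g"
  by (rule someI[of _ "(p, g)"]) (simp add: 1)
 then have "lrep V Z x f p' g'" by (simp add: pg)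
 from tvec_unique[OF v this 1] show ?thesis using f by (simp add: tvec_def pg)
qed

lemma tvec_tangent:
 assumes v: "v:tcone V Z x" shows "tvec V Z x v:tangent V Z pt"
proof -
 have vV: "v:V" using v by (rule tconeD)
 have ring: "tvec V Z x v (%y. f y + g y)=tvec V Z x v f + tvec V Z x v g"
  "tvec V Z x v (%y. f y * g y)=f pt * tvec V Z x v g + g pt * tvec V Z x v f"
  if fg: "f:R" "g:R" for f g
 proof -
  obtain p a where 1: "lrep V Z x f p a" using fg(1) local_ring_iff by blast
  obtain p' a' where 2: "lrep V Z x g p' a'" using fg(2) local_ring_iff by blast
  note D = lrepD[OF 1] lrepD[OF 2]
  note s = dd_add[OF V xV vV] dd_mult[OF V xV vV] poly_funs.mult
  show "tvec V Z x v (%y. f y + g y)=tvec V Z x v f + tvec V Z x v g"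
   unfolding tvec_eq[OF v lrep_add[OF 1 2]] tvec_eq[OF v 1] tvec_eq[OF v 2]
   using D(1-4,6-9) by (simp add: s field_simps)
  show "tvec V Z x v (%y. f y * g y)=f pt * tvec V Z x v g + g pt * tvec V Z x v f"
   unfolding tvec_eq[OF v lrep_mult[OF 1 2]] tvec_eq[OF v 1] tvec_eq[OF v 2]
   using D(1-4,6-9) by (simp add: s field_simps)
 qed
 have germ: "tvec V Z x v f=tvec V Z x v g" if f: "f:R" and fg: "germ_eq V Z pt f g" for f g
 proof -
  obtain p a where 1: "lrep V Z x f p a" using f local_ring_iff by blast
  obtain e s where s: "s:homog V e" "s x~=0" "ALL v:acone V Z. s v~=0-->f (cspan {v})=g (cspan {v})"
   using fg unfolding germ_eq_iff by blast
  have "f pt=g pt" using s(2,3) xZ by blast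
  then show ?thesis
   using tvec_eq[OF v lrep_cong[OF 1 s(1,2), of f]] tvec_eq[OF v lrep_cong[OF 1 s(1,2), of g]] s(3) by simp
 qed
 have const: "tvec V Z x v (%_. c)=0" for c
  unfolding tvec_eq[OF v lrep_const] by (simp add: dd_const)
 have "tvec V Z x v (%y. c * f y)=c * tvec V Z x v f" if "f:R" for c f
  using ring(2)[OF local_ring_const that] by (simp add: const)
 then show ?thesis unfolding tangent_def using ring germ by (auto simp: tvec_def)
qed

lemma lrep_dehom:
 assumes p: "p : pfuns V"
 obtains H d where "H:homog V d" "!!v. v:V==>q v~=0==>H v=q v ^ d * p (inverse (q v) *. v)"
  "lrep V Z x (dehom q p) H (%v. q v ^ d)"
proof -
 obtain d0 where "ALL d>=d0. EX H:homog V d. ALL v:V. q v~=0-->H v=q v ^ d * p (inverse (q v) *. v)"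
  using homogenize[OF V q p] by blast
 \<comment> \<open>A positive degree is taken, so that \<open>q v ^ d\<close> is nonzero only where
   \<open>q v\<close> is.\<close>
 then obtain H where H: "H:homog V (Suc d0)" "ALL v:V. q v~=0-->H v=q v ^ Suc d0 * p (inverse (q v) *. v)"
  using le_SucI[OF order_refl] by blast
 have "lrep V Z x (dehom q p) H (%v. q v ^ Suc d0)"
  unfolding lrep_def
 proof (intro conjI exI ballI impI)
  show "H:homog V (Suc d0)" by (rule H(1))
  show "(%v. q v ^ Suc d0):homog V (Suc d0)" by (rule homog_linear_power[OF q])
  show "q x ^ Suc d0~=0" by (simp add: qx)
  fix v assume v: "v:acone V Z" "q v ^ Suc d0~=0"
  then show "dehom q p (cspan {v})=H v / q v ^ Suc d0"
   using H(2) dehom_span1[OF q coneD(1,2)[OF v(1)]] coneD(1)[OF v(1)] by simp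
 qed
 with H show thesis by (intro that[of H "Suc d0"]) auto
qed

lemma dehom_local_ring: "p : pfuns V==>dehom q p:R"
 unfolding local_ring_iff by (rule lrep_dehom) blast+

lemma dehom_pt: "dehom q p pt = p x"
 using dehom_span1[OF q xV coneD(2)[OF xZ]] by (simp add: qx scaleC_one)

text \<open>A direction with \<open>q v = 0\<close> stays inside the chart \<open>q = 1\<close>,
  where homogenizing changes nothing.\<close>

lemma tvec_dehom:
 assumes v: "v:tcone V Z x" "q v=0" and p: "p : pfuns V"
 shows "tvec V Z x v (dehom q p)=dd p v x"
proof -
 have vV: "v:V" using v by (intro tconeD)
 obtain H d where H: "H:homog V d" "!!v. v:V==>q v~=0==>H v=q v ^ d * p (inverse (q v) *. v)"
  "lrep V Z x (dehom q p) H (%v. q v ^ d)" using lrep_dehom[OF p] by blast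
 have "q (x + s *. v)=1" for s
  using lin_add[OF q xV sub_scale[OF V vV]] lin_scale[OF q vV] v(2) qx by simp
 then have "H (x + s *. v) = p (x + s *. v)" for s
  using H(2)[of "x + s *. v"] sub_add[OF V xV sub_scale[OF V vV]] by (simp add: scaleC_one)
 then have "dd H v x=dd p v x" by (simp add: dd_def)
 moreover have "dd (%v. q v ^ d) v x=0"
  using dd_power[OF V xV vV poly_funs.linear[OF q]] dd_linear[OF V xV vV q] v(2) by simp
 ultimately show ?thesis unfolding tvec_eq[OF v(1) H(3)] by (simp add: qx)
qed

context
 fixes D assumes D: "D:tangent V Z pt"
begin

lemma tangentD:
 "f:R==>g:R==>D (%y. f y + g y)=D f + D g"
 "f:R==>g:R==>D (%y. f y * g y)=f pt * D g + g pt * D f"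
 "f:R==>germ_eq V Z pt f g==>D f=D g"
 "f:R==>D (%y. c * f y)=c * D f"
 "f \<notin> R==>D f=0"
 using D local_ring_germ unfolding tangent_def by blast+

lemma tangent_const: "D (%_. c)=0"
proof -
 have "D (%y. 1 * 1)=1 * D (%y. 1) + 1 * D (%y. 1)" by (rule tangentD(2)[OF local_ring_const local_ring_const])
 then have "D (%_. 1)=0" by simp
 then show ?thesis using tangentD(4)[OF local_ring_const, of c 1] by simp
qed

lemma tangent_sum: "(!!i. i:I==>f i:R)==>(%y. SUM i:I. c i * f i y):R&D (%y. SUM i:I. c i * f i y)=(SUM i:I. c i * D (f i))"
proof (induction I rule: infinite_finite_induct)
 case (insert i I)
 then show ?case using local_ring_cmult[of "f i" "c i"]
  by (simp add: local_ring_add tangentD(1) tangentD(4))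
qed (simp_all add: local_ring_const tangent_const)

text \<open>A derivation is determined by its values on the affine coordinates, from which
  \<open>v\<close> is assembled. The product rule extends the agreement to all polynomials and then
  to quotients.\<close>

lemma tangent_is_tvec: "EX v:tcone V Z x. q v=0&D=tvec V Z x v"
proof -
 define v where "v=(SUM b:vbasis V. D (dehom q (coord V b)) *. b)"
 have vV: "v:V" unfolding v_def using vbasis(1) by (intro sub_sum[OF V] sub_scale[OF V]) blast
 have gq: "germ_eq V Z pt f f'" if "!!v. v:acone V Z==>q v~=0==>f (cspan {v})=f' (cspan {v})" for f f'
  unfolding germ_eq_iff using that qx homog_linear[OF q] by (intro exI[of _ 1] bexI[of _ q]) auto
 have key: "D (dehom q p)=dd p v x" if "p : pfuns V" for p
  using that
 proof induction
  case (const c)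
  have "dehom q (%_. c)=(%_. c)" by (simp add: dehom_def fun_eq_iff)
  then show ?case by (simp add: tangent_const dd_const)
 next
  case (linear l)
  have cR: "dehom q (coord V b):R" for b by (intro dehom_local_ring poly_funs.linear coord_linear[OF V])
  have "germ_eq V Z pt (%y. SUM b:vbasis V. l b * dehom q (coord V b) y) (dehom q l)"
  proof (rule gq)
   fix w assume w: "w:acone V Z" "q w~=0"
   show "(SUM b:vbasis V. l b * dehom q (coord V b) (cspan {w}))=dehom q l (cspan {w})"
    unfolding dehom_span1[OF q coneD(1,2)[OF w(1)]]
    using lin_expand[OF fdV linear sub_scale[OF V coneD(1)[OF w(1)]], of "inverse (q w)"] by (simp add: mult.commute)
  qed
  then have "D (dehom q l)=(SUM b:vbasis V. l b * D (dehom q (coord V b)))"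
   using tangent_sum[of "vbasis V" "%b. dehom q (coord V b)" l] cR tangentD(3) by metis
  also have "\<dots>=l v" unfolding v_def
   by (subst lin_lincomb[OF V linear]) (use vbasis(1)[of V] in \<open>auto simp: mult.commute\<close>)
  finally show ?case by (simp add: dd_linear[OF V xV vV linear])
 next
  case (add f g)
  have "dehom q (%v. f v + g v)=(%y. dehom q f y + dehom q g y)" by (simp add: dehom_def fun_eq_iff Let_def)
  then show ?case using add by (simp add: tangentD(1) dehom_local_ring dd_add[OF V xV vV])
 next
  case (mult f g)
  have "dehom q (%v. f v * g v)=(%y. dehom q f y * dehom q g y)" by (simp add: dehom_def fun_eq_iff Let_def)
  then show ?case using mult by (simp add: tangentD(2) dehom_local_ring dehom_pt dd_mult[OF V xV vV])
 qed
 \<comment> \<open>In the chart \<open>q\<close> is the constant 1, which a derivation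
   kills.\<close>
 have "germ_eq V Z pt (%_. 1) (dehom q q)"
  by (rule gq) (simp add: dehom_span1[OF q] coneD lin_scale[OF q])
 then have "q v=0"
  using key[OF poly_funs.linear[OF q]] tangentD(3)[OF local_ring_const] tangent_const dd_linear[OF V xV vV q] by metis
 moreover have vK: "v:tcone V Z x"
  unfolding tcone_def
 proof (intro CollectI conjI allI ballI vV)
  fix d p assume p: "p:vid V Z d"
  then have pp: "p:homog V d" by (simp add: vid_def)
  have "germ_eq V Z pt (%_. 0) (dehom q p)"
  proof (rule gq)
   fix w assume "w:acone V Z"
   then show "0=dehom q p (cspan {w})"
    using p dehom_span1[OF q] homogD(2)[OF pp] by (simp add: vid_def coneD)
  qed
  then show "dd p v x=0" using key[OF homogD(1)[OF pp]] tangentD(3)[OF local_ring_const] tangent_const by metis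
 qed
 moreover have "D f=tvec V Z x v f" for f
 proof (cases "f:R")
  case True
  then obtain p g where 1: "lrep V Z x f p g" using local_ring_iff by blast
  obtain d where d: "p:homog V d" "g:homog V d" using 1 unfolding lrep_def by blast
  note L = lrepD[OF 1]
  \<comment> \<open>Applying \<open>D\<close> to \<open>f g = p\<close> and solving for
    \<open>D f\<close> gives the quotient rule.\<close>
  have "germ_eq V Z pt (%y. f y * dehom q g y) (dehom q p)"
   unfolding germ_eq_iff
  proof (intro exI bexI conjI ballI impI)
   show "(%v. g v * q v):homog V (d + 1)" by (rule homog_mult[OF d(2) homog_linear[OF q]])
   show "g x * q x~=0" using L(3) qx by simp
   fix w assume w: "w:acone V Z" "g w * q w~=0"
   then show "f (cspan {w}) * dehom q g (cspan {w})=dehom q p (cspan {w})"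
    using L(5)[OF w(1)] dehom_span1[OF q] homogD(2)[OF d(1)] homogD(2)[OF d(2)] coneD[OF w(1)] by simp
  qed
  then have "D (dehom q p)=f pt * D (dehom q g) + dehom q g pt * D f"
   using tangentD(2)[OF True dehom_local_ring[OF L(2)]] tangentD(3) local_ring_mult[OF True dehom_local_ring[OF L(2)]] by metis
  then show ?thesis unfolding tvec_eq[OF vK 1] key[OF L(1)] key[OF L(2)] dehom_pt using L(3) by (simp add: field_simps)
 qed (simp add: tangentD(5) tvec_def)
 ultimately show ?thesis by blast
qed

end

text \<open>The tangent directions inside the chart: a complement in the tangent cone of the radial
  line through \<open>x\<close>.\<close>

abbreviation "TK \<equiv> {v:tcone V Z x. q v=0}"

lemma TK_csubspace: "csubspace TK"
 by (rule sub_ker[OF tcone_csubspace lin_subset[OF q]]) (use tconeD in blast)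

lemma tangent_iso: "lin_iso TK (tangent V Z pt) (tvec V Z x)"
 unfolding lin_iso_def bij_betw_def
proof (intro conjI)
 show "lin TK (tvec V Z x)"
 proof (rule clinear_onI)
  fix u v c assume u: "u:TK"
  have cu: "c *. u:TK" using u by (rule sub_scale[OF TK_csubspace])
  show "tvec V Z x (c *. u)=c *. tvec V Z x u"
  proof
   fix f show "tvec V Z x (c *. u) f=(c *. tvec V Z x u) f"
   proof (cases "f:R")
    case True
    then obtain p g where 1: "lrep V Z x f p g" using local_ring_iff by blast
    note s = lin_scale[OF dd_linear_dir[OF V _ xV]]
    show ?thesis using u cu lrepD[OF 1] tconeD(1)
     by (simp add: tvec_eq[OF _ 1] scaleC_fun_def s algebra_simps diff_divide_distrib)
   qed (simp add: tvec_def scaleC_fun_def)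
  qed
  assume v: "v:TK"
  have uv: "u + v:TK" using u v by (rule sub_add[OF TK_csubspace])
  show "tvec V Z x (u + v)=tvec V Z x u + tvec V Z x v"
  proof
   fix f show "tvec V Z x (u + v) f=(tvec V Z x u + tvec V Z x v) f"
   proof (cases "f:R")
    case True
    then obtain p g where 1: "lrep V Z x f p g" using local_ring_iff by blast
    note s = lin_add[OF dd_linear_dir[OF V _ xV]]
    show ?thesis using u v uv lrepD[OF 1] tconeD(1)
     by (simp add: tvec_eq[OF _ 1] s algebra_simps add_divide_distrib diff_divide_distrib)
   qed (simp add: tvec_def)
  qed
 qed
 show "inj_on (tvec V Z x) TK"
 proof (rule inj_onI)
  fix u v assume u: "u:TK" and v: "v:TK" and eq: "tvec V Z x u=tvec V Z x v"
  have uV: "u:V" "v:V" using u v tconeD(1) by blast+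
  have "coord V b u=coord V b v" for b
  proof -
   have l: "lin V (coord V b)" by (rule coord_linear[OF V])
   have "coord V b u=tvec V Z x u (dehom q (coord V b))"
    using u tvec_dehom[of u "coord V b"] poly_funs.linear[OF l] dd_linear[OF V xV uV(1) l] by simp
   also have "\<dots>=coord V b v"
    using v tvec_dehom[of v "coord V b"] poly_funs.linear[OF l] dd_linear[OF V xV uV(2) l] unfolding eq by simp
   finally show ?thesis .
  qed
  then have "(SUM b:vbasis V. coord V b u *. b)=(SUM b:vbasis V. coord V b v *. b)" by simp
  then show "u=v" unfolding coord_expand[OF fdV uV(1)] coord_expand[OF fdV uV(2)] .
 qed
 show "tvec V Z x ` TK=tangent V Z pt"
  using tvec_tangent tangent_is_tvec by blast
qed

lemma TK_fd: "finite_dim TK"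
 by (rule finite_dim_subspace[OF fdV TK_csubspace]) (use tconeD in blast)

lemma cdim_tangent: "cdim (tangent V Z pt)=cdim TK" "finite_dim (tangent V Z pt)"
 using lin_iso_cdim[OF TK_fd tangent_iso] by simp_all

text \<open>The additional dimension is the radial direction \<open>x\<close>, which
  \<open>q\<close> splits off.\<close>

lemma cdim_tcone: "cdim (tcone V Z x)=cdim (tangent V Z pt) + 1"
proof -
 have K: "finite_dim (tcone V Z x)" by (rule finite_dim_subspace[OF fdV tcone_csubspace]) (use tconeD in blast)
 have "cdim TK + cdim (cspan {x})=cdim (tcone V Z x)"
 proof (rule direct_sum_dim(3)[OF K TK_csubspace _ cvs.subspace_span])
  show "cspan {x} \<subseteq> tcone V Z x" using x_tcone by (intro cvs.span_minimal[OF _ tcone_csubspace]) simp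
  show "TK \<inter> cspan {x}={0}"
  proof (intro equalityI subsetI)
   fix y assume y: "y:TK \<inter> cspan {x}"
   then obtain c where "y=c *. x" by (auto simp: mem_span1)
   then show "y:{0}" using y lin_scale[OF q xV, of c] qx by simp
  next
   fix y :: 'v assume "y:{0}"
   then show "y:TK \<inter> cspan {x}" using sub_0[OF TK_csubspace] cvs.span_zero by simp
  qed
  fix v assume v: "v:tcone V Z x"
  have "v - q v *. x:tcone V Z x" "q (v - q v *. x)=0"
   using sub_diff[OF tcone_csubspace v sub_scale[OF tcone_csubspace x_tcone]]
    lin_diff[OF V q tconeD(1)[OF v] sub_scale[OF V xV]] lin_scale[OF q xV] qx by simp_all
  then show "EX s:TK. EX t:cspan {x}. v = s + t"
   by (intro bexI[of _ "v - q v *. x"] bexI[of _ "q v *. x"]) (auto simp: mem_span1)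
 qed auto
 moreover have "cdim (cspan {x})=1"
  using cvs.dim_eq_card_independent[of "{x}"] coneD(2)[OF xZ] by simp
 ultimately show ?thesis by (simp add: cdim_tangent)
qed

end

lemma proj_point_exists:
 assumes "finite_dim V" "Z \<subseteq> proj V" "x:acone V Z" shows "EX q. proj_point V Z x q"
proof -
 obtain q :: "'a=>complex" where "clinear q" "q x=1"
  using separating_functional[of "{0}" x] coneD(2)[OF assms(3)] cvs.subspace_single_0 by blast
 then show ?thesis using assms by (intro exI[of _ q]) (simp add: proj_point_def clinear_clinear_on)
qed

lemma nonsingular_iff:
 assumes "finite_dim V" "Z \<subseteq> proj V" "x:acone V Z"
 shows "nonsingular_point V Z (cspan {x}) \<longleftrightarrow> (ALL y:acone V Z. cdim (tcone V Z x)<=cdim (tcone V Z y))"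
proof -
 have *: "cdim (tcone V Z y)=cdim (tangent V Z (cspan {y})) + 1" if y: "y:acone V Z" for y
  using proj_point_exists[OF assms(1,2) y] proj_point.cdim_tcone by blast
 have "(ALL L:Z. cdim (tangent V Z (cspan {x}))<=cdim (tangent V Z L)) \<longleftrightarrow>
   (ALL y:acone V Z. cdim (tangent V Z (cspan {x}))<=cdim (tangent V Z (cspan {y})))"
  using cone_rep[OF assms(2)] coneD(3) by metis
 then show ?thesis using assms(3) by (auto simp: nonsingular_point_def * coneD)
qed

section \<open>Upper semicontinuity of the tangent dimension\<close>

context proj_point
begin

definition eqs :: "('v=>complex) set"
 where "eqs={l. EX d. EX p:vid V Z d. ALL v:V. l v=dd p v x}"

lemma eqs_linear: "l:eqs==>lin V l"
proof -
 assume "l:eqs"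
 then obtain d p where p: "p:vid V Z d" "ALL v:V. l v=dd p v x" unfolding eqs_def by (elim CollectE exE bexE)
 have "p : pfuns V" using p(1) homogD(1) by (simp add: vid_def homog_polys_def)
 from lin_cong[OF V dd_linear_dir[OF V this xV]] p(2) show ?thesis by simp
qed

lemma tcone_eqs: "tcone V Z x={v:V. ALL l:eqs. l v=0}"
proof (intro set_eqI iffI)
 fix v assume v: "v:tcone V Z x"
 have "l v=0" if "l:eqs" for l
  using that tconeD[OF v] unfolding eqs_def by (elim CollectE exE bexE) simp
 then show "v:{v:V. ALL l:eqs. l v=0}" using tconeD(1)[OF v] by simp
next
 fix v assume v: "v:{v:V. ALL l:eqs. l v=0}"
 have "dd p v x=0" if p: "p:vid V Z d" for p d
 proof -
  have "(%v. dd p v x):eqs" unfolding eqs_def by (rule CollectI, rule exI[of _ d], rule bexI[OF _ p]) simp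
  moreover have "ALL l:eqs. l v=0" using v by simp
  ultimately show ?thesis by (rule bspec[rotated])
 qed
 then show "v:tcone V Z x" using v by (simp add: tcone_def)
qed

text \<open>Since \<open>p\<close> vanishes at \<open>x\<close> and \<open>q(x) = 1\<close>, multiplying \<open>p\<close> by powers of \<open>q\<close> does not change its differential.\<close>

lemma vid_raise_degree:
 assumes p: "p:vid V Z d" and v: "v:V"
 shows "(%v. p v * q v ^ e):vid V Z (d + e)" "dd (%v. p v * q v ^ e) v x=dd p v x"
proof -
 have ph: "p:homog V d" and px: "p x=0" using p xZ by (simp_all add: vid_def)
 show "(%v. p v * q v ^ e):vid V Z (d + e)"
  using p homog_mult[OF ph homog_linear_power[OF q, of e]] by (simp add: vid_def)
 show "dd (%v. p v * q v ^ e) v x=dd p v x"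
  using dd_mult[OF V xV v homogD(1)[OF ph] homogD(1)[OF homog_linear_power[OF q, of e]]] px qx by simp
qed

text \<open>Equations of different degrees are brought to one degree by powers of \<open>q\<close>,
  which leaves their differentials at \<open>x\<close> unchanged.\<close>

lemma eqs_lincomb:
 assumes "l:eqs" "m:eqs" shows "(%v. l v + c * m v):eqs"
proof -
 obtain d p where p: "p:vid V Z d" "ALL v:V. l v=dd p v x" using assms(1) unfolding eqs_def by (elim CollectE exE bexE)
 obtain e r where r: "r:vid V Z e" "ALL v:V. m v=dd r v x" using assms(2) unfolding eqs_def by (elim CollectE exE bexE)
 let ?p = "%v. p v * q v ^ e" and ?r = "%v. r v * q v ^ d"
 have P: "?p:vid V Z (d + e)" and R: "?r:vid V Z (d + e)"
  using vid_raise_degree(1)[OF p(1) xV, of e] vid_raise_degree(1)[OF r(1) xV, of d] by (simp_all add: add.commute)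
 have Pp: "?p : pfuns V" and Rp: "?r : pfuns V"
  using P R by (simp_all add: vid_def homog_polys_def)
 have "(%v. ?p v + c * ?r v):vid V Z (d + e)"
 proof -
  have "?p:homog V (d + e)" "?r:homog V (d + e)" using P R by (simp_all only: vid_def mem_Collect_eq)
  then have "(%v. ?p v + c * ?r v):homog V (d + e)" by (intro homog_add homog_cmult)
  moreover have "?p v + c * ?r v=0" if "v:acone V Z" for v
  proof -
   have "?p v=0" "?r v=0" using P R that unfolding vid_def by blast+
   then show ?thesis by (simp only:) simp
  qed
  ultimately show ?thesis unfolding vid_def by simp
 qed
 moreover have "l v + c * m v=dd (%v. ?p v + c * ?r v) v x" if v: "v:V" for v
  using p(2) r(2) v dd_add[OF V xV v Pp poly_funs_cmult[OF Rp]] dd_cmult[OF V xV v Rp]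
   vid_raise_degree(2)[OF p(1) v] vid_raise_degree(2)[OF r(1) v] by simp
 ultimately show ?thesis
  unfolding eqs_def by (intro CollectI exI[of _ "d + e"] bexI[of _ "%v. ?p v + c * ?r v"]) simp_all
qed

lemma eqs_dual_system:
 "EX I e. dual_system V eqs I e&(ALL v:V. ALL l:eqs. l (v - (SUM i:I. e i v *. i))=0)"
proof (rule dual_system_exists[OF fdV eqs_linear eqs_lincomb])
 fix I e assume I: "dual_system V eqs I e"
  and red: "!!v l. v:V==>l:eqs==>l (v - (SUM i:I. e i v *. i))=0"
 show ?thesis by (intro exI[of _ I] exI[of _ e] conjI ballI I red)
qed

lemma linear_eq_of_tcone:
 assumes l: "lin V l" and K: "!!v. v:tcone V Z x==>l v=0"
 shows "EX d. EX p:vid V Z d. ALL v:V. dd p v x=l v"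
proof -
 obtain I e where I: "dual_system V eqs I e" and red': "ALL v:V. ALL l:eqs. l (v - (SUM i:I. e i v *. i))=0"
  using eqs_dual_system by (elim exE conjE)
 note red = red'[rule_format]
 have fin: "finite I" and IV: "I \<subseteq> V" and eE: "!!i. i:I==>e i:eqs" using I by (auto simp: dual_system_def)
 have zero: "(%_. 0):eqs" unfolding eqs_def
  by (intro CollectI exI[of _ 0] bexI[of _ "%_. 0"]) (simp_all add: dd_const vid_def homog_const)
 have sums: "(%v. SUM i:J. c i * e i v):eqs" if "finite J" "J \<subseteq> I" for J c
  using that
 proof (induction J rule: finite_induct)
  case (insert j J)
  then show ?case using eqs_lincomb[of "%v. SUM i:J. c i * e i v" "e j" "c j"] eE[of j] by (simp add: add.commute)
 qed (simp add: zero)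
 have "l v=(SUM i:I. l i * e i v)" if v: "v:V" for v
 proof -
  have sV: "(SUM i:I. e i v *. i):V" using IV by (intro sub_sum[OF V] sub_scale[OF V]) blast
  have "l (v - (SUM i:I. e i v *. i))=0"
   by (rule K) (simp add: tcone_eqs bspec[OF red' v] sub_diff[OF V v sV])
  then have "l v=l (SUM i:I. e i v *. i)" using lin_diff[OF V l v sV] by simp
  also have "\<dots>=(SUM i:I. e i v *. l i)" using IV by (intro lin_lincomb[OF V l]) blast
  finally show ?thesis by (simp add: mult.commute)
 qed
 moreover obtain d p where "p:vid V Z d" "ALL v:V. (SUM i:I. l i * e i v)=dd p v x"
  using sums[OF fin subset_refl, of l] unfolding eqs_def by (elim CollectE exE bexE)
 ultimately show ?thesis by (intro exI[of _ d] bexI[of _ p]) simp_all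
qed

text \<open>A dual system of differentials at \<open>x\<close> cuts out the tangent cone there.
  Differentials of the same equations remain injective on \<open>cspan I\<close> where
  \<open>g\<close> is nonzero, so the tangent cone at such a point meets \<open>cspan I\<close> in 0
  and cannot be larger.\<close>

lemma tcone_semicontinuous:
 "EX e. EX g:homog V e. g x~=0&(ALL z:acone V Z. g z~=0-->cdim (tcone V Z z)<=cdim (tcone V Z x))"
proof -
 obtain I e where I: "dual_system V eqs I e" and red': "ALL v:V. ALL l:eqs. l (v - (SUM i:I. e i v *. i))=0"
  using eqs_dual_system by (elim exE conjE)
 note red = red'[rule_format]
 have card: "card I + cdim (tcone V Z x)=cdim V"
  unfolding tcone_eqs
 proof (rule dual_system_dim[of V eqs I e])
  show "l (v - (SUM i:I. e i v *. i))=0" if "v:V" "l:eqs" for v l using that by (rule red)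
 qed (fact fdV, erule eqs_linear, fact I)
 have ind: "\<not> cdependent I" by (rule dual_system_independent[OF V I eqs_linear])
 have fin: "finite I" and IV: "I \<subseteq> V" and eE: "!!i. i:I==>e i:eqs"
  and del: "!!i j. i:I==>j:I==>e i j=(if i=j then 1 else 0)"
  using I by (auto simp: dual_system_def)
 have "ALL i:I. EX dp. snd dp:vid V Z (fst dp)&(ALL v:V. e i v=dd (snd dp) v x)"
 proof
  fix i assume "i:I"
  then have "e i:eqs" by (rule eE)
  then obtain d p where "p:vid V Z d" "ALL v:V. e i v=dd p v x"
   unfolding eqs_def by (elim CollectE exE bexE)
  then show "EX dp. snd dp:vid V Z (fst dp)&(ALL v:V. e i v=dd (snd dp) v x)" by (intro exI[of _ "(d, p)"]) simp
 qed
 then obtain dp where dp: "ALL i:I. snd (dp i):vid V Z (fst (dp i))&(ALL v:V. e i v=dd (snd (dp i)) v x)"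
  by (rule bchoice[THEN exE])
 define d where "d i=fst (dp i)" for i
 define p where "p i = snd (dp i)" for i
 have p: "p i:vid V Z (d i)" "!!v. v:V==>e i v=dd (p i) v x" if "i:I" for i
  using dp that by (simp_all add: p_def d_def)
 have ph: "p i:homog V (d i)" if "i:I" for i using p(1)[OF that] by (simp add: vid_def)
 have "EX k. EX g:homog V k. g x=1 &
  (ALL y h. g y~=0-->(ALL i:I. (SUM j:I. dd (p i) j y * h j)=0)-->(ALL j:I. h j=0))"
 proof (rule nonsingular_locus[of I "homog V" "%i j. dd (p i) j" "%i. d i - 1" x])
  show "dd (p i) j:homog V (d i - 1)" if "i:I" "j:I" for i j
   using dd_homog[OF V ph[OF that(1)]] IV that(2) by blast
  show "dd (p i) j x=(if i=j then 1 else 0)" if "i:I" "j:I" for i j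
   using p(2)[OF that(1), of j] IV that(2) del[OF that] by auto
 qed (auto intro: homog_mult homog_diff homog_const fin)
 then obtain k g where g: "g:homog V k" "g x=1"
  and inj': "ALL y h. g y~=0-->(ALL i:I. (SUM j:I. dd (p i) j y * h j)=0)-->(ALL j:I. h j=0)"
  by (elim exE bexE conjE)
 note inj = inj'[THEN spec, THEN spec, THEN mp, THEN mp]
 have "cdim (tcone V Z z)<=cdim (tcone V Z x)" if z: "z:acone V Z" and gz: "g z~=0" for z
 proof -
  obtain q' where "proj_point V Z z q'" using proj_point_exists[OF fdV ZP z] by (elim exE)
  then interpret z: proj_point V Z z q' .
  have "cspan I \<inter> tcone V Z z={0}"
  proof (intro equalityI subsetI)
   fix v assume v: "v:cspan I \<inter> tcone V Z z"
   obtain h where h: "v=(SUM j:I. h j *. j)" using v unfolding cvs.span_finite[OF fin] by auto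
   have "ALL i:I. (SUM j:I. dd (p i) j z * h j)=0"
   proof
    fix i assume i: "i:I"
    have "0=dd (p i) v z" using z.tconeD(2)[of v "p i" "d i"] v p(1)[OF i] by simp
    also have "\<dots>=(SUM j:I. h j *. dd (p i) j z)"
     unfolding h using IV by (intro lin_lincomb[OF V dd_linear_dir[OF V homogD(1)[OF ph[OF i]] z.xV]]) blast
    finally show "(SUM j:I. dd (p i) j z * h j)=0" by (simp add: mult.commute)
   qed
   from inj[OF gz this] show "v:{0}" unfolding h by simp
  next
   fix v :: 'v assume "v:{0}"
   then show "v:cspan I \<inter> tcone V Z z" using sub_0[OF z.tcone_csubspace] cvs.span_zero by simp
  qed
  then have "cdim (cspan I) + cdim (tcone V Z z)<=cdim V"
   using z.tconeD(1) cvs.span_minimal[OF IV V]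
   by (intro direct_sum_dim(1)[OF fdV cvs.subspace_span _ z.tcone_csubspace]) auto
  then show ?thesis using card by (simp add: cvs.dim_eq_card_independent[OF ind])
 qed
 then show ?thesis using g by (intro exI[of _ k] bexI[of _ g]) simp_all
qed

end

section \<open>Closures of polynomial graphs\<close>

lemma dd_lincomb:
 assumes V: "csubspace V" and x: "x:V" "v:V" and p: "!!i. i:I ==> p i : pfuns V"
 shows "dd (%y. SUM i:I. c i * p i y) v x=(SUM i:I. c i * dd (p i) v x)"
 using p
proof (induction I rule: infinite_finite_induct)
 case (insert i I)
 have "dd (%y. c i * p i y + (SUM i:I. c i * p i y)) v x=dd (%y. c i * p i y) v x + dd (%y. SUM i:I. c i * p i y) v x"
  using insert.prems by (intro dd_add[OF V x] poly_funs_cmult poly_funs_sum) auto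
 then show ?case using insert by (simp add: dd_cmult[OF V x])
qed (simp_all add: dd_const)

lemma lin_eqI:
 assumes V: "finite_dim V" and uv: "u:V" "v:V" and eq: "!!l :: 'a::complex_vector=>complex. lin V l==>l u=l v"
 shows "u=v"
proof -
 have "coord V b u=coord V b v" for b by (rule eq[OF coord_linear[OF fd_sub[OF V]]])
 then have "(SUM b:vbasis V. coord V b u *. b)=(SUM b:vbasis V. coord V b v *. b)" by simp
 then show ?thesis unfolding coord_expand[OF V uv(1)] coord_expand[OF V uv(2)] .
qed

text \<open>The linear left inverse \<open>\<pi>\<close> makes the image of \<open>nvq\<close> a
  graph over \<open>W\<close>, cut out in the chart \<open>q = 1\<close> by the equations
  \<open>v = nvq (\<pi> v)\<close>. All geometry of its closure near the graph comes from
  them.\<close>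

locale graph_chart =
 fixes V :: "'v::complex_vector set" and W :: "'w::complex_vector set"
  and nvq :: "'w=>'v" and q :: "'v=>complex" and \<pi> :: "'v=>'w"
 assumes fdV: "finite_dim V" and fdW: "finite_dim W"
  and nvqV: "w:W==>nvq w:V"
  and nvq_poly: "lin V l==>(%w. l (nvq w)) : pfuns W"
  and q: "lin V q" and qnvq: "w:W==>q (nvq w)=1"
  and \<pi>: "lin V \<pi>" and \<pi>W: "v:V==>\<pi> v:W" and \<pi>nvq: "w:W==>\<pi> (nvq w)=w"
begin

definition Z :: "'v set set"
 where "Z=zariski V closure_of ((%w. cspan {nvq w}) ` W)"

lemma V: "csubspace V" using fdV by (rule fd_sub)
lemma W: "csubspace W" using fdW by (rule fd_sub)

lemma nvq_nz: "w:W==>nvq w~=0"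
 using qnvq[of w] lin_0[OF V q] by auto

lemma comp_nvq: "p : pfuns V==>(%w. p (nvq w)) : pfuns W"
 by (rule poly_funs_comp[OF _ nvq_poly])

lemma Z_closed: "closedin (zariski V) Z"
 unfolding Z_def by (rule closedin_closure_of)

lemma Z_proj: "Z \<subseteq> proj V"
 by (rule closed_subset_proj[OF Z_closed])

lemma nvq_Z: "w:W==>cspan {nvq w}:Z"
proof -
 assume w: "w:W"
 have "(%w. cspan {nvq w}) ` W \<subseteq> topspace (zariski V)"
  unfolding topspace_zariski using span1_proj[OF nvqV nvq_nz] by auto
 then have "(%w. cspan {nvq w}) ` W \<subseteq> Z" unfolding Z_def by (rule closure_of_subset)
 then show ?thesis using w by (simp add: image_subset_iff)
qed

lemma nvq_cone: "w:W==>nvq w:acone V Z"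
 by (simp add: acone_def nvqV nvq_nz nvq_Z)

text \<open>Density of the graph in its closure, in the form in which it is used for the ideal and
  for semicontinuity.\<close>

lemma cone_nz:
 assumes p: "p:homog V d" and v: "v:acone V Z" "p v~=0"
 shows "EX w:W. p (nvq w)~=0"
proof -
 have "cspan {v}:zariski V closure_of ((%w. cspan {nvq w}) ` W)" using coneD(3)[OF v(1)] by (simp add: Z_def)
 moreover have "cspan {v}:basic_open V p" using basic_span1[OF p coneD(1,2)[OF v(1)]] v(2) by simp
 ultimately have "EX M:(%w. cspan {nvq w}) ` W. M:basic_open V p" unfolding in_closure_zariski using p by blast
 then obtain w where "w:W" "cspan {nvq w}:basic_open V p" by (elim bexE imageE) simp
 then show ?thesis using basic_span1[OF p nvqV nvq_nz] by (intro bexI[of _ w]) simp_all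
qed

lemma vid_iff: "p:vid V Z d \<longleftrightarrow> p:homog V d&(ALL w:W. p (nvq w)=0)"
proof
 show "p:homog V d&(ALL w:W. p (nvq w)=0)" if "p:vid V Z d"
  using that nvq_cone by (simp add: vid_def)
 show "p:vid V Z d" if "p:homog V d&(ALL w:W. p (nvq w)=0)"
  unfolding vid_def using that cone_nz[of p d] by auto
qed

lemma homogenize_chart:
 assumes "f : pfuns W"
 shows "EX d0. ALL d>=d0. EX H:homog V d. ALL v:V. q v~=0-->H v=q v ^ d * f (\<pi> (inverse (q v) *. v))"
proof -
 have "(%v. f (\<pi> v)) : pfuns V"
 proof (rule poly_funs_comp[OF assms])
  fix l :: "'w=>complex" assume "lin W l"
  then show "(%v. l (\<pi> v)) : pfuns V" using \<pi>W by (intro poly_funs.linear lin_comp[OF \<pi>]) auto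
 qed
 from homogenize[OF V q this] show ?thesis .
qed

lemma graph_equation:
 assumes l: "lin V l"
 shows "EX d. EX H:vid V Z d. ALL v:V. q v~=0-->H v=q v ^ d * (l (inverse (q v) *. v) - l (nvq (\<pi> (inverse (q v) *. v))))"
proof -
 have "(%v. l v - l (nvq (\<pi> v))) : pfuns V"
 proof (rule poly_funs_diff[OF poly_funs.linear[OF l]])
  show "(%v. l (nvq (\<pi> v))) : pfuns V"
  proof (rule poly_funs_comp[OF nvq_poly[OF l]])
   fix m :: "'w=>complex" assume "lin W m"
   then show "(%v. m (\<pi> v)) : pfuns V" using \<pi>W by (intro poly_funs.linear lin_comp[OF \<pi>]) auto
  qed
 qed
 from homogenize[OF V q this] obtain d where
  "EX H:homog V d. ALL v:V. q v~=0-->H v=q v ^ d * (l (inverse (q v) *. v) - l (nvq (\<pi> (inverse (q v) *. v))))"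
  by (elim exE) (meson order_refl)
 then obtain H where H: "H:homog V d"
  "ALL v:V. q v~=0-->H v=q v ^ d * (l (inverse (q v) *. v) - l (nvq (\<pi> (inverse (q v) *. v))))" by (elim bexE)
 have "H (nvq w)=0" if "w:W" for w
  using H(2)[rule_format, OF nvqV[OF that]] qnvq[OF that] \<pi>nvq[OF that] by (simp add: scaleC_one)
 then have "H:vid V Z d" using H(1) by (simp add: vid_iff)
 then show ?thesis using H(2) by (intro exI[of _ d] bexI[of _ H])
qed

text \<open>All homogenized graph equations vanish on \<open>Z\<close>, and functionals separate
  points: inside the chart the closure adds nothing to the graph.\<close>

lemma chart_point:
 assumes v: "v:acone V Z" "q v~=0"
 shows "inverse (q v) *. v=nvq (\<pi> (inverse (q v) *. v))"
proof (rule lin_eqI[OF fdV])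
 have vV: "v:V" using v(1) by (rule coneD)
 show "inverse (q v) *. v:V" using vV by (rule sub_scale[OF V])
 then show "nvq (\<pi> (inverse (q v) *. v)):V" by (intro nvqV \<pi>W)
 fix l :: "'v=>complex" assume l: "lin V l"
 obtain d H where H: "H:vid V Z d"
  "ALL v:V. q v~=0-->H v=q v ^ d * (l (inverse (q v) *. v) - l (nvq (\<pi> (inverse (q v) *. v))))"
  using graph_equation[OF l] by (elim exE bexE)
 have "H v=0" using H(1) v(1) by (simp add: vid_def)
 then show "l (inverse (q v) *. v)=l (nvq (\<pi> (inverse (q v) *. v)))" using H(2)[rule_format, OF vV v(2)] v(2) by simp
qed

definition orbit :: "'v set set"
 where "orbit=(%w. cspan {nvq w}) ` W"

lemma orbit_eq: "orbit=Z \<inter> basic_open V q"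
proof (intro equalityI subsetI)
 fix L assume "L : orbit"
 then obtain w where w: "w:W" "L=cspan {nvq w}" unfolding orbit_def by (elim imageE)
 then show "L:Z \<inter> basic_open V q"
  using nvq_Z[OF w(1)] basic_span1[OF homog_linear[OF q] nvqV[OF w(1)] nvq_nz[OF w(1)]] qnvq[OF w(1)] by simp
next
 fix L assume L: "L:Z \<inter> basic_open V q"
 then obtain v where v: "v:acone V Z" "L=cspan {v}" using cone_rep[OF Z_proj, of L] by (elim IntE) blast
 then have qv: "q v~=0" using L basic_span1[OF homog_linear[OF q] coneD(1,2)[OF v(1)]] by simp
 then have "L=cspan {inverse (q v) *. v}" using v(2) by (simp add: span1_scale)
 also have "\<dots>=cspan {nvq (\<pi> (inverse (q v) *. v))}" using chart_point[OF v(1) qv] by simp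
 finally show "L : orbit" unfolding orbit_def using \<pi>W sub_scale[OF V coneD(1)[OF v(1)]] by blast
qed

lemma orbit_open: "openin (zariski_on V Z) orbit"
 unfolding orbit_eq by (rule openin_on_basic[OF homog_linear[OF q]])

lemma orbit_proj: "orbit \<subseteq> proj V"
 using orbit_eq Z_proj by blast

text \<open>By \<open>vid_iff\<close> the ideal of \<open>Z\<close> is the kernel of the pullback to
  polynomials on \<open>W\<close>, and these have no zero divisors.\<close>

lemma Z_variety: "proj_variety V Z"
proof (rule proj_varietyI[OF V Z_closed])
 show "Z~={}" using nvq_Z[OF sub_0[OF W]] by blast
 fix p r :: "'v=>complex" and d e u v
 assume p: "p:homog V d" and r: "r:homog V e" and z: "!!v. v:acone V Z ==> p v * r v=0"
  and u: "u:acone V Z" "p u~=0" and v: "v:acone V Z"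
 obtain w where w: "w:W" "p (nvq w)~=0" using cone_nz[OF p u] by (elim bexE)
 have "r (nvq y)=0" if "y:W" for y
  by (rule poly_funs_no_zero_divisors[OF W comp_nvq[OF homogD(1)[OF p]] comp_nvq[OF homogD(1)[OF r]] _ w that])
   (rule z[OF nvq_cone])
 then have "r:vid V Z e" using r by (simp add: vid_iff)
 then show "r v=0" using v by (simp add: vid_def)
qed

text \<open>The differential of \<open>nvq\<close> at \<open>u\<close>, assembled from coordinate
  functions because \<open>V\<close> carries no topology of its own.\<close>

definition dnu :: "'w=>'w=>'v"
 where "dnu u w=(SUM b:vbasis V. dd (%w. coord V b (nvq w)) w u *. b)"

context
 fixes u assumes u: "u:W"
begin

lemma dnu_V: "dnu u w:V"
 unfolding dnu_def using vbasis(1)[of V] by (intro sub_sum[OF V] sub_scale[OF V]) blast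

lemma dnu_functional:
 assumes l: "lin V l" and w: "w:W"
 shows "l (dnu u w)=dd (%w. l (nvq w)) w u"
proof -
 have "l (dnu u w)=(SUM b:vbasis V. dd (%w. coord V b (nvq w)) w u *. l b)"
  unfolding dnu_def using vbasis(1)[of V] by (intro lin_lincomb[OF V l]) blast
 also have "\<dots>=dd (%w. SUM b:vbasis V. l b * coord V b (nvq w)) w u"
  by (subst dd_lincomb[OF W u w]) (simp_all add: nvq_poly coord_linear[OF V] mult.commute)
 also have "\<dots>=dd (%w. l (nvq w)) w u"
 proof (rule dd_cong[OF W u w])
  show "(SUM b:vbasis V. l b * coord V b (nvq y))=l (nvq y)" if "y:W" for y
   using lin_expand[OF fdV l nvqV[OF that]] by (simp add: mult.commute)
 qed
 finally show ?thesis .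
qed

lemma nvq_curve:
 assumes p: "p : pfuns V" and w: "w:W"
 shows "((%s. p (nvq (u + s *. w))) has_field_derivative dd p (dnu u w) (nvq u)) (at 0)"
proof (rule dd_curve[OF V p nvqV[OF u] dnu_V])
 fix l :: "'v=>complex" assume l: "lin V l"
 show "((%s. l (nvq (u + s *. w))) has_field_derivative l (dnu u w)) (at 0)"
  unfolding dnu_functional[OF l w] by (rule dd_line[OF W nvq_poly[OF l] u w])
qed simp

lemma dd_dnu:
 assumes p: "p : pfuns V" and w: "w:W"
 shows "dd p (dnu u w) (nvq u)=dd (%w. p (nvq w)) w u"
 by (rule dd_eqI[symmetric]) (rule nvq_curve[OF p w])

lemma q_dnu: "w:W==>q (dnu u w)=0"
proof -
 assume w: "w:W"
 have "q (dnu u w)=dd (%w. q (nvq w)) w u" by (rule dnu_functional[OF q w])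
 also have "\<dots>=dd (%w. 1) w u" by (rule dd_cong[OF W u w]) (rule qnvq)
 finally show ?thesis by (simp add: dd_const)
qed

lemma \<pi>_dnu: "w:W==>\<pi> (dnu u w)=w"
proof (rule lin_eqI[OF fdW])
 assume w: "w:W"
 then show "w:W" "\<pi> (dnu u w):W" using \<pi>W[OF dnu_V] by simp_all
 fix m :: "'w=>complex" assume m: "lin W m"
 have mp: "lin V (%v. m (\<pi> v))" using \<pi>W by (intro lin_comp[OF \<pi> m]) auto
 have "m (\<pi> (dnu u w))=dd (%w. m (\<pi> (nvq w))) w u" by (rule dnu_functional[OF mp w])
 also have "\<dots>=dd m w u" by (rule dd_cong[OF W u w]) (simp add: \<pi>nvq)
 finally show "m (\<pi> (dnu u w))=m w" by (simp add: dd_linear[OF W u w m])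
qed

lemma dnu_linear: "lin W (dnu u)"
proof (rule clinear_onI)
 fix x y c assume x: "x:W"
 have cx: "c *. x:W" using x by (rule sub_scale[OF W])
 note dl = dd_linear_dir[OF W nvq_poly u]
 show "dnu u (c *. x)=c *. dnu u x"
 proof (rule lin_eqI[OF fdV dnu_V sub_scale[OF V dnu_V]])
  fix l :: "'v=>complex" assume l: "lin V l"
  show "l (dnu u (c *. x))=l (c *. dnu u x)"
   using lin_scale[OF dl[OF l] x, of c] lin_scale[OF l dnu_V, of c x]
   by (simp add: dnu_functional[OF l cx] dnu_functional[OF l x])
 qed
 assume y: "y:W"
 have xy: "x + y:W" using x y by (rule sub_add[OF W])
 show "dnu u (x + y)=dnu u x + dnu u y"
 proof (rule lin_eqI[OF fdV dnu_V sub_add[OF V dnu_V dnu_V]])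
  fix l :: "'v=>complex" assume l: "lin V l"
  show "l (dnu u (x + y))=l (dnu u x + dnu u y)"
   using lin_add[OF dl[OF l] x y] lin_add[OF l dnu_V dnu_V, of x y]
   by (simp add: dnu_functional[OF l xy] dnu_functional[OF l x] dnu_functional[OF l y])
 qed
qed

lemma chart_proj_point: "proj_point V Z (nvq u) q"
 by (simp add: proj_point_def fdV Z_proj nvq_cone[OF u] q qnvq[OF u])

text \<open>The curves \<open>nvq (u + s *. w)\<close> stay on \<open>Z\<close>, so their velocities
  satisfy the differentiated equations. Conversely, differentiating the graph equations along
  \<open>v\<close> gives \<open>v = dnu u (\<pi> v)\<close>.\<close>

lemma tangent_cone_chart: "{v:tcone V Z (nvq u). q v=0}=dnu u ` W"
proof (intro equalityI subsetI)
 fix v assume "v:dnu u ` W"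
 then obtain w where w: "w:W" "v=dnu u w" by (elim imageE)
 have "dd p (dnu u w) (nvq u)=0" if p: "p:vid V Z d" for p d
 proof -
  have "p : pfuns V" using p by (simp add: vid_def homog_polys_def)
  then have "dd p (dnu u w) (nvq u)=dd (%w. p (nvq w)) w u" by (rule dd_dnu[OF _ w(1)])
  also have "\<dots>=dd (%w. 0) w u" by (rule dd_cong[OF W u w(1)]) (use p in \<open>simp add: vid_iff\<close>)
  finally show ?thesis by (simp add: dd_const)
 qed
 then show "v:{v:tcone V Z (nvq u). q v=0}" using dnu_V q_dnu[OF w(1)] by (simp add: tcone_def w(2))
next
 fix v assume v: "v:{v:tcone V Z (nvq u). q v=0}"
 then have vV: "v:V" by (simp add: tcone_def)
 have "v=dnu u (\<pi> v)"
 proof (rule lin_eqI[OF fdV vV dnu_V])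
  fix l :: "'v=>complex" assume l: "lin V l"
  obtain d H where H: "H:vid V Z d"
   "ALL v:V. q v~=0-->H v=q v ^ d * (l (inverse (q v) *. v) - l (nvq (\<pi> (inverse (q v) *. v))))"
   using graph_equation[OF l] by (elim exE bexE)
  have sv: "s *. v:V" for s by (rule sub_scale[OF V vV])
  have in_V: "nvq u + s *. v:V" for s by (rule sub_add[OF V nvqV[OF u] sv])
  have qs: "q (nvq u + s *. v)=1" for s
   using lin_add[OF q nvqV[OF u] sv] lin_scale[OF q vV] v qnvq[OF u] by simp
  have ps: "\<pi> (nvq u + s *. v)=u + s *. \<pi> v" for s
   using lin_add[OF \<pi> nvqV[OF u] sv] lin_scale[OF \<pi> vV] \<pi>nvq[OF u] by simp
  have "H (nvq u + s *. v)=l (nvq u + s *. v) - l (nvq (u + s *. \<pi> v))" for s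
   using H(2)[rule_format, OF in_V] qs ps by (simp add: scaleC_one)
  then have "((%s. H (nvq u + s *. v)) has_field_derivative dd l v (nvq u) - dd (%w. l (nvq w)) (\<pi> v) u) (at 0)"
   using DERIV_diff[OF dd_line[OF V poly_funs.linear[OF l] nvqV[OF u] vV] dd_line[OF W nvq_poly[OF l] u \<pi>W[OF vV]]] by simp
  then have "dd H v (nvq u)=l v - l (dnu u (\<pi> v))"
   by (simp add: dd_eqI dd_linear[OF V nvqV[OF u] vV l] dnu_functional[OF l \<pi>W[OF vV]])
  moreover have "dd H v (nvq u)=0" using v H(1) by (simp add: tcone_def)
  ultimately show "l v=l (dnu u (\<pi> v))" by simp
 qed
 then show "v:dnu u ` W" using \<pi>W[OF vV] by blast
qed

lemma dnu_iso: "lin_iso W {v:tcone V Z (nvq u). q v=0} (dnu u)"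
 unfolding lin_iso_def bij_betw_def tangent_cone_chart
 using dnu_linear by (auto intro!: inj_on_inverseI[of _ \<pi>] \<pi>_dnu)

lemma cdim_tcone_chart: "cdim (tcone V Z (nvq u))=cdim W + 1"
 using proj_point.cdim_tcone[OF chart_proj_point] proj_point.cdim_tangent(1)[OF chart_proj_point]
  lin_iso_cdim(2)[OF fdW dnu_iso] by simp

end

text \<open>All points of the graph have the same tangent dimension. For an arbitrary point
  \<open>y\<close> of \<open>Z\<close>, semicontinuity compares it with a point of the graph, since
  the graph meets every nonempty open set.\<close>

lemma chart_nonsingular:
 assumes u: "u:W" shows "nonsingular_point V Z (cspan {nvq u})"
 unfolding nonsingular_iff[OF fdV Z_proj nvq_cone[OF u]] cdim_tcone_chart[OF u]
proof
 fix y assume y: "y:acone V Z"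
 obtain q' where q': "proj_point V Z y q'" using proj_point_exists[OF fdV Z_proj y] by (elim exE)
 obtain e g where g: "g:homog V e" "g y~=0"
  "ALL z:acone V Z. g z~=0-->cdim (tcone V Z z)<=cdim (tcone V Z y)"
  using proj_point.tcone_semicontinuous[OF q'] by (elim exE bexE conjE)
 obtain w where w: "w:W" "g (nvq w)~=0" using cone_nz[OF g(1) y g(2)] by (elim bexE)
 show "cdim W + 1<=cdim (tcone V Z y)"
  using g(3)[rule_format, OF nvq_cone[OF w(1)] w(2)] cdim_tcone_chart[OF w(1)] by simp
qed

end

section \<open>The open orbit as an affine space\<close>

lemma openin_affine_zariski:
 "openin (affine_zariski W) U \<longleftrightarrow>
  U \<subseteq> W&(ALL w:U. EX p:pfuns W. p w~=0&{w:W. p w~=0} \<subseteq> U)"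
proof
 assume "openin (affine_zariski W) U"
 then have "generate_topology_on {{w:W. p w~=0} | p. p : pfuns W} U"
  by (simp add: affine_zariski_def openin_topology_generated_by_iff)
 then show "U \<subseteq> W&(ALL w:U. EX p:pfuns W. p w~=0&{w:W. p w~=0} \<subseteq> U)"
 proof induction
  case (Int A B)
  show ?case
  proof (intro conjI ballI)
   show "A \<inter> B \<subseteq> W" using Int.IH(1) by (auto simp: subset_iff)
   fix w assume w: "w:A \<inter> B"
   obtain p where p: "p : pfuns W" "p w~=0" "{w:W. p w~=0} \<subseteq> A" using Int.IH(1) w by (meson IntD1)
   obtain r where r: "r : pfuns W" "r w~=0" "{w:W. r w~=0} \<subseteq> B" using Int.IH(2) w by (meson IntD2)
   show "EX p:pfuns W. p w~=0&{w:W. p w~=0} \<subseteq> A \<inter> B"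
    by (rule bexI[OF _ poly_funs.mult[OF p(1) r(1)]]) (use p r in auto)
  qed
 next
  case (UN K)
  show ?case
  proof (intro conjI ballI)
   show "\<Union>K \<subseteq> W" using UN.IH by (meson Union_least)
   fix w assume "w:\<Union>K"
   then obtain A where A: "A:K" "w:A" by (rule UnionE)
   obtain p where p: "p : pfuns W" "p w~=0" "{w:W. p w~=0} \<subseteq> A" using UN.IH[OF A(1)] A(2) by meson
   show "EX p:pfuns W. p w~=0&{w:W. p w~=0} \<subseteq> \<Union>K"
    by (rule bexI[OF _ p(1)]) (use p A in auto)
  qed
 next
  case (Basis s)
  then obtain p where p: "p : pfuns W" "s={w:W. p w~=0}" by (elim CollectE exE conjE)
  then show ?case by (auto intro!: bexI[of _ p])
 qed simp
next
 assume *: "U \<subseteq> W&(ALL w:U. EX p:pfuns W. p w~=0&{w:W. p w~=0} \<subseteq> U)"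
 let ?T = "\<Union>{{w:W. p w~=0} | p. p : pfuns W&{w:W. p w~=0} \<subseteq> U}"
 have "w:?T" if w: "w:U" for w
 proof -
  obtain p where p: "p : pfuns W" "p w~=0" "{w:W. p w~=0} \<subseteq> U" using * w by meson
  then show ?thesis using * w by (intro UnionI[of "{w:W. p w~=0}"] CollectI exI[of _ p]) auto
 qed
 then have "U=?T" by (intro equalityI subsetI) (assumption | (elim UnionE CollectE exE conjE, simp add: subset_iff))+
 moreover have "openin (affine_zariski W) ?T"
  unfolding affine_zariski_def by (rule openin_Union) (auto intro!: topology_generated_by_Basis)
 ultimately show "openin (affine_zariski W) U" by simp
qed

lemma topspace_affine_zariski: "topspace (affine_zariski W)=W"
proof
 show "topspace (affine_zariski W) \<subseteq> W"
  using openin_topspace[of "affine_zariski W"] openin_affine_zariski[of W "topspace (affine_zariski W)"] by simp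
 have "openin (affine_zariski W) W" unfolding openin_affine_zariski
  using poly_funs.const[of 1 W] by (auto intro!: bexI[of _ "%_. 1"])
 then show "W \<subseteq> topspace (affine_zariski W)" by (rule openin_subset)
qed

context graph_chart
begin

lemma orbit_point_eq:
 assumes w: "w:W" "u:W" and v: "v:cspan {nvq w}" "v:cspan {nvq u}" "v~=0"
 shows "w=u"
proof -
 have "cspan {nvq w}=cspan {nvq u}" using span1_eq[OF v(1,3)] span1_eq[OF v(2,3)] by simp
 then have "nvq w:cspan {nvq u}" using span1_self[of "nvq w"] by simp
 then obtain c where c: "nvq w=c *. nvq u" unfolding mem_span1 by (elim exE)
 have "q (nvq w)=c * q (nvq u)" unfolding c using lin_scale[OF q nvqV[OF w(2)]] by simp
 then have "c=1" using qnvq w by simp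
 then have "nvq w=nvq u" using c by (simp add: scaleC_one)
 then have "\<pi> (nvq w)=\<pi> (nvq u)" by (rule arg_cong)
 then show ?thesis unfolding \<pi>nvq[OF w(1)] \<pi>nvq[OF w(2)] .
qed

lemma homogenize_value:
 assumes H: "H:homog V d" "ALL v:V. q v~=0-->H v=q v ^ d * f (\<pi> (inverse (q v) *. v))" and w: "w:W"
 shows "H (nvq w)=f w"
 using H(2)[rule_format, OF nvqV[OF w]] qnvq[OF w] \<pi>nvq[OF w] by (simp add: scaleC_one)

text \<open>Polynomials on \<open>V\<close> are pulled back along \<open>nvq\<close>. In the other
  direction a polynomial on \<open>W\<close> is composed with \<open>\<pi>\<close> and homogenized
  by powers of \<open>q\<close>; \<open>homogenize_value\<close> recovers it because
  \<open>q\<close> is 1 on the graph.\<close>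

lemma chart_biregular:
 "biregular (affine_zariski W) (affine_regular_funs W) (zariski_on V orbit) (regular_funs V) (%w. cspan {nvq w})"
 unfolding biregular_def homeomorphic_map_def quotient_map_def topspace_affine_zariski
proof (intro conjI allI impI)
 let ?f = "%w. cspan {nvq w}"
 have ts: "topspace (zariski_on V orbit) = orbit" using orbit_proj by (simp add: topspace_zariski inf.absorb2)
 show "?f ` W=topspace (zariski_on V orbit)" unfolding ts by (rule orbit_def[symmetric])
 show "inj_on ?f W"
 proof (rule inj_onI)
  fix w u assume wu: "w:W" "u:W" "?f w=?f u"
  then have "nvq w:cspan {nvq u}" using span1_self[of "nvq w"] by simp
  then show "w=u" by (rule orbit_point_eq[OF wu(1,2) span1_self _ nvq_nz[OF wu(1)]])
 qed
 have op: "?f w:basic_open V p \<longleftrightarrow> p (nvq w)~=0" if "p:homog V d" "w:W" for p d w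
  by (rule basic_span1[OF that(1) nvqV[OF that(2)] nvq_nz[OF that(2)]])
 show "openin (affine_zariski W) {w:W. ?f w:U} = openin (zariski_on V orbit) U"
  if "U \<subseteq> topspace (zariski_on V orbit)" for U
 proof -
  have UO: "U \<subseteq> orbit" using that unfolding ts .
  show ?thesis
   unfolding openin_zariski_on[OF orbit_proj] openin_affine_zariski
  proof (intro iffI conjI ballI UO)
   fix w assume *: "U \<subseteq> orbit&(ALL L:U. znbhd V orbit L U)" and w: "w:{w:W. ?f w:U}"
   obtain d p where p: "p:homog V d" "?f w:basic_open V p" "orbit \<inter> basic_open V p \<subseteq> U"
    using * w by (elim conjE CollectE) (erule (1) znbhd_ballE)
   show "EX p:pfuns W. p w~=0&{w:W. p w~=0} \<subseteq> {w:W. ?f w:U}"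
   proof (rule bexI[OF _ comp_nvq[OF homogD(1)[OF p(1)]]], intro conjI subsetI)
    show "p (nvq w)~=0" using op[OF p(1)] p(2) w by simp
    fix y assume "y:{w:W. p (nvq w)~=0}"
    then show "y:{w:W. ?f w:U}" using op[OF p(1), of y] p(3) by (auto simp: orbit_def)
   qed
  next
   fix L assume *: "{w:W. ?f w:U} \<subseteq> W &
    (ALL w:{w:W. ?f w:U}. EX p:pfuns W. p w~=0&{w:W. p w~=0} \<subseteq> {w:W. ?f w:U})" and L: "L:U"
   obtain w where w: "w:W" "L=?f w" using L UO unfolding orbit_def by blast
   then have "w:{w:W. ?f w:U}" using L by simp
   from *[THEN conjunct2, rule_format, OF this]
   obtain p where p: "p : pfuns W" "p w~=0" "{w:W. p w~=0} \<subseteq> {w:W. ?f w:U}" by (elim bexE conjE)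
   obtain d H where H: "H:homog V d" "ALL v:V. q v~=0-->H v=q v ^ d * p (\<pi> (inverse (q v) *. v))"
    using homogenize_chart[OF p(1)] by (elim exE) (meson order_refl)
   show "znbhd V orbit L U"
   proof (rule znbhdI[OF H(1)])
    show "L:basic_open V H" using op[OF H(1) w(1)] homogenize_value[OF H w(1)] p(2) w(2) by simp
    show "orbit \<inter> basic_open V H \<subseteq> U"
    proof
     fix M assume M: "M : orbit \<inter> basic_open V H"
     then obtain y where y: "y:W" "M=?f y" unfolding orbit_def by (elim IntE imageE)
     then have "p y~=0" using M op[OF H(1) y(1)] homogenize_value[OF H y(1)] by simp
     then show "M:U" using p(3) y by blast
    qed
   qed
  qed auto
 qed
 fix U h assume "openin (zariski_on V orbit) U"
 then have UO: "U \<subseteq> orbit" unfolding openin_zariski_on[OF orbit_proj] by simp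
 show "(h:regular_funs V U)=(h \<circ> ?f:affine_regular_funs W {w:W. ?f w:U})"
 proof
  assume h: "h:regular_funs V U"
  show "h \<circ> ?f:affine_regular_funs W {w:W. ?f w:U}"
   unfolding affine_regular_funs_def
  proof (intro CollectI ballI)
   fix w assume w: "w:{w:W. ?f w:U}"
   then obtain d p r where pr: "p:homog V d" "r:homog V d" "?f w:basic_open V r"
    "ALL M:U \<inter> basic_open V r. ALL v:M - {0}. h M = p v / r v"
    using h unfolding regular_funs_def by (elim CollectE conjE) (drule (1) bspec, elim exE bexE conjE, rule)
   show "EX p:pfuns W. EX r:pfuns W. r w~=0&(ALL u:{w:W. ?f w:U}. r u~=0-->(h \<circ> ?f) u = p u / r u)"
   proof (rule bexI[OF _ comp_nvq[OF homogD(1)[OF pr(1)]]], rule bexI[OF _ comp_nvq[OF homogD(1)[OF pr(2)]]], intro conjI ballI impI)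
    show "r (nvq w)~=0" using op[OF pr(2)] pr(3) w by simp
    fix y assume y: "y:{w:W. ?f w:U}" "r (nvq y)~=0"
    then have "?f y:U \<inter> basic_open V r" using op[OF pr(2), of y] by simp
    moreover have "nvq y:?f y - {0}" using y(1) nvq_nz span1_self by simp
    ultimately show "(h \<circ> ?f) y = p (nvq y) / r (nvq y)" using pr(4) by simp
   qed
  qed
 next
  assume h: "h \<circ> ?f:affine_regular_funs W {w:W. ?f w:U}"
  show "h:regular_funs V U"
   unfolding regular_funs_def
  proof (intro CollectI ballI)
   fix L assume L: "L:U"
   then obtain w where w: "w:W" "L=?f w" using UO unfolding orbit_def by blast
   then have wU: "w:{w:W. ?f w:U}" using L by simp
   from bspec[OF CollectD[OF h[unfolded affine_regular_funs_def]] wU] obtain p r where pr: "p : pfuns W" "r : pfuns W" "r w~=0"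
    "ALL u:{w:W. ?f w:U}. r u~=0-->(h \<circ> ?f) u = p u / r u"
    by (elim bexE conjE)
   obtain d0 where d0: "ALL d>=d0. EX H:homog V d. ALL v:V. q v~=0-->H v=q v ^ d * p (\<pi> (inverse (q v) *. v))"
    using homogenize_chart[OF pr(1)] by (elim exE)
   obtain d1 where d1: "ALL d>=d1. EX H:homog V d. ALL v:V. q v~=0-->H v=q v ^ d * r (\<pi> (inverse (q v) *. v))"
    using homogenize_chart[OF pr(2)] by (elim exE)
   \<comment> \<open>Numerator and denominator need one common degree, which
     \<open>homogenize_chart\<close> supplies by covering all large degrees.\<close>
   let ?d = "d0 + d1"
   obtain P where P: "P:homog V ?d" "ALL v:V. q v~=0-->P v=q v ^ ?d * p (\<pi> (inverse (q v) *. v))"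
    using d0[rule_format, OF le_add1[of d0 d1]] by (elim bexE)
   obtain R where R: "R:homog V ?d" "ALL v:V. q v~=0-->R v=q v ^ ?d * r (\<pi> (inverse (q v) *. v))"
    using d1[rule_format, OF le_add2[of d1 d0]] by (elim bexE)
   show "EX d. EX p:homog V d. EX r:homog V d. L:basic_open V r &
    (ALL M:U \<inter> basic_open V r. ALL v:M - {0}. h M = p v / r v)"
   proof (rule exI[of _ ?d], rule bexI[OF _ P(1)], rule bexI[OF _ R(1)], intro conjI ballI)
    show "L:basic_open V R" using op[OF R(1) w(1)] homogenize_value[OF R w(1)] pr(3) w(2) by simp
    fix M v assume M: "M:U \<inter> basic_open V R" and v: "v:M - {0}"
    obtain y where y: "y:W" "M=?f y" using M UO unfolding orbit_def by blast
    have ry: "r y~=0" using M op[OF R(1) y(1)] homogenize_value[OF R y(1)] y(2) by simp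
    obtain c where c: "v=c *. nvq y" using v unfolding y(2) by (auto simp: mem_span1)
    then have "c~=0" using v by auto
    then have "P v / R v = p y / r y" unfolding c
     using homogD(2)[OF P(1) nvqV[OF y(1)], of c] homogD(2)[OF R(1) nvqV[OF y(1)], of c]
      homogenize_value[OF P y(1)] homogenize_value[OF R y(1)] by simp
    moreover have "h M = p y / r y" using pr(4) ry M y by simp
    ultimately show "h M=P v / R v" by simp
   qed
  qed
 qed
qed

end

section \<open>Expansions along lines\<close>

text \<open>Existence of this limit means vanishing to order \<open>k\<close>, and its value is the
  leading coefficient. Limits are stable under products and change of germ, so orders of vanishing
  on \<open>Z\<close> are measured this way.\<close>

lemma poly_limit_coeff:
 fixes P :: "complex poly"
 assumes "((%s. poly P s / s ^ k) \<longlongrightarrow> c) (at 0)"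
 shows "(ALL j<k. coeff P j=0)&coeff P k=c"
 using assms
proof (induction k arbitrary: P)
 case 0
 have "((%s. poly P s) \<longlongrightarrow> poly P 0) (at 0)" by (intro tendsto_intros)
 moreover have "((%s. poly P s) \<longlongrightarrow> c) (at 0)" using 0 by simp
 ultimately have "poly P 0=c" using LIM_unique by blast
 then show ?case by (simp add: poly_0_coeff_0)
next
 case (Suc k)
 have "((%s::complex. s ^ Suc k) \<longlongrightarrow> 0 ^ Suc k) (at 0)" by (intro tendsto_intros)
 from tendsto_mult[OF Suc.prems this]
 have "((%s. poly P s / s ^ Suc k * s ^ Suc k) \<longlongrightarrow> 0) (at 0)" by simp
 then have "((%s. poly P s) \<longlongrightarrow> 0) (at 0)"
  by (rule Lim_transform_eventually) (simp add: eventually_at_filter)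
 moreover have "((%s. poly P s) \<longlongrightarrow> poly P 0) (at 0)" by (intro tendsto_intros)
 ultimately have "poly P 0=0" using LIM_unique by blast
 then have c0: "coeff P 0=0" by (simp add: poly_0_coeff_0)
 obtain a Q where PQ: "P = pCons a Q" by (rule pCons_cases)
 have a: "a=0" using c0 PQ by simp
 have "((%s. poly Q s / s ^ k) \<longlongrightarrow> c) (at 0)"
  by (rule Lim_transform_eventually[OF Suc.prems]) (simp add: eventually_at_filter PQ a)
 from Suc.IH[OF this] show ?case
  by (auto simp: PQ a coeff_pCons split: nat.split)
qed

lemma poly_funs_shift:
 assumes W: "csubspace W" and p: "p : pfuns W" and u: "u:W"
 shows "(%w. p (u + w)) : pfuns W"
proof (rule poly_funs_comp[OF p])
 fix l :: "'a=>complex" assume l: "lin W l"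
 show "(%w. l (u + w)) : pfuns W"
  by (rule poly_funs_cong[OF W poly_funs.add[OF poly_funs.const[of "l u"] poly_funs.linear[OF l]]])
   (simp add: lin_add[OF l u])
qed

lemma line_expansion_limit:
 assumes W: "csubspace W" and phq: "!!j. phq j : sym_forms W j" and w: "w:W"
  and lim: "((%s. (SUM j<=N. phq j (replicate j (s *. w))) / s ^ k) \<longlongrightarrow> c) (at 0)"
 shows "(ALL j<k. j<=N-->phq j (replicate j w)=0)&(if k<=N then phq k (replicate k w) else 0)=c"
proof -
 define P where "P=(SUM j<=N. monom (phq j (replicate j w)) j)"
 have P: "poly P s=(SUM j<=N. phq j (replicate j (s *. w)))" for s
  by (simp add: P_def poly_sum poly_monom sym_form_scale[OF phq W w] mult.commute)
 have cf: "coeff P j=(if j<=N then phq j (replicate j w) else 0)" for j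
  by (simp add: P_def coeff_sum)
 have "((%s. poly P s / s ^ k) \<longlongrightarrow> c) (at 0)" using lim by (simp add: P)
 from poly_limit_coeff[OF this] show ?thesis by (auto simp: cf)
qed

lemma pullback_sym_forms:
 assumes W: "csubspace W" and h: "lin W h" "h ` W \<subseteq> T" and psq: "psq : sym_forms T k"
 shows "pullback_form W h psq : sym_forms W k"
 unfolding sym_forms_def
proof (intro CollectI conjI allI impI)
 show "pullback_form W h psq ws=0" if "\<not> (length ws=k & set ws \<subseteq> W)" for ws
  using that sym_forms_outside[OF psq, of "map h ws"] by (auto simp: pullback_form_def)
 show "pullback_form W h psq ws = pullback_form W h psq ws'" if "mset ws=mset ws'" for ws ws'
  using sym_forms_mset[OF psq, of "map h ws" "map h ws'"] mset_eq_setD[OF that] that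
  by (simp add: pullback_form_def)
 show "lin W (%x. pullback_form W h psq (us @ x # vs))"
  if l: "length us + 1 + length vs=k" "set us \<subseteq> W" "set vs \<subseteq> W" for us vs
 proof -
  have "set (map h us) \<subseteq> T" "set (map h vs) \<subseteq> T" using l h(2) by auto
  then have "lin T (%y. psq (map h us @ y # map h vs))"
   using l(1) by (intro sym_forms_linear[OF psq]) simp_all
  from lin_comp[OF h(1) this h(2)]
  show ?thesis by (rule lin_cong[OF W]) (simp add: pullback_form_def l)
 qed
qed

context proj_point
begin

lemma local_ring_prod: "(!!i. i:I==>f i:R)==>(%y. PROD i:I. f i y):R"
 by (induction I rule: infinite_finite_induct) (simp_all add: local_ring_const local_ring_mult)

lemma max_ideal_zero: "(%_. 0):max_ideal V Z pt"
 by (simp add: max_ideal_def local_ring_const)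

lemma max_ideal_pow_zero: "(%_. 0):max_ideal_pow V Z pt k"
 using max_ideal_pow.prod[of "%_. 0" V Z pt k "%_ _. 0"] by (simp add: max_ideal_zero local_ring_const)

lemma max_ideal_pow_sum: "(!!i. i:I==>f i:max_ideal_pow V Z pt k)==>(%y. SUM i:I. f i y):max_ideal_pow V Z pt k"
 by (induction I rule: infinite_finite_induct) (simp_all add: max_ideal_pow_zero max_ideal_pow.add)

text \<open>The surplus factors are absorbed into the coefficient from the local ring.\<close>

lemma max_ideal_pow_prod:
 assumes h: "h:R" and f: "!!i. i < j==>f i:max_ideal V Z pt" and kj: "k<=j"
 shows "(%y. h y * (PROD i<j. f i y)):max_ideal_pow V Z pt k"
proof -
 have R: "(%y. h y * (PROD i:{k..<j}. f i y)):R"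
  using f by (intro local_ring_mult h local_ring_prod) (simp add: max_ideal_def)
 have "(%y. (h y * (PROD i:{k..<j}. f i y)) * (PROD i<k. f i y)):max_ideal_pow V Z pt k"
  by (rule max_ideal_pow.prod[OF R]) (use f kj in simp)
 moreover have "(PROD i<j. f i y)=(PROD i:{k..<j}. f i y) * (PROD i<k. f i y)" for y
  using prod.atLeastLessThan_concat[of 0 k j "%i. f i y"] kj by (simp add: lessThan_atLeast0 mult.commute)
 ultimately show ?thesis by (simp add: mult.assoc)
qed

lemma tangent_csubspace: "csubspace (tangent V Z pt)"
 by (rule fd_sub[OF cdim_tangent(2)])

lemma eval_linear: "lin T (%D. D f)"
 by (simp add: clinear_on_def scaleC_fun_def)

end

section \<open>Jets and leading forms in the chart\<close>

context graph_chart
begin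

text \<open>The coordinate in \<open>W\<close> of a point of the chart, as a function on lines; any
  nonzero vector of the line gives the same value.\<close>

definition cpt :: "'v set=>'w"
 where "cpt y=(let v=(SOME v. v:y&v~=0) in \<pi> (inverse (q v) *. v))"

lemma cpt_span1:
 assumes "v:V" "v~=0" shows "cpt (cspan {v})=\<pi> (inverse (q v) *. v)"
proof -
 obtain c where c: "c~=0" "(SOME u. u:cspan {v}&u~=0)=c *. v" using some_span1[OF assms(2)] by (elim exE conjE)
 have "inverse (q (c *. v)) * c=inverse (q v)"
  using c(1) lin_scale[OF q assms(1), of c] by simp
 then have e: "inverse (q (c *. v)) *. c *. v=inverse (q v) *. v"
  by (simp only: scaleC_scaleC)
 show ?thesis unfolding cpt_def c(2) Let_def e ..
qed

context
 fixes u assumes u: "u:W"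
begin

interpretation pp: proj_point V Z "nvq u" q
 by (rule chart_proj_point[OF u])

abbreviation line :: "'w=>complex=>'v set"
 where "line w s \<equiv> cspan {nvq (u + s *. w)}"

abbreviation Dv :: "'w=>('v set=>complex)=>complex"
 where "Dv w \<equiv> tvec V Z (nvq u) (dnu u w)"

lemma line_W: "w:W==>u + s *. w:W"
 by (intro sub_add[OF W] sub_scale[OF W] u)

lemma line_cone: "w:W==>nvq (u + s *. w):acone V Z"
 by (rule nvq_cone[OF line_W])

lemma curve_nz:
 assumes p: "p : pfuns V" "p (nvq u)~=0" and w: "w:W"
 shows "eventually (%s. p (nvq (u + s *. w))~=0) (nhds 0)"
proof -
 have "isCont (%s. p (nvq (u + s *. w))) 0" by (rule DERIV_isCont[OF nvq_curve[OF u p(1) w]])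
 then have "((%s. p (nvq (u + s *. w))) \<longlongrightarrow> (%s. p (nvq (u + s *. w))) 0) (at 0)" unfolding isCont_def .
 from iffD1[OF tendsto_at_iff_tendsto_nhds this]
 have "((%s. p (nvq (u + s *. w))) \<longlongrightarrow> p (nvq u)) (nhds 0)" by simp
 then show ?thesis by (rule tendsto_imp_eventually_ne) (rule p(2))
qed

lemma dnu_tcone: "w:W==>dnu u w:tcone V Z (nvq u)"
 using tangent_cone_chart[OF u] by blast

text \<open>Links the algebraic derivation to analysis: the quotient rule in \<open>tvec\<close> is
  the derivative of the quotient along the curve \<open>line w\<close>.\<close>

lemma Dv_derivative:
 assumes f: "f : pp.R" and w: "w:W"
 shows "((%s. f (line w s)) has_field_derivative Dv w f) (at 0)"
proof -
 obtain p g where 1: "lrep V Z (nvq u) f p g" using f unfolding pp.local_ring_iff by (elim exE)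
 note L = pp.lrepD[OF 1]
 have "((%s. p (nvq (u + s *. w)) / g (nvq (u + s *. w))) has_field_derivative
   (dd p (dnu u w) (nvq u) * g (nvq u) - p (nvq u) * dd g (dnu u w) (nvq u)) / (g (nvq u) * g (nvq u))) (at 0)"
  using DERIV_divide[OF nvq_curve[OF u L(1) w] nvq_curve[OF u L(2) w]] L(3) by simp
 also have "(dd p (dnu u w) (nvq u) * g (nvq u) - p (nvq u) * dd g (dnu u w) (nvq u)) / (g (nvq u) * g (nvq u))=Dv w f"
  unfolding pp.tvec_eq[OF dnu_tcone[OF w] 1] L(4) using L(3) by (simp add: field_simps)
 finally have d: "((%s. p (nvq (u + s *. w)) / g (nvq (u + s *. w))) has_field_derivative Dv w f) (at 0)" .
 have "eventually (%s. f (line w s) = p (nvq (u + s *. w)) / g (nvq (u + s *. w))) (nhds 0)"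
  using curve_nz[OF L(2,3) w] by (rule eventually_mono) (rule L(5)[OF line_cone[OF w]])
 from DERIV_cong_ev[OF refl this refl] d show ?thesis by simp
qed

lemma max_ideal_limit:
 assumes f: "f:max_ideal V Z (cspan {nvq u})" and w: "w:W"
 shows "((%s. f (line w s) / s) \<longlongrightarrow> Dv w f) (at 0)"
 using Dv_derivative[of f w] f w by (simp add: max_ideal_def DERIV_def)

lemma prod_limit:
 assumes f: "!!i. i < k==>f i:max_ideal V Z (cspan {nvq u})" and w: "w:W"
 shows "((%s. (PROD i<k. f i (line w s)) / s ^ k) \<longlongrightarrow> (PROD i<k. Dv w (f i))) (at 0)"
proof -
 have "((%s. PROD i<k. f i (line w s) / s) \<longlongrightarrow> (PROD i<k. Dv w (f i))) (at 0)"
  by (rule tendsto_prod) (use max_ideal_limit[OF f w] in simp)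
 then show ?thesis by (simp add: prod_dividef)
qed

lemma germ_line:
 assumes "germ_eq V Z (cspan {nvq u}) f g" and w: "w:W"
 shows "eventually (%s. f (line w s)=g (line w s)) (at 0)"
proof -
 obtain e r where r: "r:homog V e" "r (nvq u)~=0"
  "ALL v:acone V Z. r v~=0-->f (cspan {v})=g (cspan {v})"
  using assms(1) unfolding pp.germ_eq_iff by (elim exE bexE conjE)
 have "eventually (%s. f (line w s)=g (line w s)) (nhds 0)"
  using curve_nz[OF homogD(1)[OF r(1)] r(2) w]
  by (rule eventually_mono) (rule r(3)[rule_format, OF line_cone[OF w]])
 then show ?thesis by (simp add: eventually_nhds_conv_at)
qed

lemma max_ideal_pow_limit:
 assumes "f:max_ideal_pow V Z (cspan {nvq u}) k" and w: "w:W"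
 shows "EX c. ((%s. f (line w s) / s ^ k) \<longlongrightarrow> c) (at 0)"
 using assms(1)
proof induction
 case (prod h f)
 have "isCont (%s. h (line w s)) 0" by (rule DERIV_isCont[OF Dv_derivative[OF prod(1) w]])
 then have "((%s. h (line w s)) \<longlongrightarrow> h (cspan {nvq u})) (at 0)" unfolding isCont_def by simp
 from tendsto_mult[OF this prod_limit[of k f w, OF prod(2) w]]
 show ?case by (intro exI) simp
next
 case (add f g)
 then obtain c d where "((%s. f (line w s) / s ^ k) \<longlongrightarrow> c) (at 0)" "((%s. g (line w s) / s ^ k) \<longlongrightarrow> d) (at 0)"
  by (elim exE)
 from tendsto_add[OF this] show ?case by (intro exI) (simp add: add_divide_distrib)
next
 case (germ f g)
 obtain c where c: "((%s. f (line w s) / s ^ k) \<longlongrightarrow> c) (at 0)" using germ.IH by (elim exE)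
 have "((%s. g (line w s) / s ^ k) \<longlongrightarrow> c) (at 0)"
  by (rule Lim_transform_eventually[OF c]) (use germ_line[OF germ.hyps(2) w] in \<open>rule eventually_mono; simp\<close>)
 then show ?case by (rule exI)
qed

text \<open>Evaluates the inductive relation: however a leading form was derived, its values on the
  diagonal are limits along lines, and polarization then determines it. A correction in the next
  power of the maximal ideal contributes a term that tends to 0.\<close>

lemma leading_form_limit:
 assumes "leading_form V Z (cspan {nvq u}) k f phq" and w: "w:W"
 shows "phq : sym_forms (tangent V Z (cspan {nvq u})) k &
  ((%s. f (line w s) / s ^ k) \<longlongrightarrow> phq (replicate k (Dv w))) (at 0)"
 using assms(1)
proof induction
 case (prod f c)
 have DT: "Dv w:tangent V Z (cspan {nvq u})" by (rule pp.tvec_tangent[OF dnu_tcone[OF w]])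
 have "((%s. c * ((PROD i<k. f i (line w s)) / s ^ k)) \<longlongrightarrow> c * (PROD i<k. Dv w (f i))) (at 0)"
  by (intro tendsto_mult tendsto_const prod_limit[OF prod w])
 then have "((%s. c * (PROD i<k. f i (line w s)) / s ^ k) \<longlongrightarrow>
   (c *. sym_prod (tangent V Z (cspan {nvq u})) k (%i D. D (f i))) (replicate k (Dv w))) (at 0)"
  by (simp add: scaleC_fun_def sym_prod_diag[OF DT])
 moreover have "c *. sym_prod (tangent V Z (cspan {nvq u})) k (%i D. D (f i)) : sym_forms (tangent V Z (cspan {nvq u})) k"
  by (intro sub_scale[OF sym_forms_csubspace] sym_prod_sym_forms[OF pp.tangent_csubspace] pp.eval_linear)
 ultimately show ?case by (rule conjI[rotated])
next
 case (add f phq g psq)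
 then have "((%s. f (line w s) / s ^ k + g (line w s) / s ^ k) \<longlongrightarrow> phq (replicate k (Dv w)) + psq (replicate k (Dv w))) (at 0)"
  by (intro tendsto_add) simp_all
 then have lim: "((%s. (f (line w s) + g (line w s)) / s ^ k) \<longlongrightarrow> (phq + psq) (replicate k (Dv w))) (at 0)"
  by (simp add: add_divide_distrib)
 have "phq + psq : sym_forms (tangent V Z (cspan {nvq u})) k"
  using add.IH by (intro sub_add[OF sym_forms_csubspace]) simp_all
 then show ?case using lim by (rule conjI)
next
 case (higher f phq g)
 obtain c where c: "((%s. (g (line w s) - f (line w s)) / s ^ (k + 1)) \<longlongrightarrow> c) (at 0)"
  using max_ideal_pow_limit[OF higher.hyps(2) w] by (elim exE)
 have "((%s. f (line w s) / s ^ k + (g (line w s) - f (line w s)) / s ^ (k + 1) * s) \<longlongrightarrow> phq (replicate k (Dv w)) + c * 0) (at 0)"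
  using higher.IH by (intro tendsto_add tendsto_mult c tendsto_ident_at) simp
 then have "((%s. g (line w s) / s ^ k) \<longlongrightarrow> phq (replicate k (Dv w)) + c * 0) (at 0)"
  by (rule Lim_transform_eventually) (simp add: eventually_at_filter field_simps)
 then show ?case using higher.IH by simp
qed

lemma taylor:
 assumes p: "p : pfuns W"
 obtains N phq where "ALL j. phq j : sym_forms W j" "ALL w:W. p (u + w)=(SUM j<=N. phq j (replicate j w))"
proof -
 obtain N phq where N: "ALL k. phq k : sym_forms W k" "ALL w:W. p (u + w)=(SUM k<=N. phq k (replicate k w))"
  using poly_funs_sym_expand[OF W poly_funs_shift[OF W p u]] by (elim exE conjE)
 show thesis by (rule that[of phq N]) (use N in simp_all)
qed

text \<open>The limits force all terms of degree below \<open>k\<close> to vanish on the diagonal.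
  The upper bound is raised to at least \<open>k\<close>, with zero forms as padding.\<close>

lemma taylor_order:
 assumes p: "p : pfuns W" and lim: "!!w. w:W==>EX c. ((%s. p (u + s *. w) / s ^ k) \<longlongrightarrow> c) (at 0)"
 obtains N phq where "!!j. phq j : sym_forms W j" "!!w. w:W ==> p (u + w)=(SUM j:{k..N}. phq j (replicate j w))" "k<=N"
proof -
 obtain N phq where "ALL j. phq j : sym_forms W j" "ALL w:W. p (u + w)=(SUM j<=N. phq j (replicate j w))"
  by (rule taylor[OF p])
 note phq = this(1)[rule_format] and N = this(2)[rule_format]
 have z: "phq j (replicate j w)=0" if j: "j < k" "j<=N" and w: "w:W" for j w
 proof -
  obtain c where c: "((%s. p (u + s *. w) / s ^ k) \<longlongrightarrow> c) (at 0)" using lim[OF w] by (elim exE)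
  have "((%s. (SUM j<=N. phq j (replicate j (s *. w))) / s ^ k) \<longlongrightarrow> c) (at 0)"
   using c by (simp add: N[OF sub_scale[OF W w]])
  from line_expansion_limit[OF W phq w this] show ?thesis using j by simp
 qed
 define psq where "psq j=(if j<=N then phq j else 0)" for j
 have psq: "psq j : sym_forms W j" for j using phq[of j] sub_0[OF sym_forms_csubspace[of W j]] by (simp add: psq_def)
 have "p (u + w)=(SUM j:{k..max k N}. psq j (replicate j w))" if w: "w:W" for w
 proof -
  have "p (u + w)=(SUM j<=N. psq j (replicate j w))" using N[OF w] by (simp add: psq_def)
  also have "\<dots>=(SUM j:{k..max k N}. psq j (replicate j w))"
   by (rule sum.mono_neutral_cong) (use z[OF _ _ w] in \<open>auto simp: psq_def\<close>)
  finally show ?thesis .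
 qed
 then show thesis by (intro that[of psq "max k N"]) (use psq in simp_all)
qed

lemma chart_factor_max_ideal:
 assumes \<theta>: "lin W \<theta>" shows "(%y. \<theta> (cpt y - u)):max_ideal V Z (cspan {nvq u})"
proof -
 have e: "(%y. \<theta> (cpt y - u))=dehom q (%v. \<theta> (\<pi> v - u))"
  by (simp add: fun_eq_iff cpt_def dehom_def Let_def)
 have "lin V (%v. \<theta> (\<pi> v))" using \<pi>W by (intro lin_comp[OF \<pi> \<theta>]) auto
 then have "(%v. \<theta> (\<pi> v) - \<theta> u) : pfuns V" by (intro poly_funs_diff poly_funs.const) (rule poly_funs.linear)
 then have "(%v. \<theta> (\<pi> v - u)) : pfuns V"
  by (rule poly_funs_cong[OF V]) (simp add: lin_diff[OF W \<theta> \<pi>W u])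
 then show ?thesis
  unfolding e max_ideal_def using \<pi>nvq[OF u] lin_0[OF W \<theta>] by (simp add: pp.dehom_local_ring pp.dehom_pt)
qed

lemma lin_prods_max_ideal_pow:
 assumes "f:lin_prods W j" "k<=j" "h : pp.R"
 shows "(%y. h y * f (cpt y - u)):max_ideal_pow V Z (cspan {nvq u}) k"
 using assms(1)
proof induction
 case (prod \<theta> c)
 have "(%y. c * h y) : pp.R" by (rule pp.local_ring_cmult[OF assms(3)])
 from pp.max_ideal_pow_prod[OF this chart_factor_max_ideal[OF prod] assms(2)]
 show ?case by (simp add: mult_ac)
next
 case (add f g)
 from max_ideal_pow.add[OF add.IH] show ?case by (simp add: distrib_left)
qed

lemma lin_prods_leading_form:
 assumes "f:lin_prods W k"
 shows "EX psq. leading_form V Z (cspan {nvq u}) k (%y. f (cpt y - u)) psq"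
 using assms
proof induction
 case (prod \<theta> c)
 show ?case by (rule exI, rule leading_form.prod, rule chart_factor_max_ideal, rule prod)
next
 case (add f g)
 then obtain phq psq where "leading_form V Z (cspan {nvq u}) k (%y. f (cpt y - u)) phq"
  "leading_form V Z (cspan {nvq u}) k (%y. g (cpt y - u)) psq" by (elim exE)
 from leading_form.add[OF this] show ?case by (rule exI[of _ "phq + psq"])
qed

lemma trivializing_chart: "trivializing V (cspan {nvq u}) q'\<longleftrightarrow> lin V q'&q' (nvq u)~=0"
 unfolding trivializing_def using basic_span1[OF homog_linear nvqV[OF u] nvq_nz[OF u]] by blast

lemma section_fun_line:
 assumes "lin V q'" "lin V l" "w:W"
 shows "section_fun q' l (line w s)=l (nvq (u + s *. w)) / q' (nvq (u + s *. w))"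
 by (rule section_fun_span1[OF assms(1,2)]) (simp_all add: nvqV nvq_nz line_W assms(3))

lemma chart_germ:
 fixes q' :: "'v=>complex" and f g :: "'v set=>complex"
 assumes q': "lin V q'" "q' (nvq u)~=0"
  and eq: "!!v. v:acone V Z==>q v~=0==>q' v~=0==>f (cspan {v})=g (cspan {v})"
 shows "germ_eq V Z (cspan {nvq u}) f g"
 unfolding pp.germ_eq_iff
proof (intro exI bexI conjI ballI impI)
 show "(%v. q v * q' v):homog V (1 + 1)" by (intro homog_mult homog_linear q q'(1))
 show "q (nvq u) * q' (nvq u)~=0" using qnvq[OF u] q'(2) by simp
 fix v assume "v:acone V Z" "q v * q' v~=0"
 then show "f (cspan {v})=g (cspan {v})" by (intro eq) simp_all
qed

text \<open>Near \<open>nvq(u)\<close> the section \<open>l/q'\<close> is \<open>(q/q')\<close> times the Taylor expansion of \<open>l \<circ> nvq\<close> at \<open>u\<close>.\<close>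

lemma section_fun_expand:
 assumes l: "lin V l" and q': "lin V q'" "q' (nvq u)~=0"
  and f: "!!j. j:J==>ALL w:W. f j w=phq j (replicate j w)"
  and e: "!!w. w:W==>l (nvq (u + w))=(SUM j:J. phq j (replicate j w))"
 shows "germ_eq V Z (cspan {nvq u}) (%y. SUM j:J. section_fun q' q y * f j (cpt y - u)) (section_fun q' l)"
proof (rule chart_germ[OF q'])
 fix v assume v: "v:acone V Z" "q v~=0" "q' v~=0"
 let ?z = "\<pi> (inverse (q v) *. v)"
 note vV = coneD(1,2)[OF v(1)]
 have zW: "?z:W" by (rule \<pi>W[OF sub_scale[OF V vV(1)]])
 then have zu: "?z - u:W" by (rule sub_diff[OF W _ u])
 have "(SUM j:J. f j (?z - u))=(SUM j:J. phq j (replicate j (?z - u)))"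
  by (rule sum.cong[OF refl]) (use f zu in simp)
 also have "\<dots>=l (nvq ?z)" using e[OF zu] by simp
 also have "\<dots>=l v / q v" using chart_point[OF v(1,2)] lin_scale[OF l vV(1), of "inverse (q v)"]
  by (simp add: divide_inverse mult.commute)
 finally have "(SUM j:J. f j (?z - u))=l v / q v" .
 moreover have "(SUM j:J. section_fun q' q (cspan {v}) * f j (cpt (cspan {v}) - u))=q v / q' v * (SUM j:J. f j (?z - u))"
  unfolding cpt_span1[OF vV] section_fun_span1[OF q'(1) q vV] sum_distrib_left ..
 ultimately show "(SUM j:J. section_fun q' q (cspan {v}) * f j (cpt (cspan {v}) - u)) = section_fun q' l (cspan {v})"
  unfolding section_fun_span1[OF q'(1) l vV] using v by simp
qed

lemma section_fun_local_ring:
 assumes q': "lin V q'" "q' (nvq u)~=0" and l: "lin V l"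
 shows "section_fun q' l : pp.R"
 unfolding pp.local_ring_iff lrep_def
proof (rule exI[of _ l], rule exI[of _ q'], intro conjI exI[of _ 1] ballI impI)
 show "l:homog V 1" "q':homog V 1" by (rule homog_linear, fact)+
 show "q' (nvq u)~=0" by (rule q'(2))
 show "section_fun q' l (cspan {v})=l v / q' v" if "v:acone V Z" for v
  by (rule section_fun_span1[OF q'(1) l coneD(1,2)[OF that]])
qed

lemma choose_lin_prods:
 assumes "!!j. phq j : sym_forms W j"
 obtains f where "ALL j. f j:lin_prods W j" "ALL j. ALL w:W. f j w=phq j (replicate j w)"
proof -
 have "ALL j. EX g. g:lin_prods W j&(ALL w:W. g w=phq j (replicate j w))"
  using sym_form_lin_prods[OF fdW assms] by (simp add: Bex_def)
 then obtain f where "ALL j. f j:lin_prods W j&(ALL w:W. f j w=phq j (replicate j w))" by (rule choice[THEN exE])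
 then show thesis by (intro that[of f]) simp_all
qed

text \<open>Membership in the power of the maximal ideal gives the limits, by the trivialization
  \<open>q\<close>. Conversely the limits delete the low Taylor terms, and each remaining term is a
  product of enough chart functions; another trivialization only changes the factor
  \<open>q / q'\<close>.\<close>

lemma jet_kernel_chart:
 assumes l: "lin V l"
 shows "l:jet_kernel V Z (cspan {nvq u}) k \<longleftrightarrow>
  (ALL w:W. EX c. ((%s. l (nvq (u + s *. w)) / s ^ (k + 1)) \<longlongrightarrow> c) (at 0))"
proof
 assume "l:jet_kernel V Z (cspan {nvq u}) k"
 moreover have "trivializing V (cspan {nvq u}) q" using q qnvq[OF u] by (simp add: trivializing_chart)
 ultimately have m: "section_fun q l:max_ideal_pow V Z (cspan {nvq u}) (k + 1)" by (simp add: jet_kernel_def)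
 show "ALL w:W. EX c. ((%s. l (nvq (u + s *. w)) / s ^ (k + 1)) \<longlongrightarrow> c) (at 0)"
 proof
  fix w assume w: "w:W"
  from max_ideal_pow_limit[OF m w]
  show "EX c. ((%s. l (nvq (u + s *. w)) / s ^ (k + 1)) \<longlongrightarrow> c) (at 0)"
   unfolding section_fun_line[OF q l w] qnvq[OF line_W[OF w]] by simp
 qed
next
 assume lim: "ALL w:W. EX c. ((%s. l (nvq (u + s *. w)) / s ^ (k + 1)) \<longlongrightarrow> c) (at 0)"
 obtain N phq where phq: "!!j. phq j : sym_forms W j"
  and N: "!!w. w:W==>l (nvq (u + w))=(SUM j:{k + 1..N}. phq j (replicate j w))"
  by (rule taylor_order[OF nvq_poly[OF l], of "k + 1"]) (use lim in auto)
 obtain f where "ALL j. f j:lin_prods W j" "ALL j. ALL w:W. f j w=phq j (replicate j w)"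
  by (rule choose_lin_prods[OF phq])
 note f = this[THEN spec]
 have "section_fun q' l:max_ideal_pow V Z (cspan {nvq u}) (k + 1)" if "trivializing V (cspan {nvq u}) q'" for q'
 proof -
  have q': "lin V q'" "q' (nvq u)~=0" using that by (simp_all add: trivializing_chart)
  show ?thesis
  proof (rule max_ideal_pow.germ[OF _ section_fun_expand[OF l q' f(2) N]])
   show "(%y. SUM j:{k + 1..N}. section_fun q' q y * f j (cpt y - u)):max_ideal_pow V Z (cspan {nvq u}) (k + 1)"
    by (intro pp.max_ideal_pow_sum lin_prods_max_ideal_pow[OF f(1)] section_fun_local_ring[OF q' q]) simp
  qed
 qed
 then show "l:jet_kernel V Z (cspan {nvq u}) k" using l by (simp add: jet_kernel_def)
qed

text \<open>The Taylor term of degree \<open>k\<close> is a sum of products of \<open>k\<close>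
  chart functions and so has a leading form; all later terms lie in the next power of the maximal
  ideal.\<close>

lemma section_leading_form:
 assumes l: "lin V l" and phq: "!!j. phq j : sym_forms W j" and kN: "k<=N"
  and e: "!!w. w:W==>l (nvq (u + w))=(SUM j:{k..N}. phq j (replicate j w))"
 shows "EX psq. leading_form V Z (cspan {nvq u}) k (section_fun q l) psq"
proof -
 obtain f where "ALL j. f j:lin_prods W j" "ALL j. ALL w:W. f j w=phq j (replicate j w)"
  by (rule choose_lin_prods[OF phq])
 note f = this[THEN spec]
 obtain psq where psq: "leading_form V Z (cspan {nvq u}) k (%y. f k (cpt y - u)) psq"
  using lin_prods_leading_form[OF f(1)[of k]] by (elim exE)
 have q1: "q (nvq u)~=0" using qnvq[OF u] by simp
 have rest: "(%y. SUM j:{k + 1..N}. section_fun q q y * f j (cpt y - u)):max_ideal_pow V Z (cspan {nvq u}) (k + 1)"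
  by (intro pp.max_ideal_pow_sum lin_prods_max_ideal_pow[OF f(1)] section_fun_local_ring[OF q q1 q]) simp
 have "germ_eq V Z (cspan {nvq u}) (%y. SUM j:{k + 1..N}. section_fun q q y * f j (cpt y - u))
   (%y. section_fun q l y - f k (cpt y - u))"
 proof -
  have g: "germ_eq V Z (cspan {nvq u}) (%y. SUM j:{k..N}. section_fun q q y * f j (cpt y - u)) (section_fun q l)"
   by (rule section_fun_expand[OF l q q1 f(2) e])
  obtain d r where r: "r:homog V d" "r (nvq u)~=0" "ALL v:acone V Z. r v~=0 -->
   (SUM j:{k..N}. section_fun q q (cspan {v}) * f j (cpt (cspan {v}) - u)) = section_fun q l (cspan {v})"
   using g unfolding pp.germ_eq_iff by (elim exE bexE conjE)
  show ?thesis
   unfolding pp.germ_eq_iff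
  proof (intro exI bexI conjI ballI impI)
   show "(%v. r v * q v):homog V (d + 1)" by (intro homog_mult r(1) homog_linear q)
   show "r (nvq u) * q (nvq u)~=0" using r(2) q1 by simp
   fix v assume v: "v:acone V Z" and ne: "r v * q v~=0"
   have "section_fun q q (cspan {v})=1" using section_fun_span1[OF q q coneD(1,2)[OF v]] ne by simp
   moreover have "{k..N}=insert k {k + 1..N}" using kN by auto
   ultimately show "(SUM j:{k + 1..N}. section_fun q q (cspan {v}) * f j (cpt (cspan {v}) - u)) =
     section_fun q l (cspan {v}) - f k (cpt (cspan {v}) - u)"
    using r(3)[rule_format, OF v] ne by (simp add: eq_diff_eq add.commute)
  qed
 qed
 from leading_form.higher[OF psq max_ideal_pow.germ[OF rest this]] show ?thesis by (rule exI[of _ psq])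
qed

lemma Dv_iso: "lin_iso W (tangent V Z (cspan {nvq u})) Dv"
proof -
 have 1: "lin W (dnu u)" "bij_betw (dnu u) W pp.TK" using dnu_iso[OF u] by (simp_all add: lin_iso_def)
 have 2: "lin pp.TK (tvec V Z (nvq u))" "bij_betw (tvec V Z (nvq u)) pp.TK (tangent V Z (cspan {nvq u}))"
  using pp.tangent_iso by (simp_all add: lin_iso_def)
 have "lin W Dv" using lin_comp[OF 1(1) 2(1)] bij_betw_imp_surj_on[OF 1(2)] by simp
 moreover have "bij_betw Dv W (tangent V Z (cspan {nvq u}))" using bij_betw_trans[OF 1(2) 2(2)] by (simp add: o_def)
 ultimately show ?thesis by (simp add: lin_iso_def)
qed

text \<open>Fundamental forms become leading terms of the functions \<open>l (nvq (u + w))\<close>.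
  Inclusions in both directions identify forms through their diagonal values, which are
  limits.\<close>

lemma fundamental_form_chart:
 assumes k: "2<=k"
 shows "pullback_form W Dv ` fundamental_form V Z (cspan {nvq u}) k =
  {phq : sym_forms W k. EX l. lin V l &
   (ALL w:W. ((%s. l (nvq (u + s *. w)) / s ^ k) \<longlongrightarrow> phq (replicate k w)) (at 0))}"
proof -
 let ?pt = "cspan {nvq u}"
 have Dvl: "lin W Dv" "Dv ` W \<subseteq> tangent V Z ?pt" using Dv_iso by (auto simp: lin_iso_def bij_betw_def)
 have diag: "pullback_form W Dv psq (replicate k w)=psq (replicate k (Dv w))" if "w:W" for psq w
  using that by (auto simp: pullback_form_def map_replicate)
 have k1: "k - 1 + 1=k" "\<not> k<=1" using k by simp_all
 show ?thesis
 proof (intro equalityI subsetI)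
  fix phq assume "phq : pullback_form W Dv ` fundamental_form V Z ?pt k"
  then obtain psq where psq: "psq:fundamental_form V Z ?pt k" "phq = pullback_form W Dv psq" by (elim imageE)
  have "EX l:jet_kernel V Z ?pt (k - 1). EX q'. trivializing V ?pt q'&leading_form V Z ?pt k (section_fun q' l) psq"
   using psq(1) k1(2) by (simp add: fundamental_form_def)
  then obtain l q' where lq: "l:jet_kernel V Z ?pt (k - 1)" "trivializing V ?pt q'" "leading_form V Z ?pt k (section_fun q' l) psq"
   by (elim bexE exE conjE)
  have l: "lin V l" using lq(1) by (simp add: jet_kernel_def)
  have q': "lin V q'" "q' (nvq u)~=0" using lq(2) by (simp_all add: trivializing_chart)
  have psqT: "psq : sym_forms (tangent V Z ?pt) k" using leading_form_limit[OF lq(3) sub_0[OF W]] by simp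
  have "phq : sym_forms W k" unfolding psq(2) by (rule pullback_sym_forms[OF W Dvl psqT])
  \<comment> \<open>The witness is \<open>l\<close> divided by \<open>q' (nvq u)\<close>: this
    constant is all that the change of trivialization does to a leading term.\<close>
  moreover have "((%s. (inverse (q' (nvq u)) * l (nvq (u + s *. w))) / s ^ k) \<longlongrightarrow> phq (replicate k w)) (at 0)" if w: "w:W" for w
  proof -
   have 1: "((%s. l (nvq (u + s *. w)) / q' (nvq (u + s *. w)) / s ^ k) \<longlongrightarrow> phq (replicate k w)) (at 0)"
    using leading_form_limit[OF lq(3) w] section_fun_line[OF q'(1) l w] diag[OF w] psq(2) by simp
   have "isCont (%s. q' (nvq (u + s *. w))) 0" by (rule DERIV_isCont[OF nvq_curve[OF u poly_funs.linear[OF q'(1)] w]])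
   then have 2: "((%s. q' (nvq (u + s *. w))) \<longlongrightarrow> q' (nvq u)) (at 0)" unfolding isCont_def by simp
   have 3: "((%s. inverse (q' (nvq u)) * (l (nvq (u + s *. w)) / q' (nvq (u + s *. w)) / s ^ k * q' (nvq (u + s *. w)))) \<longlongrightarrow>
     inverse (q' (nvq u)) * (phq (replicate k w) * q' (nvq u))) (at 0)"
    by (intro tendsto_mult tendsto_const 1 2)
   have "eventually (%s. q' (nvq (u + s *. w))~=0) (at 0)"
    by (rule tendsto_imp_eventually_ne[OF 2 q'(2)])
   then have 4: "eventually (%s. inverse (q' (nvq u)) * (l (nvq (u + s *. w)) / q' (nvq (u + s *. w)) / s ^ k * q' (nvq (u + s *. w))) =
     (inverse (q' (nvq u)) * l (nvq (u + s *. w))) / s ^ k) (at 0)"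
    by (rule eventually_mono) simp
   have e: "inverse (q' (nvq u)) * (phq (replicate k w) * q' (nvq u))=phq (replicate k w)" using q'(2) by simp
   from Lim_transform_eventually[OF 3 4] show ?thesis unfolding e .
  qed
  ultimately show "phq:{phq : sym_forms W k. EX l. lin V l &
   (ALL w:W. ((%s. l (nvq (u + s *. w)) / s ^ k) \<longlongrightarrow> phq (replicate k w)) (at 0))}"
   by (intro CollectI conjI exI[of _ "%v. inverse (q' (nvq u)) * l v"] lin_cmult'[OF l] ballI)
 next
  fix phq assume "phq:{phq : sym_forms W k. EX l. lin V l &
   (ALL w:W. ((%s. l (nvq (u + s *. w)) / s ^ k) \<longlongrightarrow> phq (replicate k w)) (at 0))}"
  then obtain l where phqW: "phq : sym_forms W k" and l: "lin V l"
   and lim: "ALL w:W. ((%s. l (nvq (u + s *. w)) / s ^ k) \<longlongrightarrow> phq (replicate k w)) (at 0)"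
   by (elim CollectE conjE exE)
  obtain N \<xi> where \<xi>: "!!j. \<xi> j : sym_forms W j" "k<=N"
   and N: "!!w. w:W==>l (nvq (u + w))=(SUM j:{k..N}. \<xi> j (replicate j w))"
   by (rule taylor_order[OF nvq_poly[OF l], of k]) (use lim in auto)
  have "EX psq. leading_form V Z ?pt k (section_fun q l) psq" by (rule section_leading_form[OF l \<xi>]) (erule N)
  then obtain psq where psq: "leading_form V Z ?pt k (section_fun q l) psq" by (elim exE)
  have "l:jet_kernel V Z ?pt (k - 1)" unfolding jet_kernel_chart[OF l] k1 using lim by auto
  moreover have "trivializing V ?pt q" using q qnvq[OF u] by (simp add: trivializing_chart)
  ultimately have "psq:fundamental_form V Z ?pt k" using psq k1(2) by (auto simp: fundamental_form_def)
  moreover have "phq = pullback_form W Dv psq"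
  proof (rule polarization_unique[OF phqW _ W])
   have psqT: "psq : sym_forms (tangent V Z ?pt) k" using leading_form_limit[OF psq sub_0[OF W]] by simp
   show "pullback_form W Dv psq : sym_forms W k" by (rule pullback_sym_forms[OF W Dvl psqT])
   fix w assume w: "w:W"
   have "((%s. l (nvq (u + s *. w)) / s ^ k) \<longlongrightarrow> psq (replicate k (Dv w))) (at 0)"
    using leading_form_limit[OF psq w] unfolding section_fun_line[OF q l w] qnvq[OF line_W[OF w]] by simp
   from LIM_unique[OF bspec[OF lim w] this] show "phq (replicate k w) = pullback_form W Dv psq (replicate k w)"
    using diag[OF w] by simp
  qed
  ultimately show "phq : pullback_form W Dv ` fundamental_form V Z ?pt k" by (simp only: imageI)
 qed
qed

end

end

section \<open>Linear automorphisms preserving a graph\<close>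

lemma lin_isoD:
 assumes "lin_iso V U g"
 shows "lin V g" "inj_on g V" "g ` V=U" "v:V==>g v:U"
 using assms by (auto simp: lin_iso_def bij_betw_def)

lemma image_span1:
 assumes "lin V g" "v:V" shows "g ` cspan {v}=cspan {g v}"
proof (intro set_eqI iffI)
 fix y assume "y:g ` cspan {v}"
 then obtain c where "y=g (c *. v)" by (auto simp: mem_span1)
 then show "y:cspan {g v}" using lin_scale[OF assms] by (auto simp: mem_span1)
next
 fix y assume "y:cspan {g v}"
 then obtain c where c: "y=c *. g v" by (auto simp: mem_span1)
 have "y=g (c *. v)" unfolding c using lin_scale[OF assms] by simp
 then show "y:g ` cspan {v}" by (rule image_eqI) (auto simp: mem_span1)
qed

lemma lin_iso_nz:
 assumes V: "csubspace V" and g: "lin_iso V U g" and v: "v:V" "v~=0" shows "g v~=0"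
proof
 assume "g v=0"
 then have "g v=g 0" using lin_0[OF V lin_isoD(1)[OF g]] by simp
 then show False using inj_onD[OF lin_isoD(2)[OF g] _ v(1) sub_0[OF V]] v(2) by simp
qed

lemma homog_pullback:
 assumes V: "csubspace V" and g: "lin V g" "g ` V \<subseteq> U" and p: "p:homog U d"
 shows "(%v. p (g v)):homog V d"
proof -
 have "(%v. p (g v)) : pfuns V"
 proof (rule poly_funs_comp[OF homogD(1)[OF p]])
  fix l :: "_=>complex" assume "lin U l"
  then show "(%v. l (g v)) : pfuns V" by (intro poly_funs.linear lin_comp[OF g(1) _ g(2)])
 qed
 moreover have "p (g (c *. v))=c ^ d * p (g v)" if v: "v:V" for c v
  unfolding lin_scale[OF g(1) v] using homogD(2)[OF p, of "g v" c] g(2) v by auto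
 ultimately show ?thesis by (simp add: homog_polys_def)
qed

lemma closure_image_subset:
 assumes V: "csubspace V" and g: "lin_iso V U g" and S: "S \<subseteq> proj V" and L: "L:zariski V closure_of S"
 shows "g ` L:zariski U closure_of (image g ` S)"
 unfolding in_closure_zariski
proof (intro conjI allI impI)
 note gl = lin_isoD(1)[OF g]
 obtain v where v: "v:V" "v~=0" "L=cspan {v}" using L proj_rep[of L V] unfolding in_closure_zariski by blast
 have gL: "g ` L=cspan {g v}" unfolding v(3) by (rule image_span1[OF gl v(1)])
 note gv = lin_isoD(4)[OF g v(1)] lin_iso_nz[OF V g v(1,2)]
 show "g ` L : proj U" unfolding gL by (rule span1_proj[OF gv])
 fix d p assume p: "p:homog U d" and pL: "g ` L:basic_open U p"
 have pg: "(%v. p (g v)):homog V d" by (rule homog_pullback[OF V gl _ p]) (simp add: lin_isoD(3)[OF g])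
 have "L:basic_open V (%v. p (g v))"
  using pL[unfolded gL] basic_span1[OF p gv] basic_span1[OF pg v(1,2)] unfolding v(3) by simp
 then have "EX M:S. M:basic_open V (%v. p (g v))" using L pg unfolding in_closure_zariski by simp
 then obtain M where M: "M:S" "M:basic_open V (%v. p (g v))" by (elim bexE)
 have "M : proj V" using S M(1) by (rule subsetD)
 from proj_rep[OF this] obtain w where w: "w:V" "w~=0" "M=cspan {w}" by (elim bexE conjE)
 have "p (g w)~=0" using M(2) basic_span1[OF pg w(1,2)] w(3) by simp
 then have "cspan {g w}:basic_open U p"
  using basic_span1[OF p lin_isoD(4)[OF g w(1)] lin_iso_nz[OF V g w(1,2)]] by simp
 then have "g ` M:basic_open U p" unfolding w(3) image_span1[OF gl w(1)] .
 then show "EX M:image g ` S. M:basic_open U p" using imageI[OF M(1)] by (rule bexI)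
qed

lemma lin_iso_inv:
 assumes V: "csubspace V" and g: "lin_iso V U g" shows "lin_iso U V (inv_into V g)"
proof -
 note gl = lin_isoD[OF g]
 have i: "inv_into V g (g v)=v" if "v:V" for v by (rule inv_into_f_f[OF gl(2) that])
 have b: "bij_betw (inv_into V g) U V" using g by (intro bij_betw_inv_into) (simp add: lin_iso_def)
 have "lin U (inv_into V g)"
 proof (rule clinear_onI)
  fix x y c assume "x:U"
  then obtain v where v: "v:V" "x=g v" using gl(3) by blast
  have "c *. x=g (c *. v)" using lin_scale[OF gl(1) v(1)] v(2) by simp
  then show "inv_into V g (c *. x)=c *. inv_into V g x"
   using i[OF v(1)] i[OF sub_scale[OF V v(1)]] v(2) by simp
  assume "y:U"
  then obtain w where w: "w:V" "y=g w" using gl(3) by blast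
  have "x + y=g (v + w)" using lin_add[OF gl(1) v(1) w(1)] v(2) w(2) by simp
  then show "inv_into V g (x + y)=inv_into V g x + inv_into V g y"
   using i[OF v(1)] i[OF w(1)] i[OF sub_add[OF V v(1) w(1)]] v(2) w(2) by simp
 qed
 then show ?thesis using b by (simp add: lin_iso_def)
qed

text \<open>A linear isomorphism pulls homogeneous polynomials back to homogeneous polynomials, so
  it maps closure into closure; the inverse gives the other inclusion.\<close>

lemma closure_image:
 assumes V: "csubspace V" and U: "csubspace U" and g: "lin_iso V U g" and S: "S \<subseteq> proj V"
 shows "image g ` (zariski V closure_of S)=zariski U closure_of (image g ` S)"
proof (intro equalityI subsetI)
 fix L assume "L:image g ` (zariski V closure_of S)"
 then show "L:zariski U closure_of (image g ` S)" using closure_image_subset[OF V g S] by (elim imageE) simp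
next
 fix L assume L: "L:zariski U closure_of (image g ` S)"
 let ?h = "inv_into V g"
 have LU: "L \<subseteq> U"
  using L proj_elem[OF U, of L] sub_0[OF U] unfolding in_closure_zariski by blast
 have gS: "image g ` S \<subseteq> proj U"
 proof
  fix M assume "M:image g ` S"
  then obtain L' where L': "L':S" "M=g ` L'" by (elim imageE)
  have "L' : proj V" using S L'(1) by (rule subsetD)
  from proj_rep[OF this] obtain v where v: "v:V" "v~=0" "L'=cspan {v}" by (elim bexE conjE)
  then show "M : proj U"
   unfolding L'(2) v(3) image_span1[OF lin_isoD(1)[OF g] v(1)]
   using span1_proj[OF lin_isoD(4)[OF g v(1)] lin_iso_nz[OF V g v(1,2)]] by simp
 qed
 have SV: "M \<subseteq> V" if "M:S" for M using that S proj_elem[OF V, of M] sub_0[OF V] by blast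
 have hg: "?h ` g ` M=M" if "M:S" for M
  using inv_into_image_cancel[OF lin_isoD(2)[OF g] SV[OF that]] .
 have "image ?h ` image g ` S=(%M. ?h ` g ` M) ` S" by (rule image_image)
 also have "\<dots>=S" using hg by simp
 finally have "image ?h ` image g ` S=S" .
 then have "?h ` L:zariski V closure_of S"
  using closure_image_subset[OF U lin_iso_inv[OF V g] gS L] by simp
 moreover have "L=g ` ?h ` L"
  using image_inv_into_cancel[OF lin_isoD(3)[OF g] LU] by simp
 ultimately show "L:image g ` (zariski V closure_of S)" by (rule rev_image_eqI)
qed

section \<open>Extension of maps of the parameter space to linear maps\<close>

context graph_chart
begin

text \<open>The dual formulation of linear extendability: composition with \<open>\<tau>\<close>
  preserves the space of pulled-back functionals.\<close>

definition stable :: "('w=>'w)=>bool"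
 where "stable \<tau> \<longleftrightarrow> \<tau> ` W \<subseteq> W &
  (ALL l. lin V l-->(EX l'. lin V l'&(ALL w:W. l (nvq (\<tau> w))=(l' (nvq w) :: complex))))"

lemma stable_comp:
 assumes s: "stable sgq" and t: "stable \<tau>" shows "stable (%w. sgq (\<tau> w))"
 unfolding stable_def
proof (intro conjI allI impI)
 have tW: "\<tau> w:W" if "w:W" for w using t that by (auto simp: stable_def)
 show "(%w. sgq (\<tau> w)) ` W \<subseteq> W" using s tW by (auto simp: stable_def)
 fix l :: "'v=>complex" assume "lin V l"
 then obtain l' where l': "lin V l'" "ALL w:W. l (nvq (sgq w))=l' (nvq w)" using s unfolding stable_def by blast
 obtain l'' where l'': "lin V l''" "ALL w:W. l' (nvq (\<tau> w))=l'' (nvq w)" using t l'(1) unfolding stable_def by blast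
 show "EX l'. lin V l'&(ALL w:W. l (nvq (sgq (\<tau> w)))=l' (nvq w))"
  using l'(2) l'' tW by (intro exI[of _ l'']) simp
qed

text \<open>A basis taken from the graph itself, so that a linear map can be prescribed by moving
  parameter values.\<close>

definition nb :: "'v set"
 where "nb=(SOME B. B \<subseteq> nvq ` W&\<not> cdependent B&nvq ` W \<subseteq> cspan B)"

lemma nb: "nb \<subseteq> nvq ` W" "\<not> cdependent nb" "nvq ` W \<subseteq> cspan nb"
proof -
 have "EX B. B \<subseteq> nvq ` W&\<not> cdependent B&nvq ` W \<subseteq> cspan B"
  using cvs.maximal_independent_subset[of "nvq ` W"] by metis
 from someI_ex[OF this] show "nb \<subseteq> nvq ` W" "\<not> cdependent nb" "nvq ` W \<subseteq> cspan nb" unfolding nb_def by simp_all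
qed

lemma nb_V: "nb \<subseteq> V"
 using nb(1) nvqV by blast

lemma nb_finite: "finite nb"
 using card_le_cdim[OF fdV nb(2) nb_V] by simp

lemma nb_\<pi>: "b:nb==>\<pi> b:W&nvq (\<pi> b)=b"
 using nb(1) \<pi>nvq by auto

definition lift :: "('w=>'w)=>'v=>'v"
 where "lift \<tau> v=(SUM b:nb. crepresentation nb v b *. nvq (\<tau> (\<pi> b)))"

end

locale spanning_chart = graph_chart +
 assumes nd: "lin V (l :: 'a::complex_vector=>complex)==>(!!w. w:W==>l (nvq w)=0)==>v:V==>l v=0"
begin

lemma span_nb: "cspan nb=V"
proof
 show "cspan nb \<subseteq> V" by (rule cvs.span_minimal[OF nb_V V])
 show "V \<subseteq> cspan nb"
 proof (rule ccontr)
  assume "\<not> V \<subseteq> cspan nb"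
  then obtain v where v: "v:V" "v \<notin> cspan nb" by blast
  obtain l :: "'a=>complex" where l: "clinear l" "ALL x:cspan nb. l x=0" "l v=1"
   using separating_functional[OF cvs.subspace_span v(2)] by (elim exE conjE)
  have "l (nvq w)=0" if "w:W" for w using l(2) nb(3) that by blast
  from nd[OF clinear_clinear_on[OF l(1)] this v(1)] l(3) show False by simp
 qed
qed

lemma functionals_eq:
 assumes l: "lin V l" "lin V m" and eq: "!!w. w:W==>l (nvq w)=(m (nvq w) :: complex)" and v: "v:V"
 shows "l v=m v"
proof -
 have "lin V (%v. l v + (-1) * m v)" by (intro lin_plus lin_cmult' l)
 from nd[OF this _ v] eq show ?thesis by simp
qed

lemma lift_V: "stable \<tau>==>lift \<tau> v:V"
 unfolding lift_def
proof (intro sub_sum[OF V] sub_scale[OF V] nvqV)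
 fix b assume "stable \<tau>" "b:nb"
 then show "\<tau> (\<pi> b):W" using nb_\<pi>[of b] by (auto simp: stable_def)
qed

lemma lift_linear: "lin V (lift \<tau>)"
proof (rule clinear_onI)
 fix x y c assume x: "x:V"
 show "lift \<tau> (c *. x)=c *. lift \<tau> x"
  using x by (simp add: lift_def cvs.representation_scale[OF nb(2)] span_nb cvs.scale_sum_right scaleC_scaleC)
 assume y: "y:V"
 show "lift \<tau> (x + y)=lift \<tau> x + lift \<tau> y"
  using x y by (simp add: lift_def cvs.representation_add[OF nb(2)] span_nb scaleC_add_left sum.distrib)
qed

lemma nb_expand: "v:V==>(SUM b:nb. crepresentation nb v b *. b)=v"
 by (rule cvs.sum_representation_eq[OF nb(2)]) (simp_all add: span_nb nb_finite)

lemma lift_functional: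
 assumes l: "lin V l" and \<tau>: "stable \<tau>"
 shows "l (lift \<tau> v)=(SUM b:nb. crepresentation nb v b *. l (nvq (\<tau> (\<pi> b))))"
 unfolding lift_def
proof (rule lin_lincomb[OF V l])
 fix b assume "b:nb"
 then show "nvq (\<tau> (\<pi> b)):V" using nb_\<pi>[of b] \<tau> by (intro nvqV) (auto simp: stable_def)
qed

text \<open>The point is that linear relations among points of the graph are respected: after
  applying \<open>l\<close>, the moved points are values of one functional \<open>l'\<close> at the
  old points, so the expansion in \<open>nb\<close> may be summed again.\<close>

lemma lift_nvq:
 assumes \<tau>: "stable \<tau>" and w: "w:W" shows "lift \<tau> (nvq w)=nvq (\<tau> w)"
proof (rule lin_eqI[OF fdV lift_V[OF \<tau>]])
 show "nvq (\<tau> w):V" using \<tau> w by (intro nvqV) (auto simp: stable_def)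
 fix l :: "'a=>complex" assume l: "lin V l"
 obtain l' where l': "lin V l'" "ALL w:W. l (nvq (\<tau> w))=l' (nvq w)" using \<tau> l unfolding stable_def by blast
 have "l (lift \<tau> (nvq w))=(SUM b:nb. crepresentation nb (nvq w) b *. l' b)"
  unfolding lift_functional[OF l \<tau>] using l'(2) nb_\<pi> by (intro sum.cong) simp_all
 also have "\<dots>=l' (SUM b:nb. crepresentation nb (nvq w) b *. b)"
  using nb_V by (intro lin_lincomb[OF V l'(1), symmetric]) blast
 also have "\<dots>=l (nvq (\<tau> w))" using nb_expand[OF nvqV[OF w]] l'(2) w by simp
 finally show "l (lift \<tau> (nvq w))=l (nvq (\<tau> w))" .
qed

text \<open>The graph spans \<open>V\<close>, so identities between linear maps need checking on the
  graph only. The group laws of the lifted actions are obtained from this.\<close>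

lemma maps_eq:
 assumes f: "lin V f" "f ` V \<subseteq> V" and g: "lin V g" "g ` V \<subseteq> V"
  and eq: "!!w. w:W==>f (nvq w)=g (nvq w)" and v: "v:V"
 shows "f v=g v"
proof (rule lin_eqI[OF fdV])
 show "f v:V" "g v:V" using f(2) g(2) v by auto
 fix l :: "'a=>complex" assume l: "lin V l"
 show "l (f v)=l (g v)"
  by (rule functionals_eq[OF lin_comp[OF f(1) l f(2)] lin_comp[OF g(1) l g(2)] _ v]) (simp add: eq)
qed

lemma lift_image: "stable \<tau>==>lift \<tau> ` V \<subseteq> V"
 using lift_V by auto

lemma lift_comp:
 assumes s: "stable sgq" and t: "stable \<tau>" and v: "v:V"
 shows "lift (%w. sgq (\<tau> w)) v=lift sgq (lift \<tau> v)"
proof (rule maps_eq[OF lift_linear lift_image[OF stable_comp[OF s t]] _ _ _ v])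
 show "lin V (%v. lift sgq (lift \<tau> v))" by (rule lin_comp[OF lift_linear lift_linear lift_image[OF t]])
 show "(%v. lift sgq (lift \<tau> v)) ` V \<subseteq> V" using lift_V[OF s] by auto
 fix w assume w: "w:W"
 have "\<tau> w:W" using t w by (auto simp: stable_def)
 then show "lift (%w. sgq (\<tau> w)) (nvq w)=lift sgq (lift \<tau> (nvq w))"
  by (simp add: lift_nvq[OF stable_comp[OF s t] w] lift_nvq[OF t w] lift_nvq[OF s])
qed

lemma lift_id:
 assumes s: "stable sgq" and eq: "!!w. w:W==>sgq w=w" and v: "v:V" shows "lift sgq v=v"
 by (rule maps_eq[OF lift_linear lift_image[OF s] _ _ _ v, of "%v. v"])
  (simp_all add: lift_nvq[OF s] eq clinear_on_def)

lemma lift_iso: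
 assumes s: "stable sgq" and t: "stable \<tau>" and i: "!!w. w:W==>sgq (\<tau> w)=w" "!!w. w:W==>\<tau> (sgq w)=w"
 shows "lin_iso V V (lift sgq)"
 unfolding lin_iso_def
proof (intro conjI lift_linear bij_betw_byWitness[of V "lift \<tau>"] ballI lift_image s t)
 fix v assume v: "v:V"
 show "lift \<tau> (lift sgq v)=v"
  using lift_comp[OF t s v] lift_id[OF stable_comp[OF t s] i(2) v] by simp
 show "lift sgq (lift \<tau> v)=v"
  using lift_comp[OF s t v] lift_id[OF stable_comp[OF s t] i(1) v] by simp
qed

end

section \<open>Dilations are of Euler type\<close>

context graph_chart
begin

lemma Z_invariant:
 assumes g: "lin_iso V V g" and \<tau>: "\<tau> ` W=W" and eq: "!!w. w:W==>g (nvq w)=nvq (\<tau> w)"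
 shows "image g ` Z=Z"
proof -
 have S: "(%w. cspan {nvq w}) ` W \<subseteq> proj V" using span1_proj[OF nvqV nvq_nz] by auto
 have "image g ` (%w. cspan {nvq w}) ` W=(%w. cspan {nvq (\<tau> w)}) ` W"
  unfolding image_image using image_span1[OF lin_isoD(1)[OF g] nvqV] eq by simp
 also have "\<dots>=(%w. cspan {nvq w}) ` \<tau> ` W" by (simp add: image_image)
 finally have "image g ` (%w. cspan {nvq w}) ` W=(%w. cspan {nvq w}) ` W" by (simp add: \<tau>)
 then show ?thesis using closure_image[OF V V g S] unfolding Z_def by simp
qed

lemma dilation_surj:
 assumes u: "u:W" and c: "c~=0" shows "(%w. u + c *. (w - u)) ` W=W"
proof (intro equalityI subsetI)
 fix y assume "y:(%w. u + c *. (w - u)) ` W"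
 then show "y:W" using u by (auto intro!: sub_add[OF W] sub_scale[OF W] sub_diff[OF W])
next
 fix y assume y: "y:W"
 have "u + inverse c *. (y - u):W"
  using u y by (intro sub_add[OF W] sub_scale[OF W] sub_diff[OF W])
 moreover have "y=u + c *. (u + inverse c *. (y - u) - u)" using c by (simp add: scaleC_scaleC scaleC_one)
 ultimately show "y:(%w. u + c *. (w - u)) ` W" by (rule rev_image_eqI)
qed

text \<open>The dilation reparametrizes the curve \<open>nvq (u + s *. w)\<close> by replacing
  \<open>s\<close> with \<open>c s\<close>, hence multiplies every derivative at
  \<open>s = 0\<close> by \<open>c\<close>. Fixed points in the open orbit correspond to fixed
  points of the dilation on \<open>W\<close>.\<close>

lemma dilation_euler_type:
 assumes u: "u:W" and rh: "mult_group_rep V rh"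
  and eq: "!!c w. c~=0==>w:W==>rh c (nvq w)=nvq (u + c *. (w - u))"
 shows "euler_type V Z (cspan {nvq u}) rh"
proof -
 interpret pp: proj_point V Z "nvq u" q by (rule chart_proj_point[OF u])
 have iso: "lin_iso V V (rh c)" if "c~=0" for c using rh that by (simp add: mult_group_rep_def)
 have inv: "image (rh c) ` Z=Z" if c: "c~=0" for c
  by (rule Z_invariant[OF iso[OF c] dilation_surj[OF u c] eq[OF c]])
 have rhpt: "rh c ` cspan {nvq w}=cspan {nvq (u + c *. (w - u))}" if "c~=0" "w:W" for c w
  using image_span1[OF lin_isoD(1)[OF iso[OF that(1)]] nvqV[OF that(2)]] eq[OF that] by simp
 have fixpt: "rh c ` cspan {nvq u}=cspan {nvq u}" if "c~=0" for c using rhpt[OF that u] by simp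
 have isolated: "ALL y:orbit. (ALL c. c~=0-->rh c ` y=y)-->y=cspan {nvq u}"
 proof (intro ballI impI)
  fix y assume "y : orbit" and fixd: "ALL c. c~=0-->rh c ` y=y"
  then obtain w where w: "w:W" "y=cspan {nvq w}" unfolding orbit_def by (elim imageE)
  \<comment> \<open>The factor 2 already detects fixed points: \<open>2 *. (w - u) = w - u\<close>
    forces \<open>w = u\<close>.\<close>
  let ?z = "u + 2 *. (w - u)"
  have zW: "?z:W" using dilation_surj[OF u, of 2] w(1) by auto
  have "cspan {nvq ?z}=cspan {nvq w}" using fixd[rule_format, of 2] rhpt[of 2 w] w by simp
  then have zc: "nvq ?z:cspan {nvq w}" using span1_self[of "nvq ?z"] by simp
  have e: "?z=w" by (rule orbit_point_eq[OF zW w(1) span1_self zc nvq_nz[OF zW]])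
  have "2 *. (w - u)=?z - u" by simp
  also have "\<dots>=1 *. (w - u)" unfolding e by (simp add: scaleC_one)
  finally have "w - u=0" by (simp only: cvs.scale_cancel_right) simp
  then have "w=u" by simp
  then show "y=cspan {nvq u}" using w(2) by simp
 qed
 have pull: "f \<circ> image (rh c) : pp.R" if f: "f : pp.R" and c: "c~=0" for f c
 proof -
  obtain p g where 1: "lrep V Z (nvq u) f p g" using f unfolding pp.local_ring_iff by (elim exE)
  obtain d where d: "p:homog V d" "g:homog V d" using 1 unfolding lrep_def by blast
  note l = lin_isoD[OF iso[OF c]]
  have "lrep V Z (nvq u) (f \<circ> image (rh c)) (%v. p (rh c v)) (%v. g (rh c v))"
   unfolding lrep_def
  proof (intro conjI exI[of _ d] ballI impI)
   show "(%v. p (rh c v)):homog V d" "(%v. g (rh c v)):homog V d"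
    using homog_pullback[OF V l(1) _ d(1)] homog_pullback[OF V l(1) _ d(2)] l(3) by simp_all
   show "g (rh c (nvq u))~=0" using eq[OF c u] pp.lrepD(3)[OF 1] by simp
   fix v assume v: "v:acone V Z" and ne: "g (rh c v)~=0"
   have im: "rh c ` cspan {v}=cspan {rh c v}" by (rule image_span1[OF l(1) coneD(1)[OF v]])
   have "rh c ` cspan {v}:Z" using inv[OF c] coneD(3)[OF v] by blast
   then have "rh c v:acone V Z"
    using l(4)[OF coneD(1)[OF v]] lin_iso_nz[OF V iso[OF c] coneD(1,2)[OF v]] im by (simp add: acone_def)
   then show "(f \<circ> image (rh c)) (cspan {v}) = p (rh c v) / g (rh c v)"
    using pp.lrepD(5)[OF 1 _ ne] im by simp
  qed
  then show ?thesis unfolding pp.local_ring_iff by blast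
 qed
 \<comment> \<open>The equivalence is required because tangent vectors are 0 outside the local ring,
   and the differential must respect this.\<close>
 have pull_iff: "f \<circ> image (rh c) : pp.R \<longleftrightarrow> f : pp.R" if c: "c~=0" for f c
 proof
  assume f: "f \<circ> image (rh c) : pp.R"
  have "inverse c~=0" using c by simp
  from pull[OF f this] have 1: "(f \<circ> image (rh c)) \<circ> image (rh (inverse c)) : pp.R" .
  have "germ_eq V Z (cspan {nvq u}) ((f \<circ> image (rh c)) \<circ> image (rh (inverse c))) f"
   unfolding pp.germ_eq_iff
  proof (intro exI[of _ 0] bexI[OF _ homog_const[of 1]] conjI ballI impI)
   fix v assume v: "v:acone V Z"
   have ci: "inverse c~=0" using c by simp
   have "rh c (rh (inverse c) v)=rh (c * inverse c) v" and "rh 1 v=v"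
    using rh c ci coneD(1)[OF v] unfolding mult_group_rep_def by metis+
   then have "rh c (rh (inverse c) v)=v" using c by simp
   then show "(f \<circ> image (rh c) \<circ> image (rh (inverse c))) (cspan {v})=f (cspan {v})"
    using image_span1[OF lin_isoD(1)[OF iso[OF ci]] coneD(1)[OF v]]
     image_span1[OF lin_isoD(1)[OF iso[OF c]] lin_isoD(4)[OF iso[OF ci] coneD(1)[OF v]]] by simp
  qed simp
  from pp.local_ring_germ[OF 1 this] show "f : pp.R" .
 qed (rule pull[OF _ c])
 have tang: "differential (image (rh c)) D=c *. D" if c: "c~=0" and D: "D:tangent V Z (cspan {nvq u})" for c D
 proof
  fix f
  obtain w where w: "w:W" "D=tvec V Z (nvq u) (dnu u w)"
   using D Dv_iso[OF u] unfolding lin_iso_def bij_betw_def by blast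
  show "differential (image (rh c)) D f=(c *. D) f"
  proof (cases "f : pp.R")
   case True
   have 1: "((%s. (f \<circ> image (rh c)) (cspan {nvq (u + s *. w)})) has_field_derivative D (f \<circ> image (rh c))) (at 0)"
    unfolding w(2) by (rule Dv_derivative[OF u pull[OF True c] w(1)])
   have "(f \<circ> image (rh c)) (cspan {nvq (u + s *. w)})=f (cspan {nvq (u + (s * c) *. w)})" for s
    using rhpt[OF c line_W[OF u w(1)]] by (simp add: scaleC_scaleC mult.commute)
   moreover have "((%s. f (cspan {nvq (u + (s * c) *. w)})) has_field_derivative D f * c) (at 0)"
   proof -
    have "((%s. s * c) has_field_derivative c) (at 0)" by (auto intro!: derivative_eq_intros)
    from DERIV_chain2[of "%s. f (cspan {nvq (u + s *. w)})" "D f" "%s. s * c" 0, OF _ this]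
    show ?thesis using Dv_derivative[OF u True w(1)] w(2) by simp
   qed
   ultimately have "D (f \<circ> image (rh c))=D f * c" using DERIV_unique[OF 1] by simp
   then show ?thesis by (simp add: differential_def scaleC_fun_def mult.commute)
  next
   case False
   then have "f \<circ> image (rh c) \<notin> pp.R" using pull_iff[OF c] by simp
   then show ?thesis using False pp.tangentD(5)[OF D] by (simp add: differential_def scaleC_fun_def)
  qed
 qed
 show ?thesis
  unfolding euler_type_def
 proof (intro conjI allI impI rh)
  show "nonsingular_point V Z (cspan {nvq u})" by (rule chart_nonsingular[OF u])
  show "EX U. openin (zariski_on V Z) U&cspan {nvq u}:U &
   (ALL y:U. (ALL c. c~=0-->rh c ` y=y)-->y=cspan {nvq u})"
  proof (intro exI[of _ orbit] conjI orbit_open isolated)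
   show "cspan {nvq u} : orbit" unfolding orbit_def using u by (rule imageI)
  qed
  fix c :: complex assume c: "c~=0"
  show "image (rh c) ` Z=Z" by (rule inv[OF c])
  show "rh c ` cspan {nvq u}=cspan {nvq u}" by (rule fixpt[OF c])
  show "EX \<mu>. ALL D:tangent V Z (cspan {nvq u}). differential (image (rh c)) D=\<mu> *. D"
   by (intro exI[of _ c] ballI tang[OF c])
 qed
qed

end

locale homogeneous_chart = spanning_chart +
 assumes transl: "v:W ==> stable (%w. w + v)" and scale: "stable (%w. c *. w)"
begin

lemma dilation_stable:
 assumes "u:W" shows "stable (%w. u + c *. (w - u))"
proof -
 have "stable (%w. (c *. (w + (- u))) + u)"
  by (intro stable_comp[OF transl[OF assms]] stable_comp[OF scale] transl sub_neg[OF W assms])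
 then show ?thesis by (simp add: add.commute)
qed

lemma translation_rep: "vector_group_rep W V (%v. lift (%w. w + v))"
 unfolding vector_group_rep_def
proof (intro conjI ballI allI impI)
 fix v w assume v: "v:W" and w: "w:W"
 show "lift (%x. x + (v + w)) y=lift (%x. x + v) (lift (%x. x + w) y)" if y: "y:V" for y
  using lift_comp[OF transl[OF v] transl[OF w] y] by (simp add: add.assoc add.commute[of v])
next
 fix v assume v: "v:W"
 show "lin_iso V V (lift (%w. w + v))"
  by (rule lift_iso[OF transl[OF v] transl[OF sub_neg[OF W v]]]) simp_all
next
 fix y assume "y:V"
 then show "lift (%w. w + 0) y=y" by (intro lift_id transl sub_0[OF W]) simp
next
 fix y and l :: "'a=>complex" assume y: "y:V" and l: "lin V l"
 have "(%w. SUM b:nb. crepresentation nb y b * l (nvq (\<pi> b + w))) : pfuns W"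
  using nb_\<pi> by (intro poly_funs_sum poly_funs_cmult poly_funs_shift[OF W nvq_poly[OF l]]) blast
 then show "(%w. l (lift (%x. x + w) y)) : pfuns W"
  by (rule poly_funs_cong[OF W]) (simp add: lift_functional[OF l transl])
qed

lemma dilation_rep:
 assumes u: "u:W" shows "mult_group_rep V (%c. lift (%w. u + c *. (w - u)))"
 unfolding mult_group_rep_def
proof (intro conjI ballI allI impI)
 note st = dilation_stable[OF u]
 show "lin_iso V V (lift (%w. u + c *. (w - u)))" if "c~=0" for c
  using that by (intro lift_iso[OF st st[of "inverse c"]]) (simp_all add: scaleC_scaleC scaleC_one)
 show "lift (%w. u + 1 *. (w - u)) v=v" if "v:V" for v
  by (rule lift_id[OF st _ that]) (simp add: scaleC_one)
 show "lift (%w. u + (c * d) *. (w - u)) v=lift (%w. u + c *. (w - u)) (lift (%w. u + d *. (w - u)) v)"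
  if "v:V" for c d v
  using lift_comp[OF st[of c] st[of d] that] by (simp add: scaleC_scaleC)
 fix v and l :: "'a=>complex" assume v: "v:V" and l: "lin V l"
 have "(%w. l (nvq (u + w))) : pfuns W" by (rule poly_funs_shift[OF W nvq_poly[OF l] u])
 then have "EX P. ALL c. l (nvq (u + (0 + c *. (\<pi> b - u)))) = poly P c" if "b:nb" for b
  using that nb_\<pi>[of b] u by (intro poly_funs_line[OF W] sub_0[OF W] sub_diff[OF W]) simp_all
 then have "ALL b:nb. EX P. ALL c. l (nvq (u + c *. (\<pi> b - u))) = poly P c" by simp
 then obtain P where P: "ALL b:nb. ALL c. l (nvq (u + c *. (\<pi> b - u))) = poly (P b) c" by (rule bchoice[THEN exE])
 show "EX p m. ALL c. c~=0-->l (lift (%w. u + c *. (w - u)) v) = poly p c / c ^ m"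
  \<comment> \<open>Values along a dilation are polynomial in \<open>c\<close>, so the exponent
    \<open>m\<close> of the denominator is 0.\<close>
  by (intro exI[of _ "SUM b:nb. smult (crepresentation nb v b) (P b)"] exI[of _ 0] allI impI)
   (simp add: lift_functional[OF l st] poly_sum P)
qed

lemma chart_euler_type:
 assumes u: "u:W" shows "euler_type V Z (cspan {nvq u}) (%c. lift (%w. u + c *. (w - u)))"
 by (rule dilation_euler_type[OF u dilation_rep[OF u]]) (rule lift_nvq[OF dilation_stable[OF u]])

lemma chart_euler_symmetric: "euler_symmetric V Z"
 unfolding euler_symmetric_def
proof (intro conjI exI[of _ orbit] Z_variety orbit_open ballI)
 show "orbit~={}" using sub_0[OF W] by (auto simp: orbit_def)
 fix x assume "x : orbit"
 then obtain u where u: "u:W" "x=cspan {nvq u}" unfolding orbit_def by (elim imageE)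
 show "EX rh. euler_type V Z x rh" unfolding u(2) by (rule exI, rule chart_euler_type[OF u(1)])
qed

lemma translation_invariant: "v:W==>image (lift (%w. w + v)) ` Z=Z"
proof (rule Z_invariant[of _ "%w. w + v"])
 assume v: "v:W"
 show "lin_iso V V (lift (%w. w + v))" using translation_rep v by (simp add: vector_group_rep_def)
 show "lift (%w. w + v) (nvq w)=nvq (w + v)" if "w:W" for w by (rule lift_nvq[OF transl[OF v] that])
 show "(%w. w + v) ` W=W"
 proof (intro equalityI subsetI)
  fix y assume "y:(%w. w + v) ` W"
  then show "y:W" using v sub_add[OF W] by auto
 next
  fix y assume "y:W"
  then show "y:(%w. w + v) ` W" using v sub_diff[OF W] by (intro rev_image_eqI[of "y - v"]) simp_all
 qed
qed

lemma Z_nondegenerate: "nondegenerate V Z"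
 unfolding nondegenerate_def
proof (intro allI impI ballI)
 fix l :: "'a=>complex" and v
 assume l: "lin V l&(ALL L:Z. ALL v:L. l v=0)" and v: "v:V"
 show "l v=0"
 proof (rule nd[OF _ _ v])
  show "lin V l" using l by simp
  show "l (nvq w)=0" if "w:W" for w using l nvq_Z[OF that] span1_self[of "nvq w"] by blast
 qed
qed

end

section \<open>The variety of a symbol system\<close>

lemma finite_support_finite_dim:
 assumes "finite L" shows "finite_dim {f :: 'x=>complex. ALL x. x \<notin> L-->f x=0}"
proof (rule finite_dimI)
 let ?T = "{f :: 'x=>complex. ALL x. x \<notin> L-->f x=0}"
 let ?d = "%a x. if x=a then 1 else (0::complex)"
 show "csubspace ?T" by (rule cvs.subspaceI) (simp_all add: scaleC_fun_def)
 show "finite (?d ` L)" using assms by simp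
 show "?T \<subseteq> cspan (?d ` L)"
 proof
  fix f assume f: "f:?T"
  have "f=(SUM a:L. f a *. ?d a)"
  proof
   fix x
   have "(SUM a:L. f a *. ?d a) x=(SUM a:L. if a=x then f a else 0)"
    unfolding sum_fun_apply by (rule sum.cong) (simp_all add: scaleC_fun_def)
   then show "f x=(SUM a:L. f a *. ?d a) x" using f assms by simp
  qed
  moreover have "(SUM a:L. f a *. ?d a):cspan (?d ` L)"
   by (rule cvs.span_sum, rule cvs.span_scale, rule cvs.span_base, rule imageI)
  ultimately show "f:cspan (?d ` L)" by simp
 qed
qed

lemma sym_form_zero_on_basis:
 assumes W: "finite_dim W" and "phq : sym_forms W k"
  and z: "!!bs. length bs=k ==> set bs \<subseteq> vbasis W==>phq bs=0"
 shows "phq=(%_. 0)"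
 using assms(2) z
proof (induction k arbitrary: phq)
 case 0
 show ?case
 proof
  fix ws show "phq ws=0" using 0 sym_forms_outside[OF "0.prems"(1), of ws] by (cases ws) simp_all
 qed
next
 case (Suc k)
 have cb: "contract b phq=(%_. 0)" if b: "b:vbasis W" for b
 proof (rule Suc.IH)
  show "contract b phq : sym_forms W k" using b vbasis(1)[of W] by (intro contract_sym_forms[OF Suc.prems(1)]) blast
  show "contract b phq bs=0" if "length bs=k" "set bs \<subseteq> vbasis W" for bs
   using Suc.prems(2)[of "b # bs"] that b by (simp add: contract_def)
 qed
 have "contract w phq ws=0" if w: "w:W" for w ws
 proof -
  have "contract w phq=(SUM b:vbasis W. coord W b w *. contract b phq)"
   by (rule lin_expand[OF W contract_linear[OF Suc.prems(1)] w])
  then show ?thesis by (simp add: sum_fun_apply scaleC_fun_def cb)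
 qed
 then have *: "phq (w # ws)=0" if "w:W" for w ws using that by (simp add: contract_def)
 show ?case
 proof
  fix ws show "phq ws=0" using * sym_forms_outside[OF Suc.prems(1), of ws] by (cases ws) auto
 qed
qed

text \<open>Restriction to lists of basis vectors is injective by multilinearity, and there are
  finitely many such lists of length \<open>k\<close>.\<close>

lemma sym_forms_finite_dim:
 assumes W: "finite_dim W" shows "finite_dim (sym_forms W k)"
proof -
 define L where "L={bs. set bs \<subseteq> vbasis W&length bs=k}"
 have L: "finite L" unfolding L_def by (rule finite_lists_length_eq[OF finite_vbasis[OF W]])
 let ?f = "%phq bs. if bs:L then phq bs else (0::complex)"
 show ?thesis
 proof (rule inj_linear_dim(1)[OF sym_forms_csubspace, of _ _ ?f])
  show "lin (sym_forms W k) ?f" by (rule clinear_onI) (auto simp: scaleC_fun_def fun_eq_iff)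
  show "?f ` sym_forms W k \<subseteq> {f. ALL x. x \<notin> L-->f x=0}" by auto
  show "finite_dim {f. ALL x. x \<notin> L-->f x=(0::complex)}" by (rule finite_support_finite_dim[OF L])
  show "inj_on ?f (sym_forms W k)"
  proof (rule inj_onI)
   fix phq psq assume *: "phq : sym_forms W k" "psq : sym_forms W k" "?f phq=?f psq"
   have d: "phq - psq : sym_forms W k" using *(1,2) by (rule sub_diff[OF sym_forms_csubspace])
   have "phq - psq=(%_. 0)"
   proof (rule sym_form_zero_on_basis[OF W d])
    fix bs assume "length bs=k" "set bs \<subseteq> vbasis W"
    then have "bs:L" by (simp add: L_def)
    then show "(phq - psq) bs=0" using fun_cong[OF *(3), of bs] by simp
   qed
   then show "phq=psq" by (simp add: fun_eq_iff)
  qed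
 qed
qed

definition dual_coord :: "'a::complex_vector set=>'a=>'a=>complex"
 where "dual_coord A b=(%a. if a:A then coord A b a else 0)"

lemma dual_csubspace: "csubspace (dual A)"
 by (rule cvs.subspaceI)
  (simp_all add: dual_def lin_zero lin_plus lin_cmult' scaleC_fun_def zero_fun_def plus_fun_def)

lemma dual_coord_dual: "csubspace A==>dual_coord A b:dual A"
 using lin_cong[OF _ coord_linear, of A b "dual_coord A b"] by (simp add: dual_def dual_coord_def)

lemma dual_expand:
 assumes A: "finite_dim A" and \<eta>: "\<eta>:dual A"
 shows "\<eta>=(SUM b:vbasis A. \<eta> b *. dual_coord A b)"
proof
 fix a
 show "\<eta> a=(SUM b:vbasis A. \<eta> b *. dual_coord A b) a"
 proof (cases "a:A")
  case True
  have "lin A \<eta>" using \<eta> by (simp add: dual_def)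
  from lin_expand[OF A this True] True show ?thesis
   by (simp add: sum_fun_apply scaleC_fun_def dual_coord_def mult.commute)
 next
  case False
  then show ?thesis using \<eta> by (simp add: sum_fun_apply scaleC_fun_def dual_coord_def dual_def)
 qed
qed

text \<open>The double dual in finite dimension; it turns functionals on the summands of
  \<open>V_F\<close> back into elements of \<open>F k\<close>.\<close>

lemma dual_reflexive:
 assumes A: "finite_dim A" and l: "lin (dual A) l"
 shows "EX a:A. ALL \<eta>:dual A. l \<eta>=\<eta> a"
proof (intro bexI ballI)
 let ?a = "SUM b:vbasis A. l (dual_coord A b) *. b"
 note sA = fd_sub[OF A]
 show "?a:A" using vbasis(1)[of A] by (intro sub_sum[OF sA] sub_scale[OF sA]) blast
 fix \<eta> assume \<eta>: "\<eta>:dual A"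
 have "l \<eta>=l (SUM b:vbasis A. \<eta> b *. dual_coord A b)" using dual_expand[OF A \<eta>] by simp
 also have "\<dots>=(SUM b:vbasis A. \<eta> b *. l (dual_coord A b))"
  by (rule lin_lincomb[OF dual_csubspace l dual_coord_dual[OF sA]])
 also have "\<dots>=(SUM b:vbasis A. l (dual_coord A b) *. \<eta> b)" by (simp add: mult.commute)
 also have "\<dots>=\<eta> ?a"
  using \<eta> vbasis(1)[of A] by (intro lin_lincomb[OF sA, symmetric]) (auto simp: dual_def)
 finally show "l \<eta>=\<eta> ?a" .
qed

lemma clinear_translate: "lin S (translate v)"
 by (rule clinear_onI) (auto simp: translate_def scaleC_prod_def scaleC_add_left scaleC_add_right scaleC_scaleC)

locale symbol =
 fixes W :: "'w::complex_vector set" and r :: nat and F :: "nat=>('w list=>complex) set"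
 assumes fdW: "finite_dim W" and ss: "symbol_system W r F"
begin

abbreviation "VV \<equiv> VF W r F"

lemma W: "csubspace W" using fdW by (rule fd_sub)
lemma r1: "1<=r" and Fsub: "csubspace (F k)" and Fsym: "F k \<subseteq> sym_forms W k"
 and F0: "F 0 = sym_forms W 0" and F1: "F 1 = sym_forms W 1"
 using ss by (simp_all add: symbol_system_def)

lemma F_above: "r < k==>F k={0}"
proof -
 assume "r < k"
 then have "1<=k - r" "r + (k - r)=k" by simp_all
 then show ?thesis using ss unfolding symbol_system_def by metis
qed

lemma F_sym: "phq:F k==>phq : sym_forms W k"
 using Fsym by blast

lemma F_fd: "finite_dim (F k)"
 by (rule finite_dim_subspace[OF sym_forms_finite_dim[OF fdW] Fsub Fsym])

lemma contract_F:
 assumes phq: "phq:F (Suc k)" and v: "v:W" and k: "Suc k<=r" shows "contract v phq:F k"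
proof (cases "k=0")
 case True
 then show ?thesis using contract_sym_forms[OF F_sym[OF phq] v] F0 by simp
next
 case False
 then have "F (k + 1) \<subseteq> prolong W k (F k)" using ss k unfolding symbol_system_def by simp
 then show ?thesis using phq v by (auto simp: prolong_def)
qed

lemma contract_iter_F:
 assumes "phq:F (i + j)" and v: "v:W" and "i + j<=r" shows "(%ws. phq (replicate i v @ ws)):F j"
 using assms(1,3)
proof (induction i arbitrary: phq)
 case (Suc i)
 have "contract v phq:F (i + j)" using Suc.prems v by (intro contract_F) simp_all
 from Suc.IH[OF this] Suc.prems(2) show ?case by (simp add: contract_def)
qed simp

text \<open>The functional on \<open>V_F\<close> attached to an element of \<open>F k\<close>.
  Degrees 0 and 1 are separate because those summands are stored as a scalar and a vector, not as
  functionals on \<open>F 0\<close> and \<open>F 1\<close>.\<close>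

definition pr :: "nat=>('w list=>complex)=>'w target=>complex"
 where "pr k phq X=(if k=0 then fst X * phq [] else if k=1 then phq [fst (snd X)] else snd (snd X) k phq)"

lemma VF_iff: "X:VV \<longleftrightarrow> fst (snd X):W&(ALL k. if 2<=k&k<=r then snd (snd X) k:dual (F k) else snd (snd X) k=0)"
 by (cases X) (simp add: VF_def)

lemma VFD:
 assumes "X:VV"
 shows "fst (snd X):W" "2<=k==>k<=r ==> snd (snd X) k:dual (F k)" "\<not> (2<=k&k<=r) ==> snd (snd X) k=0"
 using assms unfolding VF_iff by metis+

lemma dual_F: "0:dual (F k)" "\<eta>:dual (F k)==>\<zeta>:dual (F k)==>\<eta> + \<zeta>:dual (F k)"
 "\<eta>:dual (F k)==>c *. \<eta>:dual (F k)"
 by (rule sub_0[OF dual_csubspace] sub_add[OF dual_csubspace] sub_scale[OF dual_csubspace]; assumption?)+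

lemma VF_csubspace: "csubspace VV"
proof (rule cvs.subspaceI)
 show "0:VV" using sub_0[OF W] dual_F(1) by (simp add: VF_iff)
 fix X Y c assume X: "X:VV"
 show "c *. X:VV"
  unfolding VF_iff using VFD[OF X]
  by (simp add: scaleC_prod_def scaleC_fun_def[of c "snd (snd X)"] sub_scale[OF W] dual_F(3))
 assume Y: "Y:VV"
 show "X + Y:VV"
  unfolding VF_iff using VFD[OF X] VFD[OF Y] by (simp add: sub_add[OF W] dual_F(2))
qed

definition comp :: "nat=>(('w list=>complex)=>complex)=>'w target"
 where "comp k \<eta>=(0, 0, %j. if j=k then \<eta> else 0)"

lemma comp_VF: "2<=k==>k<=r==>\<eta>:dual (F k)==>comp k \<eta>:VV"
 by (simp add: VF_iff comp_def sub_0[OF W] dual_F(1))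

lemma comp_linear: "lin S (comp k)"
 by (rule clinear_onI) (auto simp: comp_def scaleC_prod_def scaleC_fun_def fun_eq_iff)

lemma VF_decomp:
 assumes X: "X:VV"
 shows "X=(fst X, 0, 0) + (0, fst (snd X), 0) + (SUM k:{2..r}. comp k (snd (snd X) k))"
proof -
 have "snd (snd X) j=(SUM k:{2..r}. if j=k then snd (snd X) k else 0)" for j
  using VFD(3)[OF X, of j] by auto
 then have "snd (snd X)=(SUM k:{2..r}. (%j. if j=k then snd (snd X) k else 0))"
  by (simp add: fun_eq_iff sum_fun_apply)
 then show ?thesis by (simp add: prod_eq_iff fst_sum snd_sum comp_def)
qed

lemma unit_VF: "(t, 0, 0):VV" "w:W==>(0, w, 0):VV"
 by (simp_all add: VF_iff sub_0[OF W] dual_F(1))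

lemma VF_finite_dim: "finite_dim VV"
proof (rule finite_dimI[OF VF_csubspace])
 define B where "B={(1, 0, 0)} \<union> (%b. (0, b, 0)) ` vbasis W \<union>
  (UN k:{2..r}. (%b. comp k (dual_coord (F k) b)) ` vbasis (F k))"
 show "finite B" unfolding B_def using finite_vbasis[OF fdW] finite_vbasis[OF F_fd] by simp
 show "VV \<subseteq> cspan B"
 proof
  fix X assume X: "X:VV"
  have 0: "(fst X, 0, 0):cspan B"
  proof -
   have e: "(fst X, 0, 0)=fst X *. ((1, 0, 0) :: 'w target)" by (simp add: scaleC_prod_def)
   have "(1, 0, 0):B" by (simp add: B_def)
   then show ?thesis unfolding e by (intro cvs.span_scale cvs.span_base)
  qed
  have 1: "(0, fst (snd X), 0):cspan B"
  proof -
   let ?f = "%b. (0, b, 0) :: 'w target"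
   have l: "lin W ?f" by (rule clinear_onI) (simp_all add: scaleC_prod_def)
   show ?thesis
    unfolding lin_expand[OF fdW l VFD(1)[OF X]]
    by (rule cvs.span_sum, rule cvs.span_scale, rule cvs.span_base) (simp add: B_def)
  qed
  have 2: "comp k (snd (snd X) k):cspan B" if k: "k:{2..r}" for k
  proof -
   have \<eta>: "snd (snd X) k:dual (F k)" using VFD(2)[OF X] k by simp
   have "comp k (snd (snd X) k)=comp k (SUM b:vbasis (F k). snd (snd X) k b *. dual_coord (F k) b)"
    using dual_expand[OF F_fd \<eta>] by simp
   also have "\<dots>=(SUM b:vbasis (F k). snd (snd X) k b *. comp k (dual_coord (F k) b))"
    by (rule lin_lincomb[OF dual_csubspace comp_linear dual_coord_dual[OF Fsub]])
   also have "\<dots>:cspan B"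
    by (rule cvs.span_sum, rule cvs.span_scale, rule cvs.span_base) (use k in \<open>auto simp: B_def\<close>)
   finally show ?thesis .
  qed
  show "X:cspan B"
   by (subst VF_decomp[OF X]) (intro cvs.span_add 0 1 cvs.span_sum 2)
 qed
qed

lemma pr_linear:
 assumes phq: "phq:F k" shows "lin VV (pr k phq)"
proof (rule clinear_onI)
 have l1: "lin W (%w. phq [w])" if "k=1" using sym_forms_linear[OF F_sym[OF phq], of "[]" "[]"] that by simp
 fix X Y c assume X: "X:VV"
 show "pr k phq (c *. X)=c *. pr k phq X"
  using lin_scale[OF l1 VFD(1)[OF X], of c] by (simp add: pr_def scaleC_prod_def scaleC_fun_def)
 assume Y: "Y:VV"
 show "pr k phq (X + Y) = pr k phq X + pr k phq Y"
  using lin_add[OF l1 VFD(1)[OF X] VFD(1)[OF Y]] by (simp add: pr_def distrib_right)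
qed

lemma functional_of: "(!!k. phq k:F k)==>lin VV (%X. SUM k<=r. pr k (phq k) X)"
 using lin_lincomb_fun[of "{..r}" VV "%k. pr k (phq k)" "%_. 1"] pr_linear by simp

text \<open>Duality between \<open>V_F\<close> and the sum of the \<open>F k\<close>: the degree 0
  and 1 parts exist because \<open>F 0\<close> and \<open>F 1\<close> contain all forms, the others
  by \<open>dual_reflexive\<close>.\<close>

lemma functionals:
 assumes l: "lin VV l"
 obtains phq where "ALL k. phq k:F k" "ALL X:VV. l X=(SUM k<=r. pr k (phq k) X)"
proof -
 note V = VF_csubspace
 define phq0 where "phq0=(%ws::'w list. if ws=[] then l (1, 0, 0) else 0)"
 define phq1 where "phq1=(%ws::'w list. if length ws=1 & set ws \<subseteq> W then l (0, hd ws, 0) else 0)"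
 have phq0F: "phq0:F 0" unfolding F0 sym_forms_def phq0_def by (auto dest: mset_eq_length)
 have l1: "lin W (%w. l (0, w, 0))"
 proof (rule clinear_onI)
  fix x y c assume x: "x:W"
  show "l (0, c *. x, 0)=c *. l (0, x, 0)"
   using lin_scale[OF l unit_VF(2)[OF x], of c] by (simp add: scaleC_prod_def)
  assume y: "y:W"
  show "l (0, x + y, 0)=l (0, x, 0) + l (0, y, 0)"
   using lin_add[OF l unit_VF(2)[OF x] unit_VF(2)[OF y]] by simp
 qed
 have phq1F: "phq1:F 1"
  unfolding F1 sym_forms_def
 proof (intro CollectI conjI allI impI)
  show "phq1 ws=0" if "\<not> (length ws=1 & set ws \<subseteq> W)" for ws
   unfolding phq1_def using that by (simp only: if_False)
  show "lin W (%x. phq1 (us @ x # vs))" if "length us + 1 + length vs=1" for us vs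
   using that by (intro lin_cong[OF W l1]) (simp add: phq1_def)
  show "phq1 ws=phq1 ws'" if m: "mset ws=mset ws'" for ws ws'
  proof (cases "length ws=1")
   case True
   then obtain a b where "ws=[a]" "ws'=[b]" using mset_eq_length[OF m] by (auto simp: length_Suc_conv)
   then show ?thesis using m by simp
  next
   case False
   then show ?thesis using mset_eq_length[OF m] by (simp add: phq1_def)
  qed
 qed
 have "ALL k:{2..r}. EX psq. psq:F k&(ALL \<eta>:dual (F k). l (comp k \<eta>)=\<eta> psq)"
 proof
  fix k assume k: "k:{2..r}"
  have "lin (dual (F k)) (%\<eta>. l (comp k \<eta>))"
   using k comp_VF by (intro lin_comp[OF comp_linear l]) auto
  from dual_reflexive[OF F_fd this] show "EX psq. psq:F k&(ALL \<eta>:dual (F k). l (comp k \<eta>)=\<eta> psq)" by (simp add: Bex_def)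
 qed
 then obtain psq where psq: "ALL k:{2..r}. psq k:F k&(ALL \<eta>:dual (F k). l (comp k \<eta>)=\<eta> (psq k))" by (rule bchoice[THEN exE])
 define phq where "phq k=(if k=0 then phq0 else if k=1 then phq1 else if k<=r then psq k else 0)" for k
 have phqF: "phq k:F k" for k
  using phq0F phq1F psq sub_0[OF Fsub[of k]] by (auto simp: phq_def)
 have "l X=(SUM k<=r. pr k (phq k) X)" if X: "X:VV" for X
 proof -
  have X2: "comp k (snd (snd X) k):VV" if "k:{2..r}" for k using VFD(2)[OF X] that by (intro comp_VF) simp_all
  have "l X=l ((fst X, 0, 0) + (0, fst (snd X), 0) + (SUM k:{2..r}. comp k (snd (snd X) k)))"
   by (rule arg_cong[OF VF_decomp[OF X]])
  also have "\<dots>=l (fst X, 0, 0) + l (0, fst (snd X), 0) + (SUM k:{2..r}. l (comp k (snd (snd X) k)))"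
  proof -
   note U = unit_VF(1)[of "fst X"] unit_VF(2)[OF VFD(1)[OF X]]
   have "l ((fst X, 0, 0) + (0, fst (snd X), 0) + (SUM k:{2..r}. comp k (snd (snd X) k))) =
     l ((fst X, 0, 0) + (0, fst (snd X), 0)) + l (SUM k:{2..r}. comp k (snd (snd X) k))"
    by (rule lin_add[OF l sub_add[OF V U] sub_sum[OF V X2]])
   also have "l ((fst X, 0, 0) + (0, fst (snd X), 0))=l (fst X, 0, 0) + l (0, fst (snd X), 0)"
    by (rule lin_add[OF l U])
   also have "l (SUM k:{2..r}. comp k (snd (snd X) k))=(SUM k:{2..r}. l (comp k (snd (snd X) k)))"
    by (rule lin_sum[OF V l X2])
   finally show ?thesis .
  qed
  also have "l (fst X, 0, 0) = pr 0 (phq 0) X"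
   using lin_scale[OF l unit_VF(1), of "fst X" 1] by (simp add: pr_def phq_def phq0_def scaleC_prod_def)
  also have "l (0, fst (snd X), 0) = pr 1 (phq 1) X"
   using VFD(1)[OF X] by (simp add: pr_def phq_def phq1_def)
  also have "(SUM k:{2..r}. l (comp k (snd (snd X) k)))=(SUM k:{2..r}. pr k (phq k) X)"
   using psq VFD(2)[OF X] by (intro sum.cong) (auto simp: pr_def phq_def)
  also have "pr 0 (phq 0) X + pr 1 (phq 1) X + (SUM k:{2..r}. pr k (phq k) X)=(SUM k<=r. pr k (phq k) X)"
  proof -
   have "{..r}=insert 0 (insert 1 {2..r})" using r1 by auto
   then show ?thesis by (simp add: add.assoc)
  qed
  finally show ?thesis .
 qed
 then show thesis by (intro that[of phq]) (simp_all add: phqF)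
qed

definition nu :: "'w=>'w target"
 where "nu w = phi_vec r F (1, w)"

lemma nu_eq: "nu w=(1, w, %k. if 2<=k&k<=r then power_functional (F k) k w else 0)"
 by (simp add: nu_def phi_vec_def scaleC_one cong: if_cong)

lemma power_functional_dual: "power_functional (F k) k w:dual (F k)"
 unfolding dual_def power_functional_def
 using sub_add[OF Fsub] sub_scale[OF Fsub]
 by (auto intro!: clinear_onI simp: scaleC_fun_def)

lemma phi_vec_VF: "w:W ==> phi_vec r F (t, w):VV"
 using sub_scale[OF dual_csubspace power_functional_dual]
 by (simp add: VF_iff phi_vec_def sub_scale[OF W])

lemma pr_phi_vec:
 assumes phq: "phq:F k" and k: "k<=r" and w: "w:W"
 shows "pr k phq (phi_vec r F (t, w))=t ^ (r - k) * phq (replicate k w)"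
proof -
 have "phq [c *. w]=c * phq [w]" if "k=1" for c
  using sym_form_scale[OF F_sym[OF phq] W w, of c] that by simp
 then show ?thesis using phq k by (auto simp: pr_def phi_vec_def scaleC_fun_def power_functional_def)
qed

lemma phi_vec_scale: "t~=0==>w:W ==> phi_vec r F (t, w)=t ^ r *. nu (inverse t *. w)"
proof (rule lin_eqI[OF VF_finite_dim])
 assume t: "t~=0" and w: "w:W"
 have iw: "inverse t *. w:W" by (rule sub_scale[OF W w])
 have nV: "nu (inverse t *. w):VV" unfolding nu_def by (rule phi_vec_VF[OF iw])
 show "phi_vec r F (t, w):VV" by (rule phi_vec_VF[OF w])
 show "t ^ r *. nu (inverse t *. w):VV" by (rule sub_scale[OF VF_csubspace nV])
 fix l :: "'w target=>complex" assume l: "lin VV l"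
 obtain phq where phq: "ALL k. phq k:F k" "ALL X:VV. l X=(SUM k<=r. pr k (phq k) X)" by (rule functionals[OF l])
 have "l (t ^ r *. nu (inverse t *. w))=t ^ r * l (nu (inverse t *. w))"
  using lin_scale[OF l nV] by simp
 also have "\<dots>=(SUM k<=r. t ^ r * (inverse t ^ k * phq k (replicate k w)))"
  using phq nV pr_phi_vec[OF _ _ iw, of _ _ 1] sym_form_scale[OF F_sym W w]
  by (simp add: nu_def sum_distrib_left)
 also have "\<dots>=(SUM k<=r. t ^ (r - k) * phq k (replicate k w))"
 proof (rule sum.cong[OF refl])
  fix k assume "k:{..r}"
  then have "t ^ r=t ^ (r - k) * t ^ k" by (simp add: power_add[symmetric])
  then show "t ^ r * (inverse t ^ k * phq k (replicate k w))=t ^ (r - k) * phq k (replicate k w)"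
   using t by (simp add: power_inverse)
 qed
 also have "\<dots>=l (phi_vec r F (t, w))" using phq phi_vec_VF[OF w] pr_phi_vec[OF _ _ w] by simp
 finally show "l (phi_vec r F (t, w))=l (t ^ r *. nu (inverse t *. w))" by simp
qed

lemma functional_nu:
 assumes "ALL k. phq k:F k" "ALL X:VV. l X=(SUM k<=r. pr k (phq k) X)" "w:W"
 shows "l (nu w)=(SUM k<=r. phq k (replicate k w))"
 using assms phi_vec_VF[OF assms(3), of 1] pr_phi_vec[OF _ _ assms(3), of _ _ 1] by (simp add: nu_def)

lemma nu_VV: "w:W==>nu w:VV"
 unfolding nu_def by (rule phi_vec_VF)

lemma functional_nu_eq:
 assumes "!!k. psq k:F k"
 shows "lin VV (%X. SUM k<=r. pr k (psq k) X)" "w:W==>(SUM k<=r. pr k (psq k) (nu w))=(SUM k<=r. psq k (replicate k w))"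
 using functional_of[OF assms] pr_phi_vec[OF assms, of _ w 1] by (simp_all add: nu_def)

end

text \<open>The first two components of \<open>nu w\<close> are 1 and \<open>w\<close>, so this is a
  graph over \<open>W\<close>. It spans \<open>V_F\<close>: if a functional vanishes on it,
  comparing powers of \<open>s\<close> at \<open>s *. w\<close> separates the degrees, and
  polarization kills each form.\<close>

sublocale symbol \<subseteq> chart: spanning_chart VV W nu fst "%X. fst (snd X)"
proof
 show "finite_dim VV" by (rule VF_finite_dim)
 show "finite_dim W" by (rule fdW)
 show "nu w:VV" if "w:W" for w by (rule nu_VV[OF that])
 show nup: "(%w. l (nu w)) : pfuns W" if l: "lin VV l" for l :: "'w target=>complex"
 proof -
  obtain phq where phq: "ALL k. phq k:F k" "ALL X:VV. l X=(SUM k<=r. pr k (phq k) X)" by (rule functionals[OF l])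
  have "(%w. SUM k<=r. phq k (replicate k w)) : pfuns W"
   using phq(1) by (intro poly_funs_sum sym_form_poly_funs[OF fdW] F_sym) simp
  then show ?thesis by (rule poly_funs_cong[OF W]) (simp add: functional_nu[OF phq])
 qed
 show "lin VV fst" "lin VV (%X. fst (snd X))" by (simp_all add: clinear_on_def scaleC_prod_def)
 show "fst (nu w)=1" "fst (snd (nu w))=w" for w by (simp_all add: nu_eq)
 show "fst (snd X):W" if "X:VV" for X by (rule VFD(1)[OF that])
 show "l X=0" if l: "lin VV l" and z: "!!w. w:W==>l (nu w)=0" and X: "X:VV"
  for l :: "'w target=>complex" and X
 proof -
  obtain phq where phq: "ALL k. phq k:F k" "ALL X:VV. l X=(SUM k<=r. pr k (phq k) X)" by (rule functionals[OF l])
  have "phq k=(%_. 0)" if k: "k<=r" for k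
  proof (rule polarization_zero[OF F_sym W])
   show "phq k:F k" using phq by simp
   fix w assume w: "w:W"
   have "(SUM k<=r. phq k (replicate k w) * s ^ k)=0" for s
    using z[OF sub_scale[OF W w], of s] functional_nu[OF phq sub_scale[OF W w], of s] phq(1)
     sym_form_scale[OF F_sym W w, of _ _ s] by (simp add: mult.commute)
   then have "ALL k<=r. phq k (replicate k w)=0" by (subst polyfun_eq_0[symmetric]) simp
   then show "phq k (replicate k w)=0" using k by simp
  qed
  moreover have "pr k (%_. 0) X=0" if "k<=r" for k
  proof -
   have "pr k (0 *. 0) X=0"
    using VFD(2)[OF X, of k] that lin_0[OF Fsub[of k]] by (auto simp: pr_def dual_def)
   then show ?thesis by (simp add: zero_fun_def)
  qed
  ultimately show ?thesis using phq(2) X by simp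
 qed
qed

section \<open>The group actions on the variety of a symbol system\<close>

context symbol
begin

text \<open>This is where the prolongation condition enters: in the binomial expansion of a form at
  \<open>w + v\<close> the coefficients are iterated contractions with \<open>v\<close>, which stay
  in \<open>F\<close>.\<close>

lemma translation_stable: "v:W==>chart.stable (%w. w + v)"
 unfolding chart.stable_def
proof (intro conjI allI impI)
 assume v: "v:W"
 show "(%w. w + v) ` W \<subseteq> W" using v sub_add[OF W] by auto
 fix l :: "'w target=>complex" assume l: "lin VV l"
 obtain phq where phq: "ALL k. phq k:F k" "ALL X:VV. l X=(SUM k<=r. pr k (phq k) X)" by (rule functionals[OF l])
 \<comment> \<open>Collects the terms with exactly \<open>j\<close> arguments \<open>w\<close>; the
   other \<open>k - j\<close> arguments are \<open>v\<close>.\<close>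
 define psq where "psq j=(SUM k:{k. j<=k&k<=r}. of_nat (k choose j) *. (%ws. phq k (replicate (k - j) v @ ws)))" for j
 have psqF: "psq j:F j" for j
  unfolding psq_def
 proof (intro sub_sum[OF Fsub] sub_scale[OF Fsub])
  fix k assume "k:{k. j<=k&k<=r}"
  then show "(%ws. phq k (replicate (k - j) v @ ws)):F j"
   using phq(1) by (intro contract_iter_F[OF _ v]) simp_all
 qed
 have "l (nu (w + v))=(SUM j<=r. psq j (replicate j w))" if w: "w:W" for w
 proof -
  let ?t = "%k j. of_nat (k choose j) * phq k (replicate (k - j) v @ replicate j w)"
  have "l (nu (w + v))=(SUM k<=r. phq k (replicate k (w + v)))"
   by (rule functional_nu[OF phq sub_add[OF W w v]])
  also have "\<dots>=(SUM k<=r. SUM j<=k. ?t k j)"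
   using phq(1) by (intro sum.cong refl sym_form_binomial[OF F_sym W v w]) simp
  also have "\<dots>=(SUM k<=r. SUM j<=r. if j<=k then ?t k j else 0)"
   by (intro sum.cong refl sum.mono_neutral_cong_left) auto
  also have "\<dots>=(SUM j<=r. SUM k<=r. if j<=k then ?t k j else 0)" by (rule sum.swap)
  also have "\<dots>=(SUM j<=r. SUM k:{k. j<=k&k<=r}. ?t k j)"
   by (intro sum.cong refl sum.mono_neutral_cong_right) auto
  also have "\<dots>=(SUM j<=r. psq j (replicate j w))" by (simp add: psq_def sum_fun_apply scaleC_fun_def)
  finally show ?thesis .
 qed
 then show "EX l'. lin VV l'&(ALL w:W. l (nu (w + v))=l' (nu w))"
  using functional_nu_eq[OF psqF] by (intro exI[of _ "%X. SUM k<=r. pr k (psq k) X"]) simp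
qed

lemma scale_stable: "chart.stable (%w. c *. w)"
 unfolding chart.stable_def
proof (intro conjI allI impI)
 show "(%w. c *. w) ` W \<subseteq> W" using sub_scale[OF W] by auto
 fix l :: "'w target=>complex" assume l: "lin VV l"
 obtain phq where phq: "ALL k. phq k:F k" "ALL X:VV. l X=(SUM k<=r. pr k (phq k) X)" by (rule functionals[OF l])
 define psq where "psq k=c ^ k *. phq k" for k
 have psqF: "psq k:F k" for k unfolding psq_def using phq(1) by (intro sub_scale[OF Fsub]) simp
 have "l (nu (c *. w))=(SUM j<=r. psq j (replicate j w))" if w: "w:W" for w
  unfolding functional_nu[OF phq sub_scale[OF W w]]
  using phq(1) sym_form_scale[OF F_sym W w] by (simp add: psq_def scaleC_fun_def)
 then show "EX l'. lin VV l'&(ALL w:W. l (nu (c *. w))=l' (nu w))"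
  using functional_nu_eq[OF psqF] by (intro exI[of _ "%X. SUM k<=r. pr k (psq k) X"]) simp
qed

end

sublocale symbol \<subseteq> chart: homogeneous_chart VV W nu fst "%X. fst (snd X)"
 by unfold_locales (rule translation_stable, assumption, rule scale_stable)

section \<open>Comparison with the rational map\<close>

context symbol
begin

lemma nu_0: "nu 0=(1, 0, 0)"
proof -
 have "power_functional (F k) k 0=0" if "2<=k" for k
 proof
  fix phq
  show "power_functional (F k) k 0 phq=0 phq"
   using sym_form_scale[OF F_sym W sub_0[OF W], of phq k 0] that
   by (auto simp: power_functional_def power_0_left)
 qed
 then show ?thesis by (auto simp: nu_eq fun_eq_iff)
qed

lemma base_point_eq: "base_point=cspan {nu 0}"
 by (simp add: base_point_def nu_0)

lemma phi_vec_homog: "phi_vec r F (c *. u)=c ^ r *. phi_vec r F u" if "snd u:W"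
proof -
 obtain t w where u: "u=(t, w)" by (cases u)
 have w: "w:W" using that u by simp
 show ?thesis
 proof (rule lin_eqI[OF VF_finite_dim])
  show V1: "phi_vec r F (c *. u):VV" using phi_vec_VF[OF sub_scale[OF W w]] by (simp add: u scaleC_prod_def)
  show V2: "c ^ r *. phi_vec r F u:VV" unfolding u by (rule sub_scale[OF VF_csubspace phi_vec_VF[OF w]])
  fix l :: "'w target=>complex" assume l: "lin VV l"
  obtain phq where phq: "ALL k. phq k:F k" "ALL X:VV. l X=(SUM k<=r. pr k (phq k) X)" by (rule functionals[OF l])
  have "l (phi_vec r F (c *. u))=(SUM k<=r. (c * t) ^ (r - k) * (c ^ k * phq k (replicate k w)))"
   using phq V1 pr_phi_vec[OF _ _ sub_scale[OF W w]] sym_form_scale[OF F_sym W w] by (simp add: u scaleC_prod_def)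
  also have "\<dots>=(SUM k<=r. c ^ r * (t ^ (r - k) * phq k (replicate k w)))"
  proof (rule sum.cong[OF refl])
   fix k assume "k:{..r}"
   then have "c ^ r=c ^ (r - k) * c ^ k" by (simp add: power_add[symmetric])
   then show "(c * t) ^ (r - k) * (c ^ k * phq k (replicate k w))=c ^ r * (t ^ (r - k) * phq k (replicate k w))"
    by (simp add: power_mult_distrib)
  qed
  also have "\<dots>=c ^ r * l (phi_vec r F u)"
   using phq phi_vec_VF[OF w] pr_phi_vec[OF _ _ w] by (simp add: u sum_distrib_left)
  also have "\<dots>=l (c ^ r *. phi_vec r F u)" unfolding u using lin_scale[OF l phi_vec_VF[OF w]] by simp
  finally show "l (phi_vec r F (c *. u))=l (c ^ r *. phi_vec r F u)" .
 qed
qed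

lemma phi_span1:
 assumes "snd u:W" shows "phi r F (cspan {u})=cspan {phi_vec r F u}"
proof
 have "phi_vec r F ` cspan {u} \<subseteq> cspan {phi_vec r F u}"
  using phi_vec_homog[OF assms] by (auto simp: mem_span1)
 then show "phi r F (cspan {u}) \<subseteq> cspan {phi_vec r F u}" unfolding phi_def by (rule cvs.span_minimal[OF _ cvs.subspace_span])
 have "{phi_vec r F u} \<subseteq> phi_vec r F ` cspan {u}" using span1_self[of u] by blast
 then show "cspan {phi_vec r F u} \<subseteq> phi r F (cspan {u})" unfolding phi_def by (rule cvs.span_mono)
qed

lemma phi_affine: "w:W ==> phi r F (cspan {(1, w)})=cspan {nu w}"
 using phi_span1[of "(1, w)"] by (simp add: nu_def)

lemma phi_dom_span1:
 assumes u: "snd u:W" "u~=0" shows "cspan {u} : phi_dom W r F \<longleftrightarrow> phi_vec r F u~=0"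
proof
 assume "cspan {u} : phi_dom W r F"
 then show "phi_vec r F u~=0" using span1_self[of u] u(2) by (simp add: phi_dom_def)
next
 assume ne: "phi_vec r F u~=0"
 have "cspan {u} : proj (UNIV \<times> W)" using u by (intro span1_proj) (auto simp: mem_Times_iff)
 moreover have "phi_vec r F y~=0" if "y:cspan {u} - {0}" for y
 proof -
  obtain c where c: "y=c *. u" using \<open>y : cspan {u} - {0}\<close> by (auto simp: mem_span1)
  then have "c~=0" using that by auto
  then show ?thesis unfolding c using phi_vec_homog[OF u(1), of c] ne by simp
 qed
 ultimately show "cspan {u} : phi_dom W r F" by (simp add: phi_dom_def)
qed

lemma phi_dom_rep:
 assumes "L : phi_dom W r F"
 obtains t w where "w:W" "L=cspan {(t, w)}" "(t, w)~=0" "phi_vec r F (t, w)~=0"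
proof -
 have "L : proj (UNIV \<times> W)" using assms by (simp add: phi_dom_def)
 from proj_rep[OF this] obtain u where u: "u:UNIV \<times> W" "u~=0" "L=cspan {u}" by (elim bexE conjE)
 have "phi_vec r F u~=0" using assms u phi_dom_span1[of u] by (auto simp: mem_Times_iff)
 then show thesis using u by (intro that[of "snd u" "fst u"]) (auto simp: mem_Times_iff)
qed

text \<open>Values of functionals on \<open>phi_vec\<close> are polynomial in \<open>t\<close>, so points with \<open>t = 0\<close> are limits of points with \<open>t \<noteq> 0\<close>.\<close>

lemma phi_vec_curve:
 assumes l: "lin VV l" and w: "w:W" "v:W"
 shows "EX P. ALL t. l (phi_vec r F (t, w + t *. v)) = poly P t"
proof -
 obtain phq where phq: "ALL k. phq k:F k" "ALL X:VV. l X=(SUM k<=r. pr k (phq k) X)" by (rule functionals[OF l])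
 have "ALL k. EX P. ALL t. phq k (replicate k (w + t *. v)) = poly P t"
  using poly_funs_line[OF W sym_form_poly_funs[OF fdW F_sym] w] phq(1) by simp
 then obtain P where P: "ALL k. ALL t. phq k (replicate k (w + t *. v)) = poly (P k) t" by (rule choice[THEN exE])
 have wt: "w + t *. v:W" for t using w by (intro sub_add[OF W] sub_scale[OF W])
 have "l (phi_vec r F (t, w + t *. v)) = poly (SUM k<=r. monom 1 (r - k) * P k) t" for t
  using phq phi_vec_VF[OF wt] pr_phi_vec[OF _ _ wt] P by (simp add: poly_sum poly_monom)
 then show ?thesis by blast
qed

text \<open>The closure in \<open>MF\<close> also involves images of points with
  \<open>t = 0\<close>. They are limits of affine points, so they already lie in the closure of the
  graph.\<close>

lemma MF_eq: "MF W r F=chart.Z"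
proof -
 let ?S = "phi r F ` phi_dom W r F" and ?T = "(%w. cspan {nu w}) ` W"
 have TS: "?T \<subseteq> ?S"
 proof
  fix L assume "L:?T"
  then obtain w where w: "w:W" "L=cspan {nu w}" by (elim imageE)
  have "cspan {(1, w)} : phi_dom W r F"
   using phi_dom_span1[of "(1, w)"] w(1) chart.nvq_nz[OF w(1)] by (simp add: nu_def zero_prod_def)
  then show "L:?S" unfolding w(2) phi_affine[OF w(1), symmetric] by (rule imageI)
 qed
 have ST: "?S \<subseteq> zariski VV closure_of ?T"
 proof
  fix L assume "L:?S"
  then obtain L' where L': "L' : phi_dom W r F" "L = phi r F L'" by (elim imageE)
  obtain t w where tw: "w:W" "L'=cspan {(t, w)}" "phi_vec r F (t, w)~=0" by (rule phi_dom_rep[OF L'(1)])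
  have L: "L=cspan {phi_vec r F (t, w)}" unfolding L'(2) tw(2) using phi_span1[of "(t, w)"] tw(1) by simp
  note pV = phi_vec_VF[OF tw(1)]
  show "L:zariski VV closure_of ?T"
   unfolding in_closure_zariski
  proof (intro conjI allI impI)
   show "L : proj VV" unfolding L by (rule span1_proj[OF pV tw(3)])
   fix d p assume p: "p:homog VV d" and "L:basic_open VV p"
   then have ne: "p (phi_vec r F (t, w))~=0" using basic_span1[OF p pV tw(3)] L by simp
   have "EX P. ALL s. p (phi_vec r F (s, w)) = poly P s"
   proof (rule poly_funs_curve[OF homogD(1)[OF p]])
    fix l :: "'w target=>complex" assume "lin VV l"
    from phi_vec_curve[OF this tw(1) sub_0[OF W]] show "EX P. ALL s. l (phi_vec r F (s, w)) = poly P s" by simp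
   qed
   then obtain P where P: "ALL s. p (phi_vec r F (s, w)) = poly P s" by (elim exE)
   \<comment> \<open>A polynomial in \<open>s\<close> that is nonzero at \<open>s = t\<close> is
     nonzero at some \<open>s\<close> different from 0, even if \<open>t = 0\<close>.\<close>
   have "EX s. s~=0 & poly P s~=0" using poly_eq_0_off_0[of P t] ne P by auto
   then obtain s where s: "s~=0" "p (phi_vec r F (s, w))~=0" using P by auto
   have iw: "inverse s *. w:W" by (rule sub_scale[OF W tw(1)])
   have "p (nu (inverse s *. w))~=0"
    using s(2) homogD(2)[OF p nu_VV[OF iw], of "s ^ r"] unfolding phi_vec_scale[OF s(1) tw(1)] by auto
   then have "cspan {nu (inverse s *. w)}:basic_open VV p"
    using basic_span1[OF p nu_VV[OF iw] chart.nvq_nz[OF iw]] by simp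
   then show "EX M:?T. M:basic_open VV p" using iw by blast
  qed
 qed
 have "zariski VV closure_of ?T \<subseteq> zariski VV closure_of ?S" by (rule closure_of_mono[OF TS])
 moreover have "zariski VV closure_of ?S \<subseteq> zariski VV closure_of ?T"
  by (rule closure_of_minimal[OF ST closedin_closure_of])
 ultimately show ?thesis unfolding MF_def chart.Z_def by simp
qed

abbreviation "act v \<equiv> chart.lift (%w. w + v)"

text \<open>For nonzero \<open>t\<close> both sides come from the graph by
  \<open>phi_vec_scale\<close>. As both are polynomial in \<open>t\<close>, the identity extends to
  \<open>t = 0\<close>, outside the chart.\<close>

lemma act_phi_vec:
 assumes v: "v:W" and w: "w:W" shows "act v (phi_vec r F (t, w)) = phi_vec r F (t, w + t *. v)"
proof (rule lin_eqI[OF VF_finite_dim])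
 note st = translation_stable[OF v]
 show "act v (phi_vec r F (t, w)):VV" by (rule chart.lift_V[OF st])
 have wt: "w + t *. v:W" for t using w v by (intro sub_add[OF W] sub_scale[OF W])
 show "phi_vec r F (t, w + t *. v):VV" by (rule phi_vec_VF[OF wt])
 fix l :: "'w target=>complex" assume l: "lin VV l"
 have m: "lin VV (%X. l (act v X))" by (rule lin_comp[OF chart.lift_linear l chart.lift_image[OF st]])
 obtain P where P: "ALL t. l (act v (phi_vec r F (t, w))) = poly P t"
  using phi_vec_curve[OF m w sub_0[OF W]] by auto
 obtain Q where Q: "ALL t. l (phi_vec r F (t, w + t *. v)) = poly Q t" using phi_vec_curve[OF l w v] by (elim exE)
 have "poly (P - Q) s=0" if s: "s~=0" for s
 proof -
  have iw: "inverse s *. w:W" by (rule sub_scale[OF W w])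
  have "act v (phi_vec r F (s, w)) = s ^ r *. act v (nu (inverse s *. w))"
   unfolding phi_vec_scale[OF s w] by (rule lin_scale[OF chart.lift_linear nu_VV[OF iw]])
  also have "\<dots> = s ^ r *. nu (inverse s *. w + v)" using chart.lift_nvq[OF st iw] by simp
  also have "inverse s *. w + v=inverse s *. (w + s *. v)"
   using s by (simp add: scaleC_add_right scaleC_scaleC scaleC_one)
  also have "s ^ r *. nu (inverse s *. (w + s *. v)) = phi_vec r F (s, w + s *. v)"
   by (rule phi_vec_scale[OF s wt, symmetric])
  finally have "l (act v (phi_vec r F (s, w)))=l (phi_vec r F (s, w + s *. v))" by (rule arg_cong)
  then show ?thesis unfolding P[rule_format] Q[rule_format] by simp
 qed
 from poly_eq_0_off_0[OF this, of t] show "l (act v (phi_vec r F (t, w)))=l (phi_vec r F (t, w + t *. v))"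
  using P Q by simp
qed

lemma act_phi:
 assumes v: "v:W" and L: "L : phi_dom W r F"
 shows "act v ` phi r F L = phi r F (translate v ` L)"
proof -
 obtain t w where tw: "w:W" "L=cspan {(t, w)}" by (rule phi_dom_rep[OF L])
 have wt: "w + t *. v:W" using tw(1) v by (intro sub_add[OF W] sub_scale[OF W])
 have "act v ` phi r F L=cspan {act v (phi_vec r F (t, w))}"
  unfolding tw(2) using phi_span1[of "(t, w)"] tw(1) image_span1[OF chart.lift_linear phi_vec_VF[OF tw(1)]] by simp
 also have "\<dots> = phi r F (cspan {(t, w + t *. v)})"
  unfolding act_phi_vec[OF v tw(1)] using phi_span1[of "(t, w + t *. v)"] wt by simp
 also have "cspan {(t, w + t *. v)}=translate v ` L"
  unfolding tw(2) using image_span1[OF clinear_translate[of UNIV v], of "(t, w)"] by (simp add: translate_def)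
 finally show ?thesis .
qed

lemma act_base: "v:W==>act v ` base_point=cspan {nu v}"
 unfolding base_point_eq
 using image_span1[OF chart.lift_linear nu_VV[OF sub_0[OF W]]] chart.lift_nvq[OF translation_stable sub_0[OF W]] by simp

lemma orbit_base: "{act v ` base_point | v. v:W}=chart.orbit"
 unfolding chart.orbit_def using act_base by force

text \<open>The limit selects the degree \<open>k\<close> component of \<open>l\<close>, which
  belongs to \<open>F k\<close>; polarization shows that it is the given form. With
  \<open>form_limit\<close> this yields both inclusions for the fundamental forms.\<close>

lemma limit_form:
 assumes phq: "phq : sym_forms W k" and l: "lin VV l"
  and lim: "ALL w:W. ((%s. l (nu (0 + s *. w)) / s ^ k) \<longlongrightarrow> phq (replicate k w)) (at 0)"
 shows "phq:F k"
proof -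
 obtain psq where psq: "ALL k. psq k:F k" "ALL X:VV. l X=(SUM k<=r. pr k (psq k) X)" by (rule functionals[OF l])
 have psqs: "psq j : sym_forms W j" for j using F_sym psq(1) by blast
 define \<xi> where "\<xi>=(if k<=r then psq k else 0)"
 have "phq=\<xi>"
 proof (rule polarization_unique[OF phq _ W])
  show "\<xi> : sym_forms W k" using psqs sub_0[OF sym_forms_csubspace[of W k]] by (simp add: \<xi>_def)
  fix w assume w: "w:W"
  have "((%s. (SUM j<=r. psq j (replicate j (s *. w))) / s ^ k) \<longlongrightarrow> phq (replicate k w)) (at 0)"
   using bspec[OF lim w] functional_nu[OF psq sub_scale[OF W w]] by simp
  from line_expansion_limit[OF W psqs w this] show "phq (replicate k w)=\<xi> (replicate k w)" by (auto simp: \<xi>_def)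
 qed
 moreover have "\<xi>:F k" using psq(1) sub_0[OF Fsub[of k]] by (simp add: \<xi>_def)
 ultimately show ?thesis by simp
qed

lemma form_limit:
 assumes phq: "phq:F k"
 shows "EX l. lin VV l&(ALL w:W. ((%s. l (nu (0 + s *. w)) / s ^ k) \<longlongrightarrow> phq (replicate k w)) (at 0))"
proof (cases "k<=r")
 case True
 define psq where "psq j=(if j=k then phq else 0)" for j
 have psqF: "psq j:F j" for j using phq sub_0[OF Fsub[of j]] by (simp add: psq_def)
 let ?l = "%X. SUM k<=r. pr k (psq k) X"
 have "((%s. ?l (nu (0 + s *. w)) / s ^ k) \<longlongrightarrow> phq (replicate k w)) (at 0)" if w: "w:W" for w
 proof -
  have "?l (nu (0 + s *. w)) = s ^ k * phq (replicate k w)" for s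
  proof -
   have "?l (nu (0 + s *. w))=(SUM j<=r. psq j (replicate j (s *. w)))"
    using functional_nu_eq(2)[OF psqF sub_scale[OF W w]] by simp
   also have "\<dots>=(SUM j<=r. if j=k then phq (replicate k (s *. w)) else 0)"
    by (rule sum.cong) (simp_all add: psq_def)
   also have "\<dots> = s ^ k * phq (replicate k w)" using True sym_form_scale[OF F_sym[OF phq] W w] by simp
   finally show ?thesis .
  qed
  then have "eventually (%s. phq (replicate k w)=?l (nu (0 + s *. w)) / s ^ k) (at 0)"
   by (simp add: eventually_at_filter)
  from Lim_transform_eventually[OF tendsto_const this] show ?thesis .
 qed
 then show ?thesis using functional_of[OF psqF] by blast
next
 case False
 then have "phq=0" using phq F_above by simp
 then show ?thesis by (intro exI[of _ "%_. 0"]) (simp add: lin_zero)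
qed

lemma fundamental_forms: "fundamental_forms_iso VV chart.Z base_point W F"
proof -
 note W0 = sub_0[OF W]
 let ?h = "%w. tvec VV chart.Z (nu 0) (chart.dnu 0 w)" and ?T = "tangent VV chart.Z base_point"
 have h: "lin_iso W ?T ?h" unfolding base_point_eq by (rule chart.Dv_iso[OF W0])
 have hl: "lin W ?h" "?h ` W \<subseteq> ?T" using lin_isoD[OF h] by auto
 have g: "lin_iso ?T W (inv_into W ?h)" by (rule lin_iso_inv[OF W h])
 have T: "csubspace ?T" using sub_image[OF W hl(1)] lin_isoD(3)[OF h] by simp
 \<comment> \<open>In degrees 0 and 1 both systems consist of all forms, so only surjectivity of the
   pullback has to be seen; pulling back along the inverse provides preimages.\<close>
 have low: "pullback_form W ?h ` sym_forms ?T k = sym_forms W k" for k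
 proof (intro equalityI subsetI)
  fix phq assume "phq : pullback_form W ?h ` sym_forms ?T k"
  then show "phq : sym_forms W k" using pullback_sym_forms[OF W hl] by (elim imageE) simp
 next
  fix phq assume phq: "phq : sym_forms W k"
  have "pullback_form ?T (inv_into W ?h) phq : sym_forms ?T k"
   using lin_isoD[OF g] by (intro pullback_sym_forms[OF T _ _ phq]) auto
  moreover have "phq = pullback_form W ?h (pullback_form ?T (inv_into W ?h) phq)"
  proof
   fix ws
   show "phq ws = pullback_form W ?h (pullback_form ?T (inv_into W ?h) phq) ws"
   proof (cases "set ws \<subseteq> W")
    case True
    then have "map (%w. inv_into W ?h (?h w)) ws=map (%w. w) ws"
     using inv_into_f_f[OF lin_isoD(2)[OF h]] by (intro map_cong refl) blast
    moreover have "set (map ?h ws) \<subseteq> ?T" using True hl(2) by auto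
    ultimately show ?thesis using True by (simp add: pullback_form_def o_def)
   next
    case False
    then show ?thesis using sym_forms_outside[OF phq, of ws] by (simp add: pullback_form_def)
   qed
  qed
  ultimately show "phq : pullback_form W ?h ` sym_forms ?T k" by (simp only: image_eqI)
 qed
 have "pullback_form W ?h ` fundamental_form VV chart.Z base_point k=F k" for k
 proof (cases "k<=1")
  case True
  then have "k=0 \<or> k=1" by auto
  then have "F k = sym_forms W k" using F0 F1 by auto
  then show ?thesis using True low[of k] by (simp add: fundamental_form_def)
 next
  case False
  then have "2<=k" by simp
  from chart.fundamental_form_chart[OF W0 this] show ?thesis
   unfolding base_point_eq using limit_form form_limit F_sym by auto
 qed
 then show ?thesis unfolding fundamental_forms_iso_def using h by blast
qed

theorem symbol_variety:
 "base_point:MF W r F&base_point = phi r F (cspan {(1, 0)}) &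
 (EX rh. vector_group_rep W VV rh &
  (ALL v:W. ALL L:phi_dom W r F. rh v ` phi r F L = phi r F (translate v ` L)) &
  (ALL v:W. image (rh v) ` MF W r F=MF W r F) &
  openin (zariski_on VV (MF W r F)) {rh v ` base_point | v. v:W} &
  (EX f. biregular (affine_zariski W) (affine_regular_funs W)
   (zariski_on VV {rh v ` base_point | v. v:W}) (regular_funs VV) f)) &
 (EX rh. euler_type VV (MF W r F) base_point rh &
  (ALL c w. c~=0-->w:W-->rh c ` phi r F (cspan {(1, w)}) = phi r F (cspan {(1, c *. w)}))) &
 euler_symmetric VV (MF W r F)&nonsingular_point VV (MF W r F) base_point &
 nondegenerate VV (MF W r F)&fundamental_forms_iso VV (MF W r F) base_point W F"
 unfolding MF_eq
proof (intro conjI)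
 note W0 = sub_0[OF W]
 show "base_point:chart.Z" unfolding base_point_eq by (rule chart.nvq_Z[OF W0])
 show "base_point = phi r F (cspan {(1, 0)})" unfolding phi_affine[OF W0] base_point_eq ..
 show "nonsingular_point VV chart.Z base_point" unfolding base_point_eq by (rule chart.chart_nonsingular[OF W0])
 show "EX rh. vector_group_rep W VV rh &
  (ALL v:W. ALL L:phi_dom W r F. rh v ` phi r F L = phi r F (translate v ` L)) &
  (ALL v:W. image (rh v) ` chart.Z=chart.Z) &
  openin (zariski_on VV chart.Z) {rh v ` base_point | v. v:W} &
  (EX f. biregular (affine_zariski W) (affine_regular_funs W)
   (zariski_on VV {rh v ` base_point | v. v:W}) (regular_funs VV) f)"
 proof (rule exI[of _ act], intro conjI ballI)
  show "vector_group_rep W VV act" by (rule chart.translation_rep)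
  show "act v ` phi r F L = phi r F (translate v ` L)" if "v:W" "L : phi_dom W r F" for v L by (rule act_phi[OF that])
  show "image (act v) ` chart.Z=chart.Z" if "v:W" for v by (rule chart.translation_invariant[OF that])
  show "openin (zariski_on VV chart.Z) {act v ` base_point | v. v:W}" unfolding orbit_base by (rule chart.orbit_open)
  show "EX f. biregular (affine_zariski W) (affine_regular_funs W)
   (zariski_on VV {act v ` base_point | v. v:W}) (regular_funs VV) f"
   unfolding orbit_base by (rule exI, rule chart.chart_biregular)
 qed
 \<comment> \<open>Written as a dilation about \<open>u = 0\<close>, to match
   \<open>chart_euler_type\<close>.\<close>
 let ?rh = "%c. chart.lift (%w. 0 + c *. (w - 0))"
 show "EX rh. euler_type VV chart.Z base_point rh &
  (ALL c w. c~=0-->w:W-->rh c ` phi r F (cspan {(1, w)}) = phi r F (cspan {(1, c *. w)}))"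
 proof (intro exI[of _ ?rh] conjI allI impI)
  show "euler_type VV chart.Z base_point ?rh" unfolding base_point_eq by (rule chart.chart_euler_type[OF W0])
  fix c w assume w: "w:W"
  have cw: "c *. w:W" by (rule sub_scale[OF W w])
  show "?rh c ` phi r F (cspan {(1, w)}) = phi r F (cspan {(1, c *. w)})"
   unfolding phi_affine[OF w] phi_affine[OF cw] image_span1[OF chart.lift_linear nu_VV[OF w]]
    chart.lift_nvq[OF chart.dilation_stable[OF W0] w] by simp
 qed
qed (rule chart.chart_euler_symmetric chart.Z_nondegenerate fundamental_forms)+

end

section \<open>Torus actions\<close>

text \<open>Multiplication by \<open>d ^ N\<close> gives a polynomial with all nonzero scalars as
  roots. This independence of characters underlies every comparison of weights below.\<close>

lemma laurent_zero:
 fixes a :: "int=>complex"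
 assumes z: "!!d. d~=0==>(SUM k:{-int N..int N}. d powi k * a k)=0" and k: "k:{-int N..int N}"
 shows "a k=0"
proof -
 define P where "P=(SUM s<=2*N. monom (a (int s - int N)) s)"
 have "poly P d=0" if d: "d~=0" for d
 proof -
  have "poly P d=(SUM s<=2*N. d ^ s * a (int s - int N))"
   by (simp add: P_def poly_sum poly_monom mult.commute)
  also have "\<dots>=(SUM k:{-int N..int N}. d ^ N * (d powi k * a k))"
  proof (rule sum.reindex_bij_witness[of _ "%k. nat (k + int N)" "%s. int s - int N"])
   fix s assume "s:{..2*N}"
   have "d powi (int s - int N)=d ^ s / d ^ N" using power_int_diff[of d "int s" "int N"] d by simp
   then show "d ^ N * (d powi (int s - int N) * a (int s - int N))=d ^ s * a (int s - int N)" using d by simp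
  qed auto
  also have "\<dots>=d ^ N * (SUM k:{-int N..int N}. d powi k * a k)" by (rule sum_distrib_left[symmetric])
  finally show ?thesis using z[OF d] by simp
 qed
 from poly_eq_0_off_0[OF this] have "P=0" using poly_all_0_iff_0 by blast
 moreover have "coeff P (nat (k + int N))=a k" using k by (auto simp: P_def coeff_sum nat_le_iff)
 ultimately show ?thesis by simp
qed

lemma laurent_eq:
 fixes a b :: "int=>complex"
 assumes "!!d. d~=0==>(SUM k:{-int N..int N}. d powi k * a k)=(SUM k:{-int N..int N}. d powi k * b k)"
  and "k:{-int N..int N}"
 shows "a k=b k"
 using laurent_zero[where N=N and a="%k. a k - b k" and k=k] assms by (simp add: right_diff_distrib sum_subtractf)

text \<open>A representation of the multiplicative group given by its weight projections
  \<open>E k\<close>; \<open>N\<close> bounds the weights. \<open>Th\<close> is the group action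
  itself.\<close>

locale graded_space =
 fixes V :: "'v::complex_vector set" and E :: "int=>'v=>'v" and N :: nat
 assumes fdV: "finite_dim V" and E_lin: "lin V (E k)" and E_V: "v:V==>E k v:V"
  and E_sum: "v:V==>(SUM k:{-int N..int N}. E k v)=v"
  and E_E: "v:V==>E k (E l v)=(if k=l then E l v else 0)"
  and E_out: "k \<notin> {-int N..int N}==>v:V==>E k v=0"
begin

lemma V: "csubspace V" using fdV by (rule fd_sub)

definition Th :: "complex=>'v=>'v"
 where "Th d v=(SUM k:{-int N..int N}. d powi k *. E k v)"

lemma Th_V: "v:V==>Th d v:V"
 unfolding Th_def by (intro sub_sum[OF V] sub_scale[OF V] E_V)

lemma Th_lin: "lin V (Th d)"
proof -
 have "lin V (%v. SUM k:{-int N..int N}. d powi k *. E k v)" by (rule lin_lincomb_fun) (rule E_lin)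
 then show ?thesis unfolding Th_def[abs_def] .
qed

lemma E_eq: "u:V==>v:V==>(!!k. E k u=E k v)==>u=v"
proof -
 assume uv: "u:V" "v:V" and eq: "!!k. E k u=E k v"
 have "(SUM k:{-int N..int N}. E k u)=(SUM k:{-int N..int N}. E k v)" by (rule sum.cong[OF refl eq])
 then show "u=v" unfolding E_sum[OF uv(1)] E_sum[OF uv(2)] .
qed

lemma E_Th: assumes v: "v:V" shows "E k (Th d v)=d powi k *. E k v"
proof -
 have "E k (Th d v)=(SUM l:{-int N..int N}. d powi l *. E k (E l v))"
  unfolding Th_def by (rule lin_lincomb[OF V E_lin E_V[OF v]])
 also have "\<dots>=(SUM l:{-int N..int N}. if l=k then d powi k *. E k v else 0)"
  by (rule sum.cong) (auto simp: E_E[OF v])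
 also have "\<dots>=d powi k *. E k v" using E_out[of k v] v by simp
 finally show ?thesis .
qed

lemma Th_Th: assumes v: "v:V" shows "Th c (Th d v)=Th (c * d) v"
 by (rule E_eq[OF Th_V[OF Th_V[OF v]] Th_V[OF v]])
  (simp add: E_Th[OF v] E_Th[OF Th_V[OF v]] scaleC_scaleC power_int_mult_distrib)

lemma Th_weight: assumes v: "v:V" "E k v=v" shows "Th d v=d powi k *. v"
proof (rule E_eq[OF Th_V[OF v(1)] sub_scale[OF V v(1)]])
 fix l
 have "E l v=(if l=k then v else 0)" using E_E[OF v(1), of l k] v(2) by simp
 then show "E l (Th d v)=E l (d powi k *. v)"
  using lin_scale[OF E_lin v(1)] by (simp add: E_Th[OF v(1)])
qed

lemma functional_Th:
 assumes l: "lin V l" and v: "v:V"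
 shows "l (Th d v)=(SUM k:{-int N..int N}. d powi k *. l (E k v))" "l v=(SUM k:{-int N..int N}. l (E k v))"
proof -
 show "l (Th d v)=(SUM k:{-int N..int N}. d powi k *. l (E k v))"
  unfolding Th_def by (rule lin_lincomb[OF V l E_V[OF v]])
 have "l (SUM k:{-int N..int N}. E k v)=(SUM k:{-int N..int N}. l (E k v))" by (rule lin_sum[OF V l E_V[OF v]])
 then show "l v=(SUM k:{-int N..int N}. l (E k v))" unfolding E_sum[OF v] .
qed

lemma poly_funs_E: "lin V l==>(%v. l (E k v)) : pfuns V"
 by (intro poly_funs.linear lin_comp[OF E_lin]) (auto simp: E_V)

text \<open>One bound \<open>M\<close> serves all \<open>v\<close>, so coefficients can be compared
  as functions of \<open>v\<close>. Products are expanded by adding exponents.\<close>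

lemma weight_expansion:
 assumes "p : pfuns V"
 shows "EX M f. (ALL t. f t : pfuns V) &
  (ALL v:V. ALL d. d~=0 --> p (Th d v)=(SUM t:{-int M..int M}. d powi t * f t v))"
proof -
 define A where "A \<Phi> \<longleftrightarrow> (EX M f. (ALL t. f t : pfuns V) &
  (ALL v:V. ALL d. d~=0-->\<Phi> d v=(SUM t:{-int M..int M}. d powi t * f t v)))" for \<Phi> :: "complex=>'v=>complex"
 have single: "A (%d v. d powi t * g v)" if g: "g : pfuns V" for t g
  unfolding A_def
 proof (intro exI conjI allI ballI impI)
  show "(if s=t then g else (%_. 0)) : pfuns V" for s using g by (simp add: poly_funs.const)
  fix v and d :: complex
  have "(SUM s:{-int (nat \<bar>t\<bar>)..int (nat \<bar>t\<bar>)}. d powi s * (if s=t then g else (%_. 0)) v) =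
    (SUM s:{-int (nat \<bar>t\<bar>)..int (nat \<bar>t\<bar>)}. if s=t then d powi t * g v else 0)"
   by (rule sum.cong) simp_all
  moreover have "t:{-int (nat \<bar>t\<bar>)..int (nat \<bar>t\<bar>)}" by auto
  ultimately show "d powi t * g v=(SUM s:{-int (nat \<bar>t\<bar>)..int (nat \<bar>t\<bar>)}. d powi s * (if s=t then g else (%_. 0)) v)"
   by (simp only: sum.delta finite_atLeastAtMost_int if_True)
 qed
 have Aadd: "A (%d v. \<Phi> d v + \<Psi> d v)" if P: "A \<Phi>" and Q: "A \<Psi>" for \<Phi> \<Psi>
 proof -
  obtain M f where f: "ALL t. f t : pfuns V" "ALL v:V. ALL d. d~=0-->\<Phi> d v=(SUM t:{-int M..int M}. d powi t * f t v)"
   using P unfolding A_def by (elim exE conjE)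
  obtain M' g where g: "ALL t. g t : pfuns V" "ALL v:V. ALL d. d~=0-->\<Psi> d v=(SUM t:{-int M'..int M'}. d powi t * g t v)"
   using Q unfolding A_def by (elim exE conjE)
  let ?f = "%t v. if t:{-int M..int M} then f t v else 0" and ?g = "%t v. if t:{-int M'..int M'} then g t v else 0"
  let ?L = "M + M'"
  have fp: "?f t : pfuns V" for t using f(1) by (cases "t:{-int M..int M}") (simp_all only: if_True if_False poly_funs.const)
  have gp: "?g t : pfuns V" for t using g(1) by (cases "t:{-int M'..int M'}") (simp_all only: if_True if_False poly_funs.const)
  have "\<Phi> d v + \<Psi> d v=(SUM t:{-int ?L..int ?L}. d powi t * (?f t v + ?g t v))" if v: "v:V" and d: "d~=0" for d v
  proof -
   have "\<Phi> d v=(SUM t:{-int ?L..int ?L}. d powi t * ?f t v)"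
    unfolding f(2)[rule_format, OF v d] by (rule sum.mono_neutral_cong_left) auto
   moreover have "\<Psi> d v=(SUM t:{-int ?L..int ?L}. d powi t * ?g t v)"
    unfolding g(2)[rule_format, OF v d] by (rule sum.mono_neutral_cong_left) auto
   ultimately show ?thesis by (simp only: sum.distrib[symmetric] distrib_left)
  qed
  then show ?thesis unfolding A_def
   by (intro exI[of _ ?L] exI[of _ "%t v. ?f t v + ?g t v"] conjI allI ballI impI poly_funs.add fp gp)
 qed
 have Asum: "A (%d v. SUM i:I. h i d v)" if "finite I" "!!i. i:I==>A (h i)" for I :: "int set" and h
  using that
 proof (induction I rule: finite_induct)
  case empty
  have "A (%d v. d powi 0 * 0)" by (rule single[OF poly_funs.const])
  then show ?case by simp
 next
  case (insert i I)
  then have "A (%d v. h i d v + (SUM i:I. h i d v))" by (intro Aadd) simp_all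
  then show ?case using insert.hyps by simp
 qed
 have Acong: "A \<Psi>" if "A \<Phi>" "!!d v. v:V==>d~=0==>\<Phi> d v=\<Psi> d v" for \<Phi> \<Psi>
  using that unfolding A_def by simp
 have "A (%d v. p (Th d v))"
  using assms
 proof induction
  case (const c)
  from single[OF poly_funs.const[of c], of 0] show ?case by simp
 next
  case (linear l)
  have "A (%d v. SUM k:{-int N..int N}. d powi k * l (E k v))"
   by (intro Asum single poly_funs_E[OF linear]) simp
  then show ?case by (rule Acong) (simp add: functional_Th(1)[OF linear])
 next
  case (add p q)
  from Aadd[OF add.IH] show ?case .
 next
  case (mult p q)
  obtain M f where f: "ALL t. f t : pfuns V" "ALL v:V. ALL d. d~=0 --> p (Th d v)=(SUM t:{-int M..int M}. d powi t * f t v)"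
   using mult.IH(1) unfolding A_def by (elim exE conjE)
  obtain M' g where g: "ALL t. g t : pfuns V" "ALL v:V. ALL d. d~=0-->q (Th d v)=(SUM t:{-int M'..int M'}. d powi t * g t v)"
   using mult.IH(2) unfolding A_def by (elim exE conjE)
  have "A (%d v. SUM t:{-int M..int M}. SUM s:{-int M'..int M'}. d powi (t + s) * (f t v * g s v))"
   by (intro Asum single poly_funs.mult f(1)[rule_format] g(1)[rule_format]) simp_all
  then show ?case
   by (rule Acong) (simp add: f(2) g(2) sum_product power_int_add mult_ac)
 qed
 then show ?thesis unfolding A_def .
qed

end

section \<open>Equivariant coordinates at a fixed point\<close>

locale graded_point = graded_space +
 fixes Z :: "'a set set" and x :: 'a
 assumes Zv: "proj_variety V Z" and xZ: "x:acone V Z" and Ex: "E 0 x=x"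
  and inv: "d~=0==>v:acone V Z==>Th d v:acone V Z"
begin

lemma ZP: "Z \<subseteq> proj V"
 using Zv closed_subset_proj[of V Z] unfolding proj_variety_def by simp

lemma xV: "x:V" using xZ by (rule coneD)

lemma Th_x: "Th d x=x"
 using Th_weight[OF xV Ex] by (simp add: scaleC_one)

lemma E_x: "k~=0==>E k x=0"
 using E_E[OF xV, of k 0] Ex by simp

text \<open>The coefficient of \<open>d powi i\<close> in \<open>p (Th d v)\<close> inherits
  homogeneity and vanishing on the invariant cone by comparison of Laurent coefficients. Its
  differential at the fixed vector \<open>x\<close> is the weight \<open>i\<close> part of that of
  \<open>p\<close>.\<close>

lemma weight_equation:
 assumes p: "p:vid V Z n"
 shows "EX p':vid V Z n. (ALL v:V. dd p' v x=dd p (E i v) x)&(ALL v:V. ALL d. d~=0 --> p' (Th d v)=d powi i * p' v)"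
proof -
 have ph: "p:homog V n" using p by (simp add: vid_def)
 note pp = homogD(1)[OF ph]
 obtain M0 f0 where f0: "ALL t. f0 t : pfuns V"
  "ALL v:V. ALL d. d~=0 --> p (Th d v)=(SUM t:{-int M0..int M0}. d powi t * f0 t v)"
  using weight_expansion[OF pp] by (elim exE conjE)
 \<comment> \<open>Large enough for \<open>i\<close>, for the exponents of the expansion and for the
   weights of \<open>V\<close>, so that all comparisons run over one range.\<close>
 define M where "M=M0 + N + nat \<bar>i\<bar>"
 define f where "f t=(if t:{-int M0..int M0} then f0 t else (%_. 0))" for t
 have fp: "f t : pfuns V" for t using f0(1) by (simp add: f_def poly_funs.const)
 have f: "p (Th d v)=(SUM t:{-int M..int M}. d powi t * f t v)" if "v:V" "d~=0" for d v
  unfolding f0(2)[rule_format, OF that] by (rule sum.mono_neutral_cong_left) (auto simp: M_def f_def)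
 have iM: "i:{-int M..int M}" by (auto simp: M_def)
 have hom: "f i (c *. v)=c ^ n * f i v" if v: "v:V" for c v
 proof (rule laurent_eq[OF _ iM, of "%t. f t (c *. v)" "%t. c ^ n * f t v"])
  fix d :: complex assume d: "d~=0"
  have "(SUM t:{-int M..int M}. d powi t * f t (c *. v)) = p (Th d (c *. v))" using f[OF sub_scale[OF V v] d] by simp
  also have "\<dots>=c ^ n * p (Th d v)" using lin_scale[OF Th_lin v] homogD(2)[OF ph Th_V[OF v]] by simp
  also have "\<dots>=(SUM t:{-int M..int M}. d powi t * (c ^ n * f t v))" unfolding f[OF v d] by (simp add: sum_distrib_left mult_ac)
  finally show "(SUM t:{-int M..int M}. d powi t * f t (c *. v))=(SUM t:{-int M..int M}. d powi t * (c ^ n * f t v))" .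
 qed
 have van: "f i v=0" if v: "v:acone V Z" for v
 proof (rule laurent_zero[OF _ iM])
  fix d :: complex assume d: "d~=0"
  have "p (Th d v)=0" using p inv[OF d v] by (simp add: vid_def)
  then show "(SUM t:{-int M..int M}. d powi t * f t v)=0" using f[OF coneD(1)[OF v] d] by simp
 qed
 have equi: "f i (Th c v)=c powi i * f i v" if v: "v:V" and c: "c~=0" for c v
 proof (rule laurent_eq[OF _ iM, of "%t. f t (Th c v)" "%t. c powi t * f t v"])
  fix d :: complex assume d: "d~=0"
  have "(SUM t:{-int M..int M}. d powi t * f t (Th c v)) = p (Th (d * c) v)" using f[OF Th_V[OF v] d] Th_Th[OF v] by simp
  also have "\<dots>=(SUM t:{-int M..int M}. d powi t * (c powi t * f t v))"
   using f[OF v, of "d * c"] c d by (simp add: power_int_mult_distrib mult_ac)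
  finally show "(SUM t:{-int M..int M}. d powi t * f t (Th c v))=(SUM t:{-int M..int M}. d powi t * (c powi t * f t v))" .
 qed
 have diff: "dd (f i) v x=dd p (E i v) x" if v: "v:V" for v
 proof (rule laurent_eq[OF _ iM, of "%t. dd (f t) v x" "%t. dd p (E t v) x"])
  fix d :: complex assume d: "d~=0"
  note dl = dd_linear_dir[OF V pp xV]
  have "(SUM t:{-int M..int M}. d powi t * dd (f t) v x)=dd (%y. SUM t:{-int M..int M}. d powi t * f t y) v x"
   by (rule dd_lincomb[OF V xV v fp, symmetric])
  also have "\<dots>=dd (%y. p (Th d y)) v x" by (rule dd_cong[OF V xV v]) (simp add: f[OF _ d])
  also have "\<dots>=dd p (Th d v) x"
  proof -
   have "Th d (x + s *. v)=x + s *. Th d v" for s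
    using lin_add[OF Th_lin xV sub_scale[OF V v]] lin_scale[OF Th_lin v] Th_x by simp
   then show ?thesis by (simp add: dd_def)
  qed
  also have "\<dots>=(SUM k:{-int N..int N}. d powi k *. dd p (E k v) x)" by (rule functional_Th(1)[OF dl v])
  also have "\<dots>=(SUM t:{-int M..int M}. d powi t * dd p (E t v) x)"
   using lin_0[OF V dl] E_out[OF _ v] by (intro sum.mono_neutral_cong_left) (auto simp: M_def)
  finally show "(SUM t:{-int M..int M}. d powi t * dd (f t) v x)=(SUM t:{-int M..int M}. d powi t * dd p (E t v) x)" .
 qed
 have "f i:vid V Z n" using fp hom van by (simp add: vid_def homog_polys_def)
 then show ?thesis using diff equi by (intro bexI[of _ "f i"] conjI ballI allI impI)
qed

text \<open>
 Equivariant coordinates near \<open>x\<close>: \<open>q\<close> and \<open>\<pi>\<close> are coordinates on the tangent cone, and each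
 remaining coordinate \<open>ep bt\<close>, of weight \<open>fst bt\<close>, is the differential at \<open>x\<close> of a weight vector
 \<open>P bt\<close> in the ideal of \<open>Z\<close>.
\<close>

lemma splitting:
 "EX q \<pi> (J :: (int \<times> 'a) set) ep P n.
  lin V q&q x=1&(ALL v:V. ALL i. q (E i v)=(if i=0 then q v else 0)) &
  lin V \<pi>&(ALL v:V. \<pi> v:tcone V Z x&q (\<pi> v)=0)&(ALL v:V. ALL i. E i (\<pi> v)=\<pi> (E i v)) &
  (ALL v:tcone V Z x. q v=0-->\<pi> v=v) &
  finite J&(ALL bt:J. snd bt:V&E (fst bt) (snd bt) = snd bt&lin V (ep bt) &
   (ALL v:V. ep bt (E (fst bt) v)=ep bt v)&P bt:vid V Z (n bt)&(ALL v:V. dd (P bt) v x=ep bt v) &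
   (ALL v:V. ALL d. d~=0-->P bt (Th d v)=d powi (fst bt) * P bt v)) &
  (ALL bt:J. ALL bt':J. ep bt (snd bt')=(if bt=bt' then 1 else 0)) &
  (ALL v:V. v=q v *. x + \<pi> v + (SUM bt:J. ep bt v *. snd bt))"
proof -
 obtain q0 where "proj_point V Z x q0" using proj_point_exists[OF fdV ZP xZ] by (elim exE)
 then interpret pp: proj_point V Z x q0 .
 \<comment> \<open>The equations of the tangent cone that factor through the weight \<open>i\<close>
   part; by \<open>weight_equation\<close> they contain the weight \<open>i\<close> part of every
   equation.\<close>
 define Eq where "Eq i={l : pp.eqs. ALL v:V. l (E i v)=l v}" for i
 have Eq_lin: "lin V l" if "l:Eq i" for l i using that pp.eqs_linear by (simp add: Eq_def)
 have EqE: "l (E k v)=(if k=i then l v else 0)" if l: "l:Eq i" and v: "v:V" for l i k v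
 proof -
  have "l (E k v)=l (E i (E k v))" using l E_V[OF v] by (simp add: Eq_def)
  also have "\<dots>=(if k=i then l (E i v) else 0)" using E_E[OF v, of i k] lin_0[OF V Eq_lin[OF l]] by simp
  finally show ?thesis using l v by (simp add: Eq_def)
 qed
 have comp: "(%v. l (E i v)):Eq i" if l: "l : pp.eqs" for l i
 proof -
  obtain n p where p: "p:vid V Z n" "ALL v:V. l v=dd p v x" using l unfolding pp.eqs_def by (elim CollectE exE bexE)
  obtain p' where p': "p':vid V Z n" "ALL v:V. dd p' v x=dd p (E i v) x"
   using weight_equation[OF p(1), of i] by (elim bexE conjE)
  have "(%v. l (E i v)) : pp.eqs" unfolding pp.eqs_def
   by (rule CollectI, rule exI[of _ n], rule bexI[OF _ p'(1)]) (use p(2) p'(2) E_V in simp)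
  then show ?thesis using E_E[of _ i i] by (simp add: Eq_def)
 qed
 have "EX Ie. dual_system (E i ` V) (Eq i) (fst Ie) (snd Ie) &
   (ALL v:E i ` V. ALL l:Eq i. l (v - (SUM b:fst Ie. snd Ie b v *. b))=0)" for i
 proof (rule dual_system_exists[of "E i ` V" "Eq i"])
  show "finite_dim (E i ` V)" by (rule surj_linear_dim(1)[OF fdV E_lin])
  show "lin (E i ` V) l" if "l:Eq i" for l
   using E_V by (intro lin_subset[OF Eq_lin[OF that]]) auto
  show "(%v. l v + c * m v):Eq i" if "l:Eq i" "m:Eq i" for l m c
   using that pp.eqs_lincomb[of l m c] by (simp add: Eq_def)
  fix I e assume *: "dual_system (E i ` V) (Eq i) I e"
   "!!v l. v:E i ` V==>l:Eq i==>l (v - (SUM b:I. e b v *. b))=0"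
  show ?thesis by (rule exI[of _ "(I, e)"], unfold fst_conv snd_conv, intro conjI ballI *)
 qed
 then have "ALL i. EX Ie. dual_system (E i ` V) (Eq i) (fst Ie) (snd Ie) &
   (ALL v:E i ` V. ALL l:Eq i. l (v - (SUM b:fst Ie. snd Ie b v *. b))=0)" by (rule allI)
 then obtain Ie where Ie: "ALL i. dual_system (E i ` V) (Eq i) (fst (Ie i)) (snd (Ie i)) &
   (ALL v:E i ` V. ALL l:Eq i. l (v - (SUM b:fst (Ie i). snd (Ie i) b v *. b))=0)"
  by (rule choice[THEN exE])
 define I where "I i=fst (Ie i)" for i
 define e where "e i = snd (Ie i)" for i
 have dI: "dual_system (E i ` V) (Eq i) (I i) (e i)" for i unfolding I_def e_def by (rule Ie[rule_format, THEN conjunct1])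
 have red: "l (v - (SUM b:I i. e i b v *. b))=0" if "v:E i ` V" "l:Eq i" for i v l
  unfolding I_def e_def by (rule Ie[rule_format, THEN conjunct2, THEN bspec, THEN bspec, OF that])
 have finI: "finite (I i)" and IV: "I i \<subseteq> E i ` V" and eE: "b:I i==>e i b:Eq i"
  and del: "b:I i==>c:I i==>e i b c=(if b=c then 1 else 0)" for i b c
  using dI[of i] by (simp_all add: dual_system_def)
 define J where "J=Sigma {-int N..int N} I"
 define ep where "ep bt=e (fst bt) (snd bt)" for bt :: "int \<times> 'a"
 have finJ: "finite J" unfolding J_def using finI by simp
 have bV: "snd bt:V&E (fst bt) (snd bt) = snd bt" if "bt:J" for bt
 proof -
  have "snd bt:I (fst bt)" using that by (auto simp: J_def)
  then have "snd bt:E (fst bt) ` V" using IV[of "fst bt"] by (rule subsetD[rotated])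
  then obtain v where "v:V" "snd bt=E (fst bt) v" by (elim imageE)
  then show ?thesis using E_V E_E by simp
 qed
 have epE: "ep bt:Eq (fst bt)" if "bt:J" for bt using that eE by (auto simp: J_def ep_def)
 have Eb: "E k (snd bt)=(if k=fst bt then snd bt else 0)" if "bt:J" for k bt
  using bV[OF that] E_E[of "snd bt" k "fst bt"] by simp
 have dual: "ep bt (snd bt')=(if bt=bt' then 1 else 0)" if bt: "bt:J" "bt':J" for bt bt'
 proof (cases "fst bt=fst bt'")
  case True
  then have "snd bt:I (fst bt)" "snd bt':I (fst bt)" using bt by (auto simp: J_def)
  then show ?thesis using del True by (simp add: ep_def prod_eq_iff)
 next
  case False
  have "ep bt (snd bt')=ep bt (E (fst bt') (snd bt'))" using bV[OF bt(2)] by simp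
  also have "\<dots>=0" using EqE[OF epE[OF bt(1)], of "snd bt'" "fst bt'"] bV[OF bt(2)] False by simp
  finally show ?thesis using False by auto
 qed
 have epl: "lin V (ep bt)" if "bt:J" for bt by (rule Eq_lin[OF epE[OF that]])
 have epK: "ep bt v=0" if "bt:J" "v:tcone V Z x" for bt v
  using epE[OF that(1)] that(2) unfolding pp.tcone_eqs Eq_def by blast
 \<comment> \<open>The projection onto the tangent cone. It commutes with the grading since
   \<open>ep bt\<close> and \<open>snd bt\<close> have the same weight.\<close>
 define \<kappa> where "\<kappa> v=v - (SUM bt:J. ep bt v *. snd bt)" for v
 have sV: "(SUM bt:J. c bt *. snd bt):V" for c using bV by (intro sub_sum[OF V] sub_scale[OF V]) simp
 have \<kappa>V: "\<kappa> v:V" if "v:V" for v unfolding \<kappa>_def by (rule sub_diff[OF V that sV])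
 have \<kappa>lin: "lin V \<kappa>"
 proof -
  have "lin V (%v. v + (-1) *. (SUM bt:J. ep bt v *. snd bt))"
  proof (intro lin_plus lin_cmult)
   show "lin V (%v. v)" by (simp add: clinear_on_def)
   show "lin V (%v. SUM bt:J. ep bt v *. snd bt)"
    by (rule clinear_onI)
     (simp_all add: lin_add[OF epl] lin_scale[OF epl] scaleC_add_left sum.distrib
      cvs.scale_sum_right scaleC_scaleC)
  qed
  then show ?thesis unfolding \<kappa>_def[abs_def] by simp
 qed
 have \<kappa>E: "\<kappa> (E k v)=E k (\<kappa> v)" if v: "v:V" for k v
 proof -
  have "E k (SUM bt:J. ep bt v *. snd bt)=(SUM bt:J. ep bt v *. E k (snd bt))"
   using bV by (intro lin_lincomb[OF V E_lin]) simp
  also have "\<dots>=(SUM bt:J. ep bt (E k v) *. snd bt)"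
   by (rule sum.cong[OF refl]) (simp add: Eb EqE[OF epE v])
  finally show ?thesis unfolding \<kappa>_def using lin_diff[OF V E_lin v sV] by simp
 qed
 have \<kappa>K: "\<kappa> v:tcone V Z x" if v: "v:V" for v
  unfolding pp.tcone_eqs
 proof (intro CollectI conjI ballI \<kappa>V[OF v])
  fix l assume l: "l : pp.eqs"
  have "l (E k (\<kappa> v))=0" if k: "k:{-int N..int N}" for k
  proof -
   let ?l = "%v. l (E k v)"
   have lk: "?l:Eq k" by (rule comp[OF l])
   note ll = Eq_lin[OF lk]
   have "?l (SUM bt:J. ep bt v *. snd bt)=(SUM bt:J. ep bt v *. ?l (snd bt))"
    using bV by (intro lin_lincomb[OF V ll]) simp
   also have "\<dots>=(SUM k':{-int N..int N}. SUM b:I k'. e k' b v *. ?l b)"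
    unfolding J_def using finI by (subst sum.Sigma) (auto simp: ep_def split_def)
   also have "\<dots>=(SUM k':{-int N..int N}. if k'=k then SUM b:I k. e k b v *. ?l b else 0)"
   proof (rule sum.cong[OF refl])
    fix k' assume k': "k':{-int N..int N}"
    show "(SUM b:I k'. e k' b v *. ?l b)=(if k'=k then SUM b:I k. e k b v *. ?l b else 0)"
    proof (cases "k'=k")
     case False
     have "?l b=0" if "b:I k'" for b
      using Eb[of "(k', b)" k] that k' False lin_0[OF V pp.eqs_linear[OF l]] by (simp add: J_def)
     then show ?thesis using False by simp
    qed simp
   qed
   also have "\<dots>=(SUM b:I k. e k b v *. ?l b)" using k by simp
   also have "\<dots>=?l v"
   proof -
    have Ek: "E k v:E k ` V" using v by (rule imageI)
    have bI: "b:V" if "b:I k" for b using that IV[of k] E_V by blast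
    have s: "(SUM b:I k. e k b (E k v) *. b):V" using bI by (intro sub_sum[OF V] sub_scale[OF V])
    have "?l (E k v)=?l (SUM b:I k. e k b (E k v) *. b)"
     using red[OF Ek lk] lin_diff[OF V ll E_V[OF v] s] by simp
    also have "\<dots>=(SUM b:I k. e k b (E k v) *. ?l b)" by (rule lin_lincomb[OF V ll bI])
    also have "\<dots>=(SUM b:I k. e k b v *. ?l b)"
     by (rule sum.cong[OF refl]) (simp add: EqE[OF eE v])
    finally show ?thesis using E_E[OF v, of k k] by simp
   qed
   finally have "?l (SUM bt:J. ep bt v *. snd bt)=?l v" .
   then show ?thesis unfolding \<kappa>_def using lin_diff[OF V ll v sV] by simp
  qed
  then show "l (\<kappa> v)=0" unfolding functional_Th(2)[OF pp.eqs_linear[OF l] \<kappa>V[OF v]] by simp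
 qed
 have \<kappa>id: "\<kappa> v=v" if "v:tcone V Z x" for v unfolding \<kappa>_def using epK[OF _ that] by simp
 obtain q1 :: "'a=>complex" where q1: "clinear q1" "q1 x=1"
  using separating_functional[of "{0}" x] coneD(2)[OF xZ] cvs.subspace_single_0 by blast
 \<comment> \<open>Composing with \<open>\<kappa>\<close> and \<open>E 0\<close> turns a functional
   with value 1 at \<open>x\<close> into one of weight 0; \<open>x\<close> is unaffected, being of
   weight 0 and in its own tangent cone.\<close>
 define q where "q v=q1 (E 0 (\<kappa> v))" for v
 note q1l = clinear_clinear_on[OF q1(1), of V]
 have ql: "lin V q"
 proof -
  have "lin V (%v. E 0 (\<kappa> v))" using \<kappa>V by (intro lin_comp[OF \<kappa>lin E_lin]) auto
  from lin_comp[OF this q1l] show ?thesis unfolding q_def[abs_def] using \<kappa>V E_V by auto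
 qed
 have qx: "q x=1" unfolding q_def \<kappa>id[OF pp.x_tcone] Ex by (rule q1(2))
 have qE: "q (E i v)=(if i=0 then q v else 0)" if v: "v:V" for i v
  unfolding q_def \<kappa>E[OF v] E_E[OF \<kappa>V[OF v]] using lin_0[OF V q1l] by simp
 define \<pi> where "\<pi> v=\<kappa> v - q v *. x" for v
 have \<pi>lin: "lin V \<pi>"
 proof -
  have "lin V (%v. \<kappa> v + (-1) *. (q v *. x))"
   by (intro lin_plus lin_cmult \<kappa>lin)
    (auto intro!: clinear_onI simp: lin_add[OF ql] lin_scale[OF ql] scaleC_add_left scaleC_scaleC)
  then show ?thesis unfolding \<pi>_def[abs_def] by simp
 qed
 have qx': "q (c *. x)=c" for c using lin_scale[OF ql xV] qx by simp
 have \<pi>K: "\<pi> v:tcone V Z x&q (\<pi> v)=0" if v: "v:V" for v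
 proof
  show "\<pi> v:tcone V Z x" unfolding \<pi>_def
   by (intro sub_diff[OF pp.tcone_csubspace] \<kappa>K[OF v] sub_scale[OF pp.tcone_csubspace] pp.x_tcone)
  have "q (\<kappa> v)=q v" unfolding q_def \<kappa>id[OF \<kappa>K[OF v]] ..
  then show "q (\<pi> v)=0" unfolding \<pi>_def
   using lin_diff[OF V ql \<kappa>V[OF v] sub_scale[OF V xV]] qx' by simp
 qed
 have \<pi>E: "E i (\<pi> v)=\<pi> (E i v)" if v: "v:V" for i v
  unfolding \<pi>_def \<kappa>E[OF v] qE[OF v]
  using lin_diff[OF V E_lin \<kappa>V[OF v] sub_scale[OF V xV]] lin_scale[OF E_lin xV] Ex E_x[of i] by simp
 have \<pi>id: "\<pi> v=v" if "v:tcone V Z x" "q v=0" for v unfolding \<pi>_def \<kappa>id[OF that(1)] that(2) by simp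
 have dec: "v=q v *. x + \<pi> v + (SUM bt:J. ep bt v *. snd bt)" for v unfolding \<pi>_def \<kappa>_def by simp
 have "ALL bt:J. EX np. snd np:vid V Z (fst np)&(ALL v:V. dd (snd np) v x=ep bt v) &
   (ALL v:V. ALL d. d~=0 --> snd np (Th d v)=d powi (fst bt) * snd np v)"
 proof
  fix bt assume bt: "bt:J"
  have "ep bt : pp.eqs" using epE[OF bt] by (simp add: Eq_def)
  then obtain n p where p: "p:vid V Z n" "ALL v:V. ep bt v=dd p v x" unfolding pp.eqs_def by (elim CollectE exE bexE)
  obtain p' where p': "p':vid V Z n" "ALL v:V. dd p' v x=dd p (E (fst bt) v) x"
   "ALL v:V. ALL d. d~=0 --> p' (Th d v)=d powi (fst bt) * p' v"
   using weight_equation[OF p(1), of "fst bt"] by (elim bexE conjE)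
  have "dd p' v x=ep bt v" if v: "v:V" for v
   using p(2) p'(2) v E_V[OF v] EqE[OF epE[OF bt] v, of "fst bt"] by simp
  then show "EX np. snd np:vid V Z (fst np)&(ALL v:V. dd (snd np) v x=ep bt v) &
   (ALL v:V. ALL d. d~=0 --> snd np (Th d v)=d powi (fst bt) * snd np v)"
   using p'(1,3) by (intro exI[of _ "(n, p')"]) simp
 qed
 then obtain np where np: "ALL bt:J. snd (np bt):vid V Z (fst (np bt))&(ALL v:V. dd (snd (np bt)) v x=ep bt v) &
   (ALL v:V. ALL d. d~=0 --> snd (np bt) (Th d v)=d powi (fst bt) * snd (np bt) v)" by (rule bchoice[THEN exE])
 have epEE: "ALL v:V. ep bt (E (fst bt) v)=ep bt v" if "bt:J" for bt using EqE[OF epE[OF that]] by simp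
 show ?thesis
 proof (rule exI[of _ q], rule exI[of _ \<pi>], rule exI[of _ J], rule exI[of _ ep],
   rule exI[of _ "%bt. snd (np bt)"], rule exI[of _ "%bt. fst (np bt)"], intro conjI)
  show "ALL bt:J. snd bt:V&E (fst bt) (snd bt) = snd bt&lin V (ep bt) &
   (ALL v:V. ep bt (E (fst bt) v)=ep bt v) & snd (np bt):vid V Z (fst (np bt))&(ALL v:V. dd (snd (np bt)) v x=ep bt v) &
   (ALL v:V. ALL d. d~=0 --> snd (np bt) (Th d v)=d powi (fst bt) * snd (np bt) v)"
   using bV epl epEE np by (intro ballI conjI) simp_all
  show "ALL v:V. v=q v *. x + \<pi> v + (SUM bt:J. ep bt v *. snd bt)" by (intro ballI) (rule dec)
  show "lin V q" by (rule ql)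
  show "q x=1" by (rule qx)
  show "ALL v:V. ALL i. q (E i v)=(if i=0 then q v else 0)" using qE by (intro ballI allI)
  show "lin V \<pi>" by (rule \<pi>lin)
  show "ALL v:V. \<pi> v:tcone V Z x&q (\<pi> v)=0" using \<pi>K by (intro ballI)
  show "ALL v:V. ALL i. E i (\<pi> v)=\<pi> (E i v)" using \<pi>E by (intro ballI allI)
  show "ALL v:tcone V Z x. q v=0-->\<pi> v=v" using \<pi>id by (intro ballI impI)
  show "finite J" by (rule finJ)
  show "ALL bt:J. ALL bt':J. ep bt (snd bt')=(if bt=bt' then 1 else 0)" using dual by (intro ballI)
 qed
qed

end

section \<open>Elimination of the non-tangential coordinates\<close>

lemma (in proj_point) affine_irreducible:
 assumes Zv: "proj_variety V Z" and f: "f : pfuns V" and g: "g : pfuns V"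
  and fg: "!!y. y:acone V Z==>q y=1==>f y * g y=0" and gx: "g x~=0"
  and y: "y:acone V Z" "q y=1"
 shows "f y=0"
proof -
 obtain d where "ALL d'>=d. EX H:homog V d'. ALL v:V. q v~=0-->H v=q v ^ d' * f (inverse (q v) *. v)"
  using homogenize[OF V q f] by (elim exE)
 from this[rule_format, OF order_refl] obtain H where
  H: "H:homog V d" "ALL v:V. q v~=0-->H v=q v ^ d * f (inverse (q v) *. v)" by (elim bexE)
 obtain e where "ALL d'>=e. EX H:homog V d'. ALL v:V. q v~=0-->H v=q v ^ d' * g (inverse (q v) *. v)"
  using homogenize[OF V q g] by (elim exE)
 from this[rule_format, OF order_refl] obtain K where
  K: "K:homog V e" "ALL v:V. q v~=0-->K v=q v ^ e * g (inverse (q v) *. v)" by (elim bexE)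
 have "H y=0"
 proof (rule variety_no_zero_divisors[OF V Zv homog_mult[OF homog_linear[OF q] K(1)] H(1) _ xZ _ y(1)])
  show "q x * K x~=0" using K(2)[rule_format, OF xV] gx qx by (simp add: scaleC_one)
  fix v assume v: "v:acone V Z"
  show "q v * K v * H v=0"
  proof (cases "q v=0")
   case False
   let ?u = "inverse (q v) *. v"
   have "?u:acone V Z" using False by (intro cone_scale[OF V v]) simp
   moreover have "q ?u=1" using lin_scale[OF q coneD(1)[OF v]] False by simp
   ultimately have "f ?u * g ?u=0" by (rule fg)
   then show ?thesis using H(2)[rule_format, OF coneD(1)[OF v] False] K(2)[rule_format, OF coneD(1)[OF v] False] by auto
  qed simp
 qed
 then show ?thesis using H(2)[rule_format, OF coneD(1)[OF y(1)]] y(2) by (simp add: scaleC_one)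
qed

text \<open>A form of Hadamard's lemma: the increment of \<open>p\<close> from \<open>s y\<close> to
  \<open>y\<close> is linear in \<open>y - s y\<close> with coefficients polynomial in
  \<open>y\<close>. At the fixed point \<open>x\<close> these coefficients are the derivatives of
  \<open>p\<close>.\<close>

lemma hadamard:
 assumes V: "csubspace V" and sV: "!!y. y:V ==> s y:V"
  and sp: "!!l. lin V l==>(%y. l (s y)) : pfuns V"
  and x: "x:V" "s x=x" and p: "p : pfuns V"
 shows "EX Q. (ALL v:V. Q v : pfuns V)&(ALL y:V. lin V (%v. Q v y)) &
  (ALL y:V. p y - p (s y)=Q (y - s y) y)&(ALL v:V. Q v x=dd p v x)"
 using p
proof induction
 case (const c)
 show ?case by (rule exI[of _ "%_ _. 0"]) (simp add: poly_funs.const lin_zero dd_const)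
next
 case (linear l)
 show ?case
  by (rule exI[of _ "%v _. l v"])
   (simp add: poly_funs.const linear dd_linear[OF V x(1) _ linear] lin_diff[OF V linear _ sV])
next
 case (add p1 p2)
 obtain Q1 where Q1: "ALL v:V. Q1 v : pfuns V" "ALL y:V. lin V (%v. Q1 v y)"
  "ALL y:V. p1 y - p1 (s y)=Q1 (y - s y) y" "ALL v:V. Q1 v x=dd p1 v x" using add.IH(1) by (elim exE conjE)
 obtain Q2 where Q2: "ALL v:V. Q2 v : pfuns V" "ALL y:V. lin V (%v. Q2 v y)"
  "ALL y:V. p2 y - p2 (s y)=Q2 (y - s y) y" "ALL v:V. Q2 v x=dd p2 v x" using add.IH(2) by (elim exE conjE)
 show ?case
 proof (rule exI[of _ "%v y. Q1 v y + Q2 v y"], intro conjI ballI)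
  show "(%y. Q1 v y + Q2 v y) : pfuns V" if "v:V" for v using Q1(1) Q2(1) that by (intro poly_funs.add) auto
  show "lin V (%v. Q1 v y + Q2 v y)" if "y:V" for y using Q1(2) Q2(2) that by (intro lin_plus) auto
  show "p1 y + p2 y - (p1 (s y) + p2 (s y))=Q1 (y - s y) y + Q2 (y - s y) y" if "y:V" for y
   using Q1(3)[rule_format, OF that] Q2(3)[rule_format, OF that] by (simp add: algebra_simps)
  show "Q1 v x + Q2 v x=dd (%v. p1 v + p2 v) v x" if "v:V" for v
   unfolding dd_add[OF V x(1) that add.hyps] using Q1(4) Q2(4) that by simp
 qed
next
 case (mult p1 p2)
 obtain Q1 where Q1: "ALL v:V. Q1 v : pfuns V" "ALL y:V. lin V (%v. Q1 v y)"
  "ALL y:V. p1 y - p1 (s y)=Q1 (y - s y) y" "ALL v:V. Q1 v x=dd p1 v x" using mult.IH(1) by (elim exE conjE)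
 obtain Q2 where Q2: "ALL v:V. Q2 v : pfuns V" "ALL y:V. lin V (%v. Q2 v y)"
  "ALL y:V. p2 y - p2 (s y)=Q2 (y - s y) y" "ALL v:V. Q2 v x=dd p2 v x" using mult.IH(2) by (elim exE conjE)
 show ?case
 proof (rule exI[of _ "%v y. p2 y * Q1 v y + p1 (s y) * Q2 v y"], intro conjI ballI)
  show "(%y. p2 y * Q1 v y + p1 (s y) * Q2 v y) : pfuns V" if "v:V" for v
   using Q1(1) Q2(1) that by (intro poly_funs.add poly_funs.mult mult.hyps poly_funs_comp[OF mult.hyps(1) sp]) auto
  show "lin V (%v. p2 y * Q1 v y + p1 (s y) * Q2 v y)" if "y:V" for y
   using Q1(2) Q2(2) that by (intro lin_plus lin_cmult') auto
  show "p1 y * p2 y - p1 (s y) * p2 (s y) = p2 y * Q1 (y - s y) y + p1 (s y) * Q2 (y - s y) y" if "y:V" for y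
   unfolding Q1(3)[rule_format, OF that, symmetric] Q2(3)[rule_format, OF that, symmetric] by (simp add: algebra_simps)
  show "p2 x * Q1 v x + p1 (s x) * Q2 v x=dd (%v. p1 v * p2 v) v x" if "v:V" for v
   unfolding dd_mult[OF V x(1) that mult.hyps] using Q1(4) Q2(4) that by (simp add: x(2) mult.commute)
 qed
qed

text \<open>The equations \<open>P bt\<close> express \<open>y - s y\<close> through itself by a matrix which is the identity at \<open>x\<close>.\<close>

lemma (in proj_point) elimination:
 fixes J :: "'i set" and b :: "'i=>'v"
 assumes Zv: "proj_variety V Z" and sV: "!!y. y:V ==> s y:V"
  and sp: "!!l. lin V l==>(%y. l (s y)) : pfuns V" and sx: "s x=x"
  and J: "finite J" and bV: "!!bt. bt:J==>b bt:V" and ep: "!!bt. bt:J==>lin V (ep bt)"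
  and P: "!!bt. bt:J==>P bt:vid V Z (n bt)" and dP: "!!bt v. bt:J==>v:V==>dd (P bt) v x=ep bt v"
  and dual: "!!bt bt'. bt:J==>bt':J==>ep bt (b bt')=(if bt=bt' then 1 else 0)"
  and diff: "!!y. y:acone V Z==>q y=1==>y - s y=(SUM bt:J. ep bt (y - s y) *. b bt)"
  and Ps: "!!y bt. y:acone V Z==>q y=1==>bt:J==>P bt (s y)=0"
  and y: "y:acone V Z" "q y=1"
 shows "s y=y"
proof -
 have Pp: "P bt : pfuns V" if "bt:J" for bt using P[OF that] homogD(1) by (simp add: vid_def homog_polys_def)
 have "ALL bt:J. EX Q. (ALL v:V. Q v : pfuns V)&(ALL y:V. lin V (%v. Q v y)) &
  (ALL y:V. P bt y - P bt (s y)=Q (y - s y) y)&(ALL v:V. Q v x=dd (P bt) v x)"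
  by (intro ballI hadamard[where s=s] V sV sp xV sx Pp)
 then obtain Q where "ALL bt:J. (ALL v:V. Q bt v : pfuns V)&(ALL y:V. lin V (%v. Q bt v y)) &
  (ALL y:V. P bt y - P bt (s y)=Q bt (y - s y) y)&(ALL v:V. Q bt v x=dd (P bt) v x)"
  by (rule bchoice[THEN exE])
 note Q = this[rule_format, THEN conjunct1] this[rule_format, THEN conjunct2, THEN conjunct1, rule_format]
  this[rule_format, THEN conjunct2, THEN conjunct2, THEN conjunct1, rule_format]
  this[rule_format, THEN conjunct2, THEN conjunct2, THEN conjunct2, rule_format]
 have M: "(%y. Q bt (b bt') y) : pfuns V" if "bt:J" "bt':J" for bt bt' using Q(1)[OF that(1)] bV[OF that(2)] by auto
 have Mx: "Q bt (b bt') x=(if bt=bt' then 1 else 0)" if "bt:J" "bt':J" for bt bt'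
  using Q(4)[OF that(1) bV[OF that(2)]] dP[OF that(1) bV[OF that(2)]] dual[OF that] by simp
 have "EX e::nat. EX g:pfuns V. g x=1 &
  (ALL y h. g y~=0-->(ALL i:J. (SUM j:J. Q i (b j) y * h j)=0)-->(ALL j:J. h j=0))"
  by (rule nonsingular_locus[OF J, where H="%_. pfuns V" and d="%_. 0" and M="%i j y. Q i (b j) y"])
   (intro poly_funs.mult poly_funs_diff poly_funs.const M Mx | assumption)+
 then obtain g where g: "g : pfuns V" "g x=1"
  and gM: "ALL y h. g y~=0-->(ALL i:J. (SUM j:J. Q i (b j) y * h j)=0)-->(ALL j:J. h j=0)" by (elim exE bexE conjE)
 \<comment> \<open>The coordinates of \<open>z - s z\<close> solve a homogeneous linear system with
   matrix \<open>Q bt (b bt')\<close>, which is injective where \<open>g\<close> is nonzero.\<close>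
 have van: "ALL bt:J. ep bt (z - s z)=0" if z: "z:acone V Z" "q z=1" and gz: "g z~=0" for z
 proof (rule gM[rule_format, OF gz, THEN ballI[of J], rotated])
  fix bt assume bt: "bt:J"
  have zV: "z:V" using z(1) by (rule coneD)
  have "(SUM bt':J. Q bt (b bt') z * ep bt' (z - s z))=(SUM bt':J. ep bt' (z - s z) *. Q bt (b bt') z)" by (simp add: mult.commute)
  also have "\<dots>=Q bt (SUM bt':J. ep bt' (z - s z) *. b bt') z"
   by (rule lin_lincomb[OF V Q(2)[OF bt zV] bV, symmetric])
  also have "\<dots>=Q bt (z - s z) z" by (simp only: diff[OF z, symmetric])
  also have "\<dots>=P bt z - P bt (s z)" by (rule Q(3)[OF bt zV, symmetric])
  also have "\<dots>=0" using Ps[OF z bt] P[OF bt] z(1) by (simp add: vid_def)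
  finally show "(SUM bt':J. Q bt (b bt') z * ep bt' (z - s z))=0" .
 qed
 have yV: "y:V" using y(1) by (rule coneD)
 have "ep bt (y - s y)=0" if bt: "bt:J" for bt
 proof -
  have e: "ep bt (z - s z)=ep bt z - ep bt (s z)" if "z:V" for z
   by (rule lin_diff[OF V ep[OF bt] that sV[OF that]])
  \<comment> \<open>Irreducibility of \<open>Z\<close> removes the condition that \<open>g\<close>
    is nonzero; this is how a local statement at \<open>x\<close> reaches the whole chart.\<close>
  have "ep bt y - ep bt (s y)=0"
  proof (rule affine_irreducible[OF Zv poly_funs_diff[OF poly_funs.linear[OF ep[OF bt]] sp[OF ep[OF bt]]] g(1) _ _ y])
   show "g x~=0" using g(2) by simp
   show "(ep bt z - ep bt (s z)) * g z=0" if z: "z:acone V Z" "q z=1" for z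
   proof (cases "g z=0")
    case False
    show ?thesis using van[OF z False] bt e[OF coneD(1)[OF z(1)]] by simp
   qed simp
  qed
  then show ?thesis unfolding e[OF yV] .
 qed
 then have "(SUM bt:J. ep bt (y - s y) *. b bt)=0" by (intro sum.neutral) simp
 then have "y - s y=0" by (rule trans[OF diff[OF y]])
 then show ?thesis by simp
qed

text \<open>A negative exponent would be a pole at 0, exponent 0 contradicts
  \<open>poly R 0 = 0\<close>, and otherwise \<open>R\<close> composed with the \<open>A\<close>-th
  power is a monomial, so the exponent is \<open>A\<close> times the degree of
  \<open>R\<close>.\<close>

lemma dilated_poly_weight:
 fixes R :: "complex poly"
 assumes A: "0 < A" and R: "!!d. d~=0 ==> poly R (d ^ A)=d powi i * c" and R0: "poly R 0=0" and c: "c~=0"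
 shows "EX k>=1. i=int (k * A)"
proof -
 let ?R = "pcompose R (monom 1 A)"
 have pR: "poly ?R d = poly R (d ^ A)" for d by (simp add: poly_pcompose poly_monom)
 have "\<not> i < 0"
 proof
  assume i: "i < 0"
  have "poly (monom 1 (nat (- i)) * ?R - [:c:]) d=0" if d: "d~=0" for d
  proof -
   have "d ^ nat (- i) * d powi i=d powi (- i + i)" using i d by (subst power_int_add) (auto simp: power_int_def)
   then show ?thesis using R[OF d] by (simp add: pR poly_monom mult.assoc[symmetric])
  qed
  from poly_eq_0_off_0[of "monom 1 (nat (- i)) * ?R - [:c:]", OF this, of 0]
  show False using i c A by (simp add: poly_monom power_0_left)
 qed
 then obtain m where m: "i=int m" by (metis nonneg_int_cases not_less)
 have "poly (?R - monom c m) d=0" if "d~=0" for d using R[OF that] by (simp add: pR poly_monom m)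
 from poly_eq_0_off_0[OF this] have "?R - monom c m=0" using poly_all_0_iff_0 by blast
 then have e: "?R=monom c m" by simp
 have "degree R * A=m" using arg_cong[OF e, of degree] c by (simp add: degree_pcompose degree_monom_eq)
 moreover have "m~=0"
 proof
  assume "m=0"
  then have "poly ?R 0=c" unfolding e by (simp add: poly_monom)
  then show False using R0 A c by (simp add: pR power_0_left)
 qed
 ultimately show ?thesis using m by (intro exI[of _ "degree R"]) auto
qed

locale split_point = graded_point V E N Z x
 for V :: "'v::complex_vector set" and E N Z x +
 fixes q :: "'v=>complex" and \<pi> :: "'v=>'v" and J :: "(int \<times> 'v) set"
  and ep P :: "int \<times> 'v=>'v=>complex" and n :: "int \<times> 'v=>nat"
 assumes q: "lin V q" and qx: "q x=1" and qE: "v:V==>q (E i v)=(if i=0 then q v else 0)"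
  and \<pi>: "lin V \<pi>" and \<pi>K: "v:V==>\<pi> v:tcone V Z x&q (\<pi> v)=0"
  and \<pi>E: "v:V==>E i (\<pi> v)=\<pi> (E i v)" and \<pi>id: "v:tcone V Z x==>q v=0==>\<pi> v=v"
  and J: "finite J" and bV: "bt:J ==> snd bt:V" and Eb: "bt:J==>E (fst bt) (snd bt) = snd bt"
  and ep: "bt:J==>lin V (ep bt)" and epE: "bt:J==>v:V==>ep bt (E (fst bt) v)=ep bt v"
  and P: "bt:J==>P bt:vid V Z (n bt)" and dP: "bt:J==>v:V==>dd (P bt) v x=ep bt v"
  and PTh: "bt:J==>v:V==>d~=0==>P bt (Th d v)=d powi (fst bt) * P bt v"
  and dual: "bt:J==>bt':J==>ep bt (snd bt')=(if bt=bt' then 1 else 0)"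
  and dec: "v:V==>v=q v *. x + \<pi> v + (SUM bt:J. ep bt v *. snd bt)"
begin

sublocale pp: proj_point V Z x q
 by unfold_locales (rule fdV ZP xZ q qx)+

lemma Pp: "bt:J==>P bt : pfuns V"
 using P by (simp add: vid_def homog_polys_def)

lemma Px: "bt:J==>P bt x=0"
 using P xZ by (simp add: vid_def)

lemma Ek_b: "bt:J==>E k (snd bt)=(if k=fst bt then snd bt else 0)"
 using E_E[OF bV, of bt k "fst bt"] Eb by simp

lemma ep_E: assumes bt: "bt:J" and v: "v:V" shows "ep bt (E k v)=(if k=fst bt then ep bt v else 0)"
 using epE[OF bt v] epE[OF bt E_V[OF v], of k] E_E[OF v, of "fst bt" k] lin_0[OF V ep[OF bt]] by auto

lemma weight_bound: "bt:J==>fst bt:{-int N..int N}"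
 using E_out[of "fst bt" "snd bt"] Eb bV dual[of bt bt] lin_0[OF V ep] by fastforce

lemma E_dec:
 assumes v: "v:V"
 shows "E k v=(if k=0 then q v *. x else 0) + E k (\<pi> v) + (SUM bt:{bt:J. fst bt=k}. ep bt v *. snd bt)"
proof -
 have 1: "q v *. x:V" by (rule sub_scale[OF V xV])
 have 2: "\<pi> v:V" using \<pi>K[OF v] by (intro pp.tconeD) simp
 have 3: "(SUM bt:J. ep bt v *. snd bt):V" using bV by (intro sub_sum[OF V] sub_scale[OF V])
 have "E k v=E k (q v *. x) + E k (\<pi> v) + E k (SUM bt:J. ep bt v *. snd bt)"
  using arg_cong[OF dec[OF v], of "E k"] lin_add[OF E_lin sub_add[OF V 1 2] 3] lin_add[OF E_lin 1 2] by simp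
 also have "E k (q v *. x)=(if k=0 then q v *. x else 0)"
  using lin_scale[OF E_lin xV, of k "q v"] E_x[of k] Ex by simp
 also have "E k (SUM bt:J. ep bt v *. snd bt)=(SUM bt:J. ep bt v *. E k (snd bt))"
  by (rule lin_lincomb[OF V E_lin bV])
 also have "\<dots>=(SUM bt:{bt:J. fst bt=k}. ep bt v *. snd bt)"
  by (rule sum.mono_neutral_cong_right[OF J]) (auto simp: Ek_b)
 finally show ?thesis .
qed

text \<open>The map to which \<open>elimination\<close> is applied. Splitting off the multiple of
  \<open>x\<close> first makes it fix \<open>x\<close> for every \<open>K\<close>.\<close>

definition trunc :: "int set=>'v=>'v"
 where "trunc K y=q y *. x + (SUM k:K. E k (y - q y *. x))"

lemma qx_V: "y:V==>y - q y *. x:V"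
 by (intro sub_diff[OF V] sub_scale[OF V xV])

lemma trunc_V: "y:V==>trunc K y:V"
 unfolding trunc_def by (intro sub_add[OF V] sub_sum[OF V] E_V qx_V sub_scale[OF V xV])

lemma trunc_linear: "lin V (trunc K)"
proof -
 have xl: "lin V (%y. q y *. x)"
  by (rule clinear_onI) (simp_all add: lin_add[OF q] lin_scale[OF q] scaleC_add_left scaleC_scaleC)
 have "lin V (%y. y + (-1) *. (q y *. x))"
  by (intro lin_plus lin_cmult xl) (simp add: clinear_on_def)
 then have "lin V (%y. E k (y - q y *. x))" for k
  using qx_V by (intro lin_comp[OF _ E_lin]) auto
 then have "lin V (%y. q y *. x + (SUM k:K. 1 *. E k (y - q y *. x)))"
  by (intro lin_plus xl lin_lincomb_fun)
 then show ?thesis unfolding trunc_def[abs_def] by (simp add: scaleC_one)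
qed

lemma trunc_poly: "lin V l==>(%y. l (trunc K y)) : pfuns V"
 using trunc_V by (intro poly_funs.linear lin_comp[OF trunc_linear]) auto

lemma trunc_x: "trunc K x=x"
 using lin_0[OF V E_lin] by (simp add: trunc_def qx scaleC_one)

context
 fixes a :: int
 assumes a: "!!v. v:tcone V Z x==>q v=0==>E a v=v"
begin

lemma E_\<pi>: "v:V==>E k (\<pi> v)=(if k=a then \<pi> v else 0)"
 using E_E[of "\<pi> v" k a] a[of "\<pi> v"] \<pi>K[of v] pp.tconeD(1)[of "\<pi> v"] by simp

text \<open>Truncation loses only the coordinates whose weight is outside \<open>K\<close>; the
  tangential part survives because \<open>a\<close> lies in \<open>K\<close>. If the equations of
  those weights vanish at truncated points, \<open>elimination\<close> shows that nothing was
  lost.\<close>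

lemma trunc_elim:
 assumes K: "finite K" "a:K"
  and PK: "!!y bt. y:acone V Z==>q y=1==>bt:J==>fst bt \<notin> K==>P bt (trunc K y)=0"
  and y: "y:acone V Z" "q y=1"
 shows "trunc K y=y"
proof (rule pp.elimination[where s="trunc K" and J="{bt:J. fst bt \<notin> K}" and b=snd and ep=ep and P=P and n=n])
 let ?J = "{bt:J. fst bt \<notin> K}"
 show "finite ?J" using J by simp
 fix y assume y: "y:acone V Z" "q y=1"
 have yV: "y:V" using y(1) by (rule coneD)
 have xx: "q y *. x:V" by (rule sub_scale[OF V xV])
 have Ek: "E k (y - q y *. x)=E k (\<pi> y) + (SUM bt:{bt:J. fst bt=k}. ep bt y *. snd bt)" for k
  using lin_diff[OF V E_lin[of k] yV xx] E_dec[OF yV, of k] lin_scale[OF E_lin xV, of k "q y"] E_x[of k] Ex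
  by (cases "k=0") simp_all
 have "(SUM k:K. E k (y - q y *. x))=(SUM k:K. E k (\<pi> y)) + (SUM k:K. SUM bt:{bt:J. fst bt=k}. ep bt y *. snd bt)"
  unfolding Ek by (rule sum.distrib)
 also have "(SUM k:K. E k (\<pi> y))=\<pi> y" using K by (simp add: E_\<pi>[OF yV])
 also have "(SUM k:K. SUM bt:{bt:J. fst bt=k}. ep bt y *. snd bt)=(SUM bt:{bt:J. fst bt:K}. ep bt y *. snd bt)"
 proof -
  have "(SUM bt:{bt:J. fst bt:K}. ep bt y *. snd bt) =
    (SUM k:K. SUM bt:{bt:{bt:J. fst bt:K}. fst bt=k}. ep bt y *. snd bt)"
   using J by (intro sum.group[symmetric] K(1)) auto
  also have "\<dots>=(SUM k:K. SUM bt:{bt:J. fst bt=k}. ep bt y *. snd bt)"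
   by (intro sum.cong refl) auto
  finally show ?thesis ..
 qed
 finally have t: "trunc K y=q y *. x + (\<pi> y + (SUM bt:{bt:J. fst bt:K}. ep bt y *. snd bt))" unfolding trunc_def by simp
 have "(SUM bt:J. ep bt y *. snd bt)=(SUM bt:{bt:J. fst bt:K} \<union> ?J. ep bt y *. snd bt)" by (rule sum.cong) auto
 also have "\<dots>=(SUM bt:{bt:J. fst bt:K}. ep bt y *. snd bt) + (SUM bt:?J. ep bt y *. snd bt)" using J by (intro sum.union_disjoint) auto
 finally have "y=trunc K y + (SUM bt:?J. ep bt y *. snd bt)" using dec[OF yV] t by (simp add: add.assoc)
 note e0 = this
 have d: "y - trunc K y=(SUM bt:?J. ep bt y *. snd bt)"
 proof -
  have e: "y=trunc K y + (SUM bt:?J. ep bt y *. snd bt)" by (rule e0)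
  have "y - trunc K y=(trunc K y + (SUM bt:?J. ep bt y *. snd bt)) - trunc K y" by (rule arg_cong[OF e])
  then show ?thesis by (rule trans) simp
 qed
 have sV: "(SUM bt:?J. ep bt y *. snd bt):V" using bV by (intro sub_sum[OF V] sub_scale[OF V]) auto
 have "ep bt (y - trunc K y)=ep bt y" if bt: "bt:?J" for bt
 proof -
  have "ep bt (y - trunc K y)=(SUM bt':?J. ep bt' y *. ep bt (snd bt'))"
   unfolding d using bt bV by (intro lin_lincomb[OF V ep]) auto
  also have "\<dots>=(SUM bt':?J. if bt'=bt then ep bt y else 0)" using bt by (intro sum.cong refl) (auto simp: dual)
  also have "\<dots>=ep bt y" using bt J by simp
  finally show ?thesis .
 qed
 then have "(SUM bt:?J. ep bt (y - trunc K y) *. snd bt)=(SUM bt:?J. ep bt y *. snd bt)"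
  by (rule sum.cong[OF refl, OF arg_cong])
 then show "y - trunc K y=(SUM bt:?J. ep bt (y - trunc K y) *. snd bt)" by (rule trans[OF d sym])
next
 show "P bt (trunc K z)=0" if "z:acone V Z" "q z=1" "bt:{bt:J. fst bt \<notin> K}" for z bt
  using that(3) by (intro PK[OF that(1,2)]) simp_all
 show "dd (P bt) v x=ep bt v" if "bt:{bt:J. fst bt \<notin> K}" "v:V" for bt v
  using that(1) by (intro dP[OF _ that(2)]) simp
 show "ep bt (snd bt')=(if bt=bt' then 1 else 0)"
  if "bt:{bt:J. fst bt \<notin> K}" "bt':{bt:J. fst bt \<notin> K}" for bt bt'
  using that by (intro dual) simp_all
 show "snd bt:V" "lin V (ep bt)" "P bt:vid V Z (n bt)" if "bt:{bt:J. fst bt \<notin> K}" for bt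
  using that by (simp_all add: bV ep P)
 show "trunc K y:V" if "y:V" for y by (rule trunc_V[OF that])
 show "(%y. l (trunc K y)) : pfuns V" if "lin V l" for l by (rule trunc_poly[OF that])
qed (rule Zv trunc_x y)+

end

end

lemma power_int_2_eq_1: "(2::complex) powi i=1==>i=0"
 by (auto simp: power_int_def norm_inverse split: if_splits dest!: power_eq_1_iff)

context split_point
begin

text \<open>With tangent weight 0 all points of the chart have weight 0, so the torus fixes a
  neighbourhood of \<open>x\<close> pointwise. Isolation of the fixed point then collapses it to
  \<open>x\<close>, and irreducibility collapses \<open>Z\<close>.\<close>

lemma tangent_weight_nonzero:
 assumes a: "!!v. v:tcone V Z x==>q v=0==>E 0 v=v"
  and U: "znbhd V Z (cspan {x}) U" and fixed: "!!y. y:U==>(!!d. d~=0==>Th d ` y=y)==>y=cspan {x}"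
 shows "Z={cspan {x}}"
proof -
 have E0: "E 0 (trunc {0} y)=trunc {0} y" if y: "y:V" for y
 proof -
  have "E 0 (trunc {0} y)=E 0 (q y *. x) + E 0 (E 0 (y - q y *. x))"
   unfolding trunc_def using lin_add[OF E_lin sub_scale[OF V xV] E_V[OF qx_V[OF y]], of 0 "q y" 0] by simp
  then show ?thesis using E_E[OF qx_V[OF y], of 0 0] lin_scale[OF E_lin xV, of 0 "q y"] Ex by (simp add: trunc_def)
 qed
 have Tt: "Th d (trunc {0} y)=trunc {0} y" if "y:V" for y d
  using Th_weight[OF trunc_V[OF that] E0[OF that], of d] by (simp add: scaleC_one)
 have tr: "trunc {0} y=y" if y: "y:acone V Z" "q y=1" for y
 proof (rule trunc_elim[OF a _ _ _ y])
  fix y bt assume y: "y:acone V Z" "q y=1" and bt: "bt:J" "fst bt \<notin> {0}"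
  have yV: "y:V" using y(1) by (rule coneD)
  \<comment> \<open>At a fixed vector a function of weight \<open>i\<close> is multiplied by
    \<open>2 powi i\<close>, which differs from 1 for nonzero \<open>i\<close>.\<close>
  have "P bt (trunc {0} y)=2 powi (fst bt) * P bt (trunc {0} y)"
   using PTh[OF bt(1) trunc_V[OF yV, of "{0}"], of 2] Tt[OF yV, of 2] by simp
  then show "P bt (trunc {0} y)=0" using power_int_2_eq_1[of "fst bt"] bt(2) by auto
 qed auto
 obtain n' p where p: "p:homog V n'" "cspan {x}:basic_open V p" "Z \<inter> basic_open V p \<subseteq> U" using U by (rule znbhdE)
 have xn: "x~=0" using xZ by (rule coneD)
 have px: "p x~=0" using p(2) basic_span1[OF p(1) xV xn] by simp
 have mult: "z=q z *. x" if z: "z:acone V Z" "q z~=0" "p z~=0" for z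
 proof -
  let ?u = "inverse (q z) *. z"
  have zV: "z:V" using z(1) by (rule coneD)
  have u: "?u:acone V Z" using z(2) by (intro cone_scale[OF V z(1)]) simp
  have "q ?u=1" using lin_scale[OF q zV] z(2) by simp
  then have t: "trunc {0} ?u=?u" by (rule tr[OF u])
  have cu: "cspan {?u}=cspan {z}" using z(2) by (intro span1_scale) simp
  have "cspan {z}:U" using p(3) coneD(3)[OF z(1)] basic_span1[OF p(1) zV coneD(2)[OF z(1)]] z(3) by blast
  moreover have "Th d ` cspan {z}=cspan {z}" for d
   unfolding cu[symmetric] image_span1[OF Th_lin coneD(1)[OF u]] using Tt[OF coneD(1)[OF u], of d] t by simp
  ultimately have "cspan {z}=cspan {x}" by (rule fixed)
  then have "z:cspan {x}" using span1_self[of z] by simp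
  then obtain c where c: "z=c *. x" unfolding mem_span1 by (elim exE)
  have "q z=c" unfolding c using lin_scale[OF q xV] qx by simp
  then show ?thesis using c by simp
 qed
 have all: "z=q z *. x" if z: "z:acone V Z" for z
 proof (rule lin_eqI[OF fdV coneD(1)[OF z] sub_scale[OF V xV]])
  fix l :: "'v=>complex" assume l: "lin V l"
  have "l z - l x * q z=0"
  proof (rule variety_no_zero_divisors[OF V Zv homog_mult[OF homog_linear[OF q] p(1)]
    homog_diff[OF homog_linear[OF l] homog_cmult[OF homog_linear[OF q]]] _ xZ _ z])
   show "q x * p x~=0" using px qx by simp
   fix v assume v: "v:acone V Z"
   show "q v * p v * (l v - l x * q v)=0"
   proof (cases "q v=0 \<or> p v=0")
    case False
    then have "v=q v *. x" by (intro mult[OF v]) simp_all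
    then have "l v=l (q v *. x)" by (rule arg_cong)
    then have "l v=q v * l x" unfolding lin_scale[OF l xV] by simp
    then show ?thesis by simp
   qed auto
  qed
  then show "l z=l (q z *. x)" using lin_scale[OF l xV] by simp
 qed
 have "L=cspan {x}" if L: "L:Z" for L
 proof -
  obtain z where z: "z:acone V Z" "L=cspan {z}" using cone_rep[OF ZP L] by (elim bexE)
  have qz: "q z~=0"
  proof
   assume 0: "q z=0"
   have "z=0" by (rule trans[OF all[OF z(1)]]) (simp add: 0)
   then show False using coneD(2)[OF z(1)] by simp
  qed
  have "cspan {z}=cspan {q z *. x}" by (rule arg_cong[OF all[OF z(1)]])
  then show ?thesis unfolding z(2) span1_scale[OF qz] .
 qed
 then show ?thesis using coneD(3)[OF xZ] by blast
qed

end

section \<open>Polynomial parametrization for a positive tangent weight\<close>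

locale positive_point = split_point V E N Z x q \<pi> J ep P n
 for V :: "'v::complex_vector set" and E N Z x q \<pi> J ep P n +
 fixes A :: nat
 assumes A: "0 < A" and wA: "!!v. v:tcone V Z x==>q v=0==>E (int A) v=v"
  and ns: "!!y. y:acone V Z==>cdim (tcone V Z x)<=cdim (tcone V Z y)"
begin

definition wt :: "nat=>int"
 where "wt k=int (k * A)"

lemma wt_inj: "wt j=wt k \<longleftrightarrow> j=k"
 using A by (simp add: wt_def flip: of_nat_mult)

lemma wt_0: "wt 0=0" and wt_1: "wt (Suc 0)=int A"
 by (simp_all add: wt_def)

lemma wt_nonzero: "wt (Suc k)~=0"
 using wt_inj[of "Suc k" 0] by (simp add: wt_0)

abbreviation "G k \<equiv> E (wt k)"

text \<open>A chart point cut off after weight \<open>k A\<close> and moved by the torus. The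
  parameter \<open>b\<close> stands for \<open>d ^ A\<close>, but unlike \<open>d\<close> it may be
  0, where the curve reaches \<open>x\<close>.\<close>

definition Y :: "nat=>complex=>'v=>'v"
 where "Y k b y=x + (SUM m:{1..k}. b ^ m *. G m y)"

lemma GG: "v:V==>G j (G k v)=(if j=k then G k v else 0)"
 using E_E[of v "wt j" "wt k"] by (simp add: wt_inj)

lemma Gx: "1<=m==>G m x=0"
 using E_x[of "wt m"] wt_nonzero[of "m - 1"] by simp

lemma Y_V: "y:V==>Y k b y:V"
 unfolding Y_def by (intro sub_add[OF V xV] sub_sum[OF V] sub_scale[OF V] E_V)

lemma Y_0: "Y k 0 y=x"
 by (simp add: Y_def power_0_left)

lemma Y_Suc: "Y (Suc k) 1 y=Y k 1 y + G (Suc k) y"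
 by (simp add: Y_def scaleC_one add.assoc)

lemma Th_powi: "(d::complex) powi wt m=(d ^ A) ^ m"
proof -
 have "d ^ (m * A)=d ^ (A * m)" by (rule arg_cong[OF mult.commute])
 also have "\<dots>=(d ^ A) ^ m" by (rule power_mult)
 finally show ?thesis unfolding wt_def power_int_of_nat .
qed

lemma Th_Y: assumes y: "y:V" shows "Th d (Y k 1 y)=Y k (d ^ A) y"
proof -
 have 1: "(SUM m:{1..k}. 1 ^ m *. G m y):V" by (intro sub_sum[OF V] sub_scale[OF V] E_V y)
 have "Th d (Y k 1 y)=Th d x + Th d (SUM m:{1..k}. 1 ^ m *. G m y)"
  unfolding Y_def by (rule lin_add[OF Th_lin xV 1])
 also have "Th d (SUM m:{1..k}. 1 ^ m *. G m y)=(SUM m:{1..k}. 1 ^ m *. Th d (G m y))"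
  by (rule lin_lincomb[OF V Th_lin E_V[OF y]])
 also have "\<dots>=(SUM m:{1..k}. (d ^ A) ^ m *. G m y)"
 proof (rule sum.cong[OF refl])
  fix m
  have "Th d (G m y)=d powi wt m *. G m y" using E_E[OF y, of "wt m" "wt m"] by (intro Th_weight[OF E_V[OF y]]) simp
  then show "1 ^ m *. Th d (G m y)=(d ^ A) ^ m *. G m y" by (simp add: scaleC_one Th_powi)
 qed
 finally show ?thesis unfolding Th_x Y_def .
qed

lemma Y_poly:
 assumes p: "p : pfuns V" and y: "y:V" shows "EX R. ALL b. p (Y k b y) = poly R b"
proof (rule poly_funs_curve[OF p])
 fix l :: "'v=>complex" assume l: "lin V l"
 have "l (Y k b y) = poly ([:l x:] + (SUM m:{1..k}. monom (l (G m y)) m)) b" for b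
 proof -
  have "l (Y k b y)=l x + l (SUM m:{1..k}. b ^ m *. G m y)"
   unfolding Y_def by (intro lin_add[OF l xV] sub_sum[OF V] sub_scale[OF V] E_V y)
  also have "l (SUM m:{1..k}. b ^ m *. G m y)=(SUM m:{1..k}. b ^ m *. l (G m y))"
   by (rule lin_lincomb[OF V l E_V[OF y]])
  finally show ?thesis by (simp add: poly_sum poly_monom mult.commute)
 qed
 then show "EX R. ALL b. l (Y k b y) = poly R b" by (intro exI allI)
qed

lemma trunc_G:
 assumes y: "y:V" "q y=1" shows "trunc ((%m. wt m) ` {1..k}) y=x + (SUM m:{1..k}. G m y)"
proof -
 have inj: "inj_on (%m. wt m) {1..k}" by (simp add: inj_on_def wt_inj)
 have "G m (y - 1 *. x)=G m y" if "m:{1..k}" for m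
  using lin_diff[OF V E_lin y(1) xV, of "wt m"] Gx[of m] that by (simp add: scaleC_one)
 then show ?thesis unfolding trunc_def y(2) sum.reindex[OF inj] o_def by (simp add: scaleC_one)
qed

text \<open>On a truncated point an equation of any weight becomes a polynomial in
  \<open>d ^ A\<close> without constant term, so it vanishes unless its weight is a positive
  multiple of \<open>A\<close>. By \<open>trunc_elim\<close> only such weights occur. The range up
  to \<open>Suc N\<close> covers all weights and contains \<open>A\<close> even if
  \<open>N = 0\<close>.\<close>

lemma Y_eq:
 assumes y: "y:acone V Z" "q y=1" shows "Y (Suc N) 1 y=y"
proof -
 let ?K = "(%m. wt m) ` {1..Suc N}"
 have e: "trunc ?K y=Y (Suc N) 1 y" if "y:V" "q y=1" for y
  unfolding trunc_G[OF that] Y_def by (simp add: scaleC_one)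
 have "trunc ?K y=y"
 proof (rule trunc_elim[OF wA _ _ _ y])
  show "int A:?K" by (rule image_eqI[of _ _ "Suc 0"]) (simp_all add: wt_1)
  fix y bt assume y: "y:acone V Z" "q y=1" and bt: "bt:J" "fst bt \<notin> ?K"
  have yV: "y:V" using y(1) by (rule coneD)
  obtain R where R: "ALL b. P bt (Y (Suc N) b y) = poly R b" using Y_poly[OF Pp[OF bt(1)] yV, of "Suc N"] by (elim exE)
  show "P bt (trunc ?K y)=0"
  proof (rule ccontr)
   assume ne: "P bt (trunc ?K y)~=0"
   have "EX k>=1. fst bt=int (k * A)"
   proof (rule dilated_poly_weight[OF A _ _ ne])
    show "poly R (d ^ A)=d powi fst bt * P bt (trunc ?K y)" if "d~=0" for d
     unfolding e[OF yV y(2)] PTh[OF bt(1) Y_V[OF yV] that, symmetric] Th_Y[OF yV] by (rule R[rule_format, symmetric])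
    show "poly R 0=0" using R[rule_format, of 0] Px[OF bt(1)] by (simp add: Y_0)
   qed
   then obtain k where k: "1<=k" "fst bt=int (k * A)" by (elim exE conjE)
   have "int (k * A)<=int N" using weight_bound[OF bt(1)] k(2) by simp
   then have "k * A<=N" by (simp only: of_nat_le_iff)
   with mult_le_mono2[of 1 A k] A have "k * 1<=N" by (intro order_trans[of "k * 1" "k * A" N]) simp_all
   then have "k<=Suc N" by simp
   then have "fst bt:?K" using k by (intro image_eqI[of _ _ k]) (simp_all add: wt_def)
   then show False using bt(2) by simp
  qed
 qed auto
 then show ?thesis unfolding e[OF coneD(1)[OF y(1)] y(2)] .
qed

text \<open>Move \<open>y\<close> by the torus and apply Hadamard's lemma to \<open>P bt\<close>
  between the moved point and its truncation at weight \<open>k A\<close>. Division by the power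
  \<open>Suc k\<close> of \<open>b = d ^ A\<close> leaves an identity polynomial in
  \<open>b\<close>, and at \<open>b = 0\<close> only the component of weight \<open>Suc k\<close>
  times \<open>A\<close> remains.\<close>

lemma weight_recursion:
 assumes y: "y:acone V Z" "q y=1" and bt: "bt:J" "fst bt=wt (Suc k)" and k: "k<=N"
 shows "ep bt y=- P bt (Y k 1 y)"
proof -
 have yV: "y:V" using y(1) by (rule coneD)
 let ?s = "trunc ((%m. wt m) ` {1..k})"
 obtain Q where Q: "ALL v:V. Q v : pfuns V" "ALL y:V. lin V (%v. Q v y)"
  "ALL y:V. P bt y - P bt (?s y)=Q (y - ?s y) y" "ALL v:V. Q v x=dd (P bt) v x"
 proof -
  have "EX Q. (ALL v:V. Q v : pfuns V)&(ALL y:V. lin V (%v. Q v y)) &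
   (ALL y:V. P bt y - P bt (?s y)=Q (y - ?s y) y)&(ALL v:V. Q v x=dd (P bt) v x)"
   by (intro hadamard[where s="?s"] V trunc_V trunc_poly xV trunc_x Pp bt(1))
  then show thesis using that by (elim exE conjE)
 qed
 have "ALL m. EX R. ALL b. Q (G m y) (Y (Suc N) b y) = poly R b" using Q(1) by (intro allI Y_poly[OF _ yV]) (simp add: E_V[OF yV])
 then obtain R where R: "ALL m. ALL b. Q (G m y) (Y (Suc N) b y) = poly (R m) b" by (rule choice[THEN exE])
 define T where "T=(SUM m:{Suc k..Suc N}. monom 1 (m - Suc k) * R m)"
 have T: "poly T (d ^ A)=- P bt (Y k 1 y)" if d: "d~=0" for d
 proof -
  let ?z = "Th d y" and ?b = "d ^ A"
  have zV: "?z:V" by (rule Th_V[OF yV])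
  have zY: "?z=Y (Suc N) ?b y" using Th_Y[OF yV, of d "Suc N"] Y_eq[OF y] by simp
  have Gz: "G m ?z=?b ^ m *. G m y" for m unfolding E_Th[OF yV] Th_powi ..
  have qz: "q ?z=1" using functional_Th(1)[OF q yV, of d] by (simp add: qE[OF yV] y(2) if_distrib[of "(*) _"] cong: if_cong)
  have sz: "?s ?z=Y k ?b y" unfolding trunc_G[OF zV qz] Gz Y_def ..
  have zz: "?z=x + (SUM m:{1..Suc N}. ?b ^ m *. G m y)" using zY unfolding Y_def .
  have "{1..Suc N}={1..k} \<union> {Suc k..Suc N}" using k by auto
  then have "(SUM m:{1..Suc N}. ?b ^ m *. G m y)=(SUM m:{1..k}. ?b ^ m *. G m y) + (SUM m:{Suc k..Suc N}. ?b ^ m *. G m y)"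
   using sum.union_disjoint[of "{1..k}" "{Suc k..Suc N}" "%m. ?b ^ m *. G m y"] by simp
  then have diff: "?z - ?s ?z=(SUM m:{Suc k..Suc N}. ?b ^ m *. G m y)" unfolding sz Y_def using zz by simp
  have "P bt ?z=0" using PTh[OF bt(1) yV d] P[OF bt(1)] y(1) by (simp add: vid_def)
  moreover have "P bt (?s ?z)=?b ^ Suc k * P bt (Y k 1 y)"
   unfolding sz Th_Y[OF yV, symmetric] PTh[OF bt(1) Y_V[OF yV] d] bt(2) Th_powi ..
  ultimately have "?b ^ Suc k * (- P bt (Y k 1 y))=Q (?z - ?s ?z) ?z" using Q(3)[rule_format, OF zV] by simp
  also have "\<dots>=(SUM m:{Suc k..Suc N}. ?b ^ m *. Q (G m y) ?z)"
   unfolding diff by (rule lin_lincomb[OF V Q(2)[rule_format, OF zV] E_V[OF yV]])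
  also have "\<dots>=(SUM m:{Suc k..Suc N}. ?b ^ Suc k * (?b ^ (m - Suc k) * poly (R m) ?b))"
  proof (rule sum.cong[OF refl])
   fix m assume "m:{Suc k..Suc N}"
   then have "?b ^ m=?b ^ Suc k * ?b ^ (m - Suc k)" by (simp only: power_add[symmetric]) simp
   moreover have "Q (G m y) ?z = poly (R m) ?b" unfolding zY by (rule R[rule_format])
   ultimately show "?b ^ m *. Q (G m y) ?z=?b ^ Suc k * (?b ^ (m - Suc k) * poly (R m) ?b)" by simp
  qed
  also have "\<dots>=?b ^ Suc k * poly T ?b" by (simp only: T_def poly_sum poly_monom poly_mult mult_1_left sum_distrib_left)
  finally have e: "?b ^ Suc k * (- P bt (Y k 1 y))=?b ^ Suc k * poly T ?b" .
  have "?b ^ Suc k~=0" using d by simp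
  from iffD1[OF mult_left_cancel[OF this] e] show ?thesis ..
 qed
 \<comment> \<open>\<open>T\<close> is constant on all nonzero \<open>d ^ A\<close>, hence has the
   same value at 0.\<close>
 have "poly (pcompose T (monom 1 A) - [:- P bt (Y k 1 y):]) d=0" if "d~=0" for d
  using T[OF that] by (simp add: poly_pcompose poly_monom)
 from poly_eq_0_off_0[OF this, of 0] have "poly T 0=- P bt (Y k 1 y)"
  using A by (simp add: poly_pcompose poly_monom power_0_left eq_neg_iff_add_eq_0)
 moreover have "poly T 0=(SUM m:{Suc k..Suc N}. if m=Suc k then poly (R (Suc k)) 0 else 0)"
  unfolding T_def poly_sum by (rule sum.cong) (auto simp: poly_monom power_0_left)
 moreover have "poly (R (Suc k)) 0=ep bt y"
  using R[rule_format, of "Suc k" 0] Q(4)[rule_format, OF E_V[OF yV]] dP[OF bt(1) E_V[OF yV]] epE[OF bt(1) yV]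
  by (simp only: Y_0 bt(2))
 ultimately show ?thesis using k by (cases "N=k") simp_all
qed

text \<open>Solves the equations weight by weight. The parameter \<open>w\<close> enters at weight
  \<open>A\<close>, which is the case \<open>k = 0\<close>; the other coordinates of the next weight
  are minus the equations evaluated on what is already built, as \<open>weight_recursion\<close>
  dictates.\<close>

primrec sg :: "nat=>'v=>'v" where
 "sg 0=(%w. x)"
| "sg (Suc k)=(%w. sg k w + (if k=0 then w else 0) -
  (SUM bt:{bt:J. fst bt=wt (Suc k)}. P bt (sg k w) *. snd bt))"

lemma sg_\<pi>:
 assumes y: "y:acone V Z" "q y=1" shows "k<=Suc N ==> sg k (\<pi> y)=Y k 1 y"
proof (induction k)
 case (Suc k)
 have yV: "y:V" using y(1) by (rule coneD)
 let ?J = "{bt:J. fst bt=wt (Suc k)}"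
 have "G (Suc k) y=E (wt (Suc k)) (\<pi> y) + (SUM bt:?J. ep bt y *. snd bt)"
  using E_dec[OF yV, of "wt (Suc k)"] wt_nonzero[of k] by simp
 also have "E (wt (Suc k)) (\<pi> y)=(if k=0 then \<pi> y else 0)"
  using E_\<pi>[OF wA yV, of "wt (Suc k)"] by (simp add: wt_1[symmetric] wt_inj)
 also have "(SUM bt:?J. ep bt y *. snd bt)=(SUM bt:?J. - (P bt (sg k (\<pi> y)) *. snd bt))"
 proof (rule sum.cong[OF refl])
  fix bt assume bt: "bt:?J"
  then have "ep bt y=- P bt (Y k 1 y)" using Suc.prems by (intro weight_recursion[OF y]) auto
  then show "ep bt y *. snd bt=- (P bt (sg k (\<pi> y)) *. snd bt)" using Suc by simp
 qed
 finally show ?case unfolding Y_Suc using Suc by (simp add: sum_negf)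
qed (simp add: Y_def)

lemma TK_V: "w : pp.TK==>w:V"
 using pp.tconeD by simp

lemma sg_V: "w : pp.TK ==> sg k w:V"
proof (induction k)
 case (Suc k)
 have "(if k=0 then w else 0):V" using TK_V[OF Suc.prems] sub_0[OF V] by simp
 moreover have "(SUM bt:{bt:J. fst bt=wt (Suc k)}. P bt (sg k w) *. snd bt):V"
  using bV by (intro sub_sum[OF V] sub_scale[OF V]) simp
 ultimately show ?case unfolding sg.simps using Suc by (intro sub_diff[OF V] sub_add[OF V])
qed (simp add: xV)

lemma sg_functional:
 assumes f: "lin V f" and w: "w : pp.TK"
 shows "f (sg (Suc k) w)=f (sg k w) + f (if k=0 then w else 0) -
  (SUM bt:{bt:J. fst bt=wt (Suc k)}. P bt (sg k w) *. f (snd bt))"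
proof -
 let ?J = "{bt:J. fst bt=wt (Suc k)}"
 have 1: "(if k=0 then w else 0):V" using TK_V[OF w] sub_0[OF V] by simp
 have 2: "(SUM bt:?J. P bt (sg k w) *. snd bt):V" using bV by (intro sub_sum[OF V] sub_scale[OF V]) simp
 have "f (sg (Suc k) w)=f (sg k w) + f (if k=0 then w else 0) - f (SUM bt:?J. P bt (sg k w) *. snd bt)"
  unfolding sg.simps lin_diff[OF V f sub_add[OF V sg_V[OF w] 1] 2] lin_add[OF f sg_V[OF w] 1] ..
 also have "f (SUM bt:?J. P bt (sg k w) *. snd bt)=(SUM bt:?J. P bt (sg k w) *. f (snd bt))"
  using bV by (intro lin_lincomb[OF V f]) simp
 finally show ?thesis .
qed

lemma sg_poly: "lin V l==>(%w. l (sg k w)) : pfuns pp.TK"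
proof (induction k arbitrary: l)
 case (Suc k)
 have "lin pp.TK l" using TK_V by (intro lin_subset[OF Suc.prems]) blast
 then have 1: "(%w. l (if k=0 then w else 0)) : pfuns pp.TK"
  by (cases "k=0") (simp_all add: poly_funs.linear poly_funs.const)
 have 2: "(%w. SUM bt:{bt:J. fst bt=wt (Suc k)}. P bt (sg k w) * l (snd bt)) : pfuns pp.TK"
 proof (intro poly_funs_sum poly_funs.mult poly_funs.const)
  fix bt assume "bt:{bt:J. fst bt=wt (Suc k)}"
  then have "bt:J" by simp
  then show "(%w. P bt (sg k w)) : pfuns pp.TK" by (rule poly_funs_comp[OF Pp Suc.IH])
 qed
 show ?case
  by (rule poly_funs_cong[OF pp.TK_csubspace poly_funs_diff[OF poly_funs.add[OF Suc.IH[OF Suc.prems] 1] 2]])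
   (simp only: sg_functional[OF Suc.prems] scaleC_complex)
qed (simp add: poly_funs.const)

lemma q_b: "bt:J==>fst bt~=0==>q (snd bt)=0"
 using qE[OF bV, of bt "fst bt"] Eb by simp

lemma sum_zero:
 fixes f :: "'v=>'b::complex_vector"
 shows "(!!bt. bt:J==>fst bt~=0==>f (snd bt)=0)==>(SUM bt:{bt:J. fst bt=wt (Suc k)}. P bt v *. f (snd bt))=0"
 by (intro sum.neutral ballI) (simp add: wt_nonzero)

lemma \<pi>_eq: assumes v: "v:V" shows "\<pi> v=v - q v *. x - (SUM bt:J. ep bt v *. snd bt)"
proof -
 have "v - q v *. x - (SUM bt:J. ep bt v *. snd bt) =
   (q v *. x + \<pi> v + (SUM bt:J. ep bt v *. snd bt)) - q v *. x - (SUM bt:J. ep bt v *. snd bt)"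
  by (rule arg_cong[OF dec[OF v], of "%u. u - q v *. x - (SUM bt:J. ep bt v *. snd bt)"])
 also have "\<dots>=\<pi> v" by simp
 finally show ?thesis ..
qed

lemma q_sg: "w : pp.TK==>q (sg k w)=1"
proof (induction k)
 case (Suc k)
 have "(SUM bt:{bt:J. fst bt=wt (Suc k)}. P bt (sg k w) *. q (snd bt))=0"
  by (rule sum_zero) (rule q_b)
 moreover have "q (if k=0 then w else 0)=0" using Suc.prems lin_0[OF V q] by simp
 ultimately show ?case unfolding sg_functional[OF q Suc.prems] using Suc by simp
qed (simp add: qx)

lemma \<pi>_x: "\<pi> x=0"
proof -
 have "ep bt x=0" if "bt:J" for bt using dP[OF that xV] pp.tconeD(2)[OF pp.x_tcone P[OF that]] by simp
 then have "(SUM bt:J. ep bt x *. snd bt)=0" by (intro sum.neutral) simp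
 then show ?thesis unfolding \<pi>_eq[OF xV] qx by (simp add: scaleC_one)
qed

lemma \<pi>_b: assumes bt: "bt:J" "fst bt~=0" shows "\<pi> (snd bt)=0"
proof -
 have "(SUM bt':J. ep bt' (snd bt) *. snd bt')=(SUM bt':J. if bt'=bt then snd bt else 0)"
  using bt(1) by (intro sum.cong) (auto simp: dual scaleC_one)
 then show ?thesis unfolding \<pi>_eq[OF bV[OF bt(1)]] q_b[OF bt] using bt(1) J by simp
qed

lemma \<pi>_sg: "w : pp.TK==>\<pi> (sg (Suc k) w)=w"
proof (induction k)
 case 0
 have "(SUM bt:{bt:J. fst bt=wt (Suc 0)}. P bt (sg 0 w) *. \<pi> (snd bt))=0"
  by (rule sum_zero) (rule \<pi>_b)
 then show ?case unfolding sg_functional[OF \<pi> 0] using \<pi>id 0 by (simp add: \<pi>_x)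
next
 case (Suc k)
 have "(SUM bt:{bt:J. fst bt=wt (Suc (Suc k))}. P bt (sg (Suc k) w) *. \<pi> (snd bt))=0"
  by (rule sum_zero) (rule \<pi>_b)
 then show ?case unfolding sg_functional[OF \<pi> Suc.prems, of "Suc k"] using Suc lin_0[OF V \<pi>] by (simp del: sg.simps)
qed

lemma Th_tangent: "w : pp.TK==>Th d w=d ^ A *. w"
 using Th_weight[OF TK_V wA, of w d] by simp

lemma Th_sg: assumes d: "d~=0" shows "w : pp.TK==>Th d (sg k w) = sg k (d ^ A *. w)"
proof (induction k)
 case (Suc k)
 let ?J = "{bt:J. fst bt=wt (Suc k)}"
 have w: "d ^ A *. w : pp.TK" by (rule sub_scale[OF pp.TK_csubspace Suc.prems])
 have "(SUM bt:?J. P bt (sg k w) *. Th d (snd bt))=(SUM bt:?J. P bt (sg k (d ^ A *. w)) *. snd bt)"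
 proof (rule sum.cong[OF refl])
  fix bt assume "bt:?J"
  then have bt: "bt:J" by simp
  have "Th d (snd bt)=d powi fst bt *. snd bt" by (rule Th_weight[OF bV[OF bt] Eb[OF bt]])
  moreover have "P bt (sg k (d ^ A *. w))=d powi fst bt * P bt (sg k w)"
   using PTh[OF bt sg_V[OF Suc.prems] d, of k] Suc.IH[OF Suc.prems] by simp
  ultimately show "P bt (sg k w) *. Th d (snd bt)=P bt (sg k (d ^ A *. w)) *. snd bt" by (simp add: scaleC_scaleC mult.commute)
 qed
 moreover have "Th d (if k=0 then w else 0)=(if k=0 then d ^ A *. w else 0)"
  using Th_tangent[OF Suc.prems] lin_0[OF V Th_lin] by simp
 ultimately show ?case unfolding sg_functional[OF Th_lin Suc.prems] using Suc by simp
qed (simp add: Th_x)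

lemma sg_weights: "w : pp.TK==>i \<notin> (%m. wt m) ` {..k}==>E i (sg k w)=0"
proof (induction k)
 case 0
 then show ?case using E_x[of i] by (simp add: wt_0)
next
 case (Suc k)
 have i: "i \<notin> (%m. wt m) ` {..k}" "i~=wt (Suc k)" using Suc.prems(2) by (auto simp: atMost_Suc)
 have "(SUM bt:{bt:J. fst bt=wt (Suc k)}. P bt (sg k w) *. E i (snd bt))=0"
 proof (rule sum.neutral, rule ballI)
  fix bt assume "bt:{bt:J. fst bt=wt (Suc k)}"
  then have "E i (snd bt)=0" using i(2) by (auto simp: Ek_b)
  then show "P bt (sg k w) *. E i (snd bt)=0" by simp
 qed
 moreover have "E i (if k=0 then w else 0)=0"
 proof (cases "k=0")
  case True
  have "E i w=(if i=wt (Suc 0) then w else 0)"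
   using E_E[OF TK_V[OF Suc.prems(1)], of i "int A"] wA Suc.prems(1) by (simp add: wt_1)
  then show ?thesis using True i(2) by simp
 qed (simp add: lin_0[OF V E_lin])
 ultimately show ?case unfolding sg_functional[OF E_lin Suc.prems(1)] using Suc.IH[OF Suc.prems(1) i(1)] by simp
qed

lemma sg_0: "sg k 0=x"
 by (induction k) (auto simp: Px intro!: sum.neutral)

abbreviation "nu \<equiv> sg (Suc N)"

sublocale chart: graph_chart V pp.TK nu q \<pi>
proof (unfold_locales)
 show "finite_dim pp.TK" by (rule pp.TK_fd)
 show "sg (Suc N) w:V" "q (sg (Suc N) w)=1" "\<pi> (sg (Suc N) w)=w" if "w : pp.TK" for w
  by (rule sg_V[OF that], rule q_sg[OF that], rule \<pi>_sg[OF that])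
 show "(%w. l (sg (Suc N) w)) : pfuns pp.TK" if "lin V l" for l by (rule sg_poly[OF that])
 show "\<pi> v : pp.TK" if "v:V" for v using \<pi>K[OF that] by simp
qed (rule fdV q \<pi>)+

lemma affine_point:
 assumes y: "y:acone V Z" "q y~=0"
 shows "EX w:pp.TK. inverse (q y) *. y=nu w&cspan {nu w}=cspan {y}&w=\<pi> (inverse (q y) *. y)"
proof -
 let ?u = "inverse (q y) *. y"
 have yV: "y:V" using y(1) by (rule coneD)
 have u: "?u:acone V Z" using y(2) by (intro cone_scale[OF V y(1)]) simp
 have qu: "q ?u=1" using lin_scale[OF q yV] y(2) by simp
 have "nu (\<pi> ?u)=?u" using sg_\<pi>[OF u qu order_refl] Y_eq[OF u qu] by simp
 moreover have "cspan {?u}=cspan {y}" using y(2) by (intro span1_scale) simp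
 moreover have "\<pi> ?u : pp.TK" using \<pi>K[OF coneD(1)[OF u]] by simp
 ultimately show ?thesis by (intro bexI[of _ "\<pi> ?u"]) (simp_all only: simp_thms)
qed

text \<open>By \<open>affine_point\<close> the part of \<open>Z\<close> with nonzero
  \<open>q\<close> lies on the graph; irreducibility extends vanishing on this part to all of
  \<open>Z\<close>.\<close>

lemma Z_sub: "Z \<subseteq> chart.Z"
proof
 fix L assume "L:Z"
 then obtain v where v: "v:acone V Z" "L=cspan {v}" using cone_rep[OF ZP] by blast
 show "L:chart.Z"
 proof (rule ccontr)
  assume "L \<notin> chart.Z"
  then obtain d p where p: "p:vid V chart.Z d" "p v~=0"
   using closed_separate[OF V chart.Z_closed coneD(1,2)[OF v(1)]] v(2) by blast
  have ph: "p:homog V d" using p(1) by (simp add: vid_def)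
  have "p v=0"
  proof (rule variety_no_zero_divisors[OF V Zv homog_linear[OF q] ph _ xZ _ v(1)])
   show "q x~=0" using qx by simp
   fix y assume y: "y:acone V Z"
   show "q y * p y=0"
   proof (cases "q y=0")
    case False
    obtain w where w: "w : pp.TK" "cspan {nu w}=cspan {y}" using affine_point[OF y False] by (elim bexE conjE)
    have "y:acone V chart.Z" using chart.nvq_Z[OF w(1)] w(2) coneD(1,2)[OF y] by (simp add: acone_def)
    then show ?thesis using p(1) by (simp add: vid_def)
   qed simp
  qed
  then show False using p(2) by simp
 qed
qed

text \<open>The parameters whose points already lie on \<open>Z\<close>; the aim is to show that
  functions vanishing on \<open>S\<close> vanish identically.\<close>

definition S :: "'v set"
 where "S={w : pp.TK. cspan {nu w}:Z}"

lemma S_cone: "w:S==>nu w:acone V Z"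
 by (simp add: S_def acone_def chart.nvqV chart.nvq_nz del: sg.simps)

text \<open>One inclusion is \<open>Z_sub\<close>. Equality is forced by dimension:
  \<open>ns\<close> bounds the tangent cone of \<open>Z\<close> below by its value at
  \<open>x\<close>, which is the dimension found everywhere on the graph.\<close>

lemma tcone_S: assumes w: "w:S" shows "tcone V Z (nu w)=tcone V chart.Z (nu w)"
proof (rule cdim_eq_imp_eq)
 have wT: "w : pp.TK" using w by (simp add: S_def del: sg.simps)
 interpret c: proj_point V chart.Z "nu w" q by (rule chart.chart_proj_point[OF wT])
 interpret z: proj_point V Z "nu w" q
  by (simp add: proj_point_def fdV ZP S_cone[OF w] q q_sg[OF wT] del: sg.simps)
 show "finite_dim (tcone V chart.Z (nu w))" by (rule finite_dim_subspace[OF fdV c.tcone_csubspace]) (use c.tconeD in blast)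
 show "csubspace (tcone V Z (nu w))" by (rule z.tcone_csubspace)
 have "vid V chart.Z d \<subseteq> vid V Z d" for d using Z_sub by (auto simp: vid_def acone_def simp del: sg.simps)
 then show "tcone V Z (nu w) \<subseteq> tcone V chart.Z (nu w)" by (auto simp: tcone_def simp del: sg.simps)
 show "cdim (tcone V chart.Z (nu w))<=cdim (tcone V Z (nu w))"
  using ns[OF S_cone[OF w]] chart.cdim_tcone_chart[OF wT] pp.cdim_tcone pp.cdim_tangent(1) by (simp del: sg.simps)
qed

text \<open>The homogenization of \<open>f\<close>, multiplied by \<open>q\<close>, is in the ideal
  of \<open>Z\<close>, so tangent vectors of \<open>Z\<close> kill it; by \<open>tcone_S\<close>
  these include all velocities of the graph.\<close>

lemma derivative_vanishes:
 assumes f: "f : pfuns pp.TK" "!!w. w:S==>f w=0" and v: "v : pp.TK" and w: "w:S"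
 shows "dd f v w=0"
proof -
 have wT: "w : pp.TK" using w by (simp add: S_def del: sg.simps)
 obtain d where "ALL d'>=d. EX H:homog V d'. ALL v:V. q v~=0-->H v=q v ^ d' * f (\<pi> (inverse (q v) *. v))"
  using chart.homogenize_chart[OF f(1)] by (elim exE)
 from this[rule_format, OF order_refl] obtain H where
  H: "H:homog V d" "ALL v:V. q v~=0-->H v=q v ^ d * f (\<pi> (inverse (q v) *. v))" by (elim bexE)
 let ?K = "%v. q v * H v"
 have K: "?K:homog V (1 + d)" by (rule homog_mult[OF homog_linear[OF q] H(1)])
 have "?K y=0" if y: "y:acone V Z" for y
 proof (cases "q y=0")
  case False
  obtain u where u: "u : pp.TK" "cspan {nu u}=cspan {y}" "u=\<pi> (inverse (q y) *. y)"
   using affine_point[OF y False] by (elim bexE conjE)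
  have "u:S" using u(1,2) coneD(3)[OF y] by (simp add: S_def del: sg.simps)
  then show ?thesis using H(2)[rule_format, OF coneD(1)[OF y] False] f(2)[of u] u(3) by simp
 qed simp
 then have KZ: "?K:vid V Z (1 + d)" using K by (simp add: vid_def)
 have "chart.dnu w v:tcone V Z (nu w)" unfolding tcone_S[OF w] using chart.tangent_cone_chart[OF wT] v by blast
 then have "dd ?K (chart.dnu w v) (nu w)=0" using KZ unfolding tcone_def by blast
 also have "dd ?K (chart.dnu w v) (nu w)=dd (%w. ?K (nu w)) v w" by (rule chart.dd_dnu[OF wT homogD(1)[OF K] v])
 also have "\<dots>=dd f v w"
  by (rule dd_cong[OF pp.TK_csubspace wT v]) (use chart.homogenize_value[OF H] chart.qnvq in \<open>simp del: sg.simps\<close>)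
 finally show ?thesis .
qed

text \<open>An equation of \<open>Z\<close> pulled back to the parameter space vanishes on
  \<open>S\<close> with all iterated derivatives. Since \<open>nu 0 = x\<close> puts 0 into
  \<open>S\<close>, its Taylor expansion at 0 is 0 and it vanishes on the whole graph.\<close>

lemma chart_Z: "chart.Z=Z"
proof
 show "Z \<subseteq> chart.Z" by (rule Z_sub)
 show "chart.Z \<subseteq> Z"
 proof
  fix L assume "L:chart.Z"
  then obtain v where v: "v:acone V chart.Z" "L=cspan {v}" using cone_rep[OF chart.Z_proj] by blast
  show "L:Z"
  proof (rule ccontr)
   assume "L \<notin> Z"
   moreover have "closedin (zariski V) Z" using Zv by (simp add: proj_variety_def)
   ultimately obtain d p where p: "p:vid V Z d" "p v~=0" using closed_separate[OF V _ coneD(1,2)[OF v(1)]] v(2) by blast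
   have ph: "p:homog V d" using p(1) by (simp add: vid_def)
   obtain w where w: "w : pp.TK" "p (nu w)~=0" using chart.cone_nz[OF ph v(1) p(2)] by (elim bexE)
   let ?f = "%w. p (nu w)"
   have D: "((%f. dd f w) ^^ k) ?f : pfuns pp.TK&(ALL u:S. ((%f. dd f w) ^^ k) ?f u=0)" for k
   proof (induction k)
    case 0
    show ?case using chart.comp_nvq[OF homogD(1)[OF ph]] p(1) S_cone by (simp add: vid_def del: sg.simps)
   next
    case (Suc k)
    let ?g = "((%f. dd f w) ^^ k) ?f"
    have "dd ?g w : pfuns pp.TK" using Suc by (intro dd_poly_funs[OF pp.TK_csubspace _ w(1)]) simp
    moreover have "ALL u:S. dd ?g w u=0" using Suc by (intro ballI derivative_vanishes[OF _ _ w(1)]) simp_all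
    ultimately show ?case by (simp del: sg.simps)
   qed
   have "0:S" using coneD(3)[OF xZ] sub_0[OF pp.TK_csubspace] by (simp add: S_def sg_0 del: sg.simps)
   then have "p (nu w)=0"
    using D by (intro poly_funs_eq_0_by_derivatives[OF pp.TK_csubspace chart.comp_nvq[OF homogD(1)[OF ph]] w(1)]) blast
   then show False using w(2) by simp
  qed
 qed
qed

lemma G_sum: assumes w: "w : pp.TK" shows "(SUM k<=Suc N. G k (nu w))=nu w"
proof (rule E_eq)
 have nV: "nu w:V" by (rule sg_V[OF w])
 show "nu w:V" by (rule nV)
 show "(SUM k<=Suc N. G k (nu w)):V" by (intro sub_sum[OF V] E_V nV)
 fix i
 have "E i (SUM k<=Suc N. G k (nu w))=(SUM k<=Suc N. E i (G k (nu w)))" by (rule lin_sum[OF V E_lin E_V[OF nV]])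
 also have "\<dots>=(SUM k<=Suc N. if i=wt k then E i (nu w) else 0)"
  by (rule sum.cong[OF refl]) (simp add: E_E[OF nV] del: sg.simps)
 also have "\<dots>=E i (nu w)"
 proof (cases "i:wt ` {..Suc N}")
  case True
  then obtain k where k: "k<=Suc N" "i=wt k" by auto
  have "(SUM j<=Suc N. if i=wt j then E i (nu w) else 0)=(SUM j<=Suc N. if j=k then E i (nu w) else 0)"
   by (rule sum.cong[OF refl]) (auto simp: k(2) wt_inj simp del: sg.simps)
  then show ?thesis using k(1) by (simp del: sg.simps sum.atMost_Suc)
 next
  case False
  then have "(SUM k<=Suc N. if i=wt k then E i (nu w) else 0)=0" by (intro sum.neutral) auto
  then show ?thesis using sg_weights[OF w False] by simp
 qed
 finally show "E i (SUM k<=Suc N. G k (nu w))=E i (nu w)" .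
qed

text \<open>For nonzero \<open>b\<close> an \<open>A\<close>-th root of \<open>b\<close> turns
  scaling into the torus action; \<open>b = 0\<close> is computed at \<open>x\<close>.\<close>

lemma G_hom: assumes w: "w : pp.TK" shows "G k (nu (b *. w))=b ^ k *. G k (nu w)"
proof (cases "b=0")
 case True
 have "G 0 (nu w)=x"
 proof -
  have "G 0 (sg k w)=x" for k
  proof (induction k)
   case (Suc k)
   have "(SUM bt:{bt:J. fst bt=wt (Suc k)}. P bt (sg k w) *. G 0 (snd bt))=0"
    by (intro sum.neutral) (auto simp: Ek_b wt_inj)
   moreover have "G 0 w=0" using E_E[OF TK_V[OF w], of 0 "int A"] wA w A by (simp add: wt_0)
   ultimately show ?case unfolding sg_functional[OF E_lin w] using Suc lin_0[OF V E_lin] by simp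
  qed (simp add: wt_0 Ex)
  then show ?thesis .
 qed
 moreover have "G k x=0" if "k~=0" using Gx[of k] that by simp
 ultimately show ?thesis using True by (cases "k=0") (simp_all add: sg_0 scaleC_one wt_0 Ex del: sg.simps)
next
 case False
 obtain d where d: "b=d ^ A" using exists_complex_root[of A b] A by auto
 have d0: "d~=0" using False d A by (auto simp: power_0_left)
 have "G k (nu (b *. w))=G k (Th d (nu w))" unfolding d Th_sg[OF d0 w] ..
 then show ?thesis unfolding E_Th[OF sg_V[OF w]] Th_powi d .
qed

end

section \<open>Jets in a graded chart\<close>

lemma dual_finite_dim: "finite_dim A==>finite_dim (dual A)"
proof (rule finite_dimI[OF dual_csubspace, of "dual_coord A ` vbasis A"])
 assume A: "finite_dim A"
 show "finite (dual_coord A ` vbasis A)" using finite_vbasis[OF A] by simp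
 show "dual A \<subseteq> cspan (dual_coord A ` vbasis A)"
 proof
  fix \<eta> assume "\<eta>:dual A"
  then have e: "\<eta>=(SUM b:vbasis A. \<eta> b *. dual_coord A b)" by (rule dual_expand[OF A])
  have "(SUM b:vbasis A. \<eta> b *. dual_coord A b):cspan (dual_coord A ` vbasis A)"
   by (intro cvs.span_sum cvs.span_scale cvs.span_base) simp
  then show "\<eta>:cspan (dual_coord A ` vbasis A)" by (subst e)
 qed
qed

lemma homog_line:
 assumes W: "csubspace W" and p: "p:homog W j" and u: "u:W" "w:W"
 shows "EX R. (ALL s. p (u + s *. w) = poly R s)&degree R<=j&coeff R j = p w"
proof -
 obtain phq where phq: "phq : sym_forms W j" "ALL w:W. p w=phq (replicate j w)" using homog_sym_form[OF W p] by (elim bexE)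
 define R where "R=(SUM i<=j. monom (of_nat (j choose i) * phq (replicate i w @ replicate (j - i) u)) i)"
 have cf: "coeff R i=(if i<=j then of_nat (j choose i) * phq (replicate i w @ replicate (j - i) u) else 0)" for i
  by (simp add: R_def coeff_sum)
 have "p (u + s *. w) = poly R s" for s
 proof -
  have sw: "s *. w:W" by (rule sub_scale[OF W u(2)])
  have "p (u + s *. w)=phq (replicate j (u + s *. w))" using phq(2) sub_add[OF W u(1) sw] by simp
  also have "\<dots>=(SUM i<=j. of_nat (j choose i) * phq (replicate (j - i) (s *. w) @ replicate i u))"
   by (rule sym_form_binomial[OF phq(1) W sw u(1)])
  also have "\<dots>=(SUM i<=j. of_nat (j choose i) * phq (replicate i (s *. w) @ replicate (j - i) u))"
   by (rule sum.reindex_bij_witness[of _ "%i. j - i" "%i. j - i"]) (auto simp: binomial_symmetric[symmetric])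
  also have "\<dots>=(SUM i<=j. of_nat (j choose i) * (s ^ i * phq (replicate i w @ replicate (j - i) u)))"
   using sym_form_scale_part[of phq W _ _ w u s] phq(1) W u by (intro sum.cong refl) auto
  also have "\<dots> = poly R s" by (simp add: R_def poly_sum poly_monom mult_ac)
  finally show ?thesis .
 qed
 moreover have "degree R<=j" by (rule degree_le) (simp add: cf)
 moreover have "coeff R j = p w" using phq(2) u(2) by (simp add: cf)
 ultimately show ?thesis by (intro exI[of _ R]) simp
qed

text \<open>The torus has been absorbed: weights are divided by the tangent weight, and
  \<open>G k\<close> selects the part of \<open>nvq\<close> that is homogeneous of degree
  \<open>k\<close>.\<close>

locale graded_chart = spanning_chart V W nvq q \<pi>
 for V :: "'v::complex_vector set" and W :: "'w::complex_vector set" and nvq q \<pi> +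
 fixes G :: "nat=>'v=>'v" and M :: nat
 assumes G_lin: "lin V (G k)" and G_V: "v:V==>G k v:V"
  and G_G: "v:V==>G j (G k v)=(if j=k then G k v else 0)"
  and G_sum: "w:W==>(SUM k<=M. G k (nvq w))=nvq w"
  and G_hom: "w:W==>G k (nvq (b *. w))=b ^ k *. G k (nvq w)"
begin

lemma lG: "lin V l==>lin V (%v. l (G k v))"
 using G_V by (intro lin_comp[OF G_lin]) auto

lemma G_above: assumes k: "M < k" and v: "v:V" shows "G k v=0"
proof (rule maps_eq[OF G_lin _ _ _ _ v])
 show "G k ` V \<subseteq> V" using G_V by auto
 show "lin V (%_. 0 :: 'v)" by (simp add: clinear_on_def)
 show "(%_. 0) ` V \<subseteq> V" using sub_0[OF V] by auto
 fix w assume w: "w:W"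
 have "G k (nvq w)=G k (SUM j<=M. G j (nvq w))" by (simp only: G_sum[OF w])
 also have "\<dots>=(SUM j<=M. G k (G j (nvq w)))" by (rule lin_sum[OF V G_lin G_V[OF nvqV[OF w]]])
 also have "\<dots>=0" using k by (intro sum.neutral ballI) (auto simp: G_G[OF nvqV[OF w]])
 finally show "G k (nvq w)=0" .
qed

lemma functional_sum: "lin V l==>w:W==>l (nvq w)=(SUM k<=M. l (G k (nvq w)) :: complex)"
 using lin_sum[OF V, of l "{..M}" "%k. G k (nvq w)"] G_sum[of w] G_V[OF nvqV] by simp

lemma G_homog: "lin V l==>(%w. l (G k (nvq w))):homog W k"
 unfolding homog_polys_def
 using nvq_poly[OF lG] lin_scale[of V l, OF _ G_V[OF nvqV]] by (simp add: G_hom)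

lemma scale_stable: "stable (%w. c *. w)"
 unfolding stable_def
proof (intro conjI allI impI)
 show "(%w. c *. w) ` W \<subseteq> W" using sub_scale[OF W] by auto
 fix l :: "'v=>complex" assume l: "lin V l"
 have "l (nvq (c *. w))=(SUM k<=M. c ^ k *. l (G k (nvq w)))" if w: "w:W" for w
  unfolding functional_sum[OF l sub_scale[OF W w]] G_hom[OF w] using lin_scale[OF l G_V[OF nvqV[OF w]]] by simp
 moreover have "lin V (%v. SUM k<=M. c ^ k *. l (G k v))" by (intro lin_lincomb_fun lG l)
 ultimately show "EX l'. lin V l'&(ALL w:W. l (nvq (c *. w))=l' (nvq w))"
  by (intro exI[of _ "%v. SUM k<=M. c ^ k *. l (G k v)"]) simp
qed

text \<open>\<open>low k\<close> consists of the functionals whose pullbacks to \<open>W\<close> have degree less than \<open>k\<close>, and \<open>jets u k\<close>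
 of those whose pullbacks vanish to order \<open>k\<close> at \<open>u\<close>.\<close>

definition low :: "nat=>('v=>complex) set"
 where "low k={l:dual V. ALL j>=k. ALL w:W. l (G j (nvq w))=0}"

definition jets :: "'w=>nat=>('v=>complex) set"
 where "jets u k={l:dual V. ALL w:W. EX c. ((%s. l (nvq (u + s *. w)) / s ^ k) \<longlongrightarrow> c) (at 0)}"

lemma low_csubspace: "csubspace (low k)"
 unfolding cvs.subspace_def
proof (intro conjI ballI allI)
 show "0:low k" using sub_0[OF dual_csubspace] by (simp add: low_def)
 fix l m c assume l: "l:low k"
 show "c *. l:low k" using l sub_scale[OF dual_csubspace, of l V c] by (simp add: low_def) (simp add: scaleC_fun_def)
 assume m: "m:low k"
 show "l + m:low k" using l m sub_add[OF dual_csubspace, of l V m] by (simp add: low_def)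
qed

lemma jets_csubspace: "csubspace (jets u k)"
 unfolding cvs.subspace_def
proof (intro conjI ballI allI)
 show "0:jets u k" using sub_0[OF dual_csubspace] by (auto simp: jets_def intro!: exI[of _ 0])
 fix l m c assume l: "l:jets u k"
 show "c *. l:jets u k" unfolding jets_def
 proof (intro CollectI conjI ballI)
  show "c *. l:dual V" using l sub_scale[OF dual_csubspace, of l V c] by (simp add: jets_def)
  fix w assume "w:W"
  then obtain z where "((%s. l (nvq (u + s *. w)) / s ^ k) \<longlongrightarrow> z) (at 0)" using l unfolding jets_def by blast
  from tendsto_mult[OF tendsto_const[of c] this]
  show "EX z. ((%s. (c *. l) (nvq (u + s *. w)) / s ^ k) \<longlongrightarrow> z) (at 0)" by (auto simp: scaleC_fun_def)
 qed
 assume m: "m:jets u k"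
 show "l + m:jets u k" unfolding jets_def
 proof (intro CollectI conjI ballI)
  show "l + m:dual V" using l m sub_add[OF dual_csubspace, of l V m] by (simp add: jets_def)
  fix w assume w: "w:W"
  obtain z where z: "((%s. l (nvq (u + s *. w)) / s ^ k) \<longlongrightarrow> z) (at 0)" using l w unfolding jets_def by blast
  obtain y where y: "((%s. m (nvq (u + s *. w)) / s ^ k) \<longlongrightarrow> y) (at 0)" using m w unfolding jets_def by blast
  from tendsto_add[OF z y]
  show "EX z. ((%s. (l + m) (nvq (u + s *. w)) / s ^ k) \<longlongrightarrow> z) (at 0)" by (auto simp: add_divide_distrib)
 qed
qed

lemma jets_eq: "u:W==>jets u (Suc k)=dual V \<inter> jet_kernel V Z (cspan {nvq u}) k"
 using jet_kernel_chart[of u] by (auto simp: jets_def dual_def)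

lemma low_line:
 assumes l: "l:low (Suc k)" and u: "u:W" and w: "w:W"
 shows "EX R. (ALL s. l (nvq (u + s *. w)) = poly R s)&degree R<=k&coeff R k=l (G k (nvq w))"
proof -
 have ll: "lin V l" using l by (simp add: low_def dual_def)
 have "ALL j. EX R. (ALL s. l (G j (nvq (u + s *. w))) = poly R s)&degree R<=j&coeff R j=l (G j (nvq w))"
  by (intro allI homog_line[OF W G_homog[OF ll] u w])
 then obtain R where "ALL j. (ALL s. l (G j (nvq (u + s *. w))) = poly (R j) s)&degree (R j)<=j&coeff (R j) j=l (G j (nvq w))"
  by (rule choice[THEN exE])
 note R = this[THEN spec, THEN conjunct1, THEN spec] this[THEN spec, THEN conjunct2]
 have uw: "u + s *. w:W" for s by (intro sub_add[OF W] sub_scale[OF W] u w)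
 have "l (nvq (u + s *. w)) = poly (SUM j<=k. R j) s" for s
 proof -
  have z: "l (G j (nvq (u + s *. w)))=0" if "k < j" for j using l uw that by (simp add: low_def Suc_le_eq)
  have z': "l (G j (nvq (u + s *. w)))=0" if "M < j" for j
   using G_above[OF that nvqV[OF uw]] lin_0[OF V ll] by simp
  have "l (nvq (u + s *. w))=(SUM j<=M. l (G j (nvq (u + s *. w))))" by (rule functional_sum[OF ll uw])
  also have "\<dots>=(SUM j<=k. l (G j (nvq (u + s *. w))))"
  proof (cases "M<=k")
   case True then show ?thesis by (intro sum.mono_neutral_left) (auto simp: z')
  next
   case False then show ?thesis by (intro sum.mono_neutral_right) (auto simp: z)
  qed
  finally show ?thesis by (simp add: R(1) poly_sum)
 qed
 moreover have "degree (SUM j<=k. R j)<=k" using R(2) by (intro degree_sum_le) (auto intro: order_trans)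
 moreover have "coeff (SUM j<=k. R j) k=l (G k (nvq w))"
 proof -
  have "coeff (R j) k=0" if "j < k" for j using R(2)[of j] that by (intro coeff_eq_0) simp
  then have "(SUM j<=k. coeff (R j) k)=(SUM j:{k}. coeff (R j) k)" by (intro sum.mono_neutral_right) auto
  then show ?thesis using R(2)[of k] by (simp add: coeff_sum)
 qed
 ultimately show ?thesis by (intro exI[of _ "SUM j<=k. R j"]) simp
qed

text \<open>On each line through \<open>u\<close> the function is a polynomial of degree at most
  \<open>k\<close> that vanishes to order \<open>k\<close>, hence a monomial; its coefficient is the
  top degree part.\<close>

lemma low_jets:
 assumes l: "l:low (Suc k)" "l:jets u k" and u: "u:W" and w: "w:W"
 shows "l (nvq (u + w))=l (G k (nvq w))"
proof -
 obtain R where R: "ALL s. l (nvq (u + s *. w)) = poly R s" "degree R<=k" "coeff R k=l (G k (nvq w))"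
  using low_line[OF l(1) u w] by (elim exE conjE)
 obtain c where "((%s. l (nvq (u + s *. w)) / s ^ k) \<longlongrightarrow> c) (at 0)" using l(2) w unfolding jets_def by blast
 then have "((%s. poly R s / s ^ k) \<longlongrightarrow> c) (at 0)" using R(1) by simp
 from poly_limit_coeff[OF this] have z: "ALL j<k. coeff R j=0" by simp
 have "R=monom (coeff R k) k"
 proof (rule poly_eqI)
  show "coeff R j=coeff (monom (coeff R k) k) j" for j
   using z R(2) coeff_eq_0[of R j] by (cases j k rule: linorder_cases) auto
 qed
 then have "poly R 1=coeff R k" by (metis poly_monom power_one mult.right_neutral)
 then show ?thesis using R(1)[rule_format, of 1] R(3) by (simp add: scaleC_one)
qed

lemma low_Suc: "low k \<subseteq> low (Suc k)"
 by (auto simp: low_def)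

lemma low_jets_zero:
 assumes u: "u:W" shows "low k \<inter> jets u k={0}"
proof (intro equalityI subsetI)
 fix l assume l: "l:low k \<inter> jets u k"
 then have ll: "lin V l" "ALL v. v \<notin> V-->l v=0" by (simp_all add: low_def dual_def)
 have "l (nvq w)=0" if w: "w:W" for w
 proof -
  have wu: "w - u:W" by (rule sub_diff[OF W w u])
  have "l (nvq (u + (w - u)))=l (G k (nvq (w - u)))"
   using l low_Suc by (intro low_jets[OF _ _ u wu]) auto
  then show ?thesis using l wu by (simp add: low_def)
 qed
 then have "l v=0" if "v:V" for v by (rule nd[OF ll(1) _ that])
 then have "l=0" using ll(2) by (auto simp: fun_eq_iff)
 then show "l:{0}" by simp
qed (use sub_0[OF low_csubspace] sub_0[OF jets_csubspace] in auto)

text \<open>The components with degrees in \<open>K\<close>, set to 0 outside \<open>V\<close> as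
  membership in \<open>dual V\<close> demands.\<close>

definition part :: "nat set=>('v=>complex)=>'v=>complex"
 where "part K l v=(if v:V then SUM j:K. l (G j v) else 0)"

lemma part_dual: assumes l: "lin V l" shows "part K l:dual V"
 unfolding dual_def
proof (intro CollectI conjI allI impI)
 have "lin V (%v. SUM j:K. 1 *. l (G j v))" by (intro lin_lincomb_fun lG l)
 then show "lin V (part K l)" by (rule lin_cong[OF V]) (simp add: part_def)
qed (simp add: part_def)

lemma part_G: 
 assumes l: "lin V l" and K: "finite K" and v: "v:V" shows "part K l (G i v)=(if i:K then l (G i v) else 0)"
proof -
 have "part K l (G i v)=(SUM j:K. if j=i then l (G i v) else 0)"
  unfolding part_def using G_V[OF v] lin_0[OF V l] by (auto simp: G_G[OF v] intro!: sum.cong)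
 then show ?thesis using K by simp
qed

lemma part_low: "lin V l ==> part {..<k} l:low k"
 by (simp add: low_def part_dual part_G nvqV)

lemma part_jets:
 assumes l: "lin V l" shows "part {k..M} l:jets 0 k"
 unfolding jets_def
proof (intro CollectI conjI ballI part_dual[OF l])
 fix w assume w: "w:W"
 have e: "part {k..M} l (nvq (0 + s *. w)) / s ^ k=(SUM j:{k..M}. s ^ (j - k) * l (G j (nvq w)))" if s: "s~=0" for s
 proof -
  have "part {k..M} l (nvq (0 + s *. w))=(SUM j:{k..M}. s ^ k * (s ^ (j - k) * l (G j (nvq w))))"
   unfolding part_def using nvqV[OF sub_scale[OF W w]] lin_scale[OF l G_V[OF nvqV[OF w]]]
   by (auto simp: G_hom[OF w] mult.assoc[symmetric] power_add[symmetric] intro!: sum.cong)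
  then show ?thesis using s by (simp add: sum_distrib_left[symmetric])
 qed
 have "((%s. SUM j:{k..M}. s ^ (j - k) * l (G j (nvq w))) \<longlongrightarrow> (SUM j:{k..M}. 0 ^ (j - k) * l (G j (nvq w)))) (at 0)"
  by (intro tendsto_intros)
 then have "((%s. part {k..M} l (nvq (0 + s *. w)) / s ^ k) \<longlongrightarrow> (SUM j:{k..M}. 0 ^ (j - k) * l (G j (nvq w)))) (at 0)"
 proof (rule Lim_transform_eventually)
  show "eventually (%s. (SUM j:{k..M}. s ^ (j - k) * l (G j (nvq w))) = part {k..M} l (nvq (0 + s *. w)) / s ^ k) (at 0)"
   unfolding eventually_at_filter by (rule always_eventually) (use e in simp)
 qed
 then show "EX c. ((%s. part {k..M} l (nvq (0 + s *. w)) / s ^ k) \<longlongrightarrow> c) (at 0)" by (rule exI)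
qed

text \<open>At the origin, vanishing to order \<open>k\<close> is the absence of degrees below
  \<open>k\<close>, so splitting by degree gives the decomposition. At another point this fails in
  general.\<close>

lemma low_jets_sum:
 assumes l: "l:dual V" shows "EX s:low k. EX t:jets 0 k. l = s + t"
proof -
 have ll: "lin V l" using l by (simp add: dual_def)
 let ?s = "part {..<k} l"
 have s: "?s:low k" by (rule part_low[OF ll])
 have "l - ?s = part {k..M} l"
 proof
  fix v
  show "(l - ?s) v = part {k..M} l v"
  proof (cases "v:V")
   case True
   have "(l - ?s) v - part {k..M} l v=0"
   proof (rule functionals_eq[OF _ lin_zero _ True])
    have "lin V (%v. (l v + (-1) * ?s v) + (-1) * part {k..M} l v)"
     using part_dual[OF ll] by (intro lin_plus lin_cmult' ll) (simp_all add: dual_def)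
    then show "lin V (%v. (l - ?s) v - part {k..M} l v)" by simp
    fix w assume w: "w:W"
    have "(SUM j<k. l (G j (nvq w))) + (SUM j:{k..M}. l (G j (nvq w)))=(SUM j:{..<k} \<union> {k..M}. l (G j (nvq w)))"
     by (rule sum.union_disjoint[symmetric]) auto
    also have "\<dots>=(SUM j<=M. l (G j (nvq w)))"
     using G_above[OF _ nvqV[OF w]] lin_0[OF V ll] by (intro sum.mono_neutral_right) auto
    finally have "(SUM j<k. l (G j (nvq w))) + (SUM j:{k..M}. l (G j (nvq w)))=l (nvq w)" using functional_sum[OF ll w] by simp
    then show "(l - ?s) (nvq w) - part {k..M} l (nvq w)=0" using nvqV[OF w] by (simp add: part_def algebra_simps)
   qed
   then show ?thesis by simp
  next
   case False
   then show ?thesis using l by (simp add: dual_def part_def)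
  qed
 qed
 then have "l - ?s:jets 0 k" using part_jets[OF ll] by simp
 then show ?thesis using s by (intro bexI[of _ ?s] bexI[of _ "l - ?s"]) simp_all
qed

lemma jets_dual: "jets u k \<subseteq> dual V" and low_dual: "low k \<subseteq> dual V"
 by (auto simp: jets_def low_def)

text \<open>At the origin \<open>jets 0 k\<close> complements \<open>low k\<close>; at
  \<open>u\<close> the space \<open>jets u k\<close> only meets \<open>low k\<close> in 0.\<close>

lemma jets_dim:
 assumes u: "u:W" shows "cdim (jets u k)<=cdim (jets 0 k)"
proof -
 note D = dual_finite_dim[OF fdV] and L = low_csubspace low_dual
 have "cdim (low k) + cdim (jets u k)<=cdim (dual V)"
  by (rule direct_sum_dim(1)[OF D L jets_csubspace jets_dual low_jets_zero[OF u]])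
 moreover have "cdim (low k) + cdim (jets 0 k)=cdim (dual V)"
  by (rule direct_sum_dim(3)[OF D L jets_csubspace jets_dual low_jets_zero[OF sub_0[OF W]]]) (rule low_jets_sum)
 ultimately show ?thesis by linarith
qed

text \<open>Cartan's argument: if the spaces of jets at \<open>u\<close> are as large as at the origin, then the top degree part of a
 functional can be translated to \<open>u\<close>.\<close>

lemma cartan:
 fixes l :: "'v=>complex"
 assumes u: "u:W" and dim: "cdim (jets 0 k)<=cdim (jets u k)" and l: "lin V l"
 shows "EX l'. lin V l'&(ALL w:W. l' (nvq w)=l (G k (nvq (w - u))))"
proof -
 note D = dual_finite_dim[OF fdV] and L = low_csubspace low_dual
 let ?l = "part {k} l"
 have "cdim (low k) + cdim (jets 0 k)=cdim (dual V)"
  by (rule direct_sum_dim(3)[OF D L jets_csubspace jets_dual low_jets_zero[OF sub_0[OF W]]]) (rule low_jets_sum)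
 \<comment> \<open>By the dimension hypothesis \<open>jets u k\<close> is a complement of
   \<open>low k\<close> as well; \<open>g\<close> is the component of the degree \<open>k\<close>
   part that vanishes to order \<open>k\<close> at \<open>u\<close>.\<close>
 then have "EX s:low k. EX t:jets u k. ?l = s + t"
  using dim by (intro direct_sum_dim(2)[OF D L jets_csubspace jets_dual low_jets_zero[OF u] _ part_dual[OF l]]) linarith
 then obtain h g where hg: "h:low k" "g:jets u k" "?l=h + g" by (elim bexE)
 have ls: "?l:low (Suc k)" by (simp add: low_def part_dual[OF l] part_G[OF l] nvqV)
 have ge: "g=?l - h" using hg(3) by simp
 have gl: "g:low (Suc k)" unfolding ge using hg(1) low_Suc ls by (intro sub_diff[OF low_csubspace]) auto
 have "g (nvq w)=l (G k (nvq (w - u)))" if w: "w:W" for w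
 proof -
  have wu: "w - u:W" by (rule sub_diff[OF W w u])
  have "g (nvq w)=g (G k (nvq (w - u)))" using low_jets[OF gl hg(2) u wu] by simp
  also have "\<dots>=?l (G k (nvq (w - u))) - h (G k (nvq (w - u)))" unfolding ge by simp
  also have "\<dots>=l (G k (nvq (w - u)))" using hg(1) wu part_G[OF l _ nvqV[OF wu], of "{k}" k] by (simp add: low_def)
  finally show ?thesis .
 qed
 moreover have "lin V g" using hg(2) by (simp add: jets_def dual_def)
 ultimately show ?thesis by (intro exI[of _ g]) simp
qed

text \<open>Cartan's argument applies where \<open>p\<close> is nonzero. There the value at
  \<open>w - u\<close> is a linear function of \<open>nvq w\<close>, which is stated by expanding
  \<open>nvq w\<close> in the basis \<open>nb\<close>; in this form it is a polynomial identity in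
  \<open>u\<close> and holds everywhere.\<close>

lemma translation_stable:
 assumes p: "p : pfuns W" "u0:W" "p u0~=0"
  and dim: "!!u k. u:W ==> p u~=0==>cdim (jets 0 k)<=cdim (jets u k)" and v: "v:W"
 shows "stable (%w. w + v)"
 unfolding stable_def
proof (intro conjI allI impI)
 show "(%w. w + v) ` W \<subseteq> W" using sub_add[OF W] v by auto
 fix l :: "'v=>complex" assume l: "lin V l"
 have sub: "lin V m==>(%u. m (nvq (w - u))) : pfuns W" if w: "w:W" for w and m :: "'v=>complex"
 proof (rule poly_funs_comp[OF nvq_poly])
  fix h :: "'w=>complex" assume h: "lin W h"
  show "(%u. h (w - u)) : pfuns W"
   by (rule poly_funs_cong[OF W poly_funs_diff[OF poly_funs.const[of "h w"] poly_funs.linear[OF h]]])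
    (simp add: lin_diff[OF W h w])
 qed
 have nbW: "b:nb==>\<pi> b:W" for b using nb_\<pi> by simp
 have key: "l (G k (nvq (w - u)))=(SUM b:nb. crepresentation nb (nvq w) b * l (G k (nvq (\<pi> b - u))))"
  if w: "w:W" and u: "u:W" for k w u
 proof -
  \<comment> \<open>For fixed \<open>w\<close> this is polynomial in \<open>u\<close> and vanishes
    where \<open>p\<close> does not, so it is 0.\<close>
  let ?D = "%u. l (G k (nvq (w - u))) - (SUM b:nb. crepresentation nb (nvq w) b * l (G k (nvq (\<pi> b - u))))"
  have "?D u=0"
  proof (rule poly_funs_no_zero_divisors[OF W p(1) _ _ p(2,3) u])
   show "?D : pfuns W"
    by (intro poly_funs_diff poly_funs_sum poly_funs_cmult sub[OF w lG[OF l]] sub[OF nbW lG[OF l]])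
   fix u assume u: "u:W"
   show "p u * ?D u=0"
   proof (cases "p u=0")
    case False
    obtain l' where l': "lin V l'" "ALL w:W. l' (nvq w)=l (G k (nvq (w - u)))"
     using cartan[OF u dim[OF u False] l, of k] by (elim exE conjE)
    have "l' (nvq w)=l' (SUM b:nb. crepresentation nb (nvq w) b *. b)" by (simp only: nb_expand[OF nvqV[OF w]])
    also have "\<dots>=(SUM b:nb. crepresentation nb (nvq w) b *. l' b)" using nb_V by (intro lin_lincomb[OF V l'(1)]) auto
    also have "\<dots>=(SUM b:nb. crepresentation nb (nvq w) b * l (G k (nvq (\<pi> b - u))))"
     by (rule sum.cong[OF refl]) (use l'(2) nb_\<pi> in force)
    finally show ?thesis using l'(2) w by simp
   qed simp
  qed
  then show ?thesis by simp
 qed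
 let ?l = "%y. SUM b:nb. crepresentation nb y b * (SUM k<=M. l (G k (nvq (\<pi> b + v))))"
 have "lin V ?l"
  by (rule clinear_onI)
   (simp_all add: cvs.representation_add[OF nb(2)] cvs.representation_scale[OF nb(2)] span_nb distrib_right sum.distrib
     sum_distrib_left mult.assoc)
 moreover have "l (nvq (w + v))=?l (nvq w)" if w: "w:W" for w
 proof -
  \<comment> \<open>Translation by \<open>v\<close> is the instance \<open>u = - v\<close>, a point
    at which \<open>p\<close> may vanish.\<close>
  have nv: "- v:W" using v by (rule sub_neg[OF W])
  have key': "l (G k (nvq (w + v)))=(SUM b:nb. crepresentation nb (nvq w) b * l (G k (nvq (\<pi> b + v))))" if "w:W" for k w
   using key[OF that nv, of k] by simp
  have "l (nvq (w + v))=(SUM k<=M. l (G k (nvq (w - - v))))" using functional_sum[OF l sub_add[OF W w v]] by simp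
  also have "\<dots>=(SUM k<=M. SUM b:nb. crepresentation nb (nvq w) b * l (G k (nvq (\<pi> b + v))))" by (simp only: key'[OF w] diff_minus_eq_add)
  also have "\<dots>=?l (nvq w)" unfolding sum_distrib_left by (rule sum.swap)
  finally show ?thesis .
 qed
 ultimately show "EX l'. lin V l'&(ALL w:W. l (nvq (w + v))=l' (nvq w))" by (intro exI[of _ ?l]) simp
qed

end

section \<open>From an action of Euler type to a graded chart\<close>

lemma laurent_exists:
 fixes p :: "complex poly"
 assumes N: "degree p + m<=N"
 shows "EX a. ALL c. c~=0 --> poly p c / c ^ m=(SUM k:{-int N..int N}. c powi k * a k)"
proof (rule exI[of _ "%k. if 0<=k + int m then coeff p (nat (k + int m)) else 0"], intro allI impI)
 fix c :: complex assume c: "c~=0"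
 let ?a = "%k. if 0<=k + int m then coeff p (nat (k + int m)) else 0" and ?I = "(%i. int i - int m) ` {..degree p}"
 have inj: "inj_on (%i. int i - int m) {..degree p}" by (auto simp: inj_on_def)
 have "poly p c / c ^ m=(SUM i<=degree p. c powi (int i - int m) * ?a (int i - int m))"
  unfolding poly_altdef sum_divide_distrib
 proof (rule sum.cong[OF refl])
  fix i
  have "c powi (int i - int m)=c ^ i / c ^ m" using power_int_diff[of c "int i" "int m"] c by simp
  then show "coeff p i * c ^ i / c ^ m=c powi (int i - int m) * ?a (int i - int m)" by simp
 qed
 also have "\<dots>=(SUM k:?I. c powi k * ?a k)" unfolding sum.reindex[OF inj] o_def ..
 also have "\<dots>=(SUM k:{-int N..int N}. c powi k * ?a k)"
 proof (rule sum.mono_neutral_left)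
  show "?I \<subseteq> {-int N..int N}" using N by auto
  show "ALL k:{-int N..int N} - ?I. c powi k * ?a k=0"
  proof
   fix k assume k: "k:{-int N..int N} - ?I"
   have "coeff p (nat (k + int m))=0" if "0<=k + int m"
   proof (rule coeff_eq_0, rule ccontr)
    assume "\<not> degree p < nat (k + int m)"
    then have "k:?I" using that by (intro image_eqI[of _ _ "nat (k + int m)"]) auto
    then show False using k by simp
   qed
   then show "c powi k * ?a k=0" by simp
  qed
 qed simp
 finally show "poly p c / c ^ m=(SUM k:{-int N..int N}. c powi k * ?a k)" .
qed

text \<open>The matrix entries of \<open>rh c\<close> are Laurent polynomials; their coefficients
  form the maps \<open>E k\<close>. Multiplicativity, compared coefficientwise in \<open>c\<close>
  and then in \<open>d\<close>, makes them mutually annihilating idempotents.\<close>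

lemma weight_decomposition:
 assumes fdV: "finite_dim V" and rh: "mult_group_rep V rh"
 shows "EX E N. graded_space V E N&(ALL c. ALL v:V. c~=0-->rh c v=(SUM k:{-int N..int N}. c powi k *. E k v))"
proof -
 note V = fd_sub[OF fdV]
 have iso: "lin_iso V V (rh c)" if "c~=0" for c using rh that by (simp add: mult_group_rep_def)
 note lin = lin_isoD(1)[OF iso] and inV = lin_isoD(4)[OF iso]
 let ?B = "vbasis V"
 have BV: "b:?B==>b:V" for b using vbasis(1)[of V] by blast
 have fin: "finite (?B \<times> ?B)" using finite_vbasis[OF fdV] by simp
 have rat: "ALL v:V. ALL l. lin V l-->(EX (p :: complex poly) m. ALL c. c~=0-->l (rh c v) = poly p c / c ^ m)"
  using rh unfolding mult_group_rep_def by (elim conjE)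
 have "ALL bb:?B \<times> ?B. EX pm :: complex poly \<times> nat. ALL c. c~=0-->coord V (snd bb) (rh c (fst bb)) = poly (fst pm) c / c ^ snd pm"
 proof
  fix bb assume "bb:?B \<times> ?B"
  then have "fst bb:V" using BV by auto
  from rat[rule_format, OF this coord_linear[OF V, of "snd bb"]] obtain p :: "complex poly" and m where
   "ALL c. c~=0-->coord V (snd bb) (rh c (fst bb)) = poly p c / c ^ m" by (elim exE)
  then show "EX pm :: complex poly \<times> nat. ALL c. c~=0-->coord V (snd bb) (rh c (fst bb)) = poly (fst pm) c / c ^ snd pm"
   by (intro exI[of _ "(p, m)"]) simp
 qed
 then obtain pm :: "_=>complex poly \<times> nat" where
  pm: "ALL bb:?B \<times> ?B. ALL c. c~=0-->coord V (snd bb) (rh c (fst bb)) = poly (fst (pm bb)) c / c ^ snd (pm bb)"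
  by (rule bchoice[THEN exE])
 \<comment> \<open>A crude bound that serves all finitely many matrix entries at once.\<close>
 define N where "N=(SUM bb:?B \<times> ?B. degree (fst (pm bb)) + snd (pm bb))"
 let ?K = "{-int N..int N}"
 have "ALL bb:?B \<times> ?B. EX a. ALL c. c~=0-->coord V (snd bb) (rh c (fst bb))=(SUM k:?K. c powi k * a k)"
 proof
  fix bb assume bb: "bb:?B \<times> ?B"
  have le: "degree (fst (pm bb)) + snd (pm bb)<=N"
   unfolding N_def by (rule member_le_sum[OF bb _ fin, where f="%bb. degree (fst (pm bb)) + snd (pm bb)"]) simp
  obtain a where "ALL c. c~=0 --> poly (fst (pm bb)) c / c ^ snd (pm bb)=(SUM k:?K. c powi k * a k)"
   using laurent_exists[OF le] by (elim exE)
  then show "EX a. ALL c. c~=0-->coord V (snd bb) (rh c (fst bb))=(SUM k:?K. c powi k * a k)"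
   using pm[rule_format, OF bb] by (intro exI[of _ a]) simp
 qed
 then obtain a where "ALL bb:?B \<times> ?B. ALL c. c~=0-->coord V (snd bb) (rh c (fst bb))=(SUM k:?K. c powi k * a bb k)"
  by (rule bchoice[THEN exE])
 then have a: "coord V b' (rh c b)=(SUM k:?K. c powi k * a (b, b') k)" if "b:?B" "b':?B" "c~=0" for b b' c
  using that by force
 define D where "D b k=(SUM b':?B. a (b, b') k *. b')" for b k
 have DV: "D b k:V" for b k unfolding D_def by (intro sub_sum[OF V] sub_scale[OF V] BV)
 have rhb: "rh c b=(SUM k:?K. c powi k *. D b k)" if c: "c~=0" and b: "b:?B" for c b
 proof -
  have "rh c b=(SUM b':?B. coord V b' (rh c b) *. b')" by (rule coord_expand[OF fdV inV[OF c BV[OF b]], symmetric])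
  also have "\<dots>=(SUM b':?B. SUM k:?K. c powi k *. a (b, b') k *. b')"
   by (rule sum.cong[OF refl]) (simp only: a[OF b _ c] cvs.scale_sum_left scaleC_scaleC)
  also have "\<dots>=(SUM k:?K. SUM b':?B. c powi k *. a (b, b') k *. b')" by (rule sum.swap)
  also have "\<dots>=(SUM k:?K. c powi k *. D b k)" by (simp only: D_def cvs.scale_sum_right)
  finally show ?thesis .
 qed
 define E where "E k v=(if k:?K then SUM b:?B. coord V b v *. D b k else 0)" for k v
 have rhE: "rh c v=(SUM k:?K. c powi k *. E k v)" if c: "c~=0" and v: "v:V" for c v
 proof -
  have "rh c v=(SUM b:?B. coord V b v *. rh c b)" by (rule lin_expand[OF fdV lin[OF c] v])
  also have "\<dots>=(SUM b:?B. SUM k:?K. c powi k *. coord V b v *. D b k)"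
   by (rule sum.cong[OF refl]) (simp only: rhb[OF c] cvs.scale_sum_right scaleC_scaleC mult.commute)
  also have "\<dots>=(SUM k:?K. SUM b:?B. c powi k *. coord V b v *. D b k)" by (rule sum.swap)
  also have "\<dots>=(SUM k:?K. c powi k *. E k v)" by (rule sum.cong[OF refl]) (simp only: E_def if_True cvs.scale_sum_right)
  finally show ?thesis .
 qed
 have E_V: "E k v:V" for k v
  unfolding E_def using sub_sum[OF V, of ?B "%b. coord V b v *. D b k"] sub_scale[OF V DV] sub_0[OF V] by simp
 have E_lin: "lin V (E k)" for k
  by (rule clinear_onI)
   (simp_all add: E_def lin_add[OF coord_linear[OF V]] lin_scale[OF coord_linear[OF V]] scaleC_add_left
    sum.distrib cvs.scale_sum_right scaleC_scaleC)
 have E_out: "E k v=0" if "k \<notin> ?K" for k v using that unfolding E_def by (rule if_not_P)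
 have lE: "l (rh c v)=(SUM k:?K. c powi k * l (E k v))" if l: "lin V l" and c: "c~=0" and v: "v:V"
  for l :: "'a=>complex" and c v
  unfolding rhE[OF c v] using lin_lincomb[OF V l, of ?K "%k. E k v" "%k. c powi k"] E_V by simp
 have E_E: "E k (E j v)=(if k=j then E j v else 0)" if v: "v:V" for k j v
 proof (cases "k:?K&j:?K")
  case True
  show ?thesis
  proof (rule lin_eqI[OF fdV E_V])
   show "(if k=j then E j v else 0):V" using E_V sub_0[OF V] by simp
   fix l :: "'a=>complex" assume l: "lin V l"
   have 1: "l (E k (rh d v))=d powi k * l (E k v)" if d: "d~=0" for d
   proof (rule laurent_eq[where N=N and k=k and a="%k. l (E k (rh d v))" and b="%k. d powi k * l (E k v)"])
    fix c :: complex assume c: "c~=0"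
    have "(SUM k:?K. c powi k * l (E k (rh d v)))=l (rh c (rh d v))" by (rule lE[OF l c inV[OF d v], symmetric])
    also have "rh c (rh d v)=rh (c * d) v" using rh c d v by (simp add: mult_group_rep_def)
    also have "l (rh (c * d) v)=(SUM k:?K. (c * d) powi k * l (E k v))" using c d by (intro lE[OF l _ v]) simp
    finally show "(SUM k:?K. c powi k * l (E k (rh d v)))=(SUM k:?K. c powi k * (d powi k * l (E k v)))"
     by (simp add: power_int_mult_distrib mult.assoc)
   qed (use True in simp)
   have lk: "lin V (%v. l (E k v))" using E_V by (intro lin_comp[OF E_lin l]) auto
   have "l (E k (E j v))=(if j=k then l (E k v) else 0)"
   proof (rule laurent_eq[where N=N and k=j and a="%j. l (E k (E j v))" and b="%j. if j=k then l (E k v) else 0"])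
    fix d :: complex assume d: "d~=0"
    have "(SUM j:?K. d powi j * l (E k (E j v)))=l (E k (rh d v))" by (rule lE[OF lk d v, symmetric])
    also have "\<dots>=d powi k * l (E k v)" by (rule 1[OF d])
    also have "\<dots>=(SUM j:?K. if j=k then d powi k * l (E k v) else 0)" using True by simp
    also have "\<dots>=(SUM j:?K. d powi j * (if j=k then l (E k v) else 0))" by (rule sum.cong) auto
    finally show "(SUM j:?K. d powi j * l (E k (E j v)))=(SUM j:?K. d powi j * (if j=k then l (E k v) else 0))" .
   qed (use True in simp)
   then show "l (E k (E j v))=l (if k=j then E j v else 0)" using lin_0[OF V l] by auto
  qed
 next
  case False
  then show ?thesis using E_out lin_0[OF V E_lin] by auto
 qed
 have "graded_space V E N"
 proof
  show "(SUM k:?K. E k v)=v" if "v:V" for v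
   using rhE[of 1 v] rh that by (simp add: mult_group_rep_def scaleC_one)
 qed (use fdV E_lin E_V E_E E_out in auto)
 then show ?thesis using rhE by (intro exI[of _ E] exI[of _ N]) simp
qed

context graded_space
begin

lemma weight_of_eigenvector:
 assumes v: "v:V" and a: "a:{-int N..int N}" and eig: "!!d. d~=0==>Th d v=d powi a *. v"
 shows "E a v=v"
proof (rule lin_eqI[OF fdV E_V[OF v] v])
 fix l :: "'v=>complex" assume l: "lin V l"
 show "l (E a v)=l v"
 proof -
  have "l (E a v)=(if a=a then l v else 0)"
  proof (rule laurent_eq[where N=N and k=a and a="%j. l (E j v)" and b="%j. if j=a then l v else 0"])
   fix d :: complex assume d: "d~=0"
   have "(SUM j:{-int N..int N}. d powi j * l (E j v))=l (Th d v)" using functional_Th(1)[OF l v, of d] by simp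
   also have "\<dots>=d powi a * l v" using eig[OF d] lin_scale[OF l v] by simp
   also have "\<dots>=(SUM j:{-int N..int N}. if j=a then d powi a * l v else 0)" using a by simp
   also have "\<dots>=(SUM j:{-int N..int N}. d powi j * (if j=a then l v else 0))" by (rule sum.cong) auto
   finally show "(SUM j:{-int N..int N}. d powi j * l (E j v))=(SUM j:{-int N..int N}. d powi j * (if j=a then l v else 0))" .
  qed (rule a)
  then show ?thesis by simp
 qed
qed

text \<open>A functional vanishing on the line of \<open>v\<close> vanishes on every weight
  component, by independence of characters. So the components lie on that line, and a nonzero one is
  all of \<open>v\<close> because \<open>E k\<close> is idempotent.\<close>

lemma eigenvector_weight:
 assumes v: "v:V" "v~=0" and eig: "!!d. d~=0==>EX \<mu>. Th d v=\<mu> *. v"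
 shows "EX a. a:{-int N..int N}&E a v=v"
proof -
 have sp: "E k v:cspan {v}" if k: "k:{-int N..int N}" for k
 proof (rule ccontr)
  assume "E k v \<notin> cspan {v}"
  then obtain l :: "'v=>complex" where l: "clinear l" "ALL x:cspan {v}. l x=0" "l (E k v)=1"
   using separating_functional[OF cvs.subspace_span] by blast
  have "l (E k v)=0"
  proof (rule laurent_zero[where N=N and a="%k. l (E k v)", OF _ k])
   fix d :: complex assume "d~=0"
   then obtain \<mu> where "Th d v=\<mu> *. v" using eig by blast
   then have "Th d v:cspan {v}" by (simp add: mem_span1)
   then have "l (Th d v)=0" using l(2) by simp
   then show "(SUM k:{-int N..int N}. d powi k * l (E k v))=0"
    using functional_Th(1)[OF clinear_clinear_on[OF l(1)] v(1), of d] by simp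
  qed
  then show False using l(3) by simp
 qed
 obtain k where k: "k:{-int N..int N}" "E k v~=0"
 proof (rule ccontr)
  assume "\<not> thesis"
  then have "(SUM k:{-int N..int N}. E k v)=0" using that by (intro sum.neutral) blast
  then show False using E_sum[OF v(1)] v(2) by simp
 qed
 obtain \<mu> where \<mu>: "E k v=\<mu> *. v" using sp[OF k(1)] unfolding mem_span1 by (elim exE)
 have "E k (E k v)=\<mu> *. E k v" using arg_cong[OF \<mu>, of "E k"] lin_scale[OF E_lin v(1)] by simp
 then have "\<mu> *. E k v - 1 *. E k v=0" using E_E[OF v(1), of k k] by (simp add: scaleC_one)
 then have "(\<mu> - 1) *. E k v=0" by (simp only: cvs.scale_left_diff_distrib)
 then have "\<mu>=1" using k(2) by simp
 then show ?thesis using k(1) \<mu> by (intro exI[of _ k]) (simp add: scaleC_one)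
qed

lemma sum_shift:
 fixes f :: "int=>'b::comm_monoid_add"
 assumes f: "!!j. j \<notin> {-int N..int N}==>f j=0"
 shows "(SUM k:{-int (N + nat \<bar>e\<bar>)..int (N + nat \<bar>e\<bar>)}. f (e + k))=(SUM j:{-int N..int N}. f j)"
proof -
 let ?K = "{-int (N + nat \<bar>e\<bar>)..int (N + nat \<bar>e\<bar>)}"
 have "(SUM k:?K. f (e + k))=(SUM j:(%k. e + k) ` ?K. f j)" by (subst sum.reindex) (simp_all add: inj_on_def)
 also have "\<dots>=(SUM j:{-int N..int N}. f j)"
 proof (rule sum.mono_neutral_right)
  show "{-int N..int N} \<subseteq> (%k. e + k) ` ?K"
  proof
   fix j assume "j:{-int N..int N}"
   then have "j - e:?K" by auto
   then show "j:(%k. e + k) ` ?K" by (intro image_eqI[of _ _ "j - e"]) simp_all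
  qed
 qed (use f in auto)
 finally show ?thesis .
qed

text \<open>The twist by a character that gives weight 0 to vectors of weight \<open>e\<close>. By
  \<open>Th_shift\<close> the action changes by scalars only, so the action on lines is the
  same.\<close>

lemma shift: "graded_space V (%k. E (e + k)) (N + nat \<bar>e\<bar>)"
proof
 show "(SUM k:{-int (N + nat \<bar>e\<bar>)..int (N + nat \<bar>e\<bar>)}. E (e + k) v)=v" if v: "v:V" for v
  using sum_shift[of "%k. E k v" e] E_out[OF _ v] E_sum[OF v] by simp
 show "E (e + k) (E (e + l) v)=(if k=l then E (e + l) v else 0)" if "v:V" for k l v using E_E[OF that] by simp
 show "E (e + k) v=0" if "k \<notin> {-int (N + nat \<bar>e\<bar>)..int (N + nat \<bar>e\<bar>)}" "v:V" for k v
  using that(1) by (intro E_out[OF _ that(2)]) auto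
 show "E (e + k) v:V" if "v:V" for k v by (rule E_V[OF that])
qed (rule fdV E_lin)+

lemma Th_shift:
 assumes d: "d~=0" and v: "v:V"
 shows "graded_space.Th (%k. E (e + k)) (N + nat \<bar>e\<bar>) d v=d powi (- e) *. Th d v"
proof -
 interpret s: graded_space V "%k. E (e + k)" "N + nat \<bar>e\<bar>" by (rule shift)
 have "s.Th d v=(SUM k:{-int (N + nat \<bar>e\<bar>)..int (N + nat \<bar>e\<bar>)}. d powi ((e + k) - e) *. E (e + k) v)" unfolding s.Th_def by simp
 also have "\<dots>=(SUM j:{-int N..int N}. d powi (j - e) *. E j v)"
  by (rule sum_shift[of "%j. d powi (j - e) *. E j v"]) (simp add: E_out[OF _ v])
 also have "\<dots>=(SUM j:{-int N..int N}. d powi (- e) *. d powi j *. E j v)"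
 proof (rule sum.cong[OF refl])
  fix j
  have "d powi (j - e)=d powi (- e) * d powi j" using power_int_add[of d "- e" j] d by simp
  then show "d powi (j - e) *. E j v=d powi (- e) *. d powi j *. E j v" by (simp add: scaleC_scaleC)
 qed
 finally show ?thesis by (simp only: Th_def cvs.scale_sum_right)
qed

lemma opposite: "graded_space V (%k. E (- k)) N"
proof
 show "(SUM k:{-int N..int N}. E (- k) v)=v" if v: "v:V" for v
 proof -
  have "(SUM k:{-int N..int N}. E (- k) v)=(SUM k:{-int N..int N}. E k v)"
   by (rule sum.reindex_bij_witness[of _ uminus uminus]) auto
  then show ?thesis using E_sum[OF v] by simp
 qed
 show "E (- k) (E (- l) v)=(if k=l then E (- l) v else 0)" if "v:V" for k l v using E_E[OF that] by simp
 show "E (- k) v=0" if "k \<notin> {-int N..int N}" "v:V" for k v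
  using that(1) by (intro E_out[OF _ that(2)]) auto
 show "E (- k) v:V" if "v:V" for k v by (rule E_V[OF that])
qed (rule fdV E_lin)+

lemma Th_opposite:
 assumes v: "v:V" shows "graded_space.Th (%k. E (- k)) N d v=Th (inverse d) v"
proof -
 interpret s: graded_space V "%k. E (- k)" N by (rule opposite)
 show ?thesis unfolding s.Th_def Th_def
  by (rule sum.reindex_bij_witness[of _ uminus uminus]) (auto simp: power_int_minus power_int_inverse)
qed

end

lemma (in graded_point) opposite_point: "graded_point V (%k. E (- k)) N Z x"
proof (intro graded_point.intro graded_point_axioms.intro opposite Zv xZ)
 show "E (- 0) x=x" using Ex by simp
 show "graded_space.Th (%k. E (- k)) N d v:acone V Z" if "d~=0" "v:acone V Z" for d v
  unfolding Th_opposite[OF coneD(1)[OF that(2)]] using that by (intro inv) simp_all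
qed

lemma (in positive_point) graded:
 assumes nd: "nondegenerate V Z" shows "graded_chart V pp.TK nu q \<pi> (%k. G k) (Suc N)"
proof (intro graded_chart.intro spanning_chart.intro spanning_chart_axioms.intro graded_chart_axioms.intro)
 show "graph_chart V pp.TK nu q \<pi>" by (rule chart.graph_chart_axioms)
 fix l :: "'v=>complex" and v assume l: "lin V l" and z: "!!w. w : pp.TK==>l (nu w)=0" and v: "v:V"
 have "l:vid V chart.Z 1" unfolding chart.vid_iff by (intro conjI ballI homog_linear[OF l] z)
 then have lZ: "l:vid V Z 1" unfolding chart_Z .
 have van: "l u=0" if L: "L:Z" "u:L" for L u
 proof (cases "u=0")
  case False
  have "u:acone V Z" using cone_elem[OF V ZP L False] by simp
  then show ?thesis using lZ by (simp add: vid_def)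
 qed (simp add: lin_0[OF V l])
 show "l v=0"
  by (rule nd[unfolded nondegenerate_def, rule_format, OF _ v]) (intro conjI ballI l van)
next
 show "lin V (G k)" for k by (rule E_lin)
 show "G k v:V" if "v:V" for k v by (rule E_V[OF that])
 show "G j (G k v)=(if j=k then G k v else 0)" if "v:V" for j k v by (rule GG[OF that])
 show "(SUM k<=Suc N. G k (nu w))=nu w" if "w : pp.TK" for w by (rule G_sum[OF that])
 show "G k (nu (b *. w))=b ^ k *. G k (nu w)" if "w : pp.TK" for k b w by (rule G_hom[OF that])
qed

lemma (in positive_point) chart_exists:
 assumes nd: "nondegenerate V Z"
 shows "EX (W :: 'v set) nvq q \<pi> G M. graded_chart V W nvq q \<pi> G M&graph_chart.Z V W nvq=Z&nvq 0=x"
 by (rule exI[of _ pp.TK], rule exI[of _ nu], rule exI[of _ q], rule exI[of _ \<pi>], rule exI[of _ "%k. G k"],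
   rule exI[of _ "Suc N"], intro conjI, rule graded[OF nd], rule chart_Z, rule sg_0)

context split_point
begin

text \<open>The condition on \<open>a\<close> is modulo \<open>x\<close>, so that it refers neither
  to \<open>q\<close> nor to a choice of splitting and can be transferred between gradings.\<close>

lemma chart_of_weight:
 assumes nd: "nondegenerate V Z" and ns: "!!y. y:acone V Z==>cdim (tcone V Z x)<=cdim (tcone V Z y)"
  and nt: "Z~={cspan {x}}"
  and U: "znbhd V Z (cspan {x}) U" and fixed: "!!y. y:U==>(!!d. d~=0==>Th d ` y=y)==>y=cspan {x}"
  and a: "!!v. v:tcone V Z x==>E a v - v:cspan {x}" and a0: "0<=a"
 shows "EX (W :: 'v set) nvq q \<pi> G M. graded_chart V W nvq q \<pi> G M&graph_chart.Z V W nvq=Z&nvq 0=x"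
proof -
 have aT: "E a v=v" if v: "v:tcone V Z x" "q v=0" for v
 proof -
  obtain c where c: "E a v - v=c *. x" using a[OF v(1)] unfolding mem_span1 by (elim exE)
  have vV: "v:V" by (rule pp.tconeD[OF v(1)])
  have "q (E a v - v)=0" using lin_diff[OF V q E_V[OF vV] vV] qE[OF vV, of a] v(2) by simp
  then have "c=0" unfolding c using lin_scale[OF q xV] qx by simp
  then show ?thesis using c by simp
 qed
 have an: "a~=0"
 proof
  assume a0: "a=0"
  have "Z={cspan {x}}"
  proof (rule tangent_weight_nonzero[OF _ U])
   show "E 0 v=v" if "v:tcone V Z x" "q v=0" for v using aT[OF that] a0 by simp
   show "y=cspan {x}" if "y:U" "!!d. d~=0==>Th d ` y=y" for y by (rule fixed[OF that])
  qed
  then show False using nt by simp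
 qed
 have pt: "positive_point V E N Z x q \<pi> J ep P n (nat a)"
 proof (intro positive_point.intro positive_point_axioms.intro split_point_axioms)
  show "0 < nat a" using a0 an by simp
  show "E (int (nat a)) v=v" if "v:tcone V Z x" "q v=0" for v using aT[OF that] a0 by simp
  show "cdim (tcone V Z x)<=cdim (tcone V Z y)" if "y:acone V Z" for y by (rule ns[OF that])
 qed
 show ?thesis by (rule positive_point.chart_exists[OF pt nd])
qed

end

context graded_point
begin

lemma split_point_exists: "EX q \<pi> J ep P n. split_point V E N Z x q \<pi> J ep P n"
proof -
 obtain q \<pi> J ep P n where s: "lin V q" "q x=1" "ALL v:V. ALL i. q (E i v)=(if i=0 then q v else 0)"
  "lin V \<pi>" "ALL v:V. \<pi> v:tcone V Z x&q (\<pi> v)=0" "ALL v:V. ALL i. E i (\<pi> v)=\<pi> (E i v)"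
  "ALL v:tcone V Z x. q v=0-->\<pi> v=v" "finite J"
  and b: "ALL bt:J. snd bt:V&E (fst bt) (snd bt) = snd bt&lin V (ep bt) &
   (ALL v:V. ep bt (E (fst bt) v)=ep bt v)&P bt:vid V Z (n bt)&(ALL v:V. dd (P bt) v x=ep bt v) &
   (ALL v:V. ALL d. d~=0-->P bt (Th d v)=d powi (fst bt) * P bt v)"
  and t: "ALL bt:J. ALL bt':J. ep bt (snd bt')=(if bt=bt' then 1 else 0)"
   "ALL v:V. v=q v *. x + \<pi> v + (SUM bt:J. ep bt v *. snd bt)"
  using splitting by (elim exE conjE)
 note b = b[THEN bspec]
 note b2 = b[THEN conjunct2]
 note b3 = b2[THEN conjunct2]
 note b4 = b3[THEN conjunct2]
 note b5 = b4[THEN conjunct2]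
 note b6 = b5[THEN conjunct2]
 have "split_point V E N Z x q \<pi> J ep P n"
 proof (intro split_point.intro split_point_axioms.intro)
  show "graded_point V E N Z x" by (rule graded_point_axioms)
  show "q (E i v)=(if i=0 then q v else 0)" if "v:V" for v i by (rule s(3)[rule_format, OF that])
  show "\<pi> v:tcone V Z x&q (\<pi> v)=0" if "v:V" for v by (rule s(5)[rule_format, OF that])
  show "E i (\<pi> v)=\<pi> (E i v)" if "v:V" for v i by (rule s(6)[rule_format, OF that])
  show "\<pi> v=v" if "v:tcone V Z x" "q v=0" for v by (rule s(7)[rule_format, OF that])
  show "snd bt:V" "E (fst bt) (snd bt) = snd bt" "lin V (ep bt)" "P bt:vid V Z (n bt)" if "bt:J" for bt
   by (rule b[OF that, THEN conjunct1], rule b2[OF that, THEN conjunct1], rule b3[OF that, THEN conjunct1],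
     rule b5[OF that, THEN conjunct1])
  show "ep bt (E (fst bt) v)=ep bt v" "dd (P bt) v x=ep bt v" if "bt:J" "v:V" for bt v
   by (rule b4[OF that(1), THEN conjunct1, THEN bspec, OF that(2)], rule b6[OF that(1), THEN conjunct1, THEN bspec, OF that(2)])
  show "P bt (Th d v)=d powi fst bt * P bt v" if "bt:J" "v:V" "d~=0" for bt v d
   by (rule b6[OF that(1), THEN conjunct2, THEN bspec, OF that(2), THEN spec, THEN mp, OF that(3)])
  show "ep bt (snd bt')=(if bt=bt' then 1 else 0)" if "bt:J" "bt':J" for bt bt' by (rule t(1)[rule_format, OF that])
  show "v=q v *. x + \<pi> v + (SUM bt:J. ep bt v *. snd bt)" if "v:V" for v by (rule t(2)[THEN bspec, OF that])
 qed (rule s)+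
 then show ?thesis by (intro exI)
qed

lemma chart_of_weight:
 assumes nd: "nondegenerate V Z" and ns: "!!y. y:acone V Z==>cdim (tcone V Z x)<=cdim (tcone V Z y)"
  and nt: "Z~={cspan {x}}"
  and U: "znbhd V Z (cspan {x}) U" and fixed: "!!y. y:U==>(!!d. d~=0==>Th d ` y=y)==>y=cspan {x}"
  and a: "!!v. v:tcone V Z x==>E a v - v:cspan {x}" and a0: "0<=a"
 shows "EX (W :: 'a set) nvq q \<pi> G M. graded_chart V W nvq q \<pi> G M&graph_chart.Z V W nvq=Z&nvq 0=x"
proof -
 obtain q \<pi> J ep P n where sp: "split_point V E N Z x q \<pi> J ep P n" using split_point_exists by (elim exE)
 show ?thesis
 proof (rule split_point.chart_of_weight[OF sp nd ns nt U _ a a0])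
  show "y=cspan {x}" if "y:U" "!!d. d~=0==>Th d ` y=y" for y by (rule fixed[OF that])
 qed
qed

text \<open>The torus acts by scalars on the tangent directions, so all of them are weight vectors
  with the weight of a single nonzero one.\<close>

lemma tangent_weight:
 fixes q :: "'a=>complex"
 assumes q: "lin V q" "q x=1"
  and scal: "!!d. d~=0==>EX \<mu>. ALL v:tcone V Z x. q v=0-->Th d v=\<mu> *. v"
 shows "EX a. ALL v:tcone V Z x. E a v - v:cspan {x}"
proof -
 interpret pp: proj_point V Z x q by unfold_locales (rule fdV ZP xZ q)+
 have "EX a. ALL v:pp.TK. E a v=v"
 proof (cases "EX v:pp.TK. v~=0")
  case True
  then obtain v0 where v0: "v0:tcone V Z x" "q v0=0" "v0~=0" by blast
  have v0V: "v0:V" by (rule pp.tconeD[OF v0(1)])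
  have "EX a. a:{-int N..int N}&E a v0=v0"
  proof (rule eigenvector_weight[OF v0V v0(3)])
   fix d :: complex assume "d~=0"
   then obtain \<mu> where "ALL v:tcone V Z x. q v=0-->Th d v=\<mu> *. v" using scal by blast
   from this[rule_format, OF v0(1,2)] show "EX \<mu>. Th d v0=\<mu> *. v0" by (rule exI)
  qed
  then obtain a where a: "a:{-int N..int N}" "E a v0=v0" by (elim exE conjE)
  have Ea: "E a v=v" if v: "v : pp.TK" for v
  proof (rule weight_of_eigenvector[OF _ a(1)])
   show "v:V" using v pp.tconeD by simp
   fix d :: complex assume "d~=0"
   then obtain \<mu> where \<mu>: "ALL v:tcone V Z x. q v=0-->Th d v=\<mu> *. v" using scal by blast
   have "d powi a *. v0=\<mu> *. v0" using \<mu>[rule_format, OF v0(1,2)] Th_weight[OF v0V a(2), of d] by simp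
   then have "d powi a=\<mu>" using v0(3) by simp
   then show "Th d v=d powi a *. v" using \<mu> v by simp
  qed
  show ?thesis by (rule exI[of _ a], rule ballI, rule Ea)
 next
  case False
  \<comment> \<open>If there is no nonzero tangent direction, any weight will do; 1 is
    taken.\<close>
  have E1: "E 1 v=v" if "v : pp.TK" for v
  proof -
   have v0: "v=0" using False that by auto
   show ?thesis unfolding v0 by (rule lin_0[OF V E_lin])
  qed
  show ?thesis by (rule exI[of _ 1], rule ballI, rule E1)
 qed
 then obtain a where a: "ALL v:pp.TK. E a v=v" by (elim exE)
 have Ea: "E a v - v:cspan {x}" if v: "v:tcone V Z x" for v
 proof -
  let ?v = "v - q v *. x"
  have vV: "v:V" by (rule pp.tconeD[OF v])
  have xx: "q v *. x:V" by (rule sub_scale[OF V xV])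
  have "?v:tcone V Z x"
   by (intro sub_diff[OF pp.tcone_csubspace v] sub_scale[OF pp.tcone_csubspace] pp.x_tcone)
  moreover have "q ?v=0" using lin_diff[OF V q(1) vV xx] lin_scale[OF q(1) xV] q(2) by simp
  ultimately have "E a ?v=?v" using a by simp
  then have "E a v - E a (q v *. x)=v - q v *. x" using lin_diff[OF V E_lin vV xx] by simp
  then have "E a v - v=E a (q v *. x) - q v *. x" by (simp add: algebra_simps)
  also have "E a (q v *. x)=(if a=0 then q v else 0) *. x"
   using lin_scale[OF E_lin xV] E_x[of a] Ex by simp
  also have "\<dots> - q v *. x=((if a=0 then q v else 0) - q v) *. x" by (rule cvs.scale_left_diff_distrib[symmetric])
  finally have "E a v - v=((if a=0 then q v else 0) - q v) *. x" .
  then show ?thesis unfolding mem_span1 by (rule exI)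
 qed
 show ?thesis by (rule exI[of _ a], rule ballI, rule Ea)
qed

end

text \<open>Translates the geometric definition into weights: the line \<open>L\<close> gives an
  eigenvector, the isotropic action on derivations gives a single tangent weight, and isolation
  makes that weight nonzero.\<close>

lemma euler_chart:
 fixes V :: "'v::complex_vector set"
 assumes fdV: "finite_dim V" and nd: "nondegenerate V Z" and Zv: "proj_variety V Z" and nt: "!!y. Z~={y}"
  and L: "euler_type V Z L rh"
 shows "EX (W :: 'v set) nvq q \<pi> G M. graded_chart V W nvq q \<pi> G M&graph_chart.Z V W nvq=Z&L=cspan {nvq 0}"
proof -
 note V = fd_sub[OF fdV]
 have ZP: "Z \<subseteq> proj V" using Zv closed_subset_proj[of V Z] unfolding proj_variety_def by simp
 note e1 = L[unfolded euler_type_def, THEN conjunct1]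
 note r2 = L[unfolded euler_type_def, THEN conjunct2]
 note r3 = r2[THEN conjunct2]
 note r4 = r3[THEN conjunct2]
 note r5 = r4[THEN conjunct2]
 note e2 = r2[THEN conjunct1] and e3 = r3[THEN conjunct1, rule_format] and e4 = r4[THEN conjunct1, rule_format]
  and e5 = r5[THEN conjunct1] and e6 = r5[THEN conjunct2, rule_format]
 have LZ: "L:Z" using e1 by (simp add: nonsingular_point_def)
 obtain x where x: "x:acone V Z" "L=cspan {x}" using cone_rep[OF ZP LZ] by (elim bexE)
 have xV: "x:V" and xn: "x~=0" using x(1) by (rule coneD)+
 obtain E0 N0 where g0: "graded_space V E0 N0"
  and rhE: "ALL c. ALL v:V. c~=0-->rh c v=(SUM k:{-int N0..int N0}. c powi k *. E0 k v)"
  using weight_decomposition[OF fdV e2] by (elim exE conjE)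
 interpret g0: graded_space V E0 N0 by (rule g0)
 have rhTh: "rh c v=g0.Th c v" if "c~=0" "v:V" for c v
  using rhE[rule_format, OF that(2,1)] by (simp add: g0.Th_def)
 have iso: "lin_iso V V (rh c)" if "c~=0" for c using e2 that by (simp add: mult_group_rep_def)
 note rhlin = lin_isoD(1)[OF iso] and rhV = lin_isoD(4)[OF iso]
 have "EX e. e:{-int N0..int N0}&E0 e x=x"
 proof (rule g0.eigenvector_weight[OF xV xn])
  fix d :: complex assume d: "d~=0"
  have "rh d x:rh d ` cspan {x}" by (rule imageI[OF span1_self])
  then have "rh d x:cspan {x}" using e4[OF d] unfolding x(2) by simp
  then show "EX \<mu>. g0.Th d x=\<mu> *. x" unfolding rhTh[OF d xV] mem_span1 .
 qed
 then obtain e where e: "E0 e x=x" by (elim exE conjE)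
 \<comment> \<open>The twist that makes \<open>x\<close> a vector of weight 0.\<close>
 define E where "E k=E0 (e + k)" for k
 define N where "N=N0 + nat \<bar>e\<bar>"
 have gE: "graded_space V E N" using g0.shift[of e] unfolding E_def[abs_def] N_def .
 interpret s: graded_space V E N by (rule gE)
 have sTh: "s.Th d v=d powi (- e) *. rh d v" if "d~=0" "v:V" for d v
  using g0.Th_shift[OF that, of e] unfolding rhTh[OF that] E_def[abs_def] N_def .
 have inv: "s.Th d v:acone V Z" if d: "d~=0" and v: "v:acone V Z" for d v
 proof -
  have vV: "v:V" and vn: "v~=0" using v by (rule coneD)+
  have "rh d ` cspan {v}:image (rh d) ` Z" by (rule imageI[OF coneD(3)[OF v]])
  then have "cspan {rh d v}:Z" unfolding e3[OF d] image_span1[OF rhlin[OF d] vV] .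
  then have "rh d v:acone V Z" unfolding acone_def using rhV[OF d vV] lin_iso_nz[OF V iso[OF d] vV vn] by simp
  then show ?thesis unfolding sTh[OF d vV] using d by (intro cone_scale[OF V]) simp_all
 qed
 have Thim: "s.Th d ` cspan {v}=rh d ` cspan {v}" if d: "d~=0" and v: "v:V" for d v
  unfolding image_span1[OF s.Th_lin v] image_span1[OF rhlin[OF d] v] sTh[OF d v] using d by (intro span1_scale) simp
 interpret p: graded_point V E N Z x
 proof (intro graded_point.intro graded_point_axioms.intro gE Zv x(1))
  show "E 0 x=x" using e by (simp add: E_def)
 qed (rule inv)
 obtain U where U: "openin (zariski_on V Z) U" "L:U" "ALL y:U. (ALL c. c~=0-->rh c ` y=y)-->y=L"
  using e5 by (elim exE conjE)
 have UZ: "U \<subseteq> Z" and zn: "znbhd V Z (cspan {x}) U" using U(1,2) unfolding openin_zariski_on[OF ZP] x(2) by simp_all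
 have rep: "EX v:V. y=cspan {v}" if "y:U" for y
 proof -
  have "y:Z" using UZ that by (rule subsetD)
  from cone_rep[OF ZP this] obtain v where v: "v:acone V Z" "y=cspan {v}" by (elim bexE)
  show ?thesis using v(2) by (rule bexI) (rule coneD(1)[OF v(1)])
 qed
 have fixed: "y=cspan {x}" if y: "y:U" and f: "!!d. d~=0 ==> s.Th d ` y=y" for y
 proof -
  obtain v where v: "v:V" "y=cspan {v}" using rep[OF y] by (elim bexE)
  have rhy: "rh c ` y=y" if "c~=0" for c using f[OF that] Thim[OF that v(1)] unfolding v(2) by simp
  have "y=L" by (rule U(3)[rule_format, OF y]) (rule rhy)
  then show ?thesis unfolding x(2) .
 qed
 have ns: "cdim (tcone V Z x)<=cdim (tcone V Z y)" if "y:acone V Z" for y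
  using e1 that unfolding x(2) nonsingular_iff[OF fdV ZP x(1)] by simp
 obtain q \<pi> J ep P n where sp: "split_point V E N Z x q \<pi> J ep P n" using p.split_point_exists by (elim exE)
 interpret sp: split_point V E N Z x q \<pi> J ep P n by (rule sp)
 have qTh: "q (s.Th d u)=q u" if u: "u:V" for d u
 proof -
  have "q (s.Th d u)=(SUM k:{-int N..int N}. if k=0 then q u else 0)"
   unfolding s.functional_Th(1)[OF sp.q u] by (rule sum.cong) (simp_all add: sp.qE[OF u])
  then show ?thesis by simp
 qed
 \<comment> \<open>The scalar by which derivations are multiplied is tested on the functions
   \<open>dehom q l\<close>, whose derivative along \<open>v\<close> is \<open>l v\<close>;
   functionals then identify the vector \<open>s.Th d v\<close>.\<close>
 have scal: "EX \<mu>. ALL v:tcone V Z x. q v=0 --> s.Th d v=\<mu> *. v" if d: "d~=0" for d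
 proof -
  obtain \<mu> where \<mu>: "ALL D:tangent V Z L. differential (image (rh d)) D=\<mu> *. D" using e6[OF d] by (elim exE)
  have "s.Th d v=\<mu> *. v" if v: "v:tcone V Z x" "q v=0" for v
  proof -
   have vV: "v:V" by (rule sp.pp.tconeD[OF v(1)])
   show ?thesis
   proof (rule lin_eqI[OF fdV s.Th_V[OF vV] sub_scale[OF V vV]])
    fix l :: "'v=>complex" assume l: "lin V l"
    let ?l = "%v. l (s.Th d v)" and ?D = "tvec V Z x v" and ?f = "dehom q l"
    have l': "lin V ?l" using s.Th_V by (intro lin_comp[OF s.Th_lin l]) auto
    have D: "?D:tangent V Z (cspan {x})" by (rule sp.pp.tvec_tangent[OF v(1)])
    have germ: "germ_eq V Z (cspan {x}) (dehom q ?l) (?f \<circ> image (rh d))"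
     unfolding sp.pp.germ_eq_iff
    proof (rule exI[of _ 0], rule bexI[of _ "%_. 1"], intro conjI ballI impI)
     fix u assume u: "u:acone V Z"
     have uV: "u:V" and un: "u~=0" using u by (rule coneD)+
     have Tu: "s.Th d u:V" "s.Th d u~=0" using inv[OF d u] by (rule coneD)+
     have "rh d ` cspan {u}=cspan {s.Th d u}" using Thim[OF d uV] image_span1[OF s.Th_lin uV] by simp
     then have "(?f \<circ> image (rh d)) (cspan {u})=l (inverse (q (s.Th d u)) *. s.Th d u)"
      using dehom_span1[OF sp.q Tu, of l] by simp
     also have "\<dots>=l (s.Th d (inverse (q u) *. u))" unfolding qTh[OF uV] lin_scale[OF s.Th_lin uV] ..
     also have "\<dots>=dehom q ?l (cspan {u})" by (rule dehom_span1[OF sp.q uV un, symmetric])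
     finally show "dehom q ?l (cspan {u})=(?f \<circ> image (rh d)) (cspan {u})" ..
    qed (simp_all add: homog_const)
    have "?D (?f \<circ> image (rh d))=?D (dehom q ?l)"
     by (rule sp.pp.tangentD(3)[OF D sp.pp.dehom_local_ring[OF poly_funs.linear[OF l']] germ, symmetric])
    also have "\<dots>=l (s.Th d v)"
     unfolding sp.pp.tvec_dehom[OF v poly_funs.linear[OF l']] dd_linear[OF V xV vV l'] ..
    finally have 1: "?D (?f \<circ> image (rh d))=l (s.Th d v)" .
    have "differential (image (rh d)) ?D=\<mu> *. ?D" using \<mu> D unfolding x(2) by simp
    from fun_cong[OF this, of ?f] have "?D (?f \<circ> image (rh d))=\<mu> * ?D ?f"
     by (simp add: differential_def scaleC_fun_def)
    also have "?D ?f=l v" unfolding sp.pp.tvec_dehom[OF v poly_funs.linear[OF l]] dd_linear[OF V xV vV l] ..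
    finally have 2: "?D (?f \<circ> image (rh d))=\<mu> * l v" .
    show "l (s.Th d v)=l (\<mu> *. v)"
     unfolding lin_scale[OF l vV] scaleC_complex by (rule trans[OF 1[symmetric] 2])
   qed
  qed
  then show ?thesis by (intro exI[of _ \<mu>] ballI impI)
 qed
 have "EX a. ALL v:tcone V Z x. E a v - v:cspan {x}" by (rule p.tangent_weight[OF sp.q sp.qx]) (rule scal)
 then obtain a where a: "ALL v:tcone V Z x. E a v - v:cspan {x}" by (elim exE)
 have "EX (W :: 'v set) nvq q \<pi> G M. graded_chart V W nvq q \<pi> G M&graph_chart.Z V W nvq=Z&nvq 0=x"
 proof (cases "0<=a")
  case True
  show ?thesis
  proof (rule p.chart_of_weight[OF nd ns nt zn _ _ True])
   show "y=cspan {x}" if "y:U" "!!d. d~=0 ==> s.Th d ` y=y" for y by (rule fixed[OF that])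
   show "E a v - v:cspan {x}" if "v:tcone V Z x" for v by (rule a[rule_format, OF that])
  qed
 next
  \<comment> \<open>For a negative tangent weight the inverse torus is used; it has the same fixed
    lines and tangent weight \<open>- a\<close>.\<close>
  case False
  note o = p.opposite_point
  note os = graded_point.axioms(1)[OF o]
  let ?T = "graded_space.Th (%k. E (- k)) N"
  have na: "0<=- a" using False by simp
  show ?thesis
  proof (rule graded_point.chart_of_weight[OF o nd ns nt zn _ _ na])
   show "E (- (- a)) v - v:cspan {x}" if "v:tcone V Z x" for v using a that by simp
   show "y=cspan {x}" if y: "y:U" and f: "!!d. d~=0==>?T d ` y=y" for y
   proof (rule fixed[OF y])
    fix d :: complex assume d: "d~=0"
    obtain v where v: "v:V" "y=cspan {v}" using rep[OF y] by (elim bexE)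
    have "s.Th d ` cspan {v}=cspan {s.Th d v}" by (rule image_span1[OF s.Th_lin v(1)])
    also have "s.Th d v=?T (inverse d) v" using s.Th_opposite[OF v(1), of "inverse d"] by simp
    also have "cspan {?T (inverse d) v}=?T (inverse d) ` cspan {v}" by (rule image_span1[OF graded_space.Th_lin[OF os] v(1), symmetric])
    also have "\<dots>=cspan {v}" using f[of "inverse d"] d unfolding v(2) by simp
    finally show "s.Th d ` y=y" unfolding v(2) .
   qed
  qed
 qed
 then obtain W :: "'v set" and nvq q \<pi> G M where "graded_chart V W nvq q \<pi> G M" "graph_chart.Z V W nvq=Z" "nvq 0=x" by (elim exE conjE)
 note g = this
 have "L=cspan {nvq 0}" unfolding x(2) g(3) ..
 with g(1,2) have "graded_chart V W nvq q \<pi> G M&graph_chart.Z V W nvq=Z&L=cspan {nvq 0}" by (intro conjI)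
 then show ?thesis by (intro exI)
qed

section \<open>Reconstruction of the symbol system\<close>

lemma chart_map:
 fixes V :: "'v::complex_vector set" and U :: "'u::complex_vector set"
 assumes 1: "spanning_chart V W nvq q \<pi>" and 2: "spanning_chart U W nvq' q' \<pi>'"
  and f: "!!l. lin U l==>EX l'. lin V l'&(ALL w:W. l (nvq' w)=(l' (nvq w) :: complex))"
 shows "EX g. lin V g&g ` V \<subseteq> U&(ALL w:W. g (nvq w)=nvq' w)"
proof -
 interpret a: spanning_chart V W nvq q \<pi> by (rule 1)
 interpret b: spanning_chart U W nvq' q' \<pi>' by (rule 2)
 define g where "g v=(SUM b:a.nb. crepresentation a.nb v b *. nvq' (\<pi> b))" for v
 have bU: "nvq' (\<pi> b):U" if "b:a.nb" for b using a.nb_\<pi>[OF that] b.nvqV by simp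
 have gU: "g v:U" for v unfolding g_def by (intro sub_sum[OF b.V] sub_scale[OF b.V] bU)
 have gl: "lin V g"
  by (rule clinear_onI)
   (simp_all add: g_def cvs.representation_add[OF a.nb(2)] cvs.representation_scale[OF a.nb(2)] a.span_nb scaleC_add_left
    sum.distrib cvs.scale_sum_right scaleC_scaleC)
 have "g (nvq w)=nvq' w" if w: "w:W" for w
 proof (rule lin_eqI[OF b.fdV gU b.nvqV[OF w]])
  fix l :: "'u=>complex" assume l: "lin U l"
  obtain l' :: "'v=>complex" where l': "lin V l'" "ALL w:W. l (nvq' w)=l' (nvq w)" using f[OF l] by (elim exE conjE)
  have "l (g (nvq w))=(SUM b:a.nb. crepresentation a.nb (nvq w) b *. l (nvq' (\<pi> b)))"
   unfolding g_def by (rule lin_lincomb[OF b.V l bU])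
  also have "\<dots>=(SUM b:a.nb. crepresentation a.nb (nvq w) b *. l' b)"
  proof (rule sum.cong[OF refl])
   fix b assume "b:a.nb"
   then have "\<pi> b:W" "nvq (\<pi> b)=b" using a.nb_\<pi> by simp_all
   then have "l (nvq' (\<pi> b))=l' b" using l'(2) by force
   then show "crepresentation a.nb (nvq w) b *. l (nvq' (\<pi> b))=crepresentation a.nb (nvq w) b *. l' b" by simp
  qed
  also have "\<dots>=l' (SUM b:a.nb. crepresentation a.nb (nvq w) b *. b)"
   using a.nb_V by (intro lin_lincomb[OF a.V l'(1), symmetric]) auto
  also have "\<dots>=l' (nvq w)" by (simp only: a.nb_expand[OF a.nvqV[OF w]])
  finally show "l (g (nvq w))=l (nvq' w)" using l'(2) w by simp
 qed
 then show ?thesis using gl gU by (intro exI[of _ g]) auto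
qed

text \<open>A spanning chart is determined by its space of pulled-back functionals: if two such
  spaces on \<open>W\<close> agree, the maps sending one graph to the other extend linearly and are
  mutually inverse by \<open>maps_eq\<close>.\<close>

lemma chart_iso:
 fixes V :: "'v::complex_vector set" and U :: "'u::complex_vector set"
 assumes 1: "spanning_chart V W nvq q \<pi>" and 2: "spanning_chart U W nvq' q' \<pi>'"
  and f: "!!l. lin U l==>EX l'. lin V l'&(ALL w:W. l (nvq' w)=(l' (nvq w) :: complex))"
  and f': "!!l. lin V l==>EX l'. lin U l'&(ALL w:W. l (nvq w)=(l' (nvq' w) :: complex))"
 shows "EX g. lin_iso V U g&(ALL w:W. g (nvq w)=nvq' w)"
proof -
 interpret a: spanning_chart V W nvq q \<pi> by (rule 1)
 interpret b: spanning_chart U W nvq' q' \<pi>' by (rule 2)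
 have "EX g. lin V g&g ` V \<subseteq> U&(ALL w:W. g (nvq w)=nvq' w)" by (rule chart_map[OF 1 2]) (rule f)
 then obtain g where g: "lin V g" "g ` V \<subseteq> U" "ALL w:W. g (nvq w)=nvq' w" by (elim exE conjE)
 have "EX h. lin U h&h ` U \<subseteq> V&(ALL w:W. h (nvq' w)=nvq w)" by (rule chart_map[OF 2 1]) (rule f')
 then obtain h where h: "lin U h" "h ` U \<subseteq> V" "ALL w:W. h (nvq' w)=nvq w" by (elim exE conjE)
 have hg: "h (g v)=v" if v: "v:V" for v
 proof (rule a.maps_eq[OF _ _ _ _ _ v, of "%v. h (g v)" "%v. v"])
  show "lin V (%v. h (g v))" by (rule lin_comp[OF g(1) h(1) g(2)])
  show "(%v. h (g v)) ` V \<subseteq> V" using g(2) h(2) by auto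
 qed (use g(3) h(3) in \<open>auto simp: clinear_on_def\<close>)
 have gh: "g (h v)=v" if v: "v:U" for v
 proof (rule b.maps_eq[OF _ _ _ _ _ v, of "%v. g (h v)" "%v. v"])
  show "lin U (%v. g (h v))" by (rule lin_comp[OF h(1) g(1) h(2)])
  show "(%v. g (h v)) ` U \<subseteq> U" using g(2) h(2) by auto
 qed (use g(3) h(3) in \<open>auto simp: clinear_on_def\<close>)
 have "lin_iso V U g" unfolding lin_iso_def
  by (intro conjI g(1) bij_betw_byWitness[of V h g U] ballI hg gh g(2) h(2))
 then show ?thesis using g(3) by (intro exI[of _ g]) simp
qed

locale homogeneous_graded_chart = graded_chart V W nvq q \<pi> G M + homogeneous_chart V W nvq q \<pi>
 for V :: "'v::complex_vector set" and W :: "'w::complex_vector set" and nvq q \<pi> G M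
begin

text \<open>The homogeneous pulled-back functionals, as symmetric forms. Since \<open>G k\<close>
  acts on \<open>V\<close>, each homogeneous part of a pulled-back functional is pulled back itself,
  so these forms account for all functionals.\<close>

definition FF :: "nat=>('w list=>complex) set"
 where "FF k={phq : sym_forms W k. EX l. lin V l&(ALL w:W. l (nvq w)=phq (replicate k w))}"

lemma FFE:
 assumes "phq:FF k"
 obtains l where "lin V l" "ALL w:W. l (nvq w)=phq (replicate k w)"
 using assms unfolding FF_def by (elim CollectE conjE exE)

lemma FF_sym: "FF k \<subseteq> sym_forms W k"
 by (auto simp: FF_def)

lemma FFI: "phq : sym_forms W k==>lin V l==>(!!w. w:W==>l (nvq w)=phq (replicate k w))==>phq:FF k"
 unfolding FF_def by (intro CollectI conjI exI[of _ l]) auto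

lemma FF_csubspace: "csubspace (FF k)"
 unfolding cvs.subspace_def
proof (intro conjI ballI allI)
 show "0:FF k"
  by (rule FFI[OF sub_0[OF sym_forms_csubspace] lin_zero]) simp
 fix phq psq c assume phq: "phq:FF k"
 obtain l where l: "lin V l" "ALL w:W. l (nvq w)=phq (replicate k w)" by (rule FFE[OF phq])
 have phqs: "phq : sym_forms W k" using phq FF_sym by blast
 show "c *. phq:FF k"
  by (rule FFI[OF sub_scale[OF sym_forms_csubspace phqs] lin_cmult'[OF l(1), of c]]) (simp add: l(2) scaleC_fun_def)
 assume psq: "psq:FF k"
 obtain m where m: "lin V m" "ALL w:W. m (nvq w)=psq (replicate k w)" by (rule FFE[OF psq])
 have psqs: "psq : sym_forms W k" using psq FF_sym by blast
 show "phq + psq:FF k"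
  by (rule FFI[OF sub_add[OF sym_forms_csubspace phqs psqs] lin_plus[OF l(1) m(1)]]) (simp add: l(2) m(2))
qed

lemma poly_parts:
 assumes l: "lin V l" and w: "w:W" and P: "!!b. l (nvq (b *. w)) = poly P b"
 shows "coeff P k=l (G k (nvq w))"
proof -
 have "poly P b = poly (SUM i<=M. monom (l (G i (nvq w))) i) b" for b
  unfolding P[symmetric] functional_sum[OF l sub_scale[OF W w]] G_hom[OF w]
  using lin_scale[OF l G_V[OF nvqV[OF w]]] by (simp add: poly_sum poly_monom mult.commute)
 then have e: "P=(SUM i<=M. monom (l (G i (nvq w))) i)" by (simp add: poly_eq_poly_eq_iff[symmetric] fun_eq_iff)
 have "l (G k (nvq w))=0" if "\<not> k<=M" using G_above[of k "nvq w"] that nvqV[OF w] lin_0[OF V l] by simp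
 then show ?thesis unfolding e by (simp add: coeff_sum)
qed

lemma FF_value:
 assumes phq: "phq:FF k" and l: "lin V l" "ALL w:W. l (nvq w)=phq (replicate k w)" and w: "w:W"
 shows "phq (replicate k w)=l (G k (nvq w))"
proof -
 have phqs: "phq : sym_forms W k" using phq FF_sym by blast
 have "coeff (monom (phq (replicate k w)) k) k=l (G k (nvq w))"
  by (rule poly_parts[OF l(1) w])
   (simp add: l(2) sub_scale[OF W w] sym_form_scale[OF phqs W w] poly_monom mult.commute)
 then show ?thesis by simp
qed

lemma FF_above:
 assumes k: "M < k" shows "FF k={0}"
proof (intro equalityI subsetI)
 fix phq assume phq: "phq:FF k"
 obtain l where l: "lin V l" "ALL w:W. l (nvq w)=phq (replicate k w)" by (rule FFE[OF phq])
 have phqs: "phq : sym_forms W k" using phq FF_sym by blast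
 have "phq (replicate k w)=0" if w: "w:W" for w
  unfolding FF_value[OF phq l w] G_above[OF k nvqV[OF w]] by (rule lin_0[OF V l(1)])
 then have "phq=(%_. 0)" by (rule polarization_zero[OF phqs W])
 then show "phq:{0}" by (simp add: zero_fun_def)
qed (use sub_0[OF FF_csubspace] in simp)

text \<open>Translation by \<open>v\<close> stays within the pulled-back functionals, and the degree
  \<open>k\<close> part of a form of degree \<open>Suc k\<close> at \<open>w + v\<close> is
  \<open>Suc k\<close> times its contraction with \<open>v\<close>.\<close>

lemma FF_contract:
 assumes phq: "phq:FF (Suc k)" and v: "v:W" shows "contract v phq:FF k"
proof -
 have phqs: "phq : sym_forms W (Suc k)" using phq FF_sym by blast
 obtain l where l: "lin V l" "ALL w:W. l (nvq w)=phq (replicate (Suc k) w)" by (rule FFE[OF phq])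
 obtain l' where l': "lin V l'" "ALL w:W. l (nvq (w + v))=l' (nvq w)" using transl[OF v] l(1) unfolding stable_def by blast
 have "l' (G k (nvq w)) = of_nat (Suc k) * phq (v # replicate k w)" if w: "w:W" for w
 proof -
  let ?c = "%j. of_nat (Suc k choose j) * phq (replicate (Suc k - j) w @ replicate j v)"
  define P where "P=(SUM j<=Suc k. monom (?c j) (Suc k - j))"
  have "l' (nvq (b *. w)) = poly P b" for b
  proof -
   have bw: "b *. w:W" by (rule sub_scale[OF W w])
   have "l' (nvq (b *. w))=l (nvq (b *. w + v))" using l'(2) bw by simp
   also have "\<dots>=phq (replicate (Suc k) (b *. w + v))" by (rule l(2)[rule_format, OF sub_add[OF W bw v]])
   also have "\<dots>=phq (replicate (Suc k) (v + b *. w))" by (simp only: add.commute[of v])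
   also have "\<dots>=(SUM j<=Suc k. of_nat (Suc k choose j) * phq (replicate (Suc k - j) (b *. w) @ replicate j v))"
    by (rule sym_form_binomial[OF phqs W bw v])
   also have "\<dots>=(SUM j<=Suc k. ?c j * b ^ (Suc k - j))"
   proof (rule sum.cong[OF refl])
    fix j assume "j:{..Suc k}"
    then have "phq (replicate (Suc k - j) (b *. w) @ replicate j v)=b ^ (Suc k - j) * phq (replicate (Suc k - j) w @ replicate j v)"
     using phqs by (intro sym_form_scale_part[OF _ W w v]) simp
    then show "of_nat (Suc k choose j) * phq (replicate (Suc k - j) (b *. w) @ replicate j v)=?c j * b ^ (Suc k - j)"
     by (simp only: mult_ac)
   qed
   finally show ?thesis by (simp only: P_def poly_sum poly_monom)
  qed
  from poly_parts[OF l'(1) w this, of k] have "l' (G k (nvq w))=coeff P k" ..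
  also have "\<dots>=(SUM j<=Suc k. if j=1 then ?c 1 else 0)"
   unfolding P_def coeff_sum by (rule sum.cong) auto
  also have "\<dots> = of_nat (Suc k) * phq (replicate k w @ [v])" by simp
  also have "phq (replicate k w @ [v])=phq (v # replicate k w)" by (rule sym_forms_mset[OF phqs]) simp
  finally show ?thesis .
 qed
 then have "inverse (of_nat (Suc k)) * l' (G k (nvq w))=contract v phq (replicate k w)" if "w:W" for w
  using that by (simp add: contract_def del: of_nat_Suc)
 then show ?thesis by (rule FFI[OF contract_sym_forms[OF phqs v] lin_cmult'[OF lG[OF l'(1)]]])
qed

lemma FF_0: "FF 0 = sym_forms W 0"
proof (intro equalityI FF_sym subsetI)
 fix phq assume "phq : sym_forms W 0"
 then show "phq:FF 0" by (rule FFI[OF _ lin_cmult'[OF q, of "phq []"]]) (simp add: qnvq)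
qed

lemma FF_1: "FF 1 = sym_forms W 1"
proof (intro equalityI FF_sym subsetI)
 fix phq assume phq: "phq : sym_forms W 1"
 have "lin W (%x. phq [x])" using sym_forms_linear[OF phq, of "[]" "[]"] by simp
 then have "lin V (%v. phq [\<pi> v])" using \<pi>W by (intro lin_comp[OF \<pi>, of W "%x. phq [x]"]) auto
 from FFI[OF phq this] show "phq:FF 1" by (simp add: \<pi>nvq)
qed

text \<open>The rank is the largest degree in which \<open>FF\<close> is nonzero; degree 1 occurs
  because \<open>W\<close> is nonzero. The chart and the variety of \<open>FF\<close> have the same
  pulled-back functionals on \<open>W\<close>, so \<open>chart_iso\<close> identifies them, and
  closures correspond.\<close>

theorem symbol_exists:
 assumes W0: "W~={0}"
 shows "EX r F g. symbol_system W r F&lin_iso V (VF W r F) g&image g ` Z=MF W r F"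
proof -
 define R where "R={k. FF k~={0}}"
 have RM: "R \<subseteq> {..M}" using FF_above by (auto simp: R_def not_le[symmetric])
 have finR: "finite R" by (rule finite_subset[OF RM]) simp
 have R1: "1:R"
 proof -
  obtain w0 where w0: "w0:W" "w0~=0" using W0 sub_0[OF W] by blast
  obtain l :: "'w=>complex" where l: "clinear l" "l w0=1"
   using separating_functional[of "{0}" w0] w0(2) cvs.subspace_single_0 by blast
  have "sym_prod W 1 (%_. l):FF 1" unfolding FF_1 by (rule sym_prod_sym_forms[OF W clinear_clinear_on[OF l(1)]])
  moreover have "sym_prod W 1 (%_. l) (replicate 1 w0)=1" unfolding sym_prod_diag[OF w0(1)] by (simp add: l(2))
  then have "sym_prod W 1 (%_. l)~=0" by auto
  ultimately show ?thesis unfolding R_def by blast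
 qed
 define r where "r=Max R"
 have rR: "r:R" unfolding r_def using R1 by (intro Max_in[OF finR]) auto
 have r1: "1<=r" unfolding r_def by (rule Max_ge[OF finR R1])
 have rM: "r<=M" using rR RM by auto
 have above: "FF k={0}" if "r < k" for k
 proof (rule ccontr)
  assume "FF k~={0}"
  then have "k<=r" unfolding r_def by (intro Max_ge[OF finR]) (simp add: R_def)
  then show False using that by simp
 qed
 have ss: "symbol_system W r FF"
  unfolding symbol_system_def
 proof (intro conjI allI impI)
  show "FF r~={0}" using rR by (simp add: R_def)
  show "FF (r + i)={0}" if "1<=i" for i using that by (intro above) simp
  show "FF (k + 1) \<subseteq> prolong W k (FF k)" for k
  proof
   fix phq assume phq: "phq:FF (k + 1)"
   have "phq : sym_forms W (k + 1)" using phq FF_sym by blast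
   moreover have "ALL w:W. contract w phq:FF k" using FF_contract[of phq k] phq by simp
   ultimately show "phq : prolong W k (FF k)" by (simp add: prolong_def)
  qed
 qed (rule r1 FF_csubspace FF_sym FF_0 FF_1)+
 interpret S: symbol W r FF by (simp add: symbol_def fdW ss)
 have "EX g. lin_iso V (VF W r FF) g&(ALL w:W. g (nvq w)=S.nu w)"
 proof (rule chart_iso)
  show "spanning_chart V W nvq q \<pi>" by (rule spanning_chart_axioms)
  show "spanning_chart (VF W r FF) W S.nu fst (%X. fst (snd X))" by (rule S.chart.spanning_chart_axioms)
 next
  fix l :: "'w target=>complex" assume l: "lin (VF W r FF) l"
  obtain phq where phq: "ALL k. phq k:FF k" "ALL X:VF W r FF. l X=(SUM k<=r. S.pr k (phq k) X)" by (rule S.functionals[OF l])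
  have "ALL k. EX m. lin V m&(ALL w:W. m (nvq w)=phq k (replicate k w))"
   using phq(1) unfolding FF_def by blast
  then obtain m where "ALL k. lin V (m k)&(ALL w:W. m k (nvq w)=phq k (replicate k w))" by (rule choice[THEN exE])
  note m = this[THEN spec, THEN conjunct1] this[THEN spec, THEN conjunct2, THEN bspec]
  have "lin V (%v. SUM k<=r. 1 *. m k v)" by (intro lin_lincomb_fun m(1))
  moreover have "l (S.nu w)=(SUM k<=r. 1 *. m k (nvq w))" if w: "w:W" for w
   unfolding S.functional_nu[OF phq w] using m(2)[OF w] by simp
  ultimately show "EX l'. lin V l'&(ALL w:W. l (S.nu w)=l' (nvq w))"
   by (intro exI[of _ "%v. SUM k<=r. 1 *. m k v"] conjI ballI)
 next
  fix l :: "'v=>complex" assume l: "lin V l"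
  have "ALL k. EX psq. psq:FF k&(ALL w:W. l (G k (nvq w))=psq (replicate k w))"
  proof
   fix k
   obtain psq where psq: "psq : sym_forms W k" "ALL w:W. l (G k (nvq w))=psq (replicate k w)"
    using homog_sym_form[OF W G_homog[OF l, of k]] by (elim bexE)
   have "psq:FF k" by (rule FFI[OF psq(1) lG[OF l]]) (rule psq(2)[rule_format])
   then show "EX psq. psq:FF k&(ALL w:W. l (G k (nvq w))=psq (replicate k w))" using psq(2) by (intro exI[of _ psq] conjI)
  qed
  then obtain psq where "ALL k. psq k:FF k&(ALL w:W. l (G k (nvq w))=psq k (replicate k w))" by (rule choice[THEN exE])
  note psq = this[THEN spec, THEN conjunct1] this[THEN spec, THEN conjunct2, THEN bspec]
  have "l (nvq w)=(SUM k<=r. S.pr k (psq k) (S.nu w))" if w: "w:W" for w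
  proof -
   have z: "psq k (replicate k w)=0" if "r < k" for k using psq(1)[of k] above[OF that] by simp
   have "l (nvq w)=(SUM k<=M. psq k (replicate k w))" unfolding functional_sum[OF l w] by (simp only: psq(2)[OF w])
   also have "\<dots>=(SUM k<=r. psq k (replicate k w))" using rM by (intro sum.mono_neutral_right) (auto simp: z)
   also have "\<dots>=(SUM k<=r. S.pr k (psq k) (S.nu w))" by (rule S.functional_nu_eq(2)[OF psq(1) w, symmetric])
   finally show ?thesis .
  qed
  then show "EX l'. lin (VF W r FF) l'&(ALL w:W. l (nvq w)=l' (S.nu w))"
   using S.functional_nu_eq(1)[of psq, OF psq(1)] by (intro exI[of _ "%X. SUM k<=r. S.pr k (psq k) X"] conjI ballI)
 qed
 then obtain g where g: "lin_iso V (VF W r FF) g" "ALL w:W. g (nvq w)=S.nu w" by (elim exE conjE)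
 have Sp: "(%w. cspan {nvq w}) ` W \<subseteq> proj V" using span1_proj[OF nvqV nvq_nz] by auto
 have "image g ` (%w. cspan {nvq w}) ` W=(%w. cspan {S.nu w}) ` W"
  unfolding image_image using image_span1[OF lin_isoD(1)[OF g(1)] nvqV] g(2) by simp
 then have "image g ` Z=S.chart.Z"
  using closure_image[OF V S.VF_csubspace g(1) Sp] unfolding Z_def S.chart.Z_def by simp
 then show ?thesis using ss g(1) S.MF_eq by (intro exI[of _ r] exI[of _ FF] exI[of _ g]) simp
qed

end

section \<open>Choice of the base point\<close>

context graded_chart
begin

text \<open>All degrees are at most \<open>M\<close>, so a functional vanishing to order
  \<open>Suc M\<close> would have degree below its order of vanishing.\<close>

lemma jets_top: assumes u: "u:W" shows "jets u (Suc M)={0}"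
proof -
 have "jets u (Suc M) \<subseteq> low (Suc M)"
 proof
  fix l assume "l:jets u (Suc M)"
  then have l: "l:dual V" "lin V l" by (simp_all add: jets_def dual_def)
  have "l (G j (nvq w))=0" if "Suc M<=j" "w:W" for j w
   using G_above[of j "nvq w"] that nvqV lin_0[OF V l(2)] by simp
  then show "l:low (Suc M)" using l(1) by (simp add: low_def)
 qed
 then show ?thesis using low_jets_zero[OF u, of "Suc M"] by blast
qed

lemma jets_0: assumes u: "u:W" shows "jets u 0=dual V"
proof (intro equalityI jets_dual subsetI)
 fix l assume l: "l:dual V"
 then have ll: "lin V l" by (simp add: dual_def)
 have "EX c. ((%s. l (nvq (u + s *. w)) / s ^ 0) \<longlongrightarrow> c) (at 0)" if w: "w:W" for w
 proof -
  obtain P where P: "ALL s. l (nvq (u + s *. w)) = poly P s" using poly_funs_line[OF W nvq_poly[OF ll] u w] by (elim exE)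
  have "((%s. poly P s) \<longlongrightarrow> poly P 0) (at 0)" by (intro tendsto_intros)
  then show ?thesis using P by (intro exI[of _ "poly P 0"]) simp
 qed
 then show "l:jets u 0" using l by (simp add: jets_def)
qed

lemma jets_antimono: assumes jk: "j<=k" shows "jets u k \<subseteq> jets u j"
proof
 fix l assume l: "l:jets u k"
 have "EX c. ((%s. l (nvq (u + s *. w)) / s ^ j) \<longlongrightarrow> c) (at 0)" if w: "w:W" for w
 proof -
  obtain c where c: "((%s. l (nvq (u + s *. w)) / s ^ k) \<longlongrightarrow> c) (at 0)" using l w unfolding jets_def by blast
  have p: "((%s::complex. s ^ (k - j)) \<longlongrightarrow> 0 ^ (k - j)) (at 0)" by (intro tendsto_intros)
  have e: "s ^ (k - j) * (z / s ^ k)=z / s ^ j" if "s~=0" for s z :: complex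
   using that power_add[of s "k - j" j] jk by (simp add: field_simps)
  have "((%s. l (nvq (u + s *. w)) / s ^ j) \<longlongrightarrow> 0 ^ (k - j) * c) (at 0)"
  proof (rule Lim_transform_eventually[OF tendsto_mult[OF p c]])
   show "eventually (%s. s ^ (k - j) * (l (nvq (u + s *. w)) / s ^ k)=l (nvq (u + s *. w)) / s ^ j) (at 0)"
    unfolding eventually_at_filter by (rule always_eventually) (use e in simp)
  qed
  then show ?thesis by (rule exI)
 qed
 then show "l:jets u j" using l by (simp add: jets_def)
qed

text \<open>Over \<open>W = {0}\<close> the graph is one point, and its linear equations show that
  the closure is that point.\<close>

lemma W_nonzero: assumes nt: "Z~={cspan {nvq 0}}" shows "W~={0}"
proof
 assume W0: "W={0}"
 have 0: "0:W" by (rule sub_0[OF W])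
 have "L=cspan {nvq 0}" if L: "L:Z" for L
 proof -
  obtain v where v: "v:acone V Z" "L=cspan {v}" using cone_rep[OF Z_proj L] by (elim bexE)
  have vV: "v:V" and vn: "v~=0" using v(1) by (rule coneD)+
  have e: "v=q v *. nvq 0"
  proof (rule lin_eqI[OF fdV vV sub_scale[OF V nvqV[OF 0]]])
   fix l :: "'v=>complex" assume l: "lin V l"
   have "(%v. l v - l (nvq 0) * q v):homog V 1"
    by (intro homog_diff homog_cmult homog_linear l q)
   moreover have "ALL w:W. l (nvq w) - l (nvq 0) * q (nvq w)=0" unfolding W0 using qnvq[OF 0] by simp
   ultimately have "(%v. l v - l (nvq 0) * q v):vid V Z 1" unfolding vid_iff by simp
   then have "l v - l (nvq 0) * q v=0" using v(1) by (simp add: vid_def)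
   then show "l v=l (q v *. nvq 0)" using lin_scale[OF l nvqV[OF 0]] by simp
  qed
  have qv: "q v~=0"
  proof
   assume q0: "q v=0"
   have "v=0" by (rule trans[OF e]) (simp add: q0)
   then show False using vn by simp
  qed
  have "cspan {v}=cspan {q v *. nvq 0}" by (rule arg_cong[OF e])
  then show ?thesis unfolding v(2) span1_scale[OF qv] .
 qed
 then have "Z={cspan {nvq 0}}" using nvq_Z[OF 0] by blast
 then show False using nt by simp
qed

end

text \<open>The base point is chosen to minimize the dimensions of the spaces of jets; they are then constant
 on a nonempty open subset of the chart.\<close>

theorem euler_symmetric_symbol:
 fixes V :: "'v::complex_vector set"
 assumes fdV: "finite_dim V" and nd: "nondegenerate V Z" and es: "euler_symmetric V Z" and nt: "ALL x. Z~={x}"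
 shows "EX (W :: 'v set) r F g. finite_dim W & symbol_system W r F&lin_iso V (VF W r F) g&image g ` Z=MF W r F"
proof -
 have Zv: "proj_variety V Z" and exU: "EX U. U~={} & openin (zariski_on V Z) U&(ALL x:U. EX rh. euler_type V Z x rh)"
  using es by (simp_all only: euler_symmetric_def)
 obtain U where U: "U~={}" "openin (zariski_on V Z) U" "ALL x:U. EX rh. euler_type V Z x rh" using exU by (elim exE conjE)
 have ZP: "Z \<subseteq> proj V" using Zv closed_subset_proj[of V Z] unfolding proj_variety_def by simp
 \<comment> \<open>Spaces of jets in intrinsic terms, so that points with different charts can be
   compared.\<close>
 let ?J = "%L k. dual V \<inter> jet_kernel V Z L k"
 have chart: "EX (W :: 'v set) nvq q \<pi> G M. graded_chart V W nvq q \<pi> G M&graph_chart.Z V W nvq=Z&L=cspan {nvq 0}"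
  if L: "L:U" for L
 proof -
  obtain rh where rh: "euler_type V Z L rh" using U(3)[rule_format, OF L] by (elim exE)
  show ?thesis by (rule euler_chart[OF fdV nd Zv nt[rule_format] rh])
 qed
 obtain L0 where L0: "L0:U" using U(1) by blast
 obtain W0 :: "'v set" and nvq0 q0 \<pi>0 G0 M0 where c0: "graded_chart V W0 nvq0 q0 \<pi>0 G0 M0" "graph_chart.Z V W0 nvq0=Z" "L0=cspan {nvq0 0}"
  using chart[OF L0] by (elim exE conjE)
 \<comment> \<open>Only points whose jets are trivial beyond \<open>M0\<close> compete, so the
   finite sum \<open>m\<close> sees all orders that matter; the point \<open>L0\<close> shows that
   there is one.\<close>
 define cand where "cand L \<longleftrightarrow> L:U&?J L M0={0}" for L
 define m where "m L=(SUM k<M0. cdim (?J L k))" for L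
 have "cand L0"
 proof -
  interpret c0: graded_chart V W0 nvq0 q0 \<pi>0 G0 M0 by (rule c0(1))
  have 0: "0:W0" by (rule sub_0[OF c0.W])
  have "?J L0 M0=c0.jets 0 (Suc M0)" using c0.jets_eq[OF 0, of M0] unfolding c0(2,3) by simp
  then show ?thesis unfolding cand_def c0.jets_top[OF 0] using L0 by simp
 qed
 from ex_has_least_nat[of cand, OF this, of m] obtain L where L: "cand L" "ALL L'. cand L'-->m L<=m L'" by (elim exE conjE)
 have LU: "L:U" using L(1) by (simp add: cand_def)
 obtain W :: "'v set" and nvq q \<pi> G M where c: "graded_chart V W nvq q \<pi> G M" and cZ: "graph_chart.Z V W nvq=Z" and Lnvq: "L=cspan {nvq 0}"
  using chart[OF LU] by (elim exE conjE)
 interpret c: graded_chart V W nvq q \<pi> G M by (rule c)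
 have 0: "0:W" by (rule sub_0[OF c.W])
 have cJ: "c.jets u (Suc k)=?J (cspan {nvq u}) k" if "u:W" for u k using c.jets_eq[OF that, of k] unfolding cZ .
 have "znbhd V Z L U" using U(2) LU unfolding openin_zariski_on[OF ZP] by simp
 then obtain d p where p: "p:homog V d" "L:basic_open V p" "Z \<inter> basic_open V p \<subseteq> U" by (rule znbhdE)
 have p0: "p (nvq 0)~=0" using p(2) basic_span1[OF p(1) c.nvqV[OF 0] c.nvq_nz[OF 0]] unfolding Lnvq by simp
 have dim: "cdim (c.jets 0 k)<=cdim (c.jets u k)" if u: "u:W" and pu: "p (nvq u)~=0" for u k
 proof -
  have "cspan {nvq u}:Z" using c.nvq_Z[OF u] unfolding cZ .
  then have uU: "cspan {nvq u}:U" using p(3) basic_span1[OF p(1) c.nvqV[OF u] c.nvq_nz[OF u]] pu by blast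
  have fin: "finite_dim (c.jets u j)" for j
   by (rule finite_dim_subspace[OF dual_finite_dim[OF fdV] c.jets_csubspace c.jets_dual])
  have top: "c.jets 0 (Suc M0)={0}" using L(1) unfolding cJ[OF 0] cand_def Lnvq by simp
  have z: "{0} \<subseteq> c.jets u j" for j using sub_0[OF c.jets_csubspace] by simp
  have "{0}=c.jets u (Suc M0)"
   using c.jets_dim[OF u, of "Suc M0"] unfolding top by (intro cdim_eq_imp_eq[OF fin cvs.subspace_single_0 z])
  then have "cand (cspan {nvq u})" unfolding cand_def cJ[OF u] using uU by simp
  then have "m L<=m (cspan {nvq u})" using L(2) by simp
  then have sum: "(SUM k<M0. cdim (c.jets 0 (Suc k)))<=(SUM k<M0. cdim (c.jets u (Suc k)))"
   unfolding m_def Lnvq cJ[OF 0] cJ[OF u] .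
  have small: "cdim (c.jets 0 (Suc k))<=cdim (c.jets u (Suc k))" if k: "k < M0" for k
  proof (rule ccontr)
   assume lt: "\<not> cdim (c.jets 0 (Suc k))<=cdim (c.jets u (Suc k))"
   \<comment> \<open>Each term at \<open>u\<close> is at most the term at 0 by
     \<open>jets_dim\<close>, while minimality at \<open>L\<close> gives the opposite inequality of
     sums; one strict term would contradict it.\<close>
   have "(SUM k<M0. cdim (c.jets u (Suc k))) < (SUM k<M0. cdim (c.jets 0 (Suc k)))"
   proof (rule sum_strict_mono_ex1)
    show "EX k:{..<M0}. cdim (c.jets u (Suc k)) < cdim (c.jets 0 (Suc k))"
     by (rule bexI[of _ k]) (use lt k in simp_all)
   qed (simp_all add: c.jets_dim[OF u])
   then show False using sum by simp
  qed
  show ?thesis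
  proof (cases k)
   case 0
   then show ?thesis using c.jets_0[OF u] c.jets_0[OF sub_0[OF c.W]] by simp
  next
   case (Suc j)
   show ?thesis
   proof (cases "j < M0")
    case True
    then show ?thesis unfolding Suc by (rule small)
   next
    case False
    then have "c.jets 0 (Suc j) \<subseteq> {0}" unfolding top[symmetric] by (intro c.jets_antimono) simp
    then show ?thesis unfolding Suc using z by (intro cdim_mono[OF fin c.jets_csubspace]) (rule subset_trans)
   qed
  qed
 qed
 have "homogeneous_graded_chart V W nvq q \<pi> G M"
 proof (intro homogeneous_graded_chart.intro homogeneous_chart.intro homogeneous_chart_axioms.intro)
  show "graded_chart V W nvq q \<pi> G M" by (rule c)
  show "spanning_chart V W nvq q \<pi>" by (rule c.spanning_chart_axioms)
  show "c.stable (%w. b *. w)" for b by (rule c.scale_stable)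
  show "c.stable (%w. w + v)" if v: "v:W" for v
  proof (rule c.translation_stable[OF c.comp_nvq[OF homogD(1)[OF p(1)]] 0 p0 _ v])
   show "cdim (c.jets 0 k)<=cdim (c.jets u k)" if "u:W" "p (nvq u)~=0" for u k by (rule dim[OF that])
  qed
 qed
 moreover have "W~={0}" using nt by (intro c.W_nonzero) (simp add: cZ)
 ultimately have "EX r F g. symbol_system W r F&lin_iso V (VF W r F) g&image g ` graph_chart.Z V W nvq=MF W r F"
  by (rule homogeneous_graded_chart.symbol_exists)
 then obtain r F g where "symbol_system W r F" "lin_iso V (VF W r F) g" "image g ` Z=MF W r F" unfolding cZ by (elim exE conjE)
 then show ?thesis using c.fdW by (intro exI[of _ W] exI[of _ r] exI[of _ F] exI[of _ g] conjI)
qed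

theorem theorem3p7:
  shows
   "(\<forall>(W :: 'w::complex_vector set) r F.
      finite_dim W \<longrightarrow> symbol_system W r F \<longrightarrow>
      base_point \<in> MF W r F \<and> base_point = phi r F (cspan {(1, 0)}) \<and>
      (\<exists>\<rho>. vector_group_rep W (VF W r F) \<rho> \<and>
         (\<forall>v\<in>W. \<forall>L\<in>phi_dom W r F. \<rho> v ` phi r F L = phi r F (translate v ` L)) \<and>
         (\<forall>v\<in>W. image (\<rho> v) ` MF W r F = MF W r F) \<and>
         openin (zariski_on (VF W r F) (MF W r F)) {\<rho> v ` base_point | v. v \<in> W} \<and>
         (\<exists>f. biregular (affine_zariski W) (affine_regular_funs W)
            (zariski_on (VF W r F) {\<rho> v ` base_point | v. v \<in> W}) (regular_funs (VF W r F)) f)) \<and>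
      (\<exists>\<rho>. euler_type (VF W r F) (MF W r F) base_point \<rho> \<and>
         (\<forall>c w. c \<noteq> 0 \<longrightarrow> w \<in> W \<longrightarrow>
            \<rho> c ` phi r F (cspan {(1, w)}) = phi r F (cspan {(1, c *\<^sub>C w)}))) \<and>
      euler_symmetric (VF W r F) (MF W r F) \<and>
      nonsingular_point (VF W r F) (MF W r F) base_point \<and>
      nondegenerate (VF W r F) (MF W r F) \<and>
      fundamental_forms_iso (VF W r F) (MF W r F) base_point W F) \<and>
    (\<forall>(V :: 'v::complex_vector set) Z.
      finite_dim V \<longrightarrow> nondegenerate V Z \<longrightarrow> euler_symmetric V Z \<longrightarrow> (\<forall>x. Z \<noteq> {x}) \<longrightarrow>
      (\<exists>(W :: 'v set) r F g. finite_dim W \<and> symbol_system W r F \<and>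
         lin_iso V (VF W r F) g \<and> image g ` Z = MF W r F))"
proof (rule conjI, goal_cases)
  case 1
  show ?case by (intro allI impI symbol.symbol_variety symbol.intro)
next
  case 2
  show ?case by (intro allI impI) (rule euler_symmetric_symbol)
qed

end
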